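(* Let $G$ and $H$ be two finite, isocategorical groups. Then the Witt rings $W(\mathrm{Rep}\,G)$ and $W(\mathrm{Rep}\,H)$ are isomorphic as commutative, unital rings.
   Context: For a finite group $G$, $\mathrm{Rep}\,G$ is the category of finite-dimensional complex representations of $G$, regarded as a $\mathbb{C}$-linear rigid symmetric monoidal category with the usual tensor product, the trivial representation $I=\mathbb{C}$ as unit, usual duals and the usual flip $c_{V,W}(v\otimes w)=w\otimes v$ as symmetry. Finite groups $G$ and $H$ are called isocategorical if $\mathrm{Rep}\,G$ and $\mathrm{Rep}\,H$ are equivalent as $\mathbb{C}$-linear monoidal categories (the equivalence is not required to respect the symmetries). Witt ring. Let $\mathcal{C}$ be a $k$-linear rigid braided monoidal category with finite direct sums, braiding $c$ and unit $I$, where $k$ is a commutative ring with $\frac12\in k$. For each object $M$ fix a dual $M^*$ with $\mathrm{ev}_M:M^*\otimes M\to I$ and $\mathrm{coev}_M:I\to M\otimes M^*$ satisfying the duality (triangle) identities. A bilinear form $b:M\otimes M\to I$ is symmetric if $b\circ c_{M,M}=b$, and non-singular if $h_M(b):=(b\otimes 1_{M^*})\circ(1_M\otimes \mathrm{coev}_M):M\to M^*$ is an isomorphism. A non-singular quadratic object is a pair $(M,b)$ with $b$ symmetric and non-singular; an isometry $(M,b)\to(M',b')$ is an isomorphism $f:M\to M'$ with $b'\circ(f\otimes f)=b$. The orthogonal sum is $(M,b)\perp(M',b')=(M\oplus M',b\oplus b')$ (zero on the cross terms). $\mathcal{Q}$ is the category of non-singular quadratic objects with isometries as morphisms. An object $M$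 is weakly symmetric if $\mathrm{ev}_M=\mathrm{ev}_M\circ c_{M,M^*}\circ c_{M^*,M}$ (automatic if $c$ is symmetric); $\mathcal{D}$ is the category of weakly symmetric objects with isomorphisms as morphisms. For $M\in\mathcal{D}$ the hyperbolic object is $\mathcal{H}(M)=(M\oplus M^*,b_M)$, where $b_M$ vanishes on $M\otimes M$ and on $M^*\otimes M^*$, equals $\mathrm{ev}_M$ on $M^*\otimes M$, and equals $\mathrm{ev}_M\circ c_{M,M^*}$ on $M\otimes M^*$. The Witt group is $W(\mathcal{C})=K_0(\mathcal{Q})/\mathrm{Im}(K_0(\mathcal{H}):K_0(\mathcal{D})\to K_0(\mathcal{Q}))$, where $K_0$ denotes the Grothendieck group of the commutative monoid of isomorphism classes under $\perp$ (resp. $\oplus$). If the braiding $c$ is symmetric, $W(\mathcal{C})$ is a commutative unital ring with multiplication induced by $(M,b)\otimes(M',b')=(M\otimes M',\,(b\otimes b')\circ(1_M\otimes c_{M',M}\otimes 1_{M'}))$ and unit the class of $I$ with its canonical form $I\otimes I\to I$. *)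

theory Defs
  imports
    "Jordan_Normal_Form.Matrix"
    "HOL-Algebra.QuotRing"
begin

section \<open>Linear rigid braided monoidal categories with direct sums\<close>

text \<open>
  The records below only carry the structure, not the axioms. A value of the arrow type may belong to several
  hom-sets (the same matrix can intertwine different pairs of representations), so every operation
  whose result is not determined by the values of the arrows alone takes the objects concerned as
  arguments.
\<close>

record ('o, 'm) category =
  Obj :: "'o set"
  Hom :: "'o \<Rightarrow> 'o \<Rightarrow> 'm set"
  Comp :: "'m \<Rightarrow> 'm \<Rightarrow> 'm"  (infixr \<open>\<star>\<index>\<close> 75)
  Id :: "'o \<Rightarrow> 'm"

record ('o, 'm, 'k) linear_category = "('o, 'm) category" +
  Add :: "'m \<Rightarrow> 'm \<Rightarrow> 'm"  (infixl \<open>\<boxplus>\<index>\<close> 65)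
  ZeroArr :: "'o \<Rightarrow> 'o \<Rightarrow> 'm"
  Scale :: "'k \<Rightarrow> 'm \<Rightarrow> 'm"

text \<open>
  \<open>Assoc A B D\<close> is an arrow from \<open>(A \<boxtimes> B) \<boxtimes> D\<close> to \<open>A \<boxtimes> (B \<boxtimes> D)\<close>, \<open>LUnit A\<close> one from
  \<open>Unit \<boxtimes> A\<close> to \<open>A\<close>, and \<open>RUnit A\<close> one from \<open>A \<boxtimes> Unit\<close> to \<open>A\<close>.
\<close>

record ('o, 'm, 'k) monoidal_category = "('o, 'm, 'k) linear_category" +
  Unit :: "'o"
  TObj :: "'o \<Rightarrow> 'o \<Rightarrow> 'o"  (infixr \<open>\<boxtimes>\<index>\<close> 80)
  TArr :: "'m \<Rightarrow> 'm \<Rightarrow> 'm"  (infixr \<open>\<boxtimes>\<^sub>m\<index>\<close> 80)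
  Assoc :: "'o \<Rightarrow> 'o \<Rightarrow> 'o \<Rightarrow> 'm"
  LUnit :: "'o \<Rightarrow> 'm"
  RUnit :: "'o \<Rightarrow> 'm"

text \<open>
  \<open>Braid A B\<close> is an arrow from \<open>A \<boxtimes> B\<close> to \<open>B \<boxtimes> A\<close>, \<open>Ev A\<close> one from \<open>Dual A \<boxtimes> A\<close> to \<open>Unit\<close>,
  and \<open>Coev A\<close> one from \<open>Unit\<close> to \<open>A \<boxtimes> Dual A\<close>. Of a direct sum \<open>DSum A B\<close> only the projections
  \<open>Pr1 A B\<close> and \<open>Pr2 A B\<close> to \<open>A\<close> and \<open>B\<close> are recorded; they determine the inclusions.
\<close>

record ('o, 'm, 'k) rigid_braided_category = "('o, 'm, 'k) monoidal_category" +
  Braid :: "'o \<Rightarrow> 'o \<Rightarrow> 'm"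
  Dual :: "'o \<Rightarrow> 'o"
  Ev :: "'o \<Rightarrow> 'm"
  Coev :: "'o \<Rightarrow> 'm"
  ZeroObj :: "'o"
  DSum :: "'o \<Rightarrow> 'o \<Rightarrow> 'o"  (infixr \<open>\<uplus>\<index>\<close> 78)
  Pr1 :: "'o \<Rightarrow> 'o \<Rightarrow> 'm"
  Pr2 :: "'o \<Rightarrow> 'o \<Rightarrow> 'm"

definition inverse_arrows :: "('o, 'm, 'z) category_scheme \<Rightarrow> 'o \<Rightarrow> 'o \<Rightarrow> 'm \<Rightarrow> 'm \<Rightarrow> bool" where
  "inverse_arrows C A B f g \<longleftrightarrow>
     f \<in> Hom C A B \<and> g \<in> Hom C B A \<and> g \<star>\<^bsub>C\<^esub> f = Id C A \<and> f \<star>\<^bsub>C\<^esub> g = Id C B"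

definition iso_arrow :: "('o, 'm, 'z) category_scheme \<Rightarrow> 'o \<Rightarrow> 'o \<Rightarrow> 'm \<Rightarrow> bool" where
  "iso_arrow C A B f \<longleftrightarrow> (\<exists>g. inverse_arrows C A B f g)"

definition inv_arrow :: "('o, 'm, 'z) category_scheme \<Rightarrow> 'o \<Rightarrow> 'o \<Rightarrow> 'm \<Rightarrow> 'm" where
  "inv_arrow C A B f = (THE g. inverse_arrows C A B f g)"


section \<open>Linear monoidal equivalences\<close>

record ('o, 'm, 'p, 'n) functor_data =
  FObj :: "'o \<Rightarrow> 'p"
  FArr :: "'o \<Rightarrow> 'o \<Rightarrow> 'm \<Rightarrow> 'n"

definition is_functor ::
  "('o, 'm, 'y) category_scheme \<Rightarrow> ('p, 'n, 'z) category_scheme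
    \<Rightarrow> ('o, 'm, 'p, 'n) functor_data \<Rightarrow> bool" where
  "is_functor C D F \<longleftrightarrow>
     (\<forall>A\<in>Obj C. FObj F A \<in> Obj D) \<and>
     (\<forall>A\<in>Obj C. \<forall>B\<in>Obj C. \<forall>f\<in>Hom C A B. FArr F A B f \<in> Hom D (FObj F A) (FObj F B)) \<and>
     (\<forall>A\<in>Obj C. FArr F A A (Id C A) = Id D (FObj F A)) \<and>
     (\<forall>A\<in>Obj C. \<forall>B\<in>Obj C. \<forall>E\<in>Obj C. \<forall>f\<in>Hom C A B. \<forall>g\<in>Hom C B E.
        FArr F A E (g \<star>\<^bsub>C\<^esub> f) = FArr F B E g \<star>\<^bsub>D\<^esub> FArr F A B f)"

definition id_functor :: "('o, 'm, 'o, 'm) functor_data" where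
  "id_functor = \<lparr>FObj = (\<lambda>A. A), FArr = (\<lambda>A B f. f)\<rparr>"

definition comp_functor ::
  "('p, 'n, 'q, 'l) functor_data \<Rightarrow> ('o, 'm, 'p, 'n) functor_data
    \<Rightarrow> ('o, 'm, 'q, 'l) functor_data" where
  "comp_functor K F =
     \<lparr>FObj = (\<lambda>A. FObj K (FObj F A)),
      FArr = (\<lambda>A B f. FArr K (FObj F A) (FObj F B) (FArr F A B f))\<rparr>"

definition naturally_isomorphic ::
  "('o, 'm, 'y) category_scheme \<Rightarrow> ('p, 'n, 'z) category_scheme
    \<Rightarrow> ('o, 'm, 'p, 'n) functor_data \<Rightarrow> ('o, 'm, 'p, 'n) functor_data \<Rightarrow> bool" where
  "naturally_isomorphic C D F K \<longleftrightarrow>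
     (\<exists>\<eta>. (\<forall>A\<in>Obj C. iso_arrow D (FObj F A) (FObj K A) (\<eta> A)) \<and>
          (\<forall>A\<in>Obj C. \<forall>B\<in>Obj C. \<forall>f\<in>Hom C A B.
             \<eta> B \<star>\<^bsub>D\<^esub> FArr F A B f = FArr K A B f \<star>\<^bsub>D\<^esub> \<eta> A))"

definition is_equivalence ::
  "('o, 'm, 'y) category_scheme \<Rightarrow> ('p, 'n, 'z) category_scheme
    \<Rightarrow> ('o, 'm, 'p, 'n) functor_data \<Rightarrow> bool" where
  "is_equivalence C D F \<longleftrightarrow>
     is_functor C D F \<and>
     (\<exists>K. is_functor D C K \<and>
          naturally_isomorphic C C (comp_functor K F) id_functor \<and>
          naturally_isomorphic D D (comp_functor F K) id_functor)"

definition is_linear_functor ::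
  "('o, 'm, 'k, 'y) linear_category_scheme \<Rightarrow> ('p, 'n, 'k, 'z) linear_category_scheme
    \<Rightarrow> ('o, 'm, 'p, 'n) functor_data \<Rightarrow> bool" where
  "is_linear_functor C D F \<longleftrightarrow>
     is_functor C D F \<and>
     (\<forall>A\<in>Obj C. \<forall>B\<in>Obj C. \<forall>f\<in>Hom C A B.
        (\<forall>g\<in>Hom C A B. FArr F A B (f \<boxplus>\<^bsub>C\<^esub> g) = FArr F A B f \<boxplus>\<^bsub>D\<^esub> FArr F A B g) \<and>
        (\<forall>c. FArr F A B (Scale C c f) = Scale D c (FArr F A B f)))"

text \<open>
  Strong monoidal structure on a functor: natural isomorphisms \<open>J A B\<close> from \<open>F A \<boxtimes> F B\<close> to
  \<open>F (A \<boxtimes> B)\<close> and an isomorphism \<open>u\<close> from the unit to the image of the unit. No compatibility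
  with braidings is asked for.
\<close>

definition is_monoidal_structure ::
  "('o, 'm, 'k, 'y) monoidal_category_scheme \<Rightarrow> ('p, 'n, 'k, 'z) monoidal_category_scheme
    \<Rightarrow> ('o, 'm, 'p, 'n) functor_data \<Rightarrow> ('o \<Rightarrow> 'o \<Rightarrow> 'n) \<Rightarrow> 'n \<Rightarrow> bool" where
  "is_monoidal_structure C D F J u \<longleftrightarrow>
     (\<forall>A\<in>Obj C. \<forall>B\<in>Obj C.
        iso_arrow D (FObj F A \<boxtimes>\<^bsub>D\<^esub> FObj F B) (FObj F (A \<boxtimes>\<^bsub>C\<^esub> B)) (J A B)) \<and>
     iso_arrow D (Unit D) (FObj F (Unit C)) u \<and>
     (\<forall>A\<in>Obj C. \<forall>A'\<in>Obj C. \<forall>B\<in>Obj C. \<forall>B'\<in>Obj C. \<forall>f\<in>Hom C A A'. \<forall>g\<in>Hom C B B'.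
        J A' B' \<star>\<^bsub>D\<^esub> (FArr F A A' f \<boxtimes>\<^sub>m\<^bsub>D\<^esub> FArr F B B' g) =
        FArr F (A \<boxtimes>\<^bsub>C\<^esub> B) (A' \<boxtimes>\<^bsub>C\<^esub> B') (f \<boxtimes>\<^sub>m\<^bsub>C\<^esub> g) \<star>\<^bsub>D\<^esub> J A B) \<and>
     (\<forall>A\<in>Obj C. \<forall>B\<in>Obj C. \<forall>E\<in>Obj C.
        FArr F ((A \<boxtimes>\<^bsub>C\<^esub> B) \<boxtimes>\<^bsub>C\<^esub> E) (A \<boxtimes>\<^bsub>C\<^esub> (B \<boxtimes>\<^bsub>C\<^esub> E)) (Assoc C A B E) \<star>\<^bsub>D\<^esub>
          J (A \<boxtimes>\<^bsub>C\<^esub> B) E \<star>\<^bsub>D\<^esub> (J A B \<boxtimes>\<^sub>m\<^bsub>D\<^esub> Id D (FObj F E)) =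
        J A (B \<boxtimes>\<^bsub>C\<^esub> E) \<star>\<^bsub>D\<^esub> (Id D (FObj F A) \<boxtimes>\<^sub>m\<^bsub>D\<^esub> J B E) \<star>\<^bsub>D\<^esub>
          Assoc D (FObj F A) (FObj F B) (FObj F E)) \<and>
     (\<forall>A\<in>Obj C.
        FArr F (Unit C \<boxtimes>\<^bsub>C\<^esub> A) A (LUnit C A) \<star>\<^bsub>D\<^esub> J (Unit C) A \<star>\<^bsub>D\<^esub>
          (u \<boxtimes>\<^sub>m\<^bsub>D\<^esub> Id D (FObj F A)) = LUnit D (FObj F A) \<and>
        FArr F (A \<boxtimes>\<^bsub>C\<^esub> Unit C) A (RUnit C A) \<star>\<^bsub>D\<^esub> J A (Unit C) \<star>\<^bsub>D\<^esub>
          (Id D (FObj F A) \<boxtimes>\<^sub>m\<^bsub>D\<^esub> u) = RUnit D (FObj F A))"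

definition linear_monoidal_equivalent ::
  "('o, 'm, 'k, 'y) monoidal_category_scheme \<Rightarrow> ('p, 'n, 'k, 'z) monoidal_category_scheme
    \<Rightarrow> bool" where
  "linear_monoidal_equivalent C D \<longleftrightarrow>
     (\<exists>F J u. is_linear_functor C D F \<and> is_equivalence C D F \<and> is_monoidal_structure C D F J u)"


section \<open>Grothendieck groups and rings\<close>

text \<open>\<open>class_op r f\<close> is the operation induced by \<open>f\<close> on classes of the equivalence relation \<open>r\<close>.\<close>

definition class_op :: "('a \<times> 'a) set \<Rightarrow> ('a \<Rightarrow> 'a \<Rightarrow> 'a) \<Rightarrow> 'a set \<Rightarrow> 'a set \<Rightarrow> 'a set" where
  "class_op r f X Y = (\<Union>x\<in>X. \<Union>y\<in>Y. r `` {f x y})"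

text \<open>A pair \<open>(a, b)\<close> stands for the formal difference of \<open>a\<close> and \<open>b\<close>.\<close>

definition K0_rel :: "('a, 'z) monoid_scheme \<Rightarrow> (('a \<times> 'a) \<times> ('a \<times> 'a)) set" where
  "K0_rel N =
     {((a, b), (c, d)) | a b c d.
        a \<in> carrier N \<and> b \<in> carrier N \<and> c \<in> carrier N \<and> d \<in> carrier N \<and>
        (\<exists>k\<in>carrier N. (a \<otimes>\<^bsub>N\<^esub> d) \<otimes>\<^bsub>N\<^esub> k = (c \<otimes>\<^bsub>N\<^esub> b) \<otimes>\<^bsub>N\<^esub> k)}"

definition K0 :: "('a, 'z) monoid_scheme \<Rightarrow> ('a \<times> 'a) set monoid" where
  "K0 N =
     \<lparr>carrier = (carrier N \<times> carrier N) // K0_rel N,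
      mult = class_op (K0_rel N) (\<lambda>(a, b) (c, d). (a \<otimes>\<^bsub>N\<^esub> c, b \<otimes>\<^bsub>N\<^esub> d)),
      one = K0_rel N `` {(\<one>\<^bsub>N\<^esub>, \<one>\<^bsub>N\<^esub>)}\<rparr>"

text \<open>
  The homomorphism into \<^term>\<open>K0 N\<close> induced by a monoid homomorphism \<open>f\<close> into \<open>N\<close>.
\<close>

definition K0_map ::
  "('b, 'z) monoid_scheme \<Rightarrow> ('a \<Rightarrow> 'b) \<Rightarrow> ('a \<times> 'a) set \<Rightarrow> ('b \<times> 'b) set" where
  "K0_map N f X = (\<Union>(a, b)\<in>X. K0_rel N `` {(f a, f b)})"

text \<open>For a commutative semiring \<open>R\<close> the group \<^term>\<open>K0 (add_monoid R)\<close> is a ring.\<close>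

definition K0_ring :: "'a ring \<Rightarrow> ('a \<times> 'a) set ring" where
  "K0_ring R =
     \<lparr>carrier = carrier (K0 (add_monoid R)),
      mult = class_op (K0_rel (add_monoid R))
        (\<lambda>(a, b) (c, d). ((a \<otimes>\<^bsub>R\<^esub> c) \<oplus>\<^bsub>R\<^esub> (b \<otimes>\<^bsub>R\<^esub> d), (a \<otimes>\<^bsub>R\<^esub> d) \<oplus>\<^bsub>R\<^esub> (b \<otimes>\<^bsub>R\<^esub> c))),
      one = K0_rel (add_monoid R) `` {(\<one>\<^bsub>R\<^esub>, \<zero>\<^bsub>R\<^esub>)},
      zero = one (K0 (add_monoid R)),
      add = mult (K0 (add_monoid R))\<rparr>"


section \<open>The Witt ring\<close>

context
  fixes C :: "('o, 'm, 'k, 'z) rigid_braided_category_scheme" (structure)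
begin

text \<open>The map \<open>h\<^sub>M(b)\<close>, with the unit and associativity isomorphisms made explicit.\<close>

definition adjoint_map :: "'o \<Rightarrow> 'm \<Rightarrow> 'm" where
  "adjoint_map M b =
     LUnit C (Dual C M) \<star>
     (b \<boxtimes>\<^sub>m Id C (Dual C M)) \<star>
     inv_arrow C ((M \<boxtimes> M) \<boxtimes> Dual C M) (M \<boxtimes> (M \<boxtimes> Dual C M)) (Assoc C M M (Dual C M)) \<star>
     (Id C M \<boxtimes>\<^sub>m Coev C M) \<star>
     inv_arrow C (M \<boxtimes> Unit C) M (RUnit C M)"

definition quadratic_objects :: "('o \<times> 'm) set" where
  "quadratic_objects =
     {(M, b) | M b. M \<in> Obj C \<and> b \<in> Hom C (M \<boxtimes> M) (Unit C) \<and>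
        b \<star> Braid C M M = b \<and> iso_arrow C M (Dual C M) (adjoint_map M b)}"

definition isometry_rel :: "(('o \<times> 'm) \<times> ('o \<times> 'm)) set" where
  "isometry_rel =
     {((M, b), (M', b')) | M b M' b'.
        (M, b) \<in> quadratic_objects \<and> (M', b') \<in> quadratic_objects \<and>
        (\<exists>f. iso_arrow C M M' f \<and> b' \<star> (f \<boxtimes>\<^sub>m f) = b)}"

definition orth_sum :: "'o \<times> 'm \<Rightarrow> 'o \<times> 'm \<Rightarrow> 'o \<times> 'm" where
  "orth_sum = (\<lambda>(M, b) (M', b').
     (M \<uplus> M', (b \<star> (Pr1 C M M' \<boxtimes>\<^sub>m Pr1 C M M')) \<boxplus> (b' \<star> (Pr2 C M M' \<boxtimes>\<^sub>m Pr2 C M M'))))"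

text \<open>
  The isomorphism \<open>1 \<otimes> c \<otimes> 1\<close> from \<open>(M \<boxtimes> M') \<boxtimes> (M \<boxtimes> M')\<close> to \<open>(M \<boxtimes> M) \<boxtimes> (M' \<boxtimes> M')\<close>, where
  \<open>c\<close> is the braiding from \<open>M' \<boxtimes> M\<close> to \<open>M \<boxtimes> M'\<close>.
\<close>

definition middle_swap :: "'o \<Rightarrow> 'o \<Rightarrow> 'm" where
  "middle_swap M M' =
     inv_arrow C ((M \<boxtimes> M) \<boxtimes> (M' \<boxtimes> M')) (M \<boxtimes> (M \<boxtimes> (M' \<boxtimes> M'))) (Assoc C M M (M' \<boxtimes> M')) \<star>
     (Id C M \<boxtimes>\<^sub>m
       (Assoc C M M' M' \<star>
        (Braid C M' M \<boxtimes>\<^sub>m Id C M') \<star>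
        inv_arrow C ((M' \<boxtimes> M) \<boxtimes> M') (M' \<boxtimes> (M \<boxtimes> M')) (Assoc C M' M M'))) \<star>
     Assoc C M M' (M \<boxtimes> M')"

definition tensor_quad :: "'o \<times> 'm \<Rightarrow> 'o \<times> 'm \<Rightarrow> 'o \<times> 'm" where
  "tensor_quad = (\<lambda>(M, b) (M', b').
     (M \<boxtimes> M', LUnit C (Unit C) \<star> (b \<boxtimes>\<^sub>m b') \<star> middle_swap M M'))"

definition weakly_symmetric_objects :: "'o set" where
  "weakly_symmetric_objects =
     {M \<in> Obj C. Ev C M = Ev C M \<star> Braid C M (Dual C M) \<star> Braid C (Dual C M) M}"

definition isomorphism_rel :: "('o \<times> 'o) set" where
  "isomorphism_rel =
     {(M, N) | M N. M \<in> weakly_symmetric_objects \<and> N \<in> weakly_symmetric_objects \<and>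
        (\<exists>f. iso_arrow C M N f)}"

definition hyperbolic :: "'o \<Rightarrow> 'o \<times> 'm" where
  "hyperbolic M =
     (M \<uplus> Dual C M,
      (Ev C M \<star> (Pr2 C M (Dual C M) \<boxtimes>\<^sub>m Pr1 C M (Dual C M))) \<boxplus>
      ((Ev C M \<star> Braid C M (Dual C M)) \<star> (Pr1 C M (Dual C M) \<boxtimes>\<^sub>m Pr2 C M (Dual C M))))"

text \<open>
  The isometry classes of non-singular quadratic objects; the additive part is the monoid defining
  \<open>K\<^sub>0(\<Q>)\<close>. The multiplicative part is meaningful for a symmetric braiding.
\<close>

definition quadratic_semiring :: "('o \<times> 'm) set ring" where
  "quadratic_semiring =
     \<lparr>carrier = quadratic_objects // isometry_rel,
      mult = class_op isometry_rel tensor_quad,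
      one = isometry_rel `` {(Unit C, LUnit C (Unit C))},
      zero = isometry_rel `` {(ZeroObj C, ZeroArr C (ZeroObj C \<boxtimes> ZeroObj C) (Unit C))},
      add = class_op isometry_rel orth_sum\<rparr>"

definition weakly_symmetric_monoid :: "'o set monoid" where
  "weakly_symmetric_monoid =
     \<lparr>carrier = weakly_symmetric_objects // isomorphism_rel,
      mult = class_op isomorphism_rel (\<uplus>),
      one = isomorphism_rel `` {ZeroObj C}\<rparr>"

definition hyperbolic_class :: "'o set \<Rightarrow> ('o \<times> 'm) set" where
  "hyperbolic_class X = (\<Union>M\<in>X. isometry_rel `` {hyperbolic M})"

definition Witt_ring :: "(('o \<times> 'm) set \<times> ('o \<times> 'm) set) set set ring" where
  "Witt_ring =
     K0_ring quadratic_semiring Quot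
       (K0_map (add_monoid quadratic_semiring) hyperbolic_class `
          carrier (K0 weakly_symmetric_monoid))"

end


section \<open>Complex representations of a group\<close>

text \<open>
  The Kronecker product is the matrix of the tensor product of two linear maps with respect to the
  bases \<open>e\<^sub>i \<otimes> f\<^sub>j\<close>, where \<open>e\<^sub>i \<otimes> f\<^sub>j\<close> has index \<open>i * m + j\<close> if the second space has dimension \<open>m\<close>.
\<close>

definition kronecker :: "complex mat \<Rightarrow> complex mat \<Rightarrow> complex mat" where
  "kronecker A B =
     mat (dim_row A * dim_row B) (dim_col A * dim_col B)
       (\<lambda>(i, j). A $$ (i div dim_row B, j div dim_col B) * B $$ (i mod dim_row B, j mod dim_col B))"

text \<open>The flip sends \<open>e\<^sub>i \<otimes> f\<^sub>j\<close>, of index \<open>i * m + j\<close>, to \<open>f\<^sub>j \<otimes> e\<^sub>i\<close>, of index \<open>j * n + i\<close>.\<close>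

definition flip_mat :: "nat \<Rightarrow> nat \<Rightarrow> complex mat" where
  "flip_mat n m =
     mat (m * n) (n * m) (\<lambda>(r, s). if r div n = s mod m \<and> r mod n = s div m then 1 else 0)"

text \<open>Evaluation is \<open>e\<^sup>i \<otimes> e\<^sub>j \<mapsto> \<delta>\<^sub>i\<^sub>j\<close>, coevaluation is \<open>1 \<mapsto> \<Sum>\<^sub>i e\<^sub>i \<otimes> e\<^sup>i\<close>, for the dual basis \<open>e\<^sup>i\<close>.\<close>

definition ev_mat :: "nat \<Rightarrow> complex mat" where
  "ev_mat n = mat 1 (n * n) (\<lambda>(_, s). if s div n = s mod n then 1 else 0)"

definition coev_mat :: "nat \<Rightarrow> complex mat" where
  "coev_mat n = mat (n * n) 1 (\<lambda>(r, _). if r div n = r mod n then 1 else 0)"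

definition pr1_mat :: "nat \<Rightarrow> nat \<Rightarrow> complex mat" where
  "pr1_mat n m = mat n (n + m) (\<lambda>(i, j). if j = i then 1 else 0)"

definition pr2_mat :: "nat \<Rightarrow> nat \<Rightarrow> complex mat" where
  "pr2_mat n m = mat m (n + m) (\<lambda>(i, j). if j = n + i then 1 else 0)"

text \<open>
  A representation is given by its degree \<open>n\<close>, possibly 0, and a homomorphism from \<open>G\<close> to the
  general linear group of \<open>n \<times> n\<close> matrices. It acts on column vectors.
\<close>

type_synonym 'a rep = "nat \<times> ('a \<Rightarrow> complex mat)"

definition GL :: "nat \<Rightarrow> complex mat monoid" where
  "GL n = units_of (ring_mat TYPE(complex) n ())"

definition representations :: "('a, 'z) monoid_scheme \<Rightarrow> 'a rep set" where
  "representations G = {(n, \<rho>) | n \<rho>. \<rho> \<in> hom G (GL n) \<and> \<rho> \<in> extensional (carrier G)}"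

definition intertwiners :: "('a, 'z) monoid_scheme \<Rightarrow> 'a rep \<Rightarrow> 'a rep \<Rightarrow> complex mat set" where
  "intertwiners G = (\<lambda>(n, \<rho>) (m, \<sigma>).
     {T \<in> carrier_mat m n. \<forall>g\<in>carrier G. T * \<rho> g = \<sigma> g * T})"

text \<open>The Kronecker product is strictly associative and unital, so the constraints are identities.\<close>

definition Rep ::
  "('a, 'z) monoid_scheme \<Rightarrow> ('a rep, complex mat, complex) rigid_braided_category" where
  "Rep G =
     \<lparr>Obj = representations G,
      Hom = intertwiners G,
      Comp = (*),
      Id = (\<lambda>(n, \<rho>). 1\<^sub>m n),
      Add = (+),
      ZeroArr = (\<lambda>(n, \<rho>) (m, \<sigma>). 0\<^sub>m m n),
      Scale = (\<cdot>\<^sub>m),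
      Unit = (1, \<lambda>g\<in>carrier G. 1\<^sub>m 1),
      TObj = (\<lambda>(n, \<rho>) (m, \<sigma>). (n * m, \<lambda>g\<in>carrier G. kronecker (\<rho> g) (\<sigma> g))),
      TArr = kronecker,
      Assoc = (\<lambda>(n, \<rho>) (m, \<sigma>) (l, \<tau>). 1\<^sub>m (n * m * l)),
      LUnit = (\<lambda>(n, \<rho>). 1\<^sub>m n),
      RUnit = (\<lambda>(n, \<rho>). 1\<^sub>m n),
      Braid = (\<lambda>(n, \<rho>) (m, \<sigma>). flip_mat n m),
      Dual = (\<lambda>(n, \<rho>). (n, \<lambda>g\<in>carrier G. transpose_mat (\<rho> (inv\<^bsub>G\<^esub> g)))),
      Ev = (\<lambda>(n, \<rho>). ev_mat n),
      Coev = (\<lambda>(n, \<rho>). coev_mat n),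
      ZeroObj = (0, \<lambda>g\<in>carrier G. 1\<^sub>m 0),
      DSum = (\<lambda>(n, \<rho>) (m, \<sigma>).
        (n + m, \<lambda>g\<in>carrier G. four_block_mat (\<rho> g) (0\<^sub>m n m) (0\<^sub>m m n) (\<sigma> g))),
      Pr1 = (\<lambda>(n, \<rho>) (m, \<sigma>). pr1_mat n m),
      Pr2 = (\<lambda>(n, \<rho>) (m, \<sigma>). pr2_mat n m)\<rparr>"

definition isocategorical :: "('a, 'y) monoid_scheme \<Rightarrow> ('b, 'z) monoid_scheme \<Rightarrow> bool" where
  "isocategorical G H \<longleftrightarrow> linear_monoidal_equivalent (Rep G) (Rep H)"

end

theory Submission
  imports Defs "Jordan_Normal_Form.Schur_Decomposition"
begin

text \<open>
  Over \<open>\<complex>\<close> an invertible matrix has a square root that is a polynomial in it. Applied to the quotient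
  \<open>B'\<^sup>-\<^sup>1 B\<close> of two non-degenerate invariant symmetric forms on the same representation, this gives an equivariant
  isometry between them. So the isometry class of a quadratic object is determined by the
  underlying object, and the Witt ring depends only on the isomorphism classes of objects, with their
  direct sums, tensor products and duals, and on which of them carry a non-degenerate symmetric form.

  A monoidal equivalence \<open>F\<close> preserves sums, tensor products and duals up to isomorphism. That it also preserves
  and reflects the existence of symmetric forms, although it ignores the braidings, is seen from traces. For a
  form \<open>b\<close> on \<open>M\<close> with inverse copairing \<open>c\<close>, the scalars \<open>b \<circ> (f \<otimes> 1) \<circ> c\<close> and \<open>b \<circ> (1 \<otimes> f) \<circ> c\<close>
  are preserved by \<open>F\<close>. They are \<open>tr (\<alpha> f)\<close> and \<open>tr (\<alpha>\<^sup>-\<^sup>1 f)\<close> for the asymmetry \<open>\<alpha>\<close> of \<open>b\<close>, and both equal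
  \<open>tr f\<close> if \<open>b\<close> is symmetric. Hence the asymmetry \<open>\<alpha>\<close> of the transported form satisfies \<open>\<alpha>\<^sup>2 = 1\<close>. If \<open>e\<close> is the
  projection onto its \<open>-1\<close>-eigenspace then \<open>tr (\<alpha> e) = - tr e \<le> 0\<close>, while on the other side this number is
  the trace of an idempotent and therefore not negative. So \<open>e = 0\<close> and the transported form is symmetric.
\<close>

section \<open>Grothendieck rings of commutative semirings\<close>

text \<open>The braiding is the obstacle. Symmetry of a form and the trace of an endomorphism are
  both defined through the flip, which \<open>F\<close> need not respect, so neither can be
  transported directly. The scalars of the overview are arrows from the unit to itself built from
  pairings, copairings and composition alone; linearity of \<open>F\<close> and coherence of
  \<open>J\<close> and \<open>u\<close> suffice to carry them over. Equality of the two scalars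
  still leaves the asymmetry free to be -1 on some isotypic part, as for a symplectic form;
  positivity of the trace of an idempotent is what excludes this. Recovering \<alpha> from traces
  needs the trace pairing on endomorphisms to be nondegenerate. That is proved by averaging over the
  group, and there finiteness enters. The hyperbolic classes form an ideal because a quadratic
  object is self-dual, so that tensoring with it commutes with forming duals up to isomorphism.
  Kronecker products make associativity, the unit laws and one distributive law strict in
  \<open>Rep G\<close>; the coherence maps that remain are those of \<open>F\<close>.\<close>

lemma class_op_class:
  assumes r: "equiv A r" and x: "x \<in> A" and y: "y \<in> A"
    and cong: "\<And>x x' y y'. (x, x') \<in> r \<Longrightarrow> (y, y') \<in> r \<Longrightarrow> (f x y, f x' y') \<in> r"
  shows "class_op r f (r `` {x}) (r `` {y}) = r `` {f x y}"
proof -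
  have "r `` {f x' y'} = r `` {f x y}" if "x' \<in> r `` {x}" "y' \<in> r `` {y}" for x' y'
    using equiv_class_eq[OF r cong[of x x' y y']] that by auto
  \<comment> \<open>Reflexivity keeps the union in \<open>class_op\<close> from being empty.\<close>
  moreover have "x \<in> r `` {x}" "y \<in> r `` {y}"
    using equiv_class_self[OF r] x y by auto
  ultimately show ?thesis
    unfolding class_op_def by blast
qed

definition diff_rel :: "('a, 'z) ring_scheme \<Rightarrow> (('a \<times> 'a) \<times> ('a \<times> 'a)) set" where
  "diff_rel R = K0_rel (add_monoid R)"

text \<open>\<open>add_monoid\<close> only abbreviates a record, so goals show its expanded form;
  the rule folds that form back into one constant.\<close>

lemma K0_rel_add_monoid [simp]:
  fixes R :: "'a ring"
  shows "K0_rel \<lparr>carrier = carrier R, monoid.mult = (\<oplus>\<^bsub>R\<^esub>), one = \<zero>\<^bsub>R\<^esub>\<rparr> = diff_rel R"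
  by (simp add: diff_rel_def)

definition diff_class :: "('a, 'z) ring_scheme \<Rightarrow> 'a \<Rightarrow> 'a \<Rightarrow> ('a \<times> 'a) set" where
  "diff_class R a b = diff_rel R `` {(a, b)}"

locale comm_semiring_struct = semiring R + comm_monoid R for R :: "'a ring" (structure)
begin

lemma diff_rel_iff:
  "((a, b), (c, d)) \<in> diff_rel R \<longleftrightarrow>
     a \<in> carrier R \<and> b \<in> carrier R \<and> c \<in> carrier R \<and> d \<in> carrier R \<and>
     (\<exists>k\<in>carrier R. (a \<oplus> d) \<oplus> k = (c \<oplus> b) \<oplus> k)"
  by (auto simp: diff_rel_def K0_rel_def)

lemma diff_relI:
  assumes "a \<in> carrier R" "b \<in> carrier R" "c \<in> carrier R" "d \<in> carrier R" "k \<in> carrier R"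
    and "(a \<oplus> d) \<oplus> k = (c \<oplus> b) \<oplus> k"
  shows "((a, b), (c, d)) \<in> diff_rel R"
  using assms diff_rel_iff by blast

lemma equiv_diff_rel: "equiv (carrier R \<times> carrier R) (diff_rel R)"
proof (rule equivI)
  show "diff_rel R \<subseteq> (carrier R \<times> carrier R) \<times> carrier R \<times> carrier R"
    by (auto simp: diff_rel_iff)
  show "refl_on (carrier R \<times> carrier R) (diff_rel R)"
    by (auto simp: refl_on_def diff_rel_iff)
  show "sym (diff_rel R)"
    by (rule symI) (auto simp: diff_rel_iff; metis)
  show "trans (diff_rel R)"
  proof (rule transI, clarify)
    fix a b c d e f
    assume 1: "((a, b), (c, d)) \<in> diff_rel R" "((c, d), (e, f)) \<in> diff_rel R"
    then have [simp]: "a \<in> carrier R" "b \<in> carrier R" "c \<in> carrier R" "d \<in> carrier R"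
      "e \<in> carrier R" "f \<in> carrier R"
      by (auto simp: diff_rel_iff)
    from 1 obtain k l where k [simp]: "k \<in> carrier R" "l \<in> carrier R"
      and eq: "(a \<oplus> d) \<oplus> k = (c \<oplus> b) \<oplus> k" "(c \<oplus> f) \<oplus> l = (e \<oplus> d) \<oplus> l"
      by (auto simp: diff_rel_iff)
    \<comment> \<open>Adding the two equations leaves \<open>d\<close> and \<open>c\<close> on both
      sides. They cannot be cancelled in a semiring and are absorbed into the witness.\<close>
    have "(a \<oplus> f) \<oplus> (d \<oplus> k \<oplus> c \<oplus> l) = ((a \<oplus> d) \<oplus> k) \<oplus> ((c \<oplus> f) \<oplus> l)"
      by (simp add: a_ac)
    also have "\<dots> = ((c \<oplus> b) \<oplus> k) \<oplus> ((e \<oplus> d) \<oplus> l)"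
      by (simp only: eq)
    also have "\<dots> = (e \<oplus> b) \<oplus> (d \<oplus> k \<oplus> c \<oplus> l)"
      by (simp add: a_ac)
    finally show "((a, b), (e, f)) \<in> diff_rel R"
      by (intro diff_relI[where k = "d \<oplus> k \<oplus> c \<oplus> l"]) auto
  qed
qed

lemma diff_class_eq_iff:
  assumes "a \<in> carrier R" "b \<in> carrier R" "c \<in> carrier R" "d \<in> carrier R"
  shows "diff_class R a b = diff_class R c d \<longleftrightarrow>
    (\<exists>k\<in>carrier R. (a \<oplus> d) \<oplus> k = (c \<oplus> b) \<oplus> k)"
  unfolding diff_class_def
  using eq_equiv_class_iff[OF equiv_diff_rel, of "(a, b)" "(c, d)"] assms by (auto simp: diff_rel_iff)

lemma diff_class_eqI:
  assumes "a \<in> carrier R" "b \<in> carrier R" "c \<in> carrier R" "d \<in> carrier R"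
    and "a \<oplus> d = c \<oplus> b"
  shows "diff_class R a b = diff_class R c d"
  unfolding diff_class_eq_iff[OF assms(1-4)] using assms(5) by (intro bexI[of _ \<zero>]) auto

lemma carrier_K0_ring:
  "carrier (K0_ring R) = {diff_class R a b | a b. a \<in> carrier R \<and> b \<in> carrier R}"
  by (auto simp: K0_ring_def K0_def quotient_def diff_class_def)

lemma diff_class_closed [simp]:
  "a \<in> carrier R \<Longrightarrow> b \<in> carrier R \<Longrightarrow> diff_class R a b \<in> carrier (K0_ring R)"
  by (auto simp: carrier_K0_ring)

lemma K0_ring_zero: "\<zero>\<^bsub>K0_ring R\<^esub> = diff_class R \<zero> \<zero>"
  by (simp add: K0_ring_def K0_def diff_class_def)

lemma K0_ring_one: "\<one>\<^bsub>K0_ring R\<^esub> = diff_class R \<one> \<zero>"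
  by (simp add: K0_ring_def diff_class_def)

lemma K0_ring_add:
  assumes "a \<in> carrier R" "b \<in> carrier R" "c \<in> carrier R" "d \<in> carrier R"
  shows "diff_class R a b \<oplus>\<^bsub>K0_ring R\<^esub> diff_class R c d = diff_class R (a \<oplus> c) (b \<oplus> d)"
proof -
  let ?r = "diff_rel R"
  let ?f = "\<lambda>(a, b) (c, d). (a \<oplus> c, b \<oplus> d)"
  have "class_op ?r ?f (?r `` {(a, b)}) (?r `` {(c, d)}) = ?r `` {?f (a, b) (c, d)}"
  proof (rule class_op_class[OF equiv_diff_rel])
    fix x x' y y' assume xy: "(x, x') \<in> ?r" "(y, y') \<in> ?r"
    obtain a b a' b' c d c' d' where [simp]:
      "x = (a, b)" "x' = (a', b')" "y = (c, d)" "y' = (c', d')" by (metis surj_pair)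
    have [simp]: "a \<in> carrier R" "b \<in> carrier R" "c \<in> carrier R" "d \<in> carrier R"
      "a' \<in> carrier R" "b' \<in> carrier R" "c' \<in> carrier R" "d' \<in> carrier R"
      using xy by (auto simp: diff_rel_iff)
    from xy obtain k l where [simp]: "k \<in> carrier R" "l \<in> carrier R"
      and eq: "(a \<oplus> b') \<oplus> k = (a' \<oplus> b) \<oplus> k" "(c \<oplus> d') \<oplus> l = (c' \<oplus> d) \<oplus> l"
      by (auto simp: diff_rel_iff)
    have "((a \<oplus> c) \<oplus> (b' \<oplus> d')) \<oplus> (k \<oplus> l) = ((a \<oplus> b') \<oplus> k) \<oplus> ((c \<oplus> d') \<oplus> l)"
      by (simp add: a_ac)
    also have "\<dots> = ((a' \<oplus> b) \<oplus> k) \<oplus> ((c' \<oplus> d) \<oplus> l)"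
      by (simp only: eq)
    also have "\<dots> = ((a' \<oplus> c') \<oplus> (b \<oplus> d)) \<oplus> (k \<oplus> l)"
      by (simp add: a_ac)
    finally show "(?f x y, ?f x' y') \<in> ?r"
      by simp (intro diff_relI[where k = "k \<oplus> l"]; simp)
  qed (use assms in auto)
  then show ?thesis
    by (simp add: K0_ring_def K0_def diff_class_def)
qed

text \<open>The equation behind the relation is multiplied by \<open>c\<close> in one direction and
  by \<open>d\<close> in the other, so the stabilising term becomes
  \<open>k \<otimes> c \<oplus> k \<otimes> d\<close>.\<close>

lemma diff_rel_mult_left:
  assumes "((a, b), (a', b')) \<in> diff_rel R" and [simp]: "c \<in> carrier R" "d \<in> carrier R"
  shows "((a \<otimes> c \<oplus> b \<otimes> d, a \<otimes> d \<oplus> b \<otimes> c), (a' \<otimes> c \<oplus> b' \<otimes> d, a' \<otimes> d \<oplus> b' \<otimes> c))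
    \<in> diff_rel R"
proof -
  have [simp]: "a \<in> carrier R" "b \<in> carrier R" "a' \<in> carrier R" "b' \<in> carrier R"
    using assms(1) by (auto simp: diff_rel_iff)
  from assms(1) obtain k where [simp]: "k \<in> carrier R" and eq: "(a \<oplus> b') \<oplus> k = (a' \<oplus> b) \<oplus> k"
    by (auto simp: diff_rel_iff)
  have "((a \<otimes> c \<oplus> b \<otimes> d) \<oplus> (a' \<otimes> d \<oplus> b' \<otimes> c)) \<oplus> (k \<otimes> c \<oplus> k \<otimes> d) =
      ((a \<oplus> b') \<oplus> k) \<otimes> c \<oplus> ((a' \<oplus> b) \<oplus> k) \<otimes> d"
    by (simp add: l_distr a_ac)
  also have "\<dots> = ((a' \<oplus> b) \<oplus> k) \<otimes> c \<oplus> ((a \<oplus> b') \<oplus> k) \<otimes> d"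
    by (simp only: eq)
  also have "\<dots> = ((a' \<otimes> c \<oplus> b' \<otimes> d) \<oplus> (a \<otimes> d \<oplus> b \<otimes> c)) \<oplus> (k \<otimes> c \<oplus> k \<otimes> d)"
    by (simp add: l_distr a_ac)
  finally show ?thesis
    by (intro diff_relI[where k = "k \<otimes> c \<oplus> k \<otimes> d"]) auto
qed

lemma K0_ring_mult:
  assumes "a \<in> carrier R" "b \<in> carrier R" "c \<in> carrier R" "d \<in> carrier R"
  shows "diff_class R a b \<otimes>\<^bsub>K0_ring R\<^esub> diff_class R c d =
    diff_class R (a \<otimes> c \<oplus> b \<otimes> d) (a \<otimes> d \<oplus> b \<otimes> c)"
proof -
  let ?r = "diff_rel R"
  let ?f = "\<lambda>(a, b) (c, d). (a \<otimes> c \<oplus> b \<otimes> d, a \<otimes> d \<oplus> b \<otimes> c)"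
  have left: "(?f x y, ?f x' y) \<in> ?r" if "(x, x') \<in> ?r" "y \<in> carrier R \<times> carrier R" for x x' y
    using diff_rel_mult_left that by (cases x; cases x'; cases y) auto
  \<comment> \<open>By commutativity, compatibility in the left argument gives it in the right
    one.\<close>
  have comm: "?f x y = ?f y x" if "x \<in> carrier R \<times> carrier R" "y \<in> carrier R \<times> carrier R" for x y
    using that by (auto simp: m_comm a_comm)
  have "class_op ?r ?f (?r `` {(a, b)}) (?r `` {(c, d)}) = ?r `` {?f (a, b) (c, d)}"
  proof (rule class_op_class[OF equiv_diff_rel])
    fix x x' y y' assume xy: "(x, x') \<in> ?r" "(y, y') \<in> ?r"
    then have car: "x \<in> carrier R \<times> carrier R" "x' \<in> carrier R \<times> carrier R"
      "y \<in> carrier R \<times> carrier R" "y' \<in> carrier R \<times> carrier R"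
      using equiv_diff_rel by (auto simp: equiv_def)
    have "(?f x y, ?f x' y) \<in> ?r"
      by (rule left[OF xy(1) car(3)])
    moreover have "(?f x' y, ?f x' y') \<in> ?r"
      unfolding comm[OF car(2,3)] comm[OF car(2,4)] by (rule left[OF xy(2) car(2)])
    ultimately show "(?f x y, ?f x' y') \<in> ?r"
      using equiv_diff_rel by (meson equiv_def transE)
  qed (use assms in auto)
  then show ?thesis
    by (simp add: K0_ring_def diff_class_def)
qed

lemma cring_K0_ring: "cring (K0_ring R)"
proof (rule cringI)
  note ops = K0_ring_zero K0_ring_one K0_ring_add K0_ring_mult
  show "abelian_group (K0_ring R)"
  proof (rule abelian_groupI)
    fix x y z
    assume x: "x \<in> carrier (K0_ring R)"
    then obtain a b where [simp]: "x = diff_class R a b" "a \<in> carrier R" "b \<in> carrier R"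
      by (auto simp: carrier_K0_ring)
    show "\<zero>\<^bsub>K0_ring R\<^esub> \<oplus>\<^bsub>K0_ring R\<^esub> x = x"
      by (simp add: ops)
    show "\<exists>y\<in>carrier (K0_ring R). y \<oplus>\<^bsub>K0_ring R\<^esub> x = \<zero>\<^bsub>K0_ring R\<^esub>"
    proof (rule bexI[of _ "diff_class R b a"])
      have "diff_class R (b \<oplus> a) (a \<oplus> b) = diff_class R \<zero> \<zero>"
        by (rule diff_class_eqI) (simp_all add: a_comm)
      then show "diff_class R b a \<oplus>\<^bsub>K0_ring R\<^esub> x = \<zero>\<^bsub>K0_ring R\<^esub>"
        by (simp add: ops)
    qed simp
    assume y: "y \<in> carrier (K0_ring R)"
    then obtain c d where [simp]: "y = diff_class R c d" "c \<in> carrier R" "d \<in> carrier R"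
      by (auto simp: carrier_K0_ring)
    show "x \<oplus>\<^bsub>K0_ring R\<^esub> y \<in> carrier (K0_ring R)" "x \<oplus>\<^bsub>K0_ring R\<^esub> y = y \<oplus>\<^bsub>K0_ring R\<^esub> x"
      by (simp_all add: ops a_comm)
    assume "z \<in> carrier (K0_ring R)"
    then obtain e f where [simp]: "z = diff_class R e f" "e \<in> carrier R" "f \<in> carrier R"
      by (auto simp: carrier_K0_ring)
    show "x \<oplus>\<^bsub>K0_ring R\<^esub> y \<oplus>\<^bsub>K0_ring R\<^esub> z = x \<oplus>\<^bsub>K0_ring R\<^esub> (y \<oplus>\<^bsub>K0_ring R\<^esub> z)"
      by (simp add: ops a_ac)
  qed (simp add: ops)
  show "comm_monoid (K0_ring R)"
  proof (rule comm_monoidI)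
    fix x y z
    assume x: "x \<in> carrier (K0_ring R)"
    then obtain a b where [simp]: "x = diff_class R a b" "a \<in> carrier R" "b \<in> carrier R"
      by (auto simp: carrier_K0_ring)
    show "\<one>\<^bsub>K0_ring R\<^esub> \<otimes>\<^bsub>K0_ring R\<^esub> x = x"
      by (simp add: ops)
    assume y: "y \<in> carrier (K0_ring R)"
    then obtain c d where [simp]: "y = diff_class R c d" "c \<in> carrier R" "d \<in> carrier R"
      by (auto simp: carrier_K0_ring)
    show "x \<otimes>\<^bsub>K0_ring R\<^esub> y \<in> carrier (K0_ring R)"
      by (simp add: ops)
    show "x \<otimes>\<^bsub>K0_ring R\<^esub> y = y \<otimes>\<^bsub>K0_ring R\<^esub> x"
      by (simp add: ops m_comm a_comm)
    assume "z \<in> carrier (K0_ring R)"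
    then obtain e f where [simp]: "z = diff_class R e f" "e \<in> carrier R" "f \<in> carrier R"
      by (auto simp: carrier_K0_ring)
    show "x \<otimes>\<^bsub>K0_ring R\<^esub> y \<otimes>\<^bsub>K0_ring R\<^esub> z = x \<otimes>\<^bsub>K0_ring R\<^esub> (y \<otimes>\<^bsub>K0_ring R\<^esub> z)"
      by (simp add: ops l_distr r_distr a_ac m_assoc)
  qed (simp add: ops)
  fix x y z
  assume "x \<in> carrier (K0_ring R)" "y \<in> carrier (K0_ring R)" "z \<in> carrier (K0_ring R)"
  then obtain a b c d e f where [simp]: "x = diff_class R a b" "a \<in> carrier R" "b \<in> carrier R"
    "y = diff_class R c d" "c \<in> carrier R" "d \<in> carrier R"
    "z = diff_class R e f" "e \<in> carrier R" "f \<in> carrier R"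
    by (auto simp: carrier_K0_ring)
  show "(x \<oplus>\<^bsub>K0_ring R\<^esub> y) \<otimes>\<^bsub>K0_ring R\<^esub> z =
      x \<otimes>\<^bsub>K0_ring R\<^esub> z \<oplus>\<^bsub>K0_ring R\<^esub> y \<otimes>\<^bsub>K0_ring R\<^esub> z"
    by (simp add: ops l_distr a_ac)
qed

section \<open>Ideals of differences and isomorphisms of Grothendieck rings\<close>

definition diff_ideal :: "'a set \<Rightarrow> ('a \<times> 'a) set set" where
  "diff_ideal T = {diff_class R a b | a b. a \<in> T \<and> b \<in> T}"

text \<open>Negation in the Grothendieck ring only exchanges the two entries of a difference, so a
  subset of a semiring, where nothing can be subtracted, still yields an ideal.\<close>

lemma ideal_diff_ideal:
  assumes T: "T \<subseteq> carrier R" "\<zero> \<in> T" "\<And>a b. a \<in> T \<Longrightarrow> b \<in> T \<Longrightarrow> a \<oplus> b \<in> T"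
    "\<And>a c. a \<in> T \<Longrightarrow> c \<in> carrier R \<Longrightarrow> a \<otimes> c \<in> T"
  shows "ideal (diff_ideal T) (K0_ring R)"
proof -
  interpret K: cring "K0_ring R" by (rule cring_K0_ring)
  have sub: "a \<in> carrier R" if "a \<in> T" for a using T(1) that by auto
  have mult: "x \<otimes>\<^bsub>K0_ring R\<^esub> y \<in> diff_ideal T"
    if "x \<in> diff_ideal T" "y \<in> carrier (K0_ring R)" for x y
  proof -
    note xy = that
    obtain a b c d where "x = diff_class R a b" "a \<in> T" "b \<in> T"
      "y = diff_class R c d" "c \<in> carrier R" "d \<in> carrier R"
      using xy unfolding diff_ideal_def carrier_K0_ring by blast
    moreover from this have "x \<otimes>\<^bsub>K0_ring R\<^esub> y = diff_class R (a \<otimes> c \<oplus> b \<otimes> d) (a \<otimes> d \<oplus> b \<otimes> c)"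
      by (simp add: K0_ring_mult sub)
    ultimately show ?thesis
      unfolding diff_ideal_def using T(3,4) by blast
  qed
  have neg: "\<ominus>\<^bsub>K0_ring R\<^esub> diff_class R a b = diff_class R b a" if "a \<in> carrier R" "b \<in> carrier R" for a b
  proof (rule K.minus_equality)
    show "diff_class R b a \<oplus>\<^bsub>K0_ring R\<^esub> diff_class R a b = \<zero>\<^bsub>K0_ring R\<^esub>"
      unfolding K0_ring_zero K0_ring_add[OF that(2,1) that]
      by (rule diff_class_eqI) (use that in \<open>simp_all add: a_comm\<close>)
  qed (use that in simp_all)
  show ?thesis
  proof (rule idealI)
    show "ring (K0_ring R)" by (rule K.ring_axioms)
    show "subgroup (diff_ideal T) (add_monoid (K0_ring R))"
    proof (unfold_locales, goal_cases)
      case 1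
      then show ?case by (auto simp: diff_ideal_def sub)
    next
      case (2 x y)
      then obtain a b c d where "x = diff_class R a b" "y = diff_class R c d"
        "a \<in> T" "b \<in> T" "c \<in> T" "d \<in> T"
        unfolding diff_ideal_def by blast
      then have "x \<oplus>\<^bsub>K0_ring R\<^esub> y = diff_class R (a \<oplus> c) (b \<oplus> d)" "a \<oplus> c \<in> T" "b \<oplus> d \<in> T"
        by (simp_all add: K0_ring_add sub T(3))
      then show ?case
        unfolding diff_ideal_def by auto
    next
      case 3
      then show ?case using T(2) by (auto simp: diff_ideal_def K0_ring_zero)
    next
      case (4 x)
      then obtain a b where "x = diff_class R a b" "a \<in> T" "b \<in> T"
        unfolding diff_ideal_def by blast
      then show ?case
        unfolding diff_ideal_def a_inv_def[symmetric] using neg sub by blast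
    qed
    fix a x assume a: "a \<in> diff_ideal T" and x: "x \<in> carrier (K0_ring R)"
    show r: "a \<otimes>\<^bsub>K0_ring R\<^esub> x \<in> diff_ideal T" by (rule mult[OF a x])
    have "a \<in> carrier (K0_ring R)"
      using a by (auto simp: diff_ideal_def sub)
    then show "x \<otimes>\<^bsub>K0_ring R\<^esub> a \<in> diff_ideal T"
      using r K.m_comm x by metis
  qed
qed

end

text \<open>The image of a \<open>diff_ideal\<close> is recorded as well, because the Witt ring is
  the quotient by such an ideal.\<close>

lemma ring_iso_K0_ring:
  fixes R :: "'a ring" and S :: "'b ring"
  assumes "comm_semiring_struct R" "comm_semiring_struct S" and \<theta>: "\<theta> \<in> ring_iso R S"
    and T: "T \<subseteq> carrier R"
  obtains \<Theta> where "\<Theta> \<in> ring_iso (K0_ring R) (K0_ring S)"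
    "\<Theta> ` comm_semiring_struct.diff_ideal R T = comm_semiring_struct.diff_ideal S (\<theta> ` T)"
proof -
  interpret R: comm_semiring_struct R by fact
  interpret S: comm_semiring_struct S by fact
  have hom: "\<theta> x \<in> carrier S" "\<theta> (x \<otimes>\<^bsub>R\<^esub> y) = \<theta> x \<otimes>\<^bsub>S\<^esub> \<theta> y" "\<theta> (x \<oplus>\<^bsub>R\<^esub> y) = \<theta> x \<oplus>\<^bsub>S\<^esub> \<theta> y"
    if "x \<in> carrier R" "y \<in> carrier R" for x y
    using \<theta> that by (auto simp: ring_iso_def ring_hom_def)
  have closed: "\<theta> x \<in> carrier S" if "x \<in> carrier R" for x
    using hom(1) that by blast
  have one: "\<theta> \<one>\<^bsub>R\<^esub> = \<one>\<^bsub>S\<^esub>"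
    using \<theta> by (auto simp: ring_iso_def ring_hom_def)
  have bij: "bij_betw \<theta> (carrier R) (carrier S)"
    using \<theta> by (auto simp: ring_iso_def)
  have inj: "\<theta> x = \<theta> y \<longleftrightarrow> x = y" if "x \<in> carrier R" "y \<in> carrier R" for x y
    using bij that by (auto simp: bij_betw_def inj_on_def)
  have surj: "\<exists>x\<in>carrier R. y = \<theta> x" if "y \<in> carrier S" for y
    using bij that by (auto simp: bij_betw_def image_iff)
  have zero: "\<theta> \<zero>\<^bsub>R\<^esub> = \<zero>\<^bsub>S\<^esub>"
  proof -
    obtain x where x: "x \<in> carrier R" "\<zero>\<^bsub>S\<^esub> = \<theta> x" using surj by blast
    have "\<theta> \<zero>\<^bsub>R\<^esub> = \<theta> \<zero>\<^bsub>R\<^esub> \<oplus>\<^bsub>S\<^esub> \<theta> x"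
      unfolding x(2)[symmetric] by (simp add: closed)
    also have "\<dots> = \<theta> (\<zero>\<^bsub>R\<^esub> \<oplus>\<^bsub>R\<^esub> x)" using x(1) by (simp only: hom(3) R.zero_closed)
    finally show ?thesis using x R.l_zero[OF x(1)] closed[of "\<zero>\<^bsub>R\<^esub>"] S.r_zero by simp
  qed
  define \<Theta> where "\<Theta> X = (\<Union>(a, b)\<in>X. diff_class S (\<theta> a) (\<theta> b))" for X
  have eq_iff: "diff_class S (\<theta> a) (\<theta> b) = diff_class S (\<theta> c) (\<theta> d) \<longleftrightarrow>
      diff_class R a b = diff_class R c d"
    if [simp]: "a \<in> carrier R" "b \<in> carrier R" "c \<in> carrier R" "d \<in> carrier R" for a b c d
  proof
    assume "diff_class S (\<theta> a) (\<theta> b) = diff_class S (\<theta> c) (\<theta> d)"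
    then obtain k where "k \<in> carrier S"
      "(\<theta> a \<oplus>\<^bsub>S\<^esub> \<theta> d) \<oplus>\<^bsub>S\<^esub> k = (\<theta> c \<oplus>\<^bsub>S\<^esub> \<theta> b) \<oplus>\<^bsub>S\<^esub> k"
      by (auto simp: S.diff_class_eq_iff hom(2,3) closed)
    \<comment> \<open>The stabilising element lives in \<open>S\<close> and has to be pulled back
      before injectivity applies.\<close>
    moreover from this surj obtain l where [simp]: "l \<in> carrier R" "k = \<theta> l" by blast
    ultimately have "\<theta> ((a \<oplus>\<^bsub>R\<^esub> d) \<oplus>\<^bsub>R\<^esub> l) = \<theta> ((c \<oplus>\<^bsub>R\<^esub> b) \<oplus>\<^bsub>R\<^esub> l)"
      by (simp add: hom(2,3) closed)
    then show "diff_class R a b = diff_class R c d"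
      by (auto simp: R.diff_class_eq_iff inj)
  next
    assume "diff_class R a b = diff_class R c d"
    then obtain k where [simp]: "k \<in> carrier R" and "(a \<oplus>\<^bsub>R\<^esub> d) \<oplus>\<^bsub>R\<^esub> k = (c \<oplus>\<^bsub>R\<^esub> b) \<oplus>\<^bsub>R\<^esub> k"
      by (auto simp: R.diff_class_eq_iff)
    then have "\<theta> ((a \<oplus>\<^bsub>R\<^esub> d) \<oplus>\<^bsub>R\<^esub> k) = \<theta> ((c \<oplus>\<^bsub>R\<^esub> b) \<oplus>\<^bsub>R\<^esub> k)"
      by simp
    then show "diff_class S (\<theta> a) (\<theta> b) = diff_class S (\<theta> c) (\<theta> d)"
      by (auto simp: S.diff_class_eq_iff hom(2,3) closed intro!: bexI[of _ "\<theta> k"])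
  qed
  have \<Theta>: "\<Theta> (diff_class R a b) = diff_class S (\<theta> a) (\<theta> b)"
    if ab [simp]: "a \<in> carrier R" "b \<in> carrier R" for a b
  proof -
    have "diff_class S (\<theta> c) (\<theta> d) = diff_class S (\<theta> a) (\<theta> b)" if "(c, d) \<in> diff_class R a b" for c d
    proof -
      have rel: "((a, b), (c, d)) \<in> diff_rel R" using that by (simp add: diff_class_def)
      then have "c \<in> carrier R" "d \<in> carrier R" by (auto simp: R.diff_rel_iff)
      moreover have "diff_class R a b = diff_class R c d"
        unfolding diff_class_def by (rule equiv_class_eq[OF R.equiv_diff_rel rel])
      ultimately show ?thesis using ab eq_iff[of c d a b] by metis
    qed
    moreover have "(a, b) \<in> diff_class R a b"
      unfolding diff_class_def by (rule equiv_class_self[OF R.equiv_diff_rel]) simp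
    ultimately show ?thesis unfolding \<Theta>_def by blast
  qed
  show ?thesis
  proof
    show "\<Theta> \<in> ring_iso (K0_ring R) (K0_ring S)"
    proof (rule ring_iso_memI)
      show "bij_betw \<Theta> (carrier (K0_ring R)) (carrier (K0_ring S))"
        unfolding bij_betw_def
      proof
        show "inj_on \<Theta> (carrier (K0_ring R))"
          by (auto simp: inj_on_def R.carrier_K0_ring \<Theta> eq_iff)
        show "\<Theta> ` carrier (K0_ring R) = carrier (K0_ring S)"
        proof
          show "\<Theta> ` carrier (K0_ring R) \<subseteq> carrier (K0_ring S)"
            by (auto simp: R.carrier_K0_ring \<Theta> hom(2,3) closed)
          show "carrier (K0_ring S) \<subseteq> \<Theta> ` carrier (K0_ring R)"
          proof
            fix x assume "x \<in> carrier (K0_ring S)"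
            then obtain c d where "x = diff_class S c d" "c \<in> carrier S" "d \<in> carrier S"
              by (auto simp: S.carrier_K0_ring)
            moreover from this surj obtain a b where "a \<in> carrier R" "c = \<theta> a" "b \<in> carrier R" "d = \<theta> b"
              by metis
            ultimately have "x = \<Theta> (diff_class R a b)" "diff_class R a b \<in> carrier (K0_ring R)"
              by (auto simp: \<Theta>)
            then show "x \<in> \<Theta> ` carrier (K0_ring R)" by blast
          qed
        qed
      qed
      show "\<Theta> \<one>\<^bsub>K0_ring R\<^esub> = \<one>\<^bsub>K0_ring S\<^esub>"
        by (simp add: R.K0_ring_one S.K0_ring_one \<Theta> one zero)
      fix x y assume xy: "x \<in> carrier (K0_ring R)" "y \<in> carrier (K0_ring R)"
      then obtain a b c d where [simp]: "x = diff_class R a b" "a \<in> carrier R" "b \<in> carrier R"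
        "y = diff_class R c d" "c \<in> carrier R" "d \<in> carrier R"
        unfolding R.carrier_K0_ring by blast
      show "\<Theta> x \<in> carrier (K0_ring S)"
        by (simp add: \<Theta> closed)
      show "\<Theta> (x \<otimes>\<^bsub>K0_ring R\<^esub> y) = \<Theta> x \<otimes>\<^bsub>K0_ring S\<^esub> \<Theta> y"
        by (simp add: R.K0_ring_mult S.K0_ring_mult \<Theta> hom(2,3) closed)
      show "\<Theta> (x \<oplus>\<^bsub>K0_ring R\<^esub> y) = \<Theta> x \<oplus>\<^bsub>K0_ring S\<^esub> \<Theta> y"
        by (simp add: R.K0_ring_add S.K0_ring_add \<Theta> hom(3) closed)
    qed
    have \<Theta>T: "\<Theta> (diff_class R a b) = diff_class S (\<theta> a) (\<theta> b)" if "a \<in> T" "b \<in> T" for a b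
      using \<Theta> T that by blast
    show "\<Theta> ` R.diff_ideal T = S.diff_ideal (\<theta> ` T)"
    proof
      show "\<Theta> ` R.diff_ideal T \<subseteq> S.diff_ideal (\<theta> ` T)"
        unfolding R.diff_ideal_def S.diff_ideal_def using \<Theta>T by blast
      show "S.diff_ideal (\<theta> ` T) \<subseteq> \<Theta> ` R.diff_ideal T"
      proof
        fix x assume "x \<in> S.diff_ideal (\<theta> ` T)"
        then obtain a b where "a \<in> T" "b \<in> T" "x = diff_class S (\<theta> a) (\<theta> b)"
          unfolding S.diff_ideal_def by blast
        then have "x = \<Theta> (diff_class R a b)" "diff_class R a b \<in> R.diff_ideal T"
          unfolding R.diff_ideal_def using \<Theta>T by auto
        then show "x \<in> \<Theta> ` R.diff_ideal T" by blast
      qed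
    qed
  qed
qed

text \<open>First isomorphism theorem for \<Theta> followed by the projection onto
  \<open>S Quot J\<close>; injectivity of \<Theta> makes the kernel exactly
  \<open>I\<close>.\<close>

lemma FactRing_ring_iso:
  assumes R: "ring R" and S: "ring S" and \<Theta>: "\<Theta> \<in> ring_iso R S" and J: "ideal J S"
    and I: "I \<subseteq> carrier R" "\<Theta> ` I = J"
  shows "R Quot I \<simeq> S Quot J"
proof -
  interpret R: ring R by fact
  interpret S: ring S by fact
  interpret J: ideal J S by fact
  have hom: "\<Theta> \<in> ring_hom R S" and bij: "bij_betw \<Theta> (carrier R) (carrier S)"
    using \<Theta> by (auto simp: ring_iso_def)
  have "(\<lambda>x. J +>\<^bsub>S\<^esub> \<Theta> x) \<in> ring_hom R (S Quot J)"
    using ring_hom_trans[OF hom J.rcos_ring_hom] by (simp add: comp_def)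
  then interpret h: ring_hom_ring R "S Quot J" "\<lambda>x. J +>\<^bsub>S\<^esub> \<Theta> x"
    by (rule ring_hom_ringI2[OF R J.quotient_is_ring])
  have "a_kernel R (S Quot J) (\<lambda>x. J +>\<^bsub>S\<^esub> \<Theta> x) = I"
  proof -
    have "J +>\<^bsub>S\<^esub> \<Theta> x = J \<longleftrightarrow> x \<in> I" if x: "x \<in> carrier R" for x
    proof -
      have \<Theta>x: "\<Theta> x \<in> carrier S" using hom x by (auto simp: ring_hom_def)
      have "J +>\<^bsub>S\<^esub> \<Theta> x = J \<longleftrightarrow> \<Theta> x \<in> J"
        using J.a_rcos_const J.rcos_const_imp_mem[OF \<Theta>x] by auto
      also have "\<dots> \<longleftrightarrow> x \<in> I"
        using bij I x by (auto simp: bij_betw_def inj_on_def)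
      finally show ?thesis .
    qed
    then show ?thesis using I(1) unfolding a_kernel_def' by (auto simp: FactRing_def subset_iff)
  qed
  moreover have "(\<lambda>x. J +>\<^bsub>S\<^esub> \<Theta> x) ` carrier R = carrier (S Quot J)"
  proof -
    have "carrier (S Quot J) = (\<lambda>x. J +>\<^bsub>S\<^esub> x) ` \<Theta> ` carrier R"
      using bij by (auto simp: bij_betw_def FactRing_def A_RCOSETS_def')
    then show ?thesis by (simp add: image_image)
  qed
  ultimately show ?thesis
    using h.FactRing_iso by simp
qed

section \<open>Kronecker products\<close>

lemma mod_less_mult: "(s::nat) < n * m \<Longrightarrow> s mod m < m"
  by (metis less_nat_zero_code mod_less_divisor mult_0_right not_gr_zero)

lemma mult_add_less: "i < n \<Longrightarrow> j < m \<Longrightarrow> i * m + j < n * (m::nat)"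
proof -
  assume "i < n" "j < m"
  then have "i * m + j < (i + 1) * m" by simp
  also have "\<dots> \<le> n * m" using \<open>i < n\<close> by (intro mult_right_mono) auto
  finally show ?thesis .
qed

text \<open>Splits a sum over a Kronecker index into its two digits; this is how every product with
  a Kronecker matrix is evaluated.\<close>

lemma sum_mult_div_mod:
  fixes f :: "nat \<Rightarrow> nat \<Rightarrow> 'a::comm_monoid_add"
  shows "(\<Sum>s = 0..<n * m. f (s div m) (s mod m)) = (\<Sum>i = 0..<n. \<Sum>j = 0..<m. f i j)"
proof -
  have "(\<Sum>s = 0..<n * m. f (s div m) (s mod m)) = (\<Sum>(i, j)\<in>{0..<n} \<times> {0..<m}. f i j)"
    by (rule sum.reindex_bij_witness[where j = "\<lambda>s. (s div m, s mod m)" and i = "\<lambda>(i, j). i * m + j"])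
      (auto simp: less_mult_imp_div_less mod_less_mult mult_add_less)
  then show ?thesis by (simp add: sum.cartesian_product)
qed

lemma mat_mult_assoc:
  fixes A B C :: "'a::semiring_0 mat"
  assumes "dim_col A = dim_row B" "dim_col B = dim_row C"
  shows "(A * B) * C = A * (B * C)"
  using assms by (intro assoc_mult_mat[of _ "dim_row A" "dim_col A" _ "dim_col B" _ "dim_col C"]) auto

lemma index_mult_mat_sum:
  "i < dim_row A \<Longrightarrow> j < dim_col B \<Longrightarrow> dim_col A = dim_row B \<Longrightarrow>
    (A * B) $$ (i, j) = (\<Sum>k = 0..<dim_row B. A $$ (i, k) * B $$ (k, j))"
  by (auto simp: scalar_prod_def intro!: sum.cong)

lemma dim_kronecker [simp]:
  "dim_row (kronecker A B) = dim_row A * dim_row B"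
  "dim_col (kronecker A B) = dim_col A * dim_col B"
  by (simp_all add: kronecker_def)

lemma kronecker_carrier:
  "A \<in> carrier_mat a b \<Longrightarrow> B \<in> carrier_mat c d \<Longrightarrow> kronecker A B \<in> carrier_mat (a * c) (b * d)"
  by auto

lemma index_kronecker:
  "i < dim_row A * dim_row B \<Longrightarrow> j < dim_col A * dim_col B \<Longrightarrow>
    kronecker A B $$ (i, j) =
      A $$ (i div dim_row B, j div dim_col B) * B $$ (i mod dim_row B, j mod dim_col B)"
  by (simp add: kronecker_def)

lemma kronecker_mult:
  assumes "dim_col A = dim_row C" "dim_col B = dim_row D"
  shows "kronecker A B * kronecker C D = kronecker (A * C) (B * D)"
proof (rule eq_matI)
  fix i j
  assume "i < dim_row (kronecker (A * C) (B * D))" "j < dim_col (kronecker (A * C) (B * D))"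
  then have i: "i < dim_row A * dim_row B" and j: "j < dim_col C * dim_col D" by auto
  let ?b = "dim_row B" and ?d = "dim_col D" and ?m = "dim_row D"
  have "(kronecker A B * kronecker C D) $$ (i, j) =
      (\<Sum>s = 0..<dim_row C * ?m. kronecker A B $$ (i, s) * kronecker C D $$ (s, j))"
    using i j assms by (subst index_mult_mat_sum) auto
  also have "\<dots> = (\<Sum>s = 0..<dim_row C * ?m.
      (A $$ (i div ?b, s div ?m) * B $$ (i mod ?b, s mod ?m)) *
      (C $$ (s div ?m, j div ?d) * D $$ (s mod ?m, j mod ?d)))"
    using i j assms by (intro sum.cong) (auto simp: index_kronecker)
  also have "\<dots> = (\<Sum>k = 0..<dim_row C. \<Sum>l = 0..<?m.
      (A $$ (i div ?b, k) * C $$ (k, j div ?d)) * (B $$ (i mod ?b, l) * D $$ (l, j mod ?d)))"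
    by (subst sum_mult_div_mod[symmetric]) (simp add: ac_simps)
  also have "\<dots> = (A * C) $$ (i div ?b, j div ?d) * (B * D) $$ (i mod ?b, j mod ?d)"
    using i j assms
    by (simp add: index_mult_mat_sum less_mult_imp_div_less mod_less_mult sum_product
        del: index_mult_mat)
  also have "\<dots> = kronecker (A * C) (B * D) $$ (i, j)"
    using i j by (subst index_kronecker) auto
  finally show "(kronecker A B * kronecker C D) $$ (i, j) = kronecker (A * C) (B * D) $$ (i, j)" .
qed auto

text \<open>An index of a threefold Kronecker product decodes to the same three digits for both
  bracketings.\<close>

lemma div_mod_mult2:
  fixes k m n :: nat
  shows "k mod (m * n) div n = k div n mod m" "k div (m * n) = k div n div m" "k mod (m * n) mod n = k mod n"
  by (cases "n = 0"; simp add: mod_mult2_eq div_mult2_eq mult.commute[of m n])+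

lemma kronecker_assoc: "kronecker (kronecker A B) C = kronecker A (kronecker B C)"
proof (rule eq_matI)
  fix i j
  assume "i < dim_row (kronecker A (kronecker B C))" "j < dim_col (kronecker A (kronecker B C))"
  then have i: "i < dim_row A * (dim_row B * dim_row C)" and j: "j < dim_col A * (dim_col B * dim_col C)"
    by auto
  show "kronecker (kronecker A B) C $$ (i, j) = kronecker A (kronecker B C) $$ (i, j)"
    using i j
    by (simp add: index_kronecker div_mod_mult2 less_mult_imp_div_less mod_less_mult mult.assoc)
qed (auto simp: mult.assoc)

lemma kronecker_one: "kronecker (1\<^sub>m a) (1\<^sub>m b) = 1\<^sub>m (a * b)"
proof (rule eq_matI)
  fix i j
  assume "i < dim_row (1\<^sub>m (a * b))" "j < dim_col (1\<^sub>m (a * b))"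
  then have ij: "i < a * b" "j < a * b" by auto
  then have "(i = j) = (i div b = j div b \<and> i mod b = j mod b)"
    by (metis div_mult_mod_eq)
  then show "kronecker (1\<^sub>m a) (1\<^sub>m b) $$ (i, j) = 1\<^sub>m (a * b) $$ (i, j)"
    using ij by (simp add: index_kronecker less_mult_imp_div_less mod_less_mult)
qed auto

lemma kronecker_one_left [simp]: "kronecker (1\<^sub>m 1) A = A"
  by (rule eq_matI) (auto simp: index_kronecker)

lemma kronecker_one_right [simp]: "kronecker A (1\<^sub>m 1) = A"
  by (rule eq_matI) (auto simp: index_kronecker)

lemma kronecker_transpose: "(kronecker A B)\<^sup>T = kronecker (A\<^sup>T) (B\<^sup>T)"
  by (rule eq_matI) (auto simp: index_kronecker less_mult_imp_div_less mod_less_mult)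

text \<open>The index of the left factor is the leading digit, so its blocks stay contiguous in the
  product. Direct sums in the left factor therefore distribute on the nose, without a permutation
  matrix.\<close>

lemma kronecker_four_block:
  assumes A: "A \<in> carrier_mat a a'" and D: "D \<in> carrier_mat d d'" and C: "C \<in> carrier_mat c c'"
  shows "kronecker (four_block_mat A (0\<^sub>m a d') (0\<^sub>m d a') D) C =
    four_block_mat (kronecker A C) (0\<^sub>m (a * c) (d' * c')) (0\<^sub>m (d * c) (a' * c')) (kronecker D C)"
proof (rule eq_matI)
  let ?R = "four_block_mat (kronecker A C) (0\<^sub>m (a * c) (d' * c')) (0\<^sub>m (d * c) (a' * c')) (kronecker D C)"
  fix i j
  assume "i < dim_row ?R" "j < dim_col ?R"
  then have i: "i < (a + d) * c" and j: "j < (a' + d') * c'"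
    using assms by (auto simp: algebra_simps)
  have lt: "k div n < b \<longleftrightarrow> k < b * n" if "k < e * n" for k b n e :: nat
  proof -
    have "0 < n" using that by (cases n) auto
    then show ?thesis by (rule div_less_iff_less_mult)
  qed
  have sub: "(k - b * n) div n = k div n - b" "(k - b * n) mod n = k mod n" if "\<not> k < b * n" for k b n :: nat
  proof -
    have "b * n \<le> k" using that by simp
    then obtain r where "k = b * n + r" using le_Suc_ex by blast
    then show "(k - b * n) div n = k div n - b" "(k - b * n) mod n = k mod n"
      by (cases "n = 0"; simp)+
  qed
  have rest: "k div n - b < e" if "k < (b + e) * n" "\<not> k < b * n" for k b n e :: nat
    using less_mult_imp_div_less[OF that(1)] lt[OF that(1), of b] that(2) by linarith
  show "kronecker (four_block_mat A (0\<^sub>m a d') (0\<^sub>m d a') D) C $$ (i, j) = ?R $$ (i, j)"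
    using i j assms
    by (simp add: index_kronecker less_mult_imp_div_less mod_less_mult lt[OF i] lt[OF j] sub rest[OF i] rest[OF j] add_mult_distrib)
qed (use assms in \<open>auto simp: algebra_simps\<close>)

section \<open>Bilinear forms as row vectors\<close>

text \<open>\<open>B\<close> is the Gram matrix: the form sends \<open>e_i \<otimes> f_j\<close> to
  \<open>B $$ (i, j)\<close>. Dually, \<open>form_col C\<close> is the copairing that sends 1 to the
  tensor with coefficients \<open>C $$ (i, j)\<close>.\<close>

definition form_row :: "complex mat \<Rightarrow> complex mat" where
  "form_row B = mat 1 (dim_row B * dim_col B) (\<lambda>(_, s). B $$ (s div dim_col B, s mod dim_col B))"

definition form_col :: "complex mat \<Rightarrow> complex mat" where
  "form_col C = mat (dim_row C * dim_col C) 1 (\<lambda>(r, _). C $$ (r div dim_col C, r mod dim_col C))"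

lemma dim_form_row [simp]: "dim_row (form_row B) = 1" "dim_col (form_row B) = dim_row B * dim_col B"
  by (simp_all add: form_row_def)

lemma dim_form_col [simp]: "dim_row (form_col B) = dim_row B * dim_col B" "dim_col (form_col B) = 1"
  by (simp_all add: form_col_def)

lemma form_row_carrier: "B \<in> carrier_mat n m \<Longrightarrow> form_row B \<in> carrier_mat 1 (n * m)"
  and form_col_carrier: "B \<in> carrier_mat n m \<Longrightarrow> form_col B \<in> carrier_mat (n * m) 1"
  by auto

lemma form_row_inj:
  assumes "B \<in> carrier_mat n m" "B' \<in> carrier_mat n m" "form_row B = form_row B'"
  shows "B = B'"
proof (rule eq_matI)
  fix i j assume "i < dim_row B'" "j < dim_col B'"
  then have ij: "i < n" "j < m" using assms by auto
  have "form_row B $$ (0, i * m + j) = form_row B' $$ (0, i * m + j)" using assms by simp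
  then show "B $$ (i, j) = B' $$ (i, j)"
    using assms(1,2) ij mult_add_less[OF ij] by (simp add: form_row_def)
qed (use assms in auto)

lemma form_row_surj:
  assumes b: "b \<in> carrier_mat 1 (n * m)"
  obtains B where "B \<in> carrier_mat n m" "b = form_row B"
proof
  let ?B = "mat n m (\<lambda>(i, j). b $$ (0, i * m + j))"
  show "?B \<in> carrier_mat n m" by simp
  show "b = form_row ?B"
    by (rule eq_matI)
      (use b in \<open>auto simp: form_row_def less_mult_imp_div_less mod_less_mult\<close>)
qed

lemma form_col_surj:
  assumes c: "c \<in> carrier_mat (n * m) 1"
  obtains C where "C \<in> carrier_mat n m" "c = form_col C"
proof
  let ?C = "mat n m (\<lambda>(i, j). c $$ (i * m + j, 0))"
  show "?C \<in> carrier_mat n m" by simp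
  show "c = form_col ?C"
    by (rule eq_matI)
      (use c in \<open>auto simp: form_col_def less_mult_imp_div_less mod_less_mult\<close>)
qed

lemma ev_mat_form_row: "ev_mat n = form_row (1\<^sub>m n)"
  by (rule eq_matI) (auto simp: ev_mat_def form_row_def less_mult_imp_div_less mod_less_mult)

lemma coev_mat_form_col: "coev_mat n = form_col (1\<^sub>m n)"
  by (rule eq_matI) (auto simp: coev_mat_def form_col_def less_mult_imp_div_less mod_less_mult)

lemma form_row_add:
  assumes "dim_row B = dim_row B'" "dim_col B = dim_col B'"
  shows "form_row B + form_row B' = form_row (B + B')"
  by (rule eq_matI) (use assms in \<open>auto simp: form_row_def less_mult_imp_div_less mod_less_mult\<close>)

text \<open>Precomposing a form with \<open>X \<otimes> Y\<close> is a change of basis of its Gram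
  matrix. This turns invariance, isometry and pullback of forms into congruence of square
  matrices.\<close>

lemma form_row_kronecker:
  assumes "dim_row X = dim_row B" "dim_row Y = dim_col B"
  shows "form_row B * kronecker X Y = form_row (X\<^sup>T * B * Y)"
proof (rule eq_matI)
  let ?x = "dim_col X" and ?y = "dim_col Y"
  fix i s assume "i < dim_row (form_row (X\<^sup>T * B * Y))"
    "s < dim_col (form_row (X\<^sup>T * B * Y))"
  then have i: "i = 0" and s: "s < ?x * ?y" by auto
  have "(form_row B * kronecker X Y) $$ (0, s) =
      (\<Sum>t = 0..<dim_row X * dim_row Y. form_row B $$ (0, t) * kronecker X Y $$ (t, s))"
    using s assms by (subst index_mult_mat_sum) auto
  also have "\<dots> = (\<Sum>t = 0..<dim_row X * dim_row Y. B $$ (t div dim_row Y, t mod dim_row Y) *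
      (X $$ (t div dim_row Y, s div ?y) * Y $$ (t mod dim_row Y, s mod ?y)))"
    using s assms by (intro sum.cong) (auto simp: index_kronecker form_row_def)
  also have "\<dots> = (\<Sum>k = 0..<dim_row X. \<Sum>l = 0..<dim_row Y.
      B $$ (k, l) * (X $$ (k, s div ?y) * Y $$ (l, s mod ?y)))"
    by (subst sum_mult_div_mod[symmetric]) simp
  also have "\<dots> = (\<Sum>l = 0..<dim_row Y. \<Sum>k = 0..<dim_row X.
      B $$ (k, l) * (X $$ (k, s div ?y) * Y $$ (l, s mod ?y)))"
    by (rule sum.swap)
  also have "\<dots> = (X\<^sup>T * B * Y) $$ (s div ?y, s mod ?y)"
    using s assms
    by (subst index_mult_mat_sum)
      (auto simp: index_mult_mat_sum less_mult_imp_div_less mod_less_mult sum_distrib_left sum_distrib_right ac_simps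
        intro!: sum.cong simp del: index_mult_mat(1))
  also have "\<dots> = form_row (X\<^sup>T * B * Y) $$ (0, s)"
    using s by (simp add: form_row_def)
  finally show "(form_row B * kronecker X Y) $$ (i, s) = form_row (X\<^sup>T * B * Y) $$ (i, s)"
    using i by simp
qed auto

text \<open>Transposition exchanges pairings and copairings, so this is
  \<open>form_row_kronecker\<close> transposed.\<close>

lemma kronecker_form_col:
  assumes "dim_col X = dim_row C" "dim_col Y = dim_col C"
  shows "kronecker X Y * form_col C = form_col (X * C * Y\<^sup>T)"
proof -
  have t: "(form_row A)\<^sup>T = form_col A" for A
    by (rule eq_matI) (auto simp: form_row_def form_col_def)
  let ?K = "kronecker (X\<^sup>T) (Y\<^sup>T)"
  have "(form_row C * ?K)\<^sup>T = ?K\<^sup>T * (form_row C)\<^sup>T"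
    by (rule transpose_mult[of _ 1 "dim_row C * dim_col C" _ "dim_row X * dim_row Y"])
      (use assms in \<open>auto intro!: carrier_matI\<close>)
  moreover have "form_row C * ?K = form_row (X * C * Y\<^sup>T)"
    using assms by (subst form_row_kronecker) auto
  ultimately show ?thesis
    by (simp add: t kronecker_transpose)
qed

lemma form_row_mult_form_col:
  assumes "dim_row P = dim_row Q" "dim_col P = dim_col Q"
  shows "(form_row P * form_col Q) $$ (0, 0) =
    (\<Sum>i = 0..<dim_row P. \<Sum>j = 0..<dim_col P. P $$ (i, j) * Q $$ (i, j))"
proof -
  have "(form_row P * form_col Q) $$ (0, 0) =
      (\<Sum>s = 0..<dim_row P * dim_col P. P $$ (s div dim_col P, s mod dim_col P) * Q $$ (s div dim_col P, s mod dim_col P))"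
    using assms by (subst index_mult_mat_sum) (auto simp: form_row_def form_col_def)
  also have "\<dots> = (\<Sum>i = 0..<dim_row P. \<Sum>j = 0..<dim_col P. P $$ (i, j) * Q $$ (i, j))"
    by (subst sum_mult_div_mod[symmetric]) simp
  finally show ?thesis .
qed

text \<open>The left side is the composite of a copairing inserted on the right with a pairing
  contracted on the left. It sends \<open>e_k\<close> to the vector with coordinates
  \<open>(P * Q) $$ (k, j)\<close>, whence the transpose. Both the map \<open>adjoint_map\<close>
  and one of the triangle composites have this shape.\<close>

lemma form_zigzag:
  assumes P: "P \<in> carrier_mat a b" and Q: "Q \<in> carrier_mat b c"
  shows "kronecker (form_row P) (1\<^sub>m c) * kronecker (1\<^sub>m a) (form_col Q) = (P * Q)\<^sup>T"
proof (rule eq_matI)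
  fix j k assume "j < dim_row ((P * Q)\<^sup>T)" "k < dim_col ((P * Q)\<^sup>T)"
  then have j: "j < c" and k: "k < a" using P Q by auto
  \<comment> \<open>The summation index is decoded as \<open>(a * b) * c\<close> by the pairing and
    as \<open>a * (b * c)\<close> by the copairing.\<close>
  have div: "s div c div b = s div (b * c)" "s div c mod b = s mod (b * c) div c" for s
    by (simp_all add: div_mod_mult2)
  have "(kronecker (form_row P) (1\<^sub>m c) * kronecker (1\<^sub>m a) (form_col Q)) $$ (j, k) =
      (\<Sum>s = 0..<a * (b * c). kronecker (form_row P) (1\<^sub>m c) $$ (j, s) * kronecker (1\<^sub>m a) (form_col Q) $$ (s, k))"
    using P Q j k by (subst index_mult_mat_sum) auto
  also have "\<dots> = (\<Sum>s = 0..<a * (b * c).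
      P $$ (s div (b * c), s mod (b * c) div c) * (if j = s mod (b * c) mod c then 1 else 0) *
      ((if s div (b * c) = k then 1 else 0) * Q $$ (s mod (b * c) div c, s mod (b * c) mod c)))"
  proof (intro sum.cong refl)
    fix s assume "s \<in> {0..<a * (b * c)}"
    then have s: "s < a * (b * c)" by simp
    then have s': "s < (a * b) * c" by (simp add: mult.assoc)
    have m: "s mod (b * c) mod c = s mod c" by (simp add: mod_mod_cancel)
    show "kronecker (form_row P) (1\<^sub>m c) $$ (j, s) * kronecker (1\<^sub>m a) (form_col Q) $$ (s, k) =
        P $$ (s div (b * c), s mod (b * c) div c) * (if j = s mod (b * c) mod c then 1 else 0) *
        ((if s div (b * c) = k then 1 else 0) * Q $$ (s mod (b * c) div c, s mod (b * c) mod c))"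
      using P Q s s' j k mod_less_mult[OF s] less_mult_imp_div_less[OF s'] less_mult_imp_div_less[OF s]
        mod_less_mult[OF s']
      by (simp add: index_kronecker form_row_def form_col_def div m)
  qed
  also have "\<dots> = (\<Sum>i = 0..<a. \<Sum>t = 0..<b * c.
      P $$ (i, t div c) * (if j = t mod c then 1 else 0) * ((if i = k then 1 else 0) * Q $$ (t div c, t mod c)))"
    by (subst sum_mult_div_mod[symmetric]) simp
  also have "\<dots> = (\<Sum>i = 0..<a. \<Sum>l = 0..<b. \<Sum>r = 0..<c.
      P $$ (i, l) * (if j = r then 1 else 0) * ((if i = k then 1 else 0) * Q $$ (l, r)))"
    by (intro sum.cong refl sum_mult_div_mod)
  also have "\<dots> = (\<Sum>i = 0..<a. \<Sum>l = 0..<b. if i = k then P $$ (i, l) * Q $$ (l, j) else 0)"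
  proof (intro sum.cong refl)
    fix i l
    have "(\<Sum>r = 0..<c. P $$ (i, l) * (if j = r then 1 else 0) * ((if i = k then 1 else 0) * Q $$ (l, r))) =
        (\<Sum>r = 0..<c. if r = j then (if i = k then P $$ (i, l) * Q $$ (l, r) else 0) else 0)"
      by (intro sum.cong) auto
    also have "\<dots> = (if i = k then P $$ (i, l) * Q $$ (l, j) else 0)"
      using j by simp
    finally show "(\<Sum>r = 0..<c. P $$ (i, l) * (if j = r then 1 else 0) * ((if i = k then 1 else 0) * Q $$ (l, r))) =
      (if i = k then P $$ (i, l) * Q $$ (l, j) else 0)" .
  qed
  also have "\<dots> = (\<Sum>i = 0..<a. if i = k then (\<Sum>l = 0..<b. P $$ (i, l) * Q $$ (l, j)) else 0)"
    by (intro sum.cong) auto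
  also have "\<dots> = (P * Q) $$ (k, j)"
    using k j P Q by (subst index_mult_mat_sum) auto
  finally show "(kronecker (form_row P) (1\<^sub>m c) * kronecker (1\<^sub>m a) (form_col Q)) $$ (j, k) =
      (P * Q)\<^sup>T $$ (j, k)"
    using j k P Q by simp
qed (use P Q in auto)

section \<open>Flips, traces and projections\<close>

lemma mult_delta:
  "a * (if P then 1 else 0) = (if P then a else 0)" "(if P then 1 else 0) * a = (if P then a else 0)"
  for a :: "'a::semiring_1"
  by simp_all

definition mat_trace :: "'a::comm_monoid_add mat \<Rightarrow> 'a" where
  "mat_trace A = (\<Sum>i = 0..<dim_row A. A $$ (i, i))"

lemma mat_trace_mult_comm:
  fixes A B :: "'a::comm_semiring_0 mat"
  assumes A: "A \<in> carrier_mat n m" and B: "B \<in> carrier_mat m n"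
  shows "mat_trace (A * B) = mat_trace (B * A)"
proof -
  have "mat_trace (A * B) = (\<Sum>i = 0..<n. \<Sum>k = 0..<m. A $$ (i, k) * B $$ (k, i))"
    using A B by (auto simp: mat_trace_def index_mult_mat_sum simp del: index_mult_mat(1) intro!: sum.cong)
  also have "\<dots> = (\<Sum>k = 0..<m. \<Sum>i = 0..<n. B $$ (k, i) * A $$ (i, k))"
    by (subst sum.swap) (simp add: mult.commute)
  also have "\<dots> = mat_trace (B * A)"
    using A B by (auto simp: mat_trace_def index_mult_mat_sum simp del: index_mult_mat(1) intro!: sum.cong)
  finally show ?thesis .
qed

lemma mat_trace_add:
  "A \<in> carrier_mat n n \<Longrightarrow> B \<in> carrier_mat n n \<Longrightarrow> mat_trace (A + B) = mat_trace A + mat_trace B"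
  by (auto simp: mat_trace_def sum.distrib)

lemma mat_trace_uminus: "mat_trace (- A) = - mat_trace (A :: complex mat)" if "A \<in> carrier_mat n n"
  using that by (auto simp: mat_trace_def sum_negf)

lemma mat_trace_smult: "A \<in> carrier_mat n n \<Longrightarrow> mat_trace (c \<cdot>\<^sub>m A) = c * mat_trace (A :: complex mat)"
  by (auto simp: mat_trace_def sum_distrib_left)

lemma mat_trace_transpose: "A \<in> carrier_mat n n \<Longrightarrow> mat_trace (A\<^sup>T) = mat_trace A"
  by (auto simp: mat_trace_def)

lemma form_row_mult_form_col_trace:
  assumes "P \<in> carrier_mat n m" "Q \<in> carrier_mat n m"
  shows "form_row P * form_col Q = mat_trace (P * Q\<^sup>T) \<cdot>\<^sub>m 1\<^sub>m 1"
proof (rule eq_matI)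
  fix i j assume "i < dim_row (mat_trace (P * Q\<^sup>T) \<cdot>\<^sub>m 1\<^sub>m 1)"
    "j < dim_col (mat_trace (P * Q\<^sup>T) \<cdot>\<^sub>m (1\<^sub>m 1 :: complex mat))"
  then have [simp]: "i = 0" "j = 0" by auto
  have "mat_trace (P * Q\<^sup>T) = (\<Sum>i = 0..<n. \<Sum>j = 0..<m. P $$ (i, j) * Q $$ (i, j))"
    using assms by (auto simp: mat_trace_def index_mult_mat_sum simp del: index_mult_mat(1) intro!: sum.cong)
  moreover have "(form_row P * form_col Q) $$ (0, 0) = (\<Sum>i = 0..<n. \<Sum>j = 0..<m. P $$ (i, j) * Q $$ (i, j))"
    using assms by (subst form_row_mult_form_col) auto
  ultimately show "(form_row P * form_col Q) $$ (i, j) = (mat_trace (P * Q\<^sup>T) \<cdot>\<^sub>m 1\<^sub>m 1) $$ (i, j)"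
    by simp
qed auto

lemma flip_mat_dim [simp]: "dim_row (flip_mat n m) = m * n" "dim_col (flip_mat n m) = n * m"
  by (simp_all add: flip_mat_def)

lemma flip_mat_carrier: "flip_mat n m \<in> carrier_mat (m * n) (n * m)"
  by (simp add: flip_mat_def)

lemma index_flip_mat_mult:
  assumes "dim_row X = n * m" "r < m * n" "c < dim_col X"
  shows "(flip_mat n m * X) $$ (r, c) = X $$ ((r mod n) * m + r div n, c)"
proof -
  have q: "r div n < m" "r mod n < n"
    using assms by (simp_all add: less_mult_imp_div_less mod_less_mult)
  have t: "(r mod n) * m + r div n < n * m" by (rule mult_add_less[OF q(2,1)])
  have "(flip_mat n m * X) $$ (r, c) = (\<Sum>s = 0..<n * m. flip_mat n m $$ (r, s) * X $$ (s, c))"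
    using assms by (subst index_mult_mat_sum) auto
  also have "\<dots> = (\<Sum>s = 0..<n * m. if s = (r mod n) * m + r div n then X $$ (s, c) else 0)"
  proof (rule sum.cong[OF refl])
    fix s assume s: "s \<in> {0..<n * m}"
    have "r div n = s mod m \<and> r mod n = s div m \<longleftrightarrow> s = (r mod n) * m + r div n"
      using q by auto
    then show "flip_mat n m $$ (r, s) * X $$ (s, c) = (if s = (r mod n) * m + r div n then X $$ (s, c) else 0)"
      using s assms by (simp add: flip_mat_def)
  qed
  also have "\<dots> = X $$ ((r mod n) * m + r div n, c)"
    using t by simp
  finally show ?thesis .
qed

lemma flip_mat_transpose: "(flip_mat n m)\<^sup>T = flip_mat m n"
  by (rule eq_matI) (auto simp: flip_mat_def)

lemma flip_mat_flip_mat: "flip_mat m n * flip_mat n m = 1\<^sub>m (n * m)"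
proof (rule eq_matI)
  fix r s assume "r < dim_row (1\<^sub>m (n * m))" "s < dim_col (1\<^sub>m (n * m))"
  then have rs: "r < n * m" "s < n * m" by auto
  then have q: "r div m < n" "r mod m < m" "s div m < n" "s mod m < m"
    by (simp_all add: less_mult_imp_div_less mod_less_mult)
  have lt: "r mod m * n + r div m < m * n" by (rule mult_add_less[OF q(2,1)])
  have "r = s \<longleftrightarrow> r div m = s div m \<and> r mod m = s mod m"
    by (metis div_mult_mod_eq)
  then show "(flip_mat m n * flip_mat n m) $$ (r, s) = 1\<^sub>m (n * m) $$ (r, s)"
    using rs q lt by (subst index_flip_mat_mult) (auto simp: flip_mat_def)
qed auto

lemma flip_mat_kronecker:
  assumes "A \<in> carrier_mat n' n" "B \<in> carrier_mat m' m"
  shows "flip_mat n' m' * kronecker A B = kronecker B A * flip_mat n m"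
proof -
  have eq: "flip_mat n' m' * kronecker A B * flip_mat m n = kronecker B A"
  proof (rule eq_matI)
    fix r c assume "r < dim_row (kronecker B A)" "c < dim_col (kronecker B A)"
    then have r: "r < m' * n'" and c: "c < m * n" using assms by auto
    have qr: "r div n' < m'" "r mod n' < n'" and qc: "c div n < m" "c mod n < n"
      using r c by (simp_all add: less_mult_imp_div_less mod_less_mult)
    note lt = mult_add_less[OF qr(2,1)] mult_add_less[OF qc(2,1)]
    \<comment> \<open>A flip on the right is rewritten as a flip on the left of the transpose, so
      that \<open>index_flip_mat_mult\<close> serves both sides.\<close>
    have "flip_mat n' m' * kronecker A B * flip_mat m n =
        flip_mat n' m' * (flip_mat n m * (kronecker A B)\<^sup>T)\<^sup>T"
    proof -
      have "(flip_mat n m * (kronecker A B)\<^sup>T)\<^sup>T = kronecker A B * flip_mat m n"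
        by (subst transpose_mult[OF flip_mat_carrier[of n m], of "(kronecker A B)\<^sup>T" "n' * m'"])
          (use assms in \<open>auto simp: flip_mat_transpose intro!: carrier_matI\<close>)
      then show ?thesis using assms by (subst mat_mult_assoc) auto
    qed
    also have "\<dots> $$ (r, c) = (flip_mat n m * (kronecker A B)\<^sup>T) $$ (c, r mod n' * m' + r div n')"
      using assms r c lt by (subst index_flip_mat_mult) (auto simp del: index_mult_mat(1))
    also have "\<dots> = kronecker A B $$ (r mod n' * m' + r div n', c mod n * m + c div n)"
      using assms r c lt by (subst index_flip_mat_mult) auto
    also have "\<dots> = kronecker B A $$ (r, c)"
      using assms r c lt qr qc by (simp add: index_kronecker)
    finally show "(flip_mat n' m' * kronecker A B * flip_mat m n) $$ (r, c) = kronecker B A $$ (r, c)" .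
  qed (use assms in auto)
  have "flip_mat n' m' * kronecker A B =
      flip_mat n' m' * kronecker A B * (flip_mat m n * flip_mat n m)"
    unfolding flip_mat_flip_mat using assms by (intro right_mult_one_mat[symmetric]) auto
  also have "\<dots> = kronecker B A * flip_mat n m"
    unfolding eq[symmetric] using assms by (subst (2) mat_mult_assoc) auto
  finally show ?thesis .
qed

text \<open>Translates symmetry with respect to the braiding into symmetry of the Gram
  matrix.\<close>

lemma form_row_flip_mat:
  assumes B: "B \<in> carrier_mat m n"
  shows "form_row B * flip_mat n m = form_row (B\<^sup>T)"
proof -
  have t: "(form_row A)\<^sup>T = form_col A" for A
    by (rule eq_matI) (auto simp: form_row_def form_col_def)
  have "(form_row B * flip_mat n m)\<^sup>T = flip_mat m n * form_col B"
    by (subst transpose_mult[of _ 1 "m * n" _ "n * m"])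
      (use B in \<open>auto simp: t flip_mat_transpose intro!: carrier_matI\<close>)
  also have "\<dots> = form_col (B\<^sup>T)"
  proof (rule eq_matI)
    fix r c assume "r < dim_row (form_col (B\<^sup>T))" "c < dim_col (form_col (B\<^sup>T))"
    then have r: "r < n * m" and c: "c = 0" using B by auto
    have q: "r div m < n" "r mod m < m"
      using r by (simp_all add: less_mult_imp_div_less mod_less_mult)
    show "(flip_mat m n * form_col B) $$ (r, c) = form_col (B\<^sup>T) $$ (r, c)"
      using B r c q mult_add_less[OF q(2,1)]
      by (subst index_flip_mat_mult) (auto simp: form_col_def)
  qed (use B in auto)
  finally show ?thesis
    unfolding t[symmetric] by (metis transpose_transpose)
qed

definition unit_col :: "nat \<Rightarrow> nat \<Rightarrow> complex mat" where
  "unit_col n i = mat n 1 (\<lambda>(r, _). if r = i then 1 else 0)"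

lemma unit_col_carrier [simp]: "unit_col n i \<in> carrier_mat n 1"
  and dim_unit_col [simp]: "dim_row (unit_col n i) = n" "dim_col (unit_col n i) = 1"
  by (simp_all add: unit_col_def)

lemma mult_unit_col:
  assumes "A \<in> carrier_mat k n" "i < n" "r < k"
  shows "(A * unit_col n i) $$ (r, 0) = A $$ (r, i)"
proof -
  show ?thesis
    using assms by (subst index_mult_mat_sum) (auto simp: unit_col_def mult_delta)
qed

lemma kronecker_unit_col:
  assumes "i < n" "j < m"
  shows "kronecker (unit_col n i) (unit_col m j) = unit_col (n * m) (i * m + j)"
proof (rule eq_matI)
  fix r c assume "r < dim_row (unit_col (n * m) (i * m + j))" "c < dim_col (unit_col (n * m) (i * m + j))"
  then have r: "r < n * m" and [simp]: "c = 0" by auto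
  have "r = i * m + j \<longleftrightarrow> r div m = i \<and> r mod m = j"
    using assms by auto
  then show "kronecker (unit_col n i) (unit_col m j) $$ (r, c) = unit_col (n * m) (i * m + j) $$ (r, c)"
    using r mod_less_mult[OF r] less_mult_imp_div_less[OF r] by (auto simp: index_kronecker unit_col_def)
qed auto

text \<open>Both sides are multilinear, so it suffices to evaluate them on tensors of basis vectors.\<close>

lemma kronecker_form_row_middle_flip:
  assumes B: "B \<in> carrier_mat n n" and B': "B' \<in> carrier_mat m m"
  shows "kronecker (form_row B) (form_row B') *
      kronecker (1\<^sub>m n) (kronecker (flip_mat m n) (1\<^sub>m m)) = form_row (kronecker B B')"
    (is "?L * ?M = ?R")
proof (rule eq_matI)
  fix r s assume "r < dim_row ?R" "s < dim_col ?R"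
  then have r: "r = 0" and s: "s < (n * m) * (n * m)" using assms by auto
  define p q where "p = s div (n * m)" and "q = s mod (n * m)"
  have pq: "p < n * m" "q < n * m"
    using s by (simp_all add: p_def q_def less_mult_imp_div_less mod_less_mult)
  let ?x = "unit_col n (p div m)" and ?y = "unit_col m (p mod m)"
    and ?z = "unit_col n (q div m)" and ?w = "unit_col m (q mod m)"
  have lt: "p div m < n" "p mod m < m" "q div m < n" "q mod m < m"
    using pq by (simp_all add: less_mult_imp_div_less mod_less_mult)
  have u: "unit_col ((n * m) * (n * m)) s = kronecker (kronecker ?x ?y) (kronecker ?z ?w)"
    using lt pq div_mult_mod_eq[of s "n * m"] by (simp add: kronecker_unit_col) (simp add: p_def q_def)
  have u': "kronecker (kronecker ?x ?y) (kronecker ?z ?w) = kronecker ?x (kronecker (kronecker ?y ?z) ?w)"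
    by (simp add: kronecker_assoc)
  have flip: "flip_mat m n * kronecker ?y ?z = kronecker ?z ?y"
  proof -
    have one: "flip_mat 1 1 = 1\<^sub>m 1" by (rule eq_matI) (auto simp: flip_mat_def)
    have "flip_mat m n * kronecker ?y ?z = kronecker ?z ?y * 1\<^sub>m (1 * 1)"
      using flip_mat_kronecker[of ?y m 1 ?z n 1, OF unit_col_carrier unit_col_carrier]
      unfolding one by simp
    also have "\<dots> = kronecker ?z ?y"
      by (rule right_mult_one_mat[OF kronecker_carrier[OF unit_col_carrier unit_col_carrier]])
    finally show ?thesis .
  qed
  have "(?L * ?M) * unit_col ((n * m) * (n * m)) s = ?L * (?M * kronecker ?x (kronecker (kronecker ?y ?z) ?w))"
    unfolding u u' using assms by (intro mat_mult_assoc) (auto simp: ac_simps)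
  also have "?M * kronecker ?x (kronecker (kronecker ?y ?z) ?w) = kronecker ?x (kronecker (kronecker ?z ?y) ?w)"
    by (simp add: kronecker_mult flip left_mult_one_mat[OF unit_col_carrier])
  also have "\<dots> = kronecker (kronecker ?x ?z) (kronecker ?y ?w)"
    by (simp add: kronecker_assoc)
  also have "?L * \<dots> = kronecker (form_row B * kronecker ?x ?z) (form_row B' * kronecker ?y ?w)"
    using assms by (simp add: kronecker_mult)
  also have "\<dots> = kronecker (form_row (?x\<^sup>T * B * ?z)) (form_row (?y\<^sup>T * B' * ?w))"
    using assms by (simp add: form_row_kronecker)
  finally have L: "(?L * ?M) * unit_col ((n * m) * (n * m)) s = \<dots>" .
  have "?R * unit_col ((n * m) * (n * m)) s =
      form_row ((kronecker ?x ?y)\<^sup>T * kronecker B B' * kronecker ?z ?w)"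
    unfolding u using assms by (subst form_row_kronecker) auto
  also have "\<dots> = form_row (kronecker (?x\<^sup>T * B * ?z) (?y\<^sup>T * B' * ?w))"
    using assms by (simp add: kronecker_transpose kronecker_mult)
  finally have R: "?R * unit_col ((n * m) * (n * m)) s = \<dots>" .
  have one: "kronecker (form_row S) (form_row T) = form_row (kronecker S T)"
    if "dim_row S = 1" "dim_col S = 1" "dim_row T = 1" "dim_col T = 1" for S T
    by (rule eq_matI) (use that in \<open>auto simp: index_kronecker form_row_def\<close>)
  have "(?L * ?M) * unit_col ((n * m) * (n * m)) s = ?R * unit_col ((n * m) * (n * m)) s"
    unfolding L R by (rule one) simp_all
  then have "((?L * ?M) * unit_col ((n * m) * (n * m)) s) $$ (0, 0) =
      (?R * unit_col ((n * m) * (n * m)) s) $$ (0, 0)" by simp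
  moreover have "?L * ?M \<in> carrier_mat 1 ((n * m) * (n * m))" "?R \<in> carrier_mat 1 ((n * m) * (n * m))"
    using assms by (auto intro!: carrier_matI)
  ultimately show "(?L * ?M) $$ (r, s) = ?R $$ (r, s)"
    using s r mult_unit_col[of "?L * ?M" 1 _ s 0] mult_unit_col[of ?R 1 _ s 0]
    by (simp del: index_mult_mat(1))
qed (use assms in \<open>auto simp: ac_simps\<close>)

lemma pr_mat_dim [simp]:
  "dim_row (pr1_mat n m) = n" "dim_col (pr1_mat n m) = n + m"
  "dim_row (pr2_mat n m) = m" "dim_col (pr2_mat n m) = n + m"
  by (simp_all add: pr1_mat_def pr2_mat_def)

lemma pr_mat_carrier:
  "pr1_mat n m \<in> carrier_mat n (n + m)" "pr2_mat n m \<in> carrier_mat m (n + m)"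
  by auto

lemma pr1_mat_mult: "X \<in> carrier_mat (n + m) k \<Longrightarrow> pr1_mat n m * X = mat n k (\<lambda>(i, j). X $$ (i, j))"
proof (rule eq_matI)
  fix i j assume X: "X \<in> carrier_mat (n + m) k"
    and "i < dim_row (mat n k (\<lambda>(i, j). X $$ (i, j)))" "j < dim_col (mat n k (\<lambda>(i, j). X $$ (i, j)))"
  then have ij: "i < n" "j < k" by auto
  have "(pr1_mat n m * X) $$ (i, j) = X $$ (i, j)"
    using X ij by (subst index_mult_mat_sum) (auto simp: pr1_mat_def mult_delta)
  then show "(pr1_mat n m * X) $$ (i, j) = mat n k (\<lambda>(i, j). X $$ (i, j)) $$ (i, j)"
    using ij by simp
qed auto

lemma pr2_mat_mult: "X \<in> carrier_mat (n + m) k \<Longrightarrow> pr2_mat n m * X = mat m k (\<lambda>(i, j). X $$ (n + i, j))"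
proof (rule eq_matI)
  fix i j assume X: "X \<in> carrier_mat (n + m) k"
    and "i < dim_row (mat m k (\<lambda>(i, j). X $$ (n + i, j)))" "j < dim_col (mat m k (\<lambda>(i, j). X $$ (n + i, j)))"
  then have ij: "i < m" "j < k" by auto
  have "(pr2_mat n m * X) $$ (i, j) = X $$ (n + i, j)"
    using X ij by (subst index_mult_mat_sum) (auto simp: pr2_mat_def mult_delta)
  then show "(pr2_mat n m * X) $$ (i, j) = mat m k (\<lambda>(i, j). X $$ (n + i, j)) $$ (i, j)"
    using ij by simp
qed auto

text \<open>Direct sums record only their projections; the transposes serve as inclusions. Together
  with \<open>pr_mat_decomposition\<close> these are the biproduct equations.\<close>

lemma pr_mat_transpose:
  "pr1_mat n m * (pr1_mat n m)\<^sup>T = 1\<^sub>m n"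
  "pr1_mat n m * (pr2_mat n m)\<^sup>T = 0\<^sub>m n m"
  "pr2_mat n m * (pr1_mat n m)\<^sup>T = 0\<^sub>m m n"
  "pr2_mat n m * (pr2_mat n m)\<^sup>T = 1\<^sub>m m"
proof -
  note car = transpose_carrier_mat[THEN iffD2, OF pr_mat_carrier(1)] transpose_carrier_mat[THEN iffD2, OF pr_mat_carrier(2)]
  show "pr1_mat n m * (pr1_mat n m)\<^sup>T = 1\<^sub>m n"
    unfolding pr1_mat_mult[OF car(1)] by (rule eq_matI) (auto simp: pr1_mat_def)
  show "pr1_mat n m * (pr2_mat n m)\<^sup>T = 0\<^sub>m n m"
    unfolding pr1_mat_mult[OF car(2)] by (rule eq_matI) (auto simp: pr2_mat_def)
  show "pr2_mat n m * (pr1_mat n m)\<^sup>T = 0\<^sub>m m n"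
    unfolding pr2_mat_mult[OF car(1)] by (rule eq_matI) (auto simp: pr1_mat_def)
  show "pr2_mat n m * (pr2_mat n m)\<^sup>T = 1\<^sub>m m"
    unfolding pr2_mat_mult[OF car(2)] by (rule eq_matI) (auto simp: pr2_mat_def)
qed

lemma pr_mat_four_block:
  assumes "A \<in> carrier_mat n n" "D \<in> carrier_mat m m"
  shows "pr1_mat n m * four_block_mat A (0\<^sub>m n m) (0\<^sub>m m n) D = A * pr1_mat n m"
    "pr2_mat n m * four_block_mat A (0\<^sub>m n m) (0\<^sub>m m n) D = D * pr2_mat n m"
proof -
  have m: "(X * pr1_mat n m) $$ (i, j) = (if j < n then X $$ (i, j) else 0)"
    "(Y * pr2_mat n m) $$ (i, j) = (if n \<le> j then Y $$ (i, j - n) else 0)"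
    if "X \<in> carrier_mat k n" "Y \<in> carrier_mat k m" "i < k" "j < n + m" for X Y i j k
  proof -
    show "(X * pr1_mat n m) $$ (i, j) = (if j < n then X $$ (i, j) else 0)"
      using that by (subst index_mult_mat_sum) (auto simp: pr1_mat_def mult_delta)
    show "(Y * pr2_mat n m) $$ (i, j) = (if n \<le> j then Y $$ (i, j - n) else 0)"
    proof (cases "n \<le> j")
      case True
      then obtain j' where "j = n + j'" by (auto dest: le_Suc_ex)
      then show ?thesis
        using that by (subst index_mult_mat_sum) (auto simp: pr2_mat_def mult_delta)
    next
      case False
      then show ?thesis
        using that by (subst index_mult_mat_sum) (auto simp: pr2_mat_def mult_delta)
    qed
  qed
  have four: "four_block_mat A (0\<^sub>m n m) (0\<^sub>m m n) D \<in> carrier_mat (n + m) (n + m)"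
    using assms by auto
  show "pr1_mat n m * four_block_mat A (0\<^sub>m n m) (0\<^sub>m m n) D = A * pr1_mat n m"
    unfolding pr1_mat_mult[OF four]
    by (rule eq_matI) (use assms in \<open>auto simp: m(1)[OF assms(1), of "0\<^sub>m n m"] simp del: index_mult_mat(1)\<close>)
  show "pr2_mat n m * four_block_mat A (0\<^sub>m n m) (0\<^sub>m m n) D = D * pr2_mat n m"
    unfolding pr2_mat_mult[OF four]
    by (rule eq_matI) (use assms in \<open>auto simp: m(2)[OF _ assms(2), of "0\<^sub>m m n"] simp del: index_mult_mat(1)\<close>)
qed

lemma pr_mat_decomposition:
  "(pr1_mat n m)\<^sup>T * pr1_mat n m + (pr2_mat n m)\<^sup>T * pr2_mat n m = 1\<^sub>m (n + m)"
proof (rule eq_matI)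
  fix i j assume "i < dim_row (1\<^sub>m (n + m))" "j < dim_col (1\<^sub>m (n + m))"
  then have ij: "i < n + m" "j < n + m" by auto
  have 1: "((pr1_mat n m)\<^sup>T * pr1_mat n m) $$ (i, j) = (if i = j \<and> i < n then 1 else 0)"
    using ij by (subst index_mult_mat_sum) (auto simp: pr1_mat_def mult_delta)
  have 2: "((pr2_mat n m)\<^sup>T * pr2_mat n m) $$ (i, j) = (if i = j \<and> n \<le> i then 1 else 0)"
  proof (cases "n \<le> i")
    case True
    then obtain i' where "i = n + i'" by (auto dest: le_Suc_ex)
    then show ?thesis
      using ij by (subst index_mult_mat_sum) (auto simp: pr2_mat_def mult_delta intro!: sum.neutral)
  next
    case False
    then show ?thesis
      using ij by (subst index_mult_mat_sum) (auto simp: pr2_mat_def mult_delta)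
  qed
  show "((pr1_mat n m)\<^sup>T * pr1_mat n m + (pr2_mat n m)\<^sup>T * pr2_mat n m) $$ (i, j) =
      1\<^sub>m (n + m) $$ (i, j)"
    using ij 1 2 by (subst index_add_mat) (auto simp del: index_mult_mat(1))
qed auto

lemma congruence_transpose:
  fixes B P :: "complex mat"
  assumes "B \<in> carrier_mat n n" "P \<in> carrier_mat n k"
  shows "(P\<^sup>T * B * P)\<^sup>T = P\<^sup>T * B\<^sup>T * P"
proof -
  have "(P\<^sup>T * B * P)\<^sup>T = P\<^sup>T * (P\<^sup>T * B)\<^sup>T"
    by (rule transpose_mult[of _ k n _ k]) (use assms in auto)
  also have "(P\<^sup>T * B)\<^sup>T = B\<^sup>T * P"
    using transpose_mult[of "P\<^sup>T" k n B n] assms by simp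
  finally show ?thesis using assms by (simp add: mat_mult_assoc carrier_matD)
qed

section \<open>Square roots and idempotents\<close>

lemma smult_mat_zero: "0 \<cdot>\<^sub>m A = 0\<^sub>m (dim_row A) (dim_col A)" for A :: "complex mat"
  by (rule eq_matI) auto

lemma smult_mat_one: "1 \<cdot>\<^sub>m A = A" for A :: "complex mat"
  by (rule eq_matI) auto

text \<open>Horner evaluation. Matrices of all sizes share one type, so the size of the zero and
  identity matrices is read off from \<open>A\<close>.\<close>

definition poly_mat :: "complex mat \<Rightarrow> complex poly \<Rightarrow> complex mat" where
  "poly_mat A p = fold_coeffs (\<lambda>a X. a \<cdot>\<^sub>m 1\<^sub>m (dim_row A) + A * X) p (0\<^sub>m (dim_row A) (dim_row A))"

lemma poly_mat_0 [simp]: "poly_mat A 0 = 0\<^sub>m (dim_row A) (dim_row A)"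
  by (simp add: poly_mat_def)

lemma poly_mat_pCons:
  assumes "A \<in> carrier_mat n n"
  shows "poly_mat A (pCons a p) = a \<cdot>\<^sub>m 1\<^sub>m n + A * poly_mat A p"
proof (cases "a = 0 \<and> p = 0")
  case True
  then show ?thesis using assms by (auto intro!: eq_matI)
next
  case False
  then show ?thesis using assms by (auto simp: poly_mat_def)
qed

context
  fixes A :: "complex mat" and n :: nat
  assumes A: "A \<in> carrier_mat n n"
begin

lemma poly_mat_carrier [simp]: "poly_mat A p \<in> carrier_mat n n"
  by (induction p) (use A in \<open>auto simp: poly_mat_pCons[OF A]\<close>)

lemma dim_poly_mat [simp]: "dim_row (poly_mat A p) = n" "dim_col (poly_mat A p) = n"
  using carrier_matD[OF poly_mat_carrier] by blast+

lemma poly_mat_add: "poly_mat A (p + q) = poly_mat A p + poly_mat A q"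
proof (induction p q rule: poly_induct2)
  case 0
  then show ?case using A by auto
next
  case (pCons a p b q)
  have eq: "(a + b) \<cdot>\<^sub>m 1\<^sub>m n + (A * P + A * Q) = (a \<cdot>\<^sub>m 1\<^sub>m n + A * P) + (b \<cdot>\<^sub>m 1\<^sub>m n + A * Q)"
    if "P \<in> carrier_mat n n" "Q \<in> carrier_mat n n" for P Q
    by (rule eq_matI) (use that A in \<open>auto simp: algebra_simps simp del: index_mult_mat(1)\<close>)
  then show ?case
    using pCons A eq[OF poly_mat_carrier poly_mat_carrier]
    by (simp add: poly_mat_pCons[OF A] mult_add_distrib_mat[OF A poly_mat_carrier poly_mat_carrier])
qed

lemma poly_mat_smult: "poly_mat A (smult c p) = c \<cdot>\<^sub>m poly_mat A p"
proof (induction p)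
  case 0
  then show ?case using A by auto
next
  case (pCons a p)
  have "(c * a) \<cdot>\<^sub>m 1\<^sub>m n + A * (c \<cdot>\<^sub>m poly_mat A p) = c \<cdot>\<^sub>m (a \<cdot>\<^sub>m 1\<^sub>m n + A * poly_mat A p)"
    using mult_smult_distrib[OF A poly_mat_carrier[of p], of c]
    by (intro eq_matI) (use A poly_mat_carrier[of p] in \<open>auto simp: algebra_simps simp del: index_mult_mat(1)\<close>)
  then show ?case using pCons by (simp add: poly_mat_pCons[OF A])
qed

lemma poly_mat_mult: "poly_mat A (p * q) = poly_mat A p * poly_mat A q"
proof (induction p)
  case 0
  then show ?case using A by (auto simp: left_mult_zero_mat[OF poly_mat_carrier])
next
  case (pCons a p)
  have "poly_mat A (pCons a p * q) = a \<cdot>\<^sub>m poly_mat A q + A * poly_mat A (p * q)"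
    using A by (simp add: poly_mat_add poly_mat_smult poly_mat_pCons[OF A] smult_mat_zero left_add_zero_mat[of _ n n])
  also have "\<dots> = (a \<cdot>\<^sub>m 1\<^sub>m n) * poly_mat A q + (A * poly_mat A p) * poly_mat A q"
    using pCons A
    by (simp add: mat_mult_assoc mult_smult_assoc_mat[of _ n n _ n] left_mult_one_mat[of _ n n])
  also have "\<dots> = (a \<cdot>\<^sub>m 1\<^sub>m n + A * poly_mat A p) * poly_mat A q"
    using A by (intro add_mult_distrib_mat[symmetric, of _ n n _ _ n]) auto
  finally show ?case by (simp add: poly_mat_pCons[OF A])
qed

text \<open>Used with several kinds of \<open>T\<close>: a similarity matrix, \<open>A\<close>
  itself, a Gram matrix between a matrix and its transpose, and the matrix of a group element
  commuting with \<open>A\<close>.\<close>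

lemma poly_mat_intertwines:
  assumes "T \<in> carrier_mat m n" "B \<in> carrier_mat m m" "T * A = B * T"
  shows "T * poly_mat A p = poly_mat B p * T"
proof (induction p)
  case 0
  then show ?case using assms A by auto
next
  case (pCons a p)
  have Bp: "poly_mat B p \<in> carrier_mat m m"
    by (induction p) (use assms(2) in \<open>auto simp: poly_mat_pCons[OF assms(2)]\<close>)
  have "T * (A * poly_mat A p) = (B * T) * poly_mat A p"
    unfolding assms(3)[symmetric] using assms A by (intro mat_mult_assoc[symmetric]) auto
  also have "\<dots> = B * (poly_mat B p * T)"
    unfolding pCons(2)[symmetric] using assms A by (intro mat_mult_assoc) auto
  finally have "T * (A * poly_mat A p) = B * (poly_mat B p * T)" .
  then have "T * poly_mat A (pCons a p) = a \<cdot>\<^sub>m T + B * (poly_mat B p * T)"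
    using assms A
    by (simp add: poly_mat_pCons[OF A] mult_add_distrib_mat[of _ m n _ n] mult_smult_distrib[of _ m n _ n])
  also have "\<dots> = poly_mat B (pCons a p) * T"
    using assms Bp
    by (simp add: poly_mat_pCons[OF assms(2)] add_mult_distrib_mat[of _ m m _ _ n]
        mult_smult_assoc_mat[of _ m m _ n] assoc_mult_mat[of _ m m _ m _ n])
  finally show ?case .
qed

end

text \<open>
  Given \<open>p\<^sup>2 - X = q r\<close>, the ansatz \<open>p + t q\<close> turns \<open>r\<close> into \<open>r + 2 t p + t\<^sup>2 q\<close>, and \<open>t\<close> is chosen
  such that \<open>\<mu>\<close> is a root of this polynomial. If \<open>\<mu>\<close> is a root of \<open>q\<close> then
  \<open>p(\<mu>)\<^sup>2 = \<mu> \<noteq> 0\<close> and the equation for \<open>t\<close> is linear.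
\<close>

lemma ex_sqrt_modulo_linear_factors:
  fixes es :: "complex list"
  assumes "0 \<notin> set es"
  shows "\<exists>p r. p * p - [:0, 1:] = (\<Prod>e\<leftarrow>es. [:- e, 1:]) * r"
  using assms
proof (induction es)
  case Nil
  show ?case by (intro exI[of _ 0] exI[of _ "- [:0, 1:]"]) simp
next
  case (Cons \<mu> es)
  let ?q = "\<Prod>e\<leftarrow>es. [:- e, 1:]"
  from Cons obtain p r where pr: "p * p - [:0, 1:] = ?q * r" by auto
  have \<mu>: "\<mu> \<noteq> 0" using Cons by auto
  have "\<exists>t. poly (r + smult (2 * t) p + smult (t * t) ?q) \<mu> = 0"
  proof (cases "poly ?q \<mu> = 0")
    case True
    have "poly (p * p - [:0, 1:]) \<mu> = 0" unfolding pr using True by simp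
    then have "poly p \<mu> \<noteq> 0" using \<mu> by auto
    then show ?thesis
      using True by (intro exI[of _ "- poly r \<mu> / (2 * poly p \<mu>)"]) simp
  next
    case False
    \<comment> \<open>As a polynomial in \<open>t\<close> the value at \<mu> has leading coefficient
      \<open>poly ?q \<mu>\<close>, which is nonzero in this case.\<close>
    have "degree [:poly r \<mu>, 2 * poly p \<mu>, poly ?q \<mu>:] \<noteq> 0" using False by simp
    then obtain t where "poly [:poly r \<mu>, 2 * poly p \<mu>, poly ?q \<mu>:] t = 0"
      using fundamental_theorem_of_algebra unfolding constant_degree by blast
    then show ?thesis by (intro exI[of _ t]) (simp add: algebra_simps)
  qed
  then obtain t s where s: "r + smult (2 * t) p + smult (t * t) ?q = [:- \<mu>, 1:] * s"
    unfolding poly_eq_0_iff_dvd dvd_def by blast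
  have "(p + smult t ?q) * (p + smult t ?q) - [:0, 1:] =
      (p * p - [:0, 1:]) + ?q * (smult (2 * t) p + smult (t * t) ?q)"
  proof -
    have "smult (2 * t) p = smult t p + smult t p" by (simp flip: smult_add_left)
    then show ?thesis by (simp add: algebra_simps)
  qed
  also have "\<dots> = ?q * (r + smult (2 * t) p + smult (t * t) ?q)"
    unfolding pr by (simp add: algebra_simps)
  also have "\<dots> = (\<Prod>e\<leftarrow>\<mu> # es. [:- e, 1:]) * s"
    unfolding s by (simp only: list.map prod_list.Cons mult_ac)
  finally show ?case by blast
qed

text \<open>For \<open>k = n\<close> this is the Cayley-Hamilton theorem for a triangular matrix. In
  a column \<open>j \<le> k\<close> the next factor, \<open>T\<close> minus its diagonal entry at
  \<open>k\<close>, has nonzero entries only in rows below index \<open>k\<close>, and there the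
  columns of the previous product already vanish.\<close>

lemma poly_mat_upper_triangular:
  assumes T: "T \<in> carrier_mat n n" "upper_triangular T" and k: "k \<le> n"
  shows "\<forall>i<n. \<forall>j<k. poly_mat T (\<Prod>e\<leftarrow>take k (diag_mat T). [:- e, 1:]) $$ (i, j) = 0"
  using k
proof (induction k)
  case 0
  then show ?case by simp
next
  case (Suc k)
  let ?p = "\<Prod>e\<leftarrow>take k (diag_mat T). [:- e, 1:]"
  have len: "length (diag_mat T) = n" and nth: "diag_mat T ! k = T $$ (k, k)"
    using T Suc by (auto simp: diag_mat_def)
  have p: "(\<Prod>e\<leftarrow>take (Suc k) (diag_mat T). [:- e, 1:]) = ?p * [:- T $$ (k, k), 1:]"
    using Suc len nth by (simp add: take_Suc_conv_app_nth)
  have lin: "poly_mat T [:- c, 1:] = - c \<cdot>\<^sub>m 1\<^sub>m n + T" for c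
    using T by (simp add: poly_mat_pCons[OF T(1)] left_add_zero_mat) (auto simp: poly_mat_pCons[OF T(1)])
  show ?case
  proof (intro allI impI)
    fix i j assume i: "i < n" and j: "j < Suc k"
    let ?M = "poly_mat T ?p" and ?L = "- T $$ (k, k) \<cdot>\<^sub>m 1\<^sub>m n + T"
    have "(?M * ?L) $$ (i, j) = (\<Sum>l = 0..<n. ?M $$ (i, l) * ?L $$ (l, j))"
      using i j Suc(2) T by (subst index_mult_mat_sum) (auto simp: dim_poly_mat[OF T(1)])
    also have "\<dots> = 0"
    proof (rule sum.neutral, rule ballI)
      fix l assume l: "l \<in> {0..<n}"
      show "?M $$ (i, l) * ?L $$ (l, j) = 0"
      proof (cases "l < k")
        case True
        then show ?thesis using Suc i by simp
      next
        case False
        have "?L $$ (l, j) = 0"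
        proof (cases "l = j")
          case True
          then have "l = k" "j = k" using j False by auto
          then show ?thesis using Suc(2) T by simp
        next
          case False
          then show ?thesis
            using l j Suc(2) T \<open>\<not> l < k\<close> upper_triangularD[OF T(2), of j l] by auto
        qed
        then show ?thesis by simp
      qed
    qed
    finally show "poly_mat T (\<Prod>e\<leftarrow>take (Suc k) (diag_mat T). [:- e, 1:]) $$ (i, j) = 0"
      unfolding p poly_mat_mult[OF T(1)] lin .
  qed
qed

lemma complex_mat_triangular_form:
  fixes A :: "complex mat"
  assumes A: "A \<in> carrier_mat n n"
  obtains T P Q where "similar_mat_wit A T P Q" "upper_triangular T"
    "char_poly A = (\<Prod>e\<leftarrow>diag_mat T. [:- e, 1:])"
proof -
  obtain es where es: "char_poly A = (\<Prod>e\<leftarrow>es. [:- e, 1:])"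
    using char_poly_factorized[OF A] by blast
  obtain T P Q where "schur_decomposition A es = (T, P, Q)" by (metis prod_cases3)
  from schur_decomposition[OF A es this] es show thesis using that by blast
qed

text \<open>Invertibility keeps 0 out of the spectrum, so X has a square root modulo the
  characteristic polynomial, and by Cayley-Hamilton the multiple of that polynomial vanishes at
  \<open>A\<close>. The root is produced as a polynomial because only then does it inherit
  adjointness and commutation from \<open>A\<close>.\<close>

lemma complex_mat_sqrt:
  fixes A :: "complex mat"
  assumes A: "A \<in> carrier_mat n n" and inv: "A' \<in> carrier_mat n n" "A' * A = 1\<^sub>m n"
  obtains p where "poly_mat A p * poly_mat A p = A"
proof -
  obtain T P Q where sim: "similar_mat_wit A T P Q" and ut: "upper_triangular T"
    and cp: "char_poly A = (\<Prod>e\<leftarrow>diag_mat T. [:- e, 1:])"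
    using complex_mat_triangular_form[OF A] .
  let ?q = "\<Prod>e\<leftarrow>diag_mat T. [:- e, 1:]"
  note PQ = similar_mat_witD2[OF A sim]
  \<comment> \<open>Cayley-Hamilton for the triangular form, carried over to \<open>A\<close> by the
    similarity matrix \<open>P\<close>.\<close>
  have "poly_mat T ?q = 0\<^sub>m n n"
    using poly_mat_upper_triangular[OF PQ(5) ut order_refl] PQ(5)
    by (intro eq_matI) (auto simp: diag_mat_def dim_poly_mat[OF PQ(5)])
  moreover have "P * poly_mat T ?q = poly_mat A ?q * P"
  proof (rule poly_mat_intertwines[OF PQ(5,6,4)])
    show "P * T = A * P"
      unfolding PQ(3) using PQ(2,5-7) by (simp add: mat_mult_assoc)
  qed
  ultimately have "poly_mat A ?q * P = 0\<^sub>m n n"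
    using PQ(6) by simp
  then have "(poly_mat A ?q * P) * Q = 0\<^sub>m n n"
    using PQ(7) by simp
  then have q: "poly_mat A ?q = 0\<^sub>m n n"
    using PQ(1,6,7) A by (simp add: mat_mult_assoc dim_poly_mat[OF A] right_mult_one_mat[OF poly_mat_carrier[OF A]])
  have "0 \<notin> set (diag_mat T)"
  proof
    assume "0 \<in> set (diag_mat T)"
    then have "poly (char_poly A) 0 = 0"
      unfolding cp by (auto simp: poly_prod_list o_def prod_list_zero_iff)
    then have "eigenvalue A 0" using eigenvalue_root_char_poly[OF A] by simp
    then obtain v where v: "v \<in> carrier_vec n" "v \<noteq> 0\<^sub>v n" "A *\<^sub>v v = 0 \<cdot>\<^sub>v v"
      using A by (auto simp: eigenvalue_def eigenvector_def)
    have "v = (A' * A) *\<^sub>v v" using v inv by simp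
    also have "\<dots> = A' *\<^sub>v (A *\<^sub>v v)" using assoc_mult_mat_vec[OF inv(1) A v(1)] .
    also have "\<dots> = 0\<^sub>v n" using v inv(1) by (auto simp: mult_mat_vec_def scalar_prod_def intro!: eq_vecI)
    finally show False using v by simp
  qed
  then obtain p r where pr: "p * p - [:0, 1:] = ?q * r"
    using ex_sqrt_modulo_linear_factors by blast
  have "poly_mat A (p * p) = poly_mat A ([:0, 1:] + ?q * r)"
    unfolding pr[symmetric] by simp
  also have "\<dots> = poly_mat A [:0, 1:]"
    using A poly_mat_carrier[OF A, of r] poly_mat_carrier[OF A, of "[:0, 1:]"]
    by (simp only: poly_mat_add[OF A] poly_mat_mult[OF A] q left_mult_zero_mat right_add_zero_mat)
  also have "poly_mat A [:0, 1:] = A"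
  proof -
    have "poly_mat A [:1:] = 1\<^sub>m n"
      using A by (simp add: poly_mat_pCons[OF A] smult_mat_one)
    then show ?thesis
      using A by (subst poly_mat_pCons[OF A]) (auto intro!: eq_matI)
  qed
  finally have "poly_mat A p * poly_mat A p = A"
    unfolding poly_mat_mult[OF A] .
  then show thesis by (rule that)
qed

lemma poly_mat_transpose:
  assumes A: "A \<in> carrier_mat n n"
  shows "poly_mat (A\<^sup>T) p = (poly_mat A p)\<^sup>T"
proof (induction p)
  case 0
  then show ?case using A by auto
next
  case (pCons a p)
  have A': "A\<^sup>T \<in> carrier_mat n n" using A by simp
  have "(A * poly_mat A p)\<^sup>T = A\<^sup>T * (poly_mat A p)\<^sup>T"
  proof -
    \<comment> \<open>Transposing reverses the product; commuting the factors restores the order of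
      the Horner step.\<close>
    have "A * poly_mat A p = poly_mat A p * A"
      by (rule poly_mat_intertwines[OF A A A refl])
    then show ?thesis using transpose_mult[OF poly_mat_carrier[OF A] A, of p] by simp
  qed
  moreover have "(a \<cdot>\<^sub>m 1\<^sub>m n + A * poly_mat A p)\<^sup>T =
      a \<cdot>\<^sub>m 1\<^sub>m n + (A * poly_mat A p)\<^sup>T"
    by (rule eq_matI) (use A in \<open>auto simp: dim_poly_mat[OF A] simp del: index_mult_mat(1)\<close>)
  ultimately show ?case
    using pCons by (simp add: poly_mat_pCons[OF A] poly_mat_pCons[OF A'])
qed

text \<open>Invariance of \<open>B\<close> exhibits a left inverse of \<open>R\<close>, which for
  square matrices is also a right inverse; cancelling \<open>B\<close> gives the claim. It says that
  the inverse of an invariant pairing is an invariant copairing.\<close>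

lemma invariant_form_inverse:
  fixes R :: "complex mat"
  assumes [simp]: "B \<in> carrier_mat n n" "Bi \<in> carrier_mat n n" "R \<in> carrier_mat n n"
    and inv: "B * Bi = 1\<^sub>m n" and R: "R\<^sup>T * B * R = B"
    and Bi: "Bi * B = 1\<^sub>m n"
  shows "R * Bi * R\<^sup>T = Bi"
proof -
  note sq = assoc_mult_mat[of _ n n _ n _ n] mult_carrier_mat[of _ n n _ n]
    left_mult_one_mat[of _ n n] right_mult_one_mat[of _ n n]
  have [simp]: "R\<^sup>T \<in> carrier_mat n n" by simp
  have "(Bi * R\<^sup>T * B) * R = Bi * (R\<^sup>T * B * R)"
    by (simp add: sq)
  also have "\<dots> = 1\<^sub>m n" unfolding R by (rule Bi)
  finally have "R * (Bi * R\<^sup>T * B) = 1\<^sub>m n"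
    by (intro mat_mult_left_right_inverse[OF _ assms(3)]) (simp_all only: sq assms(1-3) transpose_carrier_mat)
  then have "R * (Bi * R\<^sup>T * B) * Bi = 1\<^sub>m n * Bi" by simp
  moreover have "R * (Bi * R\<^sup>T * B) * Bi = R * Bi * R\<^sup>T * (B * Bi)"
    by (simp add: sq)
  ultimately show ?thesis
    unfolding inv by (simp add: sq)
qed

text \<open>
  A square root \<open>S\<close> of \<open>B'\<^sup>-\<^sup>1 B\<close> that is a polynomial in it is self-adjoint for \<open>B'\<close> and commutes with
  everything that preserves both forms.
\<close>

lemma symmetric_forms_congruent:
  fixes B B' :: "complex mat"
  assumes car [simp]: "B \<in> carrier_mat n n" "B' \<in> carrier_mat n n" "Bi \<in> carrier_mat n n" "Bi' \<in> carrier_mat n n"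
    and sym: "B\<^sup>T = B" "B'\<^sup>T = B'"
    and inv: "B * Bi = 1\<^sub>m n" "Bi * B = 1\<^sub>m n" "B' * Bi' = 1\<^sub>m n" "Bi' * B' = 1\<^sub>m n"
  obtains S Si where "S \<in> carrier_mat n n" "Si \<in> carrier_mat n n" "S * Si = 1\<^sub>m n" "Si * S = 1\<^sub>m n"
    "S\<^sup>T * B' * S = B"
    "\<And>R. R \<in> carrier_mat n n \<Longrightarrow> R\<^sup>T * B * R = B \<Longrightarrow>
      R\<^sup>T * B' * R = B' \<Longrightarrow> R * S = S * R"
proof -
  let ?A = "Bi' * B" and ?Ai = "Bi * B'"
  note assoc = assoc_mult_mat[of _ n n _ n _ n] mult_carrier_mat[of _ n n _ n]
    left_mult_one_mat[of _ n n] right_mult_one_mat[of _ n n]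
  have A: "?A \<in> carrier_mat n n" and Ai: "?Ai \<in> carrier_mat n n" by (simp_all add: assoc)
  have "?Ai * ?A = Bi * (B' * Bi') * B"
    by (simp add: assoc)
  then have AiA: "?Ai * ?A = 1\<^sub>m n" by (simp add: inv assoc)
  obtain p where p: "poly_mat ?A p * poly_mat ?A p = ?A"
    using complex_mat_sqrt[OF A Ai AiA] .
  let ?S = "poly_mat ?A p"
  have S [simp]: "?S \<in> carrier_mat n n" by (rule poly_mat_carrier[OF A])
  \<comment> \<open>From S S = A the inverse of S is the inverse of A times S.\<close>
  let ?Si = "?Ai * ?S"
  have SiS: "?Si * ?S = 1\<^sub>m n"
  proof -
    have "?Si * ?S = ?Ai * (?S * ?S)" by (rule assoc_mult_mat[OF Ai S S])
    then show ?thesis unfolding p AiA .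
  qed
  have SSi: "?S * ?Si = 1\<^sub>m n"
    by (rule mat_mult_left_right_inverse[OF _ S SiS]) (simp only: assoc S car)
  have B'A: "B' * ?A = B"
  proof -
    have "B' * ?A = (B' * Bi') * B" by (simp add: assoc)
    then show ?thesis by (simp add: inv assoc)
  qed
  have AtB': "?A\<^sup>T * B' = B"
  proof -
    have "(B' * ?A)\<^sup>T = ?A\<^sup>T * B'\<^sup>T"
      by (rule transpose_mult[OF car(2) A])
    then show ?thesis unfolding B'A sym by simp
  qed
  \<comment> \<open>Here the Gram matrix \<open>B'\<close> itself is the intertwiner, from
    \<open>?A\<close> to its transpose.\<close>
  have "B' * ?S = ?S\<^sup>T * B'"
    unfolding poly_mat_transpose[OF A, symmetric]
    by (rule poly_mat_intertwines[OF A, where m = n]) (simp_all add: B'A AtB' assoc)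
  then have "?S\<^sup>T * B' * ?S = B' * (?S * ?S)"
    by (simp add: assoc_mult_mat[OF car(2) S S, symmetric])
  then have 1: "?S\<^sup>T * B' * ?S = B" unfolding p B'A .
  have 2: "R * ?S = ?S * R"
    if R: "R \<in> carrier_mat n n" "R\<^sup>T * B * R = B" "R\<^sup>T * B' * R = B'" for R
  proof (rule poly_mat_intertwines[OF A R(1) A])
    have [simp]: "R \<in> carrier_mat n n" "R\<^sup>T \<in> carrier_mat n n" using R by auto
    have "R * ?A = R * Bi' * (R\<^sup>T * B * R)"
      unfolding R(2) by (simp add: assoc)
    also have "\<dots> = R * Bi' * R\<^sup>T * (B * R)"
      by (simp add: assoc)
    also have "\<dots> = Bi' * (B * R)"
      unfolding invariant_form_inverse[OF car(2,4) R(1) inv(3) R(3) inv(4)] ..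
    also have "\<dots> = ?A * R" by (simp add: assoc)
    finally show "R * ?A = ?A * R" .
  qed
  show thesis
    by (rule that[of ?S ?Si]) (use SSi SiS 1 2 in \<open>auto simp: assoc\<close>)
qed

text \<open>An idempotent triangular matrix has only 0 and 1 on its diagonal, so the trace counts
  the ones. With no ones it is strictly triangular and idempotent, hence zero.\<close>

lemma idempotent_trace:
  fixes A :: "complex mat"
  assumes A: "A \<in> carrier_mat n n" and idem: "A * A = A"
  obtains k :: nat where "mat_trace A = of_nat k" "k = 0 \<Longrightarrow> A = 0\<^sub>m n n"
proof -
  obtain T P Q where sim: "similar_mat_wit A T P Q" and ut: "upper_triangular T"
    using complex_mat_triangular_form[OF A] .
  note PQ = similar_mat_witD2[OF A sim]
  note assoc = assoc_mult_mat[of _ n n _ n _ n] mult_carrier_mat[of _ n n _ n]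
    left_mult_one_mat[of _ n n] right_mult_one_mat[of _ n n]
  have T: "T = Q * A * P"
  proof -
    have "Q * A * P = (Q * P) * T * (Q * P)"
      unfolding PQ(3) using PQ(5-7) by (simp add: assoc)
    then show ?thesis using PQ(2,5) by simp
  qed
  have TT: "T * T = T"
  proof -
    have "T * T = Q * A * (P * Q) * A * P"
      unfolding T using PQ(4-7) by (simp add: assoc)
    also have "\<dots> = Q * (A * A) * P"
      unfolding PQ(1) using PQ(4-7) by (simp add: assoc)
    finally show ?thesis unfolding idem T .
  qed
  have low: "T $$ (i, j) = 0" if "j < i" "i < n" for i j
    using upper_triangularD[OF ut that(1)] that PQ(5) by auto
  have TTs: "T $$ (i, j) = (\<Sum>l = 0..<n. T $$ (i, l) * T $$ (l, j))" if "i < n" "j < n" for i j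
  proof -
    have "(T * T) $$ (i, j) = (\<Sum>l = 0..<n. T $$ (i, l) * T $$ (l, j))"
      using that PQ(5) by (subst index_mult_mat_sum) auto
    then show ?thesis unfolding TT .
  qed
  have diag: "T $$ (i, i) = 0 \<or> T $$ (i, i) = 1" if i: "i < n" for i
  proof -
    have "T $$ (i, i) = (\<Sum>l = 0..<n. T $$ (i, l) * T $$ (l, i))"
      by (rule TTs[OF i i])
    also have "\<dots> = (\<Sum>l = 0..<n. if l = i then T $$ (i, i) * T $$ (i, i) else 0)"
    proof (rule sum.cong[OF refl])
      fix l assume "l \<in> {0..<n}"
      then show "T $$ (i, l) * T $$ (l, i) = (if l = i then T $$ (i, i) * T $$ (i, i) else 0)"
        using low[of l i] low[of i l] i by (cases l i rule: linorder_cases) auto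
    qed
    also have "\<dots> = T $$ (i, i) * T $$ (i, i)" using i by simp
    finally have "T $$ (i, i) * (T $$ (i, i) - 1) = 0"
      unfolding right_diff_distrib mult_1_right by (simp only: eq_iff_diff_eq_0[symmetric])
    then show ?thesis by auto
  qed
  let ?I = "{i\<in>{0..<n}. T $$ (i, i) = 1}"
  have "mat_trace A = mat_trace (P * (T * Q))"
    unfolding PQ(3) using PQ(5-7) by (simp add: assoc)
  also have "\<dots> = mat_trace ((T * Q) * P)"
    by (rule mat_trace_mult_comm[of _ n n]) (use PQ(5-7) in auto)
  also have "(T * Q) * P = T" using PQ(2,5-7) by (simp add: assoc)
  also have "mat_trace T = (\<Sum>i = 0..<n. if i \<in> ?I then 1 else 0)"
    unfolding mat_trace_def using PQ(5) diag by (intro sum.cong) auto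
  also have "\<dots> = of_nat (card ?I)"
    by (subst sum.If_cases) (auto intro!: arg_cong[of _ _ card])
  finally have tr: "mat_trace A = of_nat (card ?I)" .
  have "A = 0\<^sub>m n n" if "card ?I = 0"
  proof -
    have zero: "T $$ (i, i) = 0" if "i < n" for i
      using diag[OF that] \<open>card ?I = 0\<close> that by auto
    \<comment> \<open>Induction on the distance from the diagonal: in the expansion of
      \<open>T * T\<close> each summand has a factor on or below the diagonal, or one strictly
      closer to it.\<close>
    have "i < n \<Longrightarrow> j < n \<Longrightarrow> T $$ (i, j) = 0" for i j
    proof (induction "j - i" arbitrary: i j rule: less_induct)
      case less
      have "T $$ (i, l) * T $$ (l, j) = 0" if "l < n" for l
      proof -
        consider "l < i" | "l = i" | "j < l" | "i < l" "l \<le> j" by linarith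
        then show ?thesis
        proof cases
          case 4
          show ?thesis
          proof (cases "l = j")
            case True then show ?thesis using zero less(3) by simp
          next
            case False
            then have "T $$ (i, l) = 0" using 4 less(2) that by (intro less(1)) auto
            then show ?thesis by simp
          qed
        qed (use low zero less(2,3) that in auto)
      qed
      then show ?case unfolding TTs[OF less(2,3)] by (intro sum.neutral) simp
    qed
    then have "T = 0\<^sub>m n n" using PQ(5) by (intro eq_matI) auto
    then show ?thesis unfolding PQ(3) using PQ(6,7) by simp
  qed
  with tr show thesis by (rule that)
qed

section \<open>The category of representations\<close>

lemma Rep_sel [simp]:
  "Obj (Rep G) = representations G"
  "Hom (Rep G) M N = intertwiners G M N"
  "f \<star>\<^bsub>Rep G\<^esub> g = f * g"
  "Id (Rep G) M = 1\<^sub>m (fst M)"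
  "f \<boxplus>\<^bsub>Rep G\<^esub> g = f + g"
  "ZeroArr (Rep G) M N = 0\<^sub>m (fst N) (fst M)"
  "Scale (Rep G) c f = c \<cdot>\<^sub>m f"
  "f \<boxtimes>\<^sub>m\<^bsub>Rep G\<^esub> g = kronecker f g"
  "Assoc (Rep G) M N L = 1\<^sub>m (fst M * fst N * fst L)"
  "LUnit (Rep G) M = 1\<^sub>m (fst M)"
  "RUnit (Rep G) M = 1\<^sub>m (fst M)"
  "Braid (Rep G) M N = flip_mat (fst M) (fst N)"
  "Ev (Rep G) M = ev_mat (fst M)"
  "Coev (Rep G) M = coev_mat (fst M)"
  "Pr1 (Rep G) M N = pr1_mat (fst M) (fst N)"
  "Pr2 (Rep G) M N = pr2_mat (fst M) (fst N)"
  by (simp_all add: Rep_def split_beta)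

lemma Rep_obj:
  "Unit (Rep G) = (1, \<lambda>g\<in>carrier G. 1\<^sub>m 1)"
  "M \<boxtimes>\<^bsub>Rep G\<^esub> N = (fst M * fst N, \<lambda>g\<in>carrier G. kronecker (snd M g) (snd N g))"
  "Dual (Rep G) M = (fst M, \<lambda>g\<in>carrier G. (snd M (inv\<^bsub>G\<^esub> g))\<^sup>T)"
  "ZeroObj (Rep G) = (0, \<lambda>g\<in>carrier G. 1\<^sub>m 0)"
  "M \<uplus>\<^bsub>Rep G\<^esub> N = (fst M + fst N,
     \<lambda>g\<in>carrier G. four_block_mat (snd M g) (0\<^sub>m (fst M) (fst N)) (0\<^sub>m (fst N) (fst M)) (snd N g))"
  by (simp_all add: Rep_def split_beta)

lemma fst_Rep_obj [simp]:
  "fst (Unit (Rep G)) = 1"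
  "fst (M \<boxtimes>\<^bsub>Rep G\<^esub> N) = fst M * fst N"
  "fst (Dual (Rep G) M) = fst M"
  "fst (ZeroObj (Rep G)) = 0"
  "fst (M \<uplus>\<^bsub>Rep G\<^esub> N) = fst M + fst N"
  by (simp_all add: Rep_obj)

lemma snd_Rep_obj [simp]:
  "g \<in> carrier G \<Longrightarrow> snd (Unit (Rep G)) g = 1\<^sub>m 1"
  "g \<in> carrier G \<Longrightarrow> snd (M \<boxtimes>\<^bsub>Rep G\<^esub> N) g = kronecker (snd M g) (snd N g)"
  "g \<in> carrier G \<Longrightarrow> snd (Dual (Rep G) M) g = (snd M (inv\<^bsub>G\<^esub> g))\<^sup>T"
  "g \<in> carrier G \<Longrightarrow> snd (ZeroObj (Rep G)) g = 1\<^sub>m 0"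
  "g \<in> carrier G \<Longrightarrow> snd (M \<uplus>\<^bsub>Rep G\<^esub> N) g =
     four_block_mat (snd M g) (0\<^sub>m (fst M) (fst N)) (0\<^sub>m (fst N) (fst M)) (snd N g)"
  by (simp_all add: Rep_obj)

lemma intertwiners_iff:
  "T \<in> intertwiners G M N \<longleftrightarrow>
     T \<in> carrier_mat (fst N) (fst M) \<and> (\<forall>g\<in>carrier G. T * snd M g = snd N g * T)"
  by (simp add: intertwiners_def split_beta)

lemma intertwiners_carrier: "T \<in> intertwiners G M N \<Longrightarrow> T \<in> carrier_mat (fst N) (fst M)"
  by (simp add: intertwiners_iff)

lemma dim_intertwiner:
  assumes "T \<in> intertwiners G M N"
  shows "dim_row T = fst N" "dim_col T = fst M"
  using intertwiners_carrier[OF assms] by auto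

locale group_reps = group G for G (structure)
begin

text \<open>Membership in \<open>GL n\<close> comes from the group: \<open>snd M (inv g)\<close>
  inverts \<open>snd M g\<close> once products and the neutral element are respected.\<close>

lemma representations_iff:
  "M \<in> representations G \<longleftrightarrow>
     snd M \<in> extensional (carrier G) \<and> (\<forall>g\<in>carrier G. snd M g \<in> carrier_mat (fst M) (fst M)) \<and>
     snd M \<one> = 1\<^sub>m (fst M) \<and>
     (\<forall>g\<in>carrier G. \<forall>h\<in>carrier G. snd M (g \<otimes> h) = snd M g * snd M h)"
    (is "?L \<longleftrightarrow> ?R")
proof -
  obtain n \<rho> where M: "M = (n, \<rho>)" by (cases M)
  interpret GL: group "GL n"
    unfolding GL_def by (rule monoid.units_group, rule ring.is_monoid, rule ring_mat)
  have GL_sel: "monoid.mult (GL n) = (*)" "\<one>\<^bsub>GL n\<^esub> = 1\<^sub>m n"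
    by (simp_all add: GL_def units_of_def ring_mat_def)
  have GL_carrier: "X \<in> carrier (GL n) \<longleftrightarrow>
      X \<in> carrier_mat n n \<and> (\<exists>Y\<in>carrier_mat n n. Y * X = 1\<^sub>m n \<and> X * Y = 1\<^sub>m n)" for X
    by (simp add: GL_def units_of_def ring_mat_def Units_def)
  show ?thesis
  proof
    assume ?L
    then have \<rho>: "\<rho> \<in> hom G (GL n)" "\<rho> \<in> extensional (carrier G)"
      by (auto simp: representations_def M)
    have "\<rho> \<one> = \<one>\<^bsub>GL n\<^esub>" using hom_one[OF \<rho>(1)] by (simp add: GL.group_axioms)
    with \<rho> show ?R by (auto simp: M hom_def GL_sel GL_carrier Pi_iff)
  next
    assume R: ?R
    have "\<rho> g \<in> carrier (GL n)" if "g \<in> carrier G" for g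
    proof -
      have one: "\<rho> \<one> = 1\<^sub>m n" and car: "\<rho> h \<in> carrier_mat n n" if "h \<in> carrier G" for h
        using R that by (simp_all add: M)
      have mult: "\<rho> h * \<rho> k = \<rho> (h \<otimes> k)" if "h \<in> carrier G" "k \<in> carrier G" for h k
        using R that by (simp add: M)
      have "\<rho> (inv g) * \<rho> g = 1\<^sub>m n" "\<rho> g * \<rho> (inv g) = 1\<^sub>m n"
        using that by (simp_all add: mult one[OF one_closed])
      then show ?thesis
        unfolding GL_carrier using that car by (intro conjI bexI[of _ "\<rho> (inv g)"]) simp_all
    qed
    then show ?L
      using R by (auto simp: M representations_def hom_def GL_sel)
  qed
qed

context
  fixes M assumes M: "M \<in> representations G"
begin

lemma rep_carrier: "g \<in> carrier G \<Longrightarrow> snd M g \<in> carrier_mat (fst M) (fst M)"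
  and rep_one: "snd M \<one> = 1\<^sub>m (fst M)"
  and rep_mult: "g \<in> carrier G \<Longrightarrow> h \<in> carrier G \<Longrightarrow> snd M (g \<otimes> h) = snd M g * snd M h"
  and rep_extensional: "snd M \<in> extensional (carrier G)"
  using M by (auto simp: representations_iff)

lemma rep_dim: "g \<in> carrier G \<Longrightarrow> dim_row (snd M g) = fst M" "g \<in> carrier G \<Longrightarrow> dim_col (snd M g) = fst M"
  using rep_carrier by auto

lemma rep_inv:
  "g \<in> carrier G \<Longrightarrow> snd M (inv g) * snd M g = 1\<^sub>m (fst M)"
  "g \<in> carrier G \<Longrightarrow> snd M g * snd M (inv g) = 1\<^sub>m (fst M)"
  by (simp_all add: rep_one flip: rep_mult)

end

text \<open>The condition \<open>extensional\<close> fixes the values outside the group. Thus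
  associativity, units and one distributive law hold as equalities of representations, not merely up
  to isomorphism.\<close>

lemma rep_eqI:
  assumes "M \<in> representations G" "N \<in> representations G" "fst M = fst N"
    "\<And>g. g \<in> carrier G \<Longrightarrow> snd M g = snd N g"
  shows "M = N"
  using assms rep_extensional by (metis extensionalityI prod_eqI)

lemma Unit_rep [simp]: "Unit (Rep G) \<in> representations G"
  by (auto simp: representations_iff) (auto simp: Rep_obj)

lemma ZeroObj_rep [simp]: "ZeroObj (Rep G) \<in> representations G"
  by (auto simp: representations_iff) (auto simp: Rep_obj)

lemma TObj_rep [simp]:
  assumes "M \<in> representations G" "N \<in> representations G"
  shows "M \<boxtimes>\<^bsub>Rep G\<^esub> N \<in> representations G"
  unfolding representations_iff
proof (intro conjI ballI)
  show "snd (M \<boxtimes>\<^bsub>Rep G\<^esub> N) \<in> extensional (carrier G)" by (simp add: Rep_obj)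
qed (use assms in \<open>auto simp: kronecker_mult rep_mult rep_dim rep_one kronecker_one intro!: carrier_matI\<close>)

lemma Dual_rep [simp]:
  assumes M: "M \<in> representations G"
  shows "Dual (Rep G) M \<in> representations G"
  unfolding representations_iff
proof (intro conjI ballI)
  show "snd (Dual (Rep G) M) \<in> extensional (carrier G)" by (simp add: Rep_obj)
  fix g h assume gh: "g \<in> carrier G" "h \<in> carrier G"
  then have "snd M (inv (g \<otimes> h)) = snd M (inv h) * snd M (inv g)"
    by (simp add: inv_mult_group rep_mult[OF M])
  then show "snd (Dual (Rep G) M) (g \<otimes> h) = snd (Dual (Rep G) M) g * snd (Dual (Rep G) M) h"
    using gh by (simp add: transpose_mult[OF rep_carrier[OF M] rep_carrier[OF M]])
qed (use M in \<open>auto simp: rep_dim rep_one intro!: carrier_matI\<close>)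

lemma DSum_rep [simp]:
  assumes M: "M \<in> representations G" and N: "N \<in> representations G"
  shows "M \<uplus>\<^bsub>Rep G\<^esub> N \<in> representations G"
  unfolding representations_iff
proof (intro conjI ballI)
  show "snd (M \<uplus>\<^bsub>Rep G\<^esub> N) \<in> extensional (carrier G)" by (simp add: Rep_obj)
  fix g h assume gh: "g \<in> carrier G" "h \<in> carrier G"
  note car = rep_carrier[OF M gh(1)] rep_carrier[OF M gh(2)] rep_carrier[OF N gh(1)] rep_carrier[OF N gh(2)]
  show "snd (M \<uplus>\<^bsub>Rep G\<^esub> N) (g \<otimes> h) = snd (M \<uplus>\<^bsub>Rep G\<^esub> N) g * snd (M \<uplus>\<^bsub>Rep G\<^esub> N) h"
    using gh car
    by (simp add: rep_mult M N mult_four_block_mat[OF car(1) zero_carrier_mat zero_carrier_mat car(3)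
          car(2) zero_carrier_mat zero_carrier_mat car(4)])
qed (use M N in \<open>auto simp: rep_dim rep_one intro!: carrier_matI\<close>)

lemma TObj_assoc:
  assumes "M \<in> representations G" "N \<in> representations G" "L \<in> representations G"
  shows "(M \<boxtimes>\<^bsub>Rep G\<^esub> N) \<boxtimes>\<^bsub>Rep G\<^esub> L = M \<boxtimes>\<^bsub>Rep G\<^esub> (N \<boxtimes>\<^bsub>Rep G\<^esub> L)"
  by (rule rep_eqI) (use assms in \<open>auto simp: kronecker_assoc\<close>)

lemma TObj_Unit:
  assumes "M \<in> representations G"
  shows "Unit (Rep G) \<boxtimes>\<^bsub>Rep G\<^esub> M = M" "M \<boxtimes>\<^bsub>Rep G\<^esub> Unit (Rep G) = M"
  by (rule rep_eqI; use assms kronecker_one_left kronecker_one_right in auto)+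

lemma TObj_ZeroObj:
  assumes "M \<in> representations G"
  shows "ZeroObj (Rep G) \<boxtimes>\<^bsub>Rep G\<^esub> M = ZeroObj (Rep G)"
  by (rule rep_eqI) (use assms in \<open>auto intro!: eq_matI\<close>)

lemma DSum_ZeroObj:
  assumes "M \<in> representations G"
  shows "ZeroObj (Rep G) \<uplus>\<^bsub>Rep G\<^esub> M = M"
  by (rule rep_eqI) (use assms in \<open>auto simp: rep_dim intro!: eq_matI\<close>)

lemma DSum_assoc:
  assumes "M \<in> representations G" "N \<in> representations G" "L \<in> representations G"
  shows "(M \<uplus>\<^bsub>Rep G\<^esub> N) \<uplus>\<^bsub>Rep G\<^esub> L = M \<uplus>\<^bsub>Rep G\<^esub> (N \<uplus>\<^bsub>Rep G\<^esub> L)"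
  by (rule rep_eqI) (use assms in \<open>auto simp: rep_dim intro!: eq_matI\<close>)

lemma TObj_DSum:
  assumes "M \<in> representations G" "N \<in> representations G" "L \<in> representations G"
  shows "(M \<uplus>\<^bsub>Rep G\<^esub> N) \<boxtimes>\<^bsub>Rep G\<^esub> L = (M \<boxtimes>\<^bsub>Rep G\<^esub> L) \<uplus>\<^bsub>Rep G\<^esub> (N \<boxtimes>\<^bsub>Rep G\<^esub> L)"
  by (rule rep_eqI)
    (use assms in \<open>auto simp: kronecker_four_block[OF rep_carrier rep_carrier rep_carrier] algebra_simps\<close>)

lemma Dual_TObj:
  assumes "M \<in> representations G" "N \<in> representations G"
  shows "Dual (Rep G) (M \<boxtimes>\<^bsub>Rep G\<^esub> N) = Dual (Rep G) M \<boxtimes>\<^bsub>Rep G\<^esub> Dual (Rep G) N"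
  by (rule rep_eqI) (use assms in \<open>auto simp: kronecker_transpose\<close>)

lemma Dual_DSum:
  assumes "M \<in> representations G" "N \<in> representations G"
  shows "Dual (Rep G) (M \<uplus>\<^bsub>Rep G\<^esub> N) = Dual (Rep G) M \<uplus>\<^bsub>Rep G\<^esub> Dual (Rep G) N"
  by (rule rep_eqI)
    (use assms in \<open>auto simp: transpose_four_block_mat[OF rep_carrier zero_carrier_mat zero_carrier_mat rep_carrier]\<close>)

lemma intertwiner_id: "M \<in> representations G \<Longrightarrow> 1\<^sub>m (fst M) \<in> intertwiners G M M"
  by (auto simp: intertwiners_iff rep_carrier left_mult_one_mat[OF rep_carrier] right_mult_one_mat[OF rep_carrier])

lemma intertwiner_comp:
  assumes "S \<in> intertwiners G N L" "T \<in> intertwiners G M N"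
    "M \<in> representations G" "N \<in> representations G" "L \<in> representations G"
  shows "S * T \<in> intertwiners G M L"
  unfolding intertwiners_iff
proof (intro conjI ballI)
  note dim = dim_intertwiner[OF assms(1)] dim_intertwiner[OF assms(2)]
  show "S * T \<in> carrier_mat (fst L) (fst M)" using dim by (auto intro: carrier_matI)
  fix g assume g: "g \<in> carrier G"
  note d = dim rep_dim[OF assms(3) g] rep_dim[OF assms(4) g] rep_dim[OF assms(5) g]
  have "S * T * snd M g = S * (T * snd M g)" by (rule mat_mult_assoc) (simp_all add: d)
  also have "\<dots> = S * (snd N g * T)" using assms(2) g by (simp add: intertwiners_iff)
  also have "\<dots> = (S * snd N g) * T" by (rule mat_mult_assoc[symmetric]) (simp_all add: d)
  also have "\<dots> = (snd L g * S) * T" using assms(1) g by (simp add: intertwiners_iff)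
  also have "\<dots> = snd L g * (S * T)" by (rule mat_mult_assoc) (simp_all add: d)
  finally show "S * T * snd M g = snd L g * (S * T)" .
qed

lemma intertwiner_kronecker:
  assumes "S \<in> intertwiners G M M'" "T \<in> intertwiners G N N'"
    "M \<in> representations G" "M' \<in> representations G" "N \<in> representations G" "N' \<in> representations G"
  shows "kronecker S T \<in> intertwiners G (M \<boxtimes>\<^bsub>Rep G\<^esub> N) (M' \<boxtimes>\<^bsub>Rep G\<^esub> N')"
  unfolding intertwiners_iff
proof (intro conjI ballI)
  note dim = dim_intertwiner[OF assms(1)] dim_intertwiner[OF assms(2)]
  show "kronecker S T \<in> carrier_mat (fst (M' \<boxtimes>\<^bsub>Rep G\<^esub> N')) (fst (M \<boxtimes>\<^bsub>Rep G\<^esub> N))"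
    using dim by (auto intro: carrier_matI)
  fix g assume g: "g \<in> carrier G"
  show "kronecker S T * snd (M \<boxtimes>\<^bsub>Rep G\<^esub> N) g = snd (M' \<boxtimes>\<^bsub>Rep G\<^esub> N') g * kronecker S T"
    using assms(1,2) g dim by (simp add: kronecker_mult rep_dim assms intertwiners_iff)
qed

lemma intertwiner_add:
  assumes "S \<in> intertwiners G M N" "T \<in> intertwiners G M N" "M \<in> representations G" "N \<in> representations G"
  shows "S + T \<in> intertwiners G M N"
  unfolding intertwiners_iff
proof (intro conjI ballI)
  note car = intertwiners_carrier[OF assms(1)] intertwiners_carrier[OF assms(2)]
  show "S + T \<in> carrier_mat (fst N) (fst M)" using car by auto
  fix g assume g: "g \<in> carrier G"
  show "(S + T) * snd M g = snd N g * (S + T)"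
    using assms(1,2) g
    by (simp add: add_mult_distrib_mat[OF car rep_carrier[OF assms(3) g]]
        mult_add_distrib_mat[OF rep_carrier[OF assms(4) g] car] intertwiners_iff)
qed

lemma intertwiner_smult:
  assumes "S \<in> intertwiners G M N" "M \<in> representations G" "N \<in> representations G"
  shows "c \<cdot>\<^sub>m S \<in> intertwiners G M N"
  unfolding intertwiners_iff
proof (intro conjI ballI)
  note car = intertwiners_carrier[OF assms(1)]
  show "c \<cdot>\<^sub>m S \<in> carrier_mat (fst N) (fst M)" using car by auto
  fix g assume g: "g \<in> carrier G"
  show "c \<cdot>\<^sub>m S * snd M g = snd N g * (c \<cdot>\<^sub>m S)"
    using assms(1) g mult_smult_assoc_mat[OF car rep_carrier[OF assms(2) g]]
      mult_smult_distrib[OF rep_carrier[OF assms(3) g] car]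
    by (simp add: intertwiners_iff)
qed

lemma intertwiner_flip:
  assumes "M \<in> representations G" "N \<in> representations G"
  shows "flip_mat (fst M) (fst N) \<in> intertwiners G (M \<boxtimes>\<^bsub>Rep G\<^esub> N) (N \<boxtimes>\<^bsub>Rep G\<^esub> M)"
  using assms flip_mat_kronecker[OF rep_carrier rep_carrier]
  by (auto simp: intertwiners_iff flip_mat_carrier)

text \<open>The inverse matrix of an intertwiner is again an intertwiner, so isomorphisms can be
  recognised by matrix algebra alone.\<close>

lemma iso_arrow_iff:
  assumes M: "M \<in> representations G" and N: "N \<in> representations G"
  shows "iso_arrow (Rep G) M N T \<longleftrightarrow> T \<in> intertwiners G M N \<and>
    (\<exists>S\<in>carrier_mat (fst M) (fst N). S * T = 1\<^sub>m (fst M) \<and> T * S = 1\<^sub>m (fst N))"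
proof
  assume "iso_arrow (Rep G) M N T"
  then show "T \<in> intertwiners G M N \<and>
    (\<exists>S\<in>carrier_mat (fst M) (fst N). S * T = 1\<^sub>m (fst M) \<and> T * S = 1\<^sub>m (fst N))"
    by (auto simp: iso_arrow_def inverse_arrows_def intro: intertwiners_carrier)
next
  assume "T \<in> intertwiners G M N \<and>
    (\<exists>S\<in>carrier_mat (fst M) (fst N). S * T = 1\<^sub>m (fst M) \<and> T * S = 1\<^sub>m (fst N))"
  then obtain S where T: "T \<in> intertwiners G M N" and S: "S \<in> carrier_mat (fst M) (fst N)"
    "S * T = 1\<^sub>m (fst M)" "T * S = 1\<^sub>m (fst N)" by blast
  have "S * snd N g = snd M g * S" if g: "g \<in> carrier G" for g
  proof -
    note d = dim_intertwiner[OF T] carrier_matD[OF S(1)] rep_dim[OF M g] rep_dim[OF N g]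
    have "S * snd N g = S * (snd N g * (T * S))"
      unfolding S(3) right_mult_one_mat[OF rep_carrier[OF N g]] ..
    also have "\<dots> = S * ((snd N g * T) * S)" by (simp add: mat_mult_assoc d)
    also have "\<dots> = S * ((T * snd M g) * S)" using T g by (simp add: intertwiners_iff)
    also have "\<dots> = (S * T) * (snd M g * S)" by (simp add: mat_mult_assoc d)
    also have "\<dots> = snd M g * S"
      unfolding S(2) using d by (intro left_mult_one_mat) (auto intro: carrier_matI)
    finally show ?thesis .
  qed
  then have "S \<in> intertwiners G N M" using S by (simp add: intertwiners_iff)
  then show "iso_arrow (Rep G) M N T"
    using S T by (auto simp: iso_arrow_def inverse_arrows_def)
qed

lemma inv_arrow_eqI:
  assumes fg: "inverse_arrows (Rep G) M N f g"
  shows "inv_arrow (Rep G) M N f = g"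
  unfolding inv_arrow_def
proof (rule the_equality, rule fg)
  fix h assume h: "inverse_arrows (Rep G) M N f h"
  have car: "f \<in> carrier_mat (fst N) (fst M)" "g \<in> carrier_mat (fst M) (fst N)"
    "h \<in> carrier_mat (fst M) (fst N)"
    using fg h by (auto simp: inverse_arrows_def intertwiners_carrier)
  have "h = h * (f * g)"
    using fg car by (simp add: inverse_arrows_def)
  also have "\<dots> = (h * f) * g" using car by (intro mat_mult_assoc[symmetric]) auto
  also have "\<dots> = g" using h car by (simp add: inverse_arrows_def)
  finally show "h = g" .
qed

lemma inv_arrow_one [simp]:
  "M \<in> representations G \<Longrightarrow> n = fst M \<Longrightarrow> inv_arrow (Rep G) M M (1\<^sub>m n) = 1\<^sub>m n"
  by (rule inv_arrow_eqI) (simp add: inverse_arrows_def intertwiner_id)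

section \<open>Isomorphism classes of representations and biproducts\<close>

definition rep_iso where
  "rep_iso M N \<longleftrightarrow> M \<in> representations G \<and> N \<in> representations G \<and> (\<exists>f. iso_arrow (Rep G) M N f)"

lemma rep_isoI:
  assumes "M \<in> representations G" "N \<in> representations G" "T \<in> intertwiners G M N"
    "S \<in> carrier_mat (fst M) (fst N)" "S * T = 1\<^sub>m (fst M)" "T * S = 1\<^sub>m (fst N)"
  shows "rep_iso M N"
  unfolding rep_iso_def using assms iso_arrow_iff by blast

lemma rep_isoE:
  assumes "rep_iso M N"
  obtains T S where "M \<in> representations G" "N \<in> representations G"
    "T \<in> intertwiners G M N" "S \<in> intertwiners G N M" "S * T = 1\<^sub>m (fst M)" "T * S = 1\<^sub>m (fst N)"
  using assms by (auto simp: rep_iso_def iso_arrow_def inverse_arrows_def)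

lemma rep_iso_refl: "M \<in> representations G \<Longrightarrow> rep_iso M M"
  by (rule rep_isoI[where T = "1\<^sub>m (fst M)" and S = "1\<^sub>m (fst M)"]) (auto simp: intertwiner_id)

lemma rep_iso_sym: "rep_iso M N \<Longrightarrow> rep_iso N M"
  by (elim rep_isoE) (rule rep_isoI, auto intro: intertwiners_carrier)

lemma rep_iso_trans:
  assumes "rep_iso M N" "rep_iso N L"
  shows "rep_iso M L"
proof -
  from assms obtain T S T' S' where reps: "M \<in> representations G" "N \<in> representations G" "L \<in> representations G"
    and T: "T \<in> intertwiners G M N" "S \<in> intertwiners G N M" "S * T = 1\<^sub>m (fst M)" "T * S = 1\<^sub>m (fst N)"
    and T': "T' \<in> intertwiners G N L" "S' \<in> intertwiners G L N" "S' * T' = 1\<^sub>m (fst N)" "T' * S' = 1\<^sub>m (fst L)"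
    by (elim rep_isoE)
  note d = dim_intertwiner[OF T(1)] dim_intertwiner[OF T(2)] dim_intertwiner[OF T'(1)] dim_intertwiner[OF T'(2)]
  have "(S * S') * (T' * T) = S * ((S' * T') * T)" by (simp add: mat_mult_assoc d)
  then have 1: "(S * S') * (T' * T) = 1\<^sub>m (fst M)"
    using T' T intertwiners_carrier[OF T(1)] by simp
  have "(T' * T) * (S * S') = T' * ((T * S) * S')" by (simp add: mat_mult_assoc d)
  then have 2: "(T' * T) * (S * S') = 1\<^sub>m (fst L)"
    using T' T intertwiners_carrier[OF T'(2)] by simp
  show ?thesis
    by (rule rep_isoI[OF reps(1,3) intertwiner_comp[OF T'(1) T(1) reps] _ 1 2])
      (use d in \<open>auto intro: carrier_matI\<close>)
qed

lemma rep_iso_TObj: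
  assumes "rep_iso M M'" "rep_iso N N'"
  shows "rep_iso (M \<boxtimes>\<^bsub>Rep G\<^esub> N) (M' \<boxtimes>\<^bsub>Rep G\<^esub> N')"
proof -
  from assms obtain T S T' S' where reps: "M \<in> representations G" "M' \<in> representations G"
      "N \<in> representations G" "N' \<in> representations G"
    and T: "T \<in> intertwiners G M M'" "S \<in> intertwiners G M' M" "S * T = 1\<^sub>m (fst M)" "T * S = 1\<^sub>m (fst M')"
    and T': "T' \<in> intertwiners G N N'" "S' \<in> intertwiners G N' N" "S' * T' = 1\<^sub>m (fst N)" "T' * S' = 1\<^sub>m (fst N')"
    by (elim rep_isoE)
  note d = dim_intertwiner[OF T(1)] dim_intertwiner[OF T(2)] dim_intertwiner[OF T'(1)] dim_intertwiner[OF T'(2)]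
  show ?thesis
    by (rule rep_isoI[OF _ _ intertwiner_kronecker[OF T(1) T'(1) reps], where S = "kronecker S S'"])
      (use d reps T T' in \<open>auto simp: kronecker_mult kronecker_one intro: carrier_matI\<close>)
qed

lemma rep_iso_TObj_comm:
  assumes "M \<in> representations G" "N \<in> representations G"
  shows "rep_iso (M \<boxtimes>\<^bsub>Rep G\<^esub> N) (N \<boxtimes>\<^bsub>Rep G\<^esub> M)"
  by (rule rep_isoI[OF _ _ intertwiner_flip[OF assms], where S = "flip_mat (fst N) (fst M)"])
    (use assms in \<open>auto simp: flip_mat_flip_mat flip_mat_carrier\<close>)

text \<open>Duality is contravariant, so the forward arrow is the transpose of the inverse
  \<open>S\<close>.\<close>

lemma rep_iso_Dual:
  assumes "rep_iso M N"
  shows "rep_iso (Dual (Rep G) M) (Dual (Rep G) N)"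
proof -
  from assms obtain T S where reps: "M \<in> representations G" "N \<in> representations G"
    and T: "T \<in> intertwiners G M N" "S \<in> intertwiners G N M" "S * T = 1\<^sub>m (fst M)" "T * S = 1\<^sub>m (fst N)"
    by (elim rep_isoE)
  note car = intertwiners_carrier[OF T(1)] intertwiners_carrier[OF T(2)]
  have "S\<^sup>T \<in> intertwiners G (Dual (Rep G) M) (Dual (Rep G) N)"
    unfolding intertwiners_iff
  proof (intro conjI ballI)
    fix g assume g: "g \<in> carrier G"
    then have "(snd M (inv g) * S)\<^sup>T = (S * snd N (inv g))\<^sup>T"
      using T(2) by (simp add: intertwiners_iff)
    then show "S\<^sup>T * snd (Dual (Rep G) M) g = snd (Dual (Rep G) N) g * S\<^sup>T"
      using g by (simp add: transpose_mult[OF car(2) rep_carrier[OF reps(2)]]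
          transpose_mult[OF rep_carrier[OF reps(1)] car(2)])
  qed (use car in auto)
  moreover have "T\<^sup>T * S\<^sup>T = 1\<^sub>m (fst M)" "S\<^sup>T * T\<^sup>T = 1\<^sub>m (fst N)"
    using transpose_mult[OF car(2,1)] transpose_mult[OF car] T by simp_all
  ultimately show ?thesis
    using reps car by (intro rep_isoI[where T = "S\<^sup>T" and S = "T\<^sup>T"]) auto
qed

lemma intertwiner_pr:
  assumes M: "M \<in> representations G" and N: "N \<in> representations G"
  shows "pr1_mat (fst M) (fst N) \<in> intertwiners G (M \<uplus>\<^bsub>Rep G\<^esub> N) M"
    "pr2_mat (fst M) (fst N) \<in> intertwiners G (M \<uplus>\<^bsub>Rep G\<^esub> N) N"
    "(pr1_mat (fst M) (fst N))\<^sup>T \<in> intertwiners G M (M \<uplus>\<^bsub>Rep G\<^esub> N)"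
    "(pr2_mat (fst M) (fst N))\<^sup>T \<in> intertwiners G N (M \<uplus>\<^bsub>Rep G\<^esub> N)"
proof -
  show "pr1_mat (fst M) (fst N) \<in> intertwiners G (M \<uplus>\<^bsub>Rep G\<^esub> N) M"
    "pr2_mat (fst M) (fst N) \<in> intertwiners G (M \<uplus>\<^bsub>Rep G\<^esub> N) N"
    using M N by (auto simp: intertwiners_iff pr_mat_four_block rep_carrier)
  have "(pr1_mat (fst M) (fst N))\<^sup>T * snd M g = snd (M \<uplus>\<^bsub>Rep G\<^esub> N) g * (pr1_mat (fst M) (fst N))\<^sup>T"
    "(pr2_mat (fst M) (fst N))\<^sup>T * snd N g = snd (M \<uplus>\<^bsub>Rep G\<^esub> N) g * (pr2_mat (fst M) (fst N))\<^sup>T"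
    if g: "g \<in> carrier G" for g
  proof -
    note car = rep_carrier[OF M g] rep_carrier[OF N g]
    \<comment> \<open>Equivariance of the inclusions is that of the projections for the transposed
      blocks, transposed back.\<close>
    have t: "(four_block_mat ((snd M g)\<^sup>T) (0\<^sub>m (fst M) (fst N)) (0\<^sub>m (fst N) (fst M)) ((snd N g)\<^sup>T))\<^sup>T
        = snd (M \<uplus>\<^bsub>Rep G\<^esub> N) g" (is "?X\<^sup>T = _")
      using g car by (subst transpose_four_block_mat[of _ "fst M" "fst M" _ "fst N" _ "fst N"]) auto
    have X: "?X \<in> carrier_mat (fst M + fst N) (fst M + fst N)" using car by auto
    have tr: "(snd M g)\<^sup>T \<in> carrier_mat (fst M) (fst M)" "(snd N g)\<^sup>T \<in> carrier_mat (fst N) (fst N)"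
      using car by auto
    show "(pr1_mat (fst M) (fst N))\<^sup>T * snd M g = snd (M \<uplus>\<^bsub>Rep G\<^esub> N) g * (pr1_mat (fst M) (fst N))\<^sup>T"
      using arg_cong[OF pr_mat_four_block(1)[OF tr], of transpose_mat]
      unfolding transpose_mult[OF pr_mat_carrier(1) X] transpose_mult[OF tr(1) pr_mat_carrier(1)] t by simp
    show "(pr2_mat (fst M) (fst N))\<^sup>T * snd N g = snd (M \<uplus>\<^bsub>Rep G\<^esub> N) g * (pr2_mat (fst M) (fst N))\<^sup>T"
      using arg_cong[OF pr_mat_four_block(2)[OF tr], of transpose_mat]
      unfolding transpose_mult[OF pr_mat_carrier(2) X] transpose_mult[OF tr(2) pr_mat_carrier(2)] t by simp
  qed
  then show "(pr1_mat (fst M) (fst N))\<^sup>T \<in> intertwiners G M (M \<uplus>\<^bsub>Rep G\<^esub> N)"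
    "(pr2_mat (fst M) (fst N))\<^sup>T \<in> intertwiners G N (M \<uplus>\<^bsub>Rep G\<^esub> N)"
    by (auto simp: intertwiners_iff)
qed

text \<open>Direct sums are characterised by equations between arrows. A linear functor preserves
  these equations, so it preserves direct sums up to isomorphism; commutativity of the sum follows
  by exchanging the roles of the arrows.\<close>

lemma biproduct_rep_iso:
  assumes X: "X \<in> representations G" and A: "A \<in> representations G" and B: "B \<in> representations G"
    and p: "p1 \<in> intertwiners G X A" "p2 \<in> intertwiners G X B"
    and i: "i1 \<in> intertwiners G A X" "i2 \<in> intertwiners G B X"
    and pi: "p1 * i1 = 1\<^sub>m (fst A)" "p2 * i2 = 1\<^sub>m (fst B)"
      "p1 * i2 = 0\<^sub>m (fst A) (fst B)" "p2 * i1 = 0\<^sub>m (fst B) (fst A)"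
    and ip: "i1 * p1 + i2 * p2 = 1\<^sub>m (fst X)"
  shows "rep_iso X (A \<uplus>\<^bsub>Rep G\<^esub> B)"
proof -
  let ?P1 = "pr1_mat (fst A) (fst B)" and ?P2 = "pr2_mat (fst A) (fst B)"
  let ?I1 = "?P1\<^sup>T" and ?I2 = "?P2\<^sup>T"
  let ?T = "?I1 * p1 + ?I2 * p2" and ?S = "i1 * ?P1 + i2 * ?P2"
  note pr = intertwiner_pr[OF A B]
  note car = intertwiners_carrier[OF p(1)] intertwiners_carrier[OF p(2)]
    intertwiners_carrier[OF i(1)] intertwiners_carrier[OF i(2)]
  have AB: "A \<uplus>\<^bsub>Rep G\<^esub> B \<in> representations G" using A B by simp
  have T: "?T \<in> intertwiners G X (A \<uplus>\<^bsub>Rep G\<^esub> B)"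
    by (intro intertwiner_add[OF _ _ X AB] intertwiner_comp[OF pr(3) p(1) X A AB] intertwiner_comp[OF pr(4) p(2) X B AB])
  let ?x = "fst X" and ?a = "fst A" and ?b = "fst B"
  note dims = car[THEN carrier_matD(1)] car[THEN carrier_matD(2)]
  have c1: "?I1 * p1 \<in> carrier_mat (?a + ?b) ?x" "?I2 * p2 \<in> carrier_mat (?a + ?b) ?x"
    "i1 * ?P1 \<in> carrier_mat ?x (?a + ?b)" "i2 * ?P2 \<in> carrier_mat ?x (?a + ?b)"
    using car by (auto intro!: carrier_matI)
  have prod: "?S * ?T = (i1 * (?P1 * ?I1) * p1 + i1 * (?P1 * ?I2) * p2) + (i2 * (?P2 * ?I1) * p1 + i2 * (?P2 * ?I2) * p2)"
  proof -
    have "?S * ?T = (i1 * ?P1) * ?T + (i2 * ?P2) * ?T"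
      by (rule add_mult_distrib_mat[of _ ?x "?a + ?b" _ _ ?x]) (use c1 in auto)
    also have "(i1 * ?P1) * ?T = (i1 * ?P1) * (?I1 * p1) + (i1 * ?P1) * (?I2 * p2)"
      by (rule mult_add_distrib_mat) (use c1 in auto)
    also have "(i2 * ?P2) * ?T = (i2 * ?P2) * (?I1 * p1) + (i2 * ?P2) * (?I2 * p2)"
      by (rule mult_add_distrib_mat) (use c1 in auto)
    finally show ?thesis by (simp add: mat_mult_assoc dims)
  qed
  have ST: "?S * ?T = 1\<^sub>m ?x"
  proof -
    have z: "i1 * 0\<^sub>m ?a ?b * p2 = 0\<^sub>m ?x ?x" "i2 * 0\<^sub>m ?b ?a * p1 = 0\<^sub>m ?x ?x"
      using car by simp_all
    have "i1 * p1 \<in> carrier_mat ?x ?x" "i2 * p2 \<in> carrier_mat ?x ?x"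
      using car by (auto intro!: carrier_matI)
    then show ?thesis unfolding prod pr_mat_transpose z
      using car ip by simp
  qed
  have TS: "?T * ?S = 1\<^sub>m (?a + ?b)"
  proof -
    have "?T * ?S = (?I1 * p1) * ?S + (?I2 * p2) * ?S"
      by (rule add_mult_distrib_mat[of _ "?a + ?b" ?x _ _ "?a + ?b"]) (use c1 in auto)
    also have "(?I1 * p1) * ?S = (?I1 * p1) * (i1 * ?P1) + (?I1 * p1) * (i2 * ?P2)"
      by (rule mult_add_distrib_mat) (use c1 in auto)
    also have "(?I2 * p2) * ?S = (?I2 * p2) * (i1 * ?P1) + (?I2 * p2) * (i2 * ?P2)"
      by (rule mult_add_distrib_mat) (use c1 in auto)
    also have "(?I1 * p1) * (i1 * ?P1) = ?I1 * (p1 * i1) * ?P1"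
      by (simp add: mat_mult_assoc dims)
    also have "(?I1 * p1) * (i2 * ?P2) = ?I1 * (p1 * i2) * ?P2"
      by (simp add: mat_mult_assoc dims)
    also have "(?I2 * p2) * (i1 * ?P1) = ?I2 * (p2 * i1) * ?P1"
      by (simp add: mat_mult_assoc dims)
    also have "(?I2 * p2) * (i2 * ?P2) = ?I2 * (p2 * i2) * ?P2"
      by (simp add: mat_mult_assoc dims)
    also have "?I1 * (p1 * i1) * ?P1 = ?I1 * ?P1"
      unfolding pi by (simp add: right_mult_one_mat[of _ "?a + ?b"] pr_mat_carrier)
    also have "?I2 * (p2 * i2) * ?P2 = ?I2 * ?P2"
      unfolding pi by (simp add: right_mult_one_mat[of _ "?a + ?b"] pr_mat_carrier)
    also have "?I1 * (p1 * i2) * ?P2 = 0\<^sub>m (?a + ?b) (?a + ?b)"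
      unfolding pi by (simp add: right_mult_zero_mat[of _ "?a + ?b" ?a] left_mult_zero_mat[of _ ?b] pr_mat_carrier)
    also have "?I2 * (p2 * i1) * ?P1 = 0\<^sub>m (?a + ?b) (?a + ?b)"
      unfolding pi by (simp add: right_mult_zero_mat[of _ "?a + ?b" ?b] left_mult_zero_mat[of _ ?a] pr_mat_carrier)
    finally have "?T * ?S = (?I1 * ?P1 + 0\<^sub>m (?a + ?b) (?a + ?b)) + (0\<^sub>m (?a + ?b) (?a + ?b) + ?I2 * ?P2)" .
    also have "\<dots> = ?I1 * ?P1 + ?I2 * ?P2"
    proof -
      have "?I1 * ?P1 \<in> carrier_mat (?a + ?b) (?a + ?b)" "?I2 * ?P2 \<in> carrier_mat (?a + ?b) (?a + ?b)"
        by (auto intro!: carrier_matI)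
      then show ?thesis by simp
    qed
    finally show ?thesis unfolding pr_mat_decomposition .
  qed
  show ?thesis
    by (rule rep_isoI[OF X AB T _ ST]) (use TS c1 in auto)
qed

lemma rep_iso_reps: "rep_iso M N \<Longrightarrow> M \<in> representations G" "rep_iso M N \<Longrightarrow> N \<in> representations G"
  by (simp_all add: rep_iso_def)

lemma rep_iso_DSum:
  assumes "rep_iso M M'" "rep_iso N N'"
  shows "rep_iso (M \<uplus>\<^bsub>Rep G\<^esub> N) (M' \<uplus>\<^bsub>Rep G\<^esub> N')"
proof -
  from assms obtain T S T' S' where M: "M \<in> representations G" and M': "M' \<in> representations G"
      and N: "N \<in> representations G" and N': "N' \<in> representations G"
    and T: "T \<in> intertwiners G M M'" "S \<in> intertwiners G M' M" "S * T = 1\<^sub>m (fst M)" "T * S = 1\<^sub>m (fst M')"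
    and T': "T' \<in> intertwiners G N N'" "S' \<in> intertwiners G N' N" "S' * T' = 1\<^sub>m (fst N)" "T' * S' = 1\<^sub>m (fst N')"
    by (elim rep_isoE)
  let ?p = "pr1_mat (fst M) (fst N)" and ?q = "pr2_mat (fst M) (fst N)"
  let ?i = "?p\<^sup>T" and ?j = "?q\<^sup>T"
  note d = dim_intertwiner[OF T(1)] dim_intertwiner[OF T(2)] dim_intertwiner[OF T'(1)] dim_intertwiner[OF T'(2)]
  note car = intertwiners_carrier[OF T(1)] intertwiners_carrier[OF T(2)]
    intertwiners_carrier[OF T'(1)] intertwiners_carrier[OF T'(2)]
  have MN: "M \<uplus>\<^bsub>Rep G\<^esub> N \<in> representations G" using M N by simp
  note pr = intertwiner_pr[OF M N]
  have assoc: "(A * P) * (Q * B) = A * ((P * Q) * B)"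
    if "dim_col A = dim_row P" "dim_col P = dim_row Q" "dim_col Q = dim_row B" for A P Q B :: "complex mat"
    using that by (simp add: mat_mult_assoc)
  show ?thesis
  proof (rule biproduct_rep_iso[OF MN M' N'])
    show "T * ?p \<in> intertwiners G (M \<uplus>\<^bsub>Rep G\<^esub> N) M'" by (rule intertwiner_comp[OF T(1) pr(1) MN M M'])
    show "T' * ?q \<in> intertwiners G (M \<uplus>\<^bsub>Rep G\<^esub> N) N'" by (rule intertwiner_comp[OF T'(1) pr(2) MN N N'])
    show "?i * S \<in> intertwiners G M' (M \<uplus>\<^bsub>Rep G\<^esub> N)" by (rule intertwiner_comp[OF pr(3) T(2) M' M MN])
    show "?j * S' \<in> intertwiners G N' (M \<uplus>\<^bsub>Rep G\<^esub> N)" by (rule intertwiner_comp[OF pr(4) T'(2) N' N MN])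
    show "(T * ?p) * (?i * S) = 1\<^sub>m (fst M')" "(T' * ?q) * (?j * S') = 1\<^sub>m (fst N')"
      "(T * ?p) * (?j * S') = 0\<^sub>m (fst M') (fst N')" "(T' * ?q) * (?i * S) = 0\<^sub>m (fst N') (fst M')"
      using T T' car by (simp_all add: assoc d pr_mat_transpose)
    have "(?i * S) * (T * ?p) = ?i * ((S * T) * ?p)" "(?j * S') * (T' * ?q) = ?j * ((S' * T') * ?q)"
      by (simp_all add: assoc d)
    then show "(?i * S) * (T * ?p) + (?j * S') * (T' * ?q) = 1\<^sub>m (fst (M \<uplus>\<^bsub>Rep G\<^esub> N))"
      by (simp add: T T' pr_mat_carrier left_mult_one_mat[OF pr_mat_carrier(1)]
          left_mult_one_mat[OF pr_mat_carrier(2)] pr_mat_decomposition)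
  qed
qed

lemma rep_iso_DSum_comm:
  assumes M: "M \<in> representations G" and N: "N \<in> representations G"
  shows "rep_iso (N \<uplus>\<^bsub>Rep G\<^esub> M) (M \<uplus>\<^bsub>Rep G\<^esub> N)"
proof -
  have NM: "N \<uplus>\<^bsub>Rep G\<^esub> M \<in> representations G" using M N by simp
  note pr = intertwiner_pr[OF N M]
  have "(pr2_mat (fst N) (fst M))\<^sup>T * pr2_mat (fst N) (fst M) +
      (pr1_mat (fst N) (fst M))\<^sup>T * pr1_mat (fst N) (fst M) =
      (pr1_mat (fst N) (fst M))\<^sup>T * pr1_mat (fst N) (fst M) +
      (pr2_mat (fst N) (fst M))\<^sup>T * pr2_mat (fst N) (fst M)"
    by (rule comm_add_mat[of _ "fst N + fst M" "fst N + fst M"]) (auto intro!: carrier_matI)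
  then show ?thesis
    by (intro biproduct_rep_iso[OF NM M N pr(2,1,4,3)]) (simp_all add: pr_mat_transpose pr_mat_decomposition)
qed

section \<open>Quadratic objects in the category of representations\<close>

text \<open>The Gram matrix of a non-singular quadratic object; \<open>quadratic_objects_Rep\<close>
  is the dictionary to the categorical definition.\<close>

definition orthogonal_form :: "'a rep \<Rightarrow> complex mat \<Rightarrow> bool" where
  "orthogonal_form M B \<longleftrightarrow> M \<in> representations G \<and> B \<in> carrier_mat (fst M) (fst M) \<and>
     B\<^sup>T = B \<and>
     (\<exists>Bi\<in>carrier_mat (fst M) (fst M). B * Bi = 1\<^sub>m (fst M) \<and> Bi * B = 1\<^sub>m (fst M)) \<and>
     (\<forall>g\<in>carrier G. (snd M g)\<^sup>T * B * snd M g = B)"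

lemma orthogonal_formI:
  assumes "M \<in> representations G" "B \<in> carrier_mat (fst M) (fst M)" "Bi \<in> carrier_mat (fst M) (fst M)"
    "B\<^sup>T = B" "B * Bi = 1\<^sub>m (fst M)"
    "\<And>g. g \<in> carrier G \<Longrightarrow> (snd M g)\<^sup>T * B * snd M g = B"
  shows "orthogonal_form M B"
  using assms mat_mult_left_right_inverse[OF assms(2,3,5)] by (auto simp: orthogonal_form_def)

lemma orthogonal_formE:
  assumes "orthogonal_form M B"
  obtains Bi where "M \<in> representations G" "B \<in> carrier_mat (fst M) (fst M)" "Bi \<in> carrier_mat (fst M) (fst M)"
    "B\<^sup>T = B" "B * Bi = 1\<^sub>m (fst M)"
    "\<forall>g\<in>carrier G. (snd M g)\<^sup>T * B * snd M g = B" "Bi * B = 1\<^sub>m (fst M)"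
  using assms by (auto simp: orthogonal_form_def)

lemma orthogonal_form_pullback:
  assumes "orthogonal_form N B" and M: "M \<in> representations G"
    and T: "T \<in> intertwiners G M N" "R \<in> intertwiners G N M" "R * T = 1\<^sub>m (fst M)" "T * R = 1\<^sub>m (fst N)"
  shows "orthogonal_form M (T\<^sup>T * B * T)"
proof -
  from assms(1) obtain Bi where N: "N \<in> representations G" and B: "B \<in> carrier_mat (fst N) (fst N)"
    "Bi \<in> carrier_mat (fst N) (fst N)" "B\<^sup>T = B" "B * Bi = 1\<^sub>m (fst N)"
    and inv: "\<forall>g\<in>carrier G. (snd N g)\<^sup>T * B * snd N g = B" and "Bi * B = 1\<^sub>m (fst N)"
    by (rule orthogonal_formE)
  note Tc = intertwiners_carrier[OF T(1)] intertwiners_carrier[OF T(2)]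
  note d = carrier_matD[OF Tc(1)] carrier_matD[OF Tc(2)] carrier_matD[OF B(1)] carrier_matD[OF B(2)]
  let ?C = "T\<^sup>T * B * T" and ?Ci = "R * Bi * R\<^sup>T"
  show ?thesis
  proof (rule orthogonal_formI[OF M])
    show "?C \<in> carrier_mat (fst M) (fst M)" "?Ci \<in> carrier_mat (fst M) (fst M)"
      using d by (auto intro!: carrier_matI)
    show "?C\<^sup>T = ?C"
      using congruence_transpose[OF B(1) Tc(1)] B(3) by simp
    have "?C * ?Ci = T\<^sup>T * (B * ((T * R) * (Bi * R\<^sup>T)))"
      by (simp add: mat_mult_assoc d)
    also have "\<dots> = T\<^sup>T * (B * (Bi * R\<^sup>T))"
      unfolding T(4) using d by (subst left_mult_one_mat[of _ "fst N" "fst M"]) (auto intro!: carrier_matI)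
    also have "\<dots> = T\<^sup>T * ((B * Bi) * R\<^sup>T)"
      by (simp add: mat_mult_assoc d)
    also have "\<dots> = (R * T)\<^sup>T"
      unfolding B using Tc transpose_mult[OF Tc(2,1)] by simp
    finally show "?C * ?Ci = 1\<^sub>m (fst M)"
      unfolding T(3) by simp
    fix g assume g: "g \<in> carrier G"
    note dg = rep_dim[OF M g] rep_dim[OF N g]
    have "(snd M g)\<^sup>T * ?C * snd M g = ((snd M g)\<^sup>T * T\<^sup>T) * B * (T * snd M g)"
      by (simp add: mat_mult_assoc d dg)
    also have "(snd M g)\<^sup>T * T\<^sup>T = (T * snd M g)\<^sup>T"
      using transpose_mult[OF Tc(1) rep_carrier[OF M g]] by simp
    also have "T * snd M g = snd N g * T"
      using T(1) g by (simp add: intertwiners_iff)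
    also have "(snd N g * T)\<^sup>T = T\<^sup>T * (snd N g)\<^sup>T"
      by (rule transpose_mult[OF rep_carrier[OF N g] Tc(1)])
    also have "(T\<^sup>T * (snd N g)\<^sup>T) * B * (snd N g * T) =
        T\<^sup>T * ((snd N g)\<^sup>T * B * snd N g) * T"
      by (simp add: mat_mult_assoc d dg)
    finally show "(snd M g)\<^sup>T * ?C * snd M g = ?C"
      using inv g by simp
  qed
qed

lemma form_row_intertwiner_iff:
  assumes M: "M \<in> representations G" and N: "N \<in> representations G"
    and B: "B \<in> carrier_mat (fst M) (fst N)"
  shows "form_row B \<in> intertwiners G (M \<boxtimes>\<^bsub>Rep G\<^esub> N) (Unit (Rep G)) \<longleftrightarrow>
    (\<forall>g\<in>carrier G. (snd M g)\<^sup>T * B * snd N g = B)"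
proof -
  have "form_row B * snd (M \<boxtimes>\<^bsub>Rep G\<^esub> N) g = snd (Unit (Rep G)) g * form_row B \<longleftrightarrow>
      (snd M g)\<^sup>T * B * snd N g = B" if g: "g \<in> carrier G" for g
  proof -
    note car = rep_carrier[OF M g] rep_carrier[OF N g]
    have "form_row B * snd (M \<boxtimes>\<^bsub>Rep G\<^esub> N) g = form_row ((snd M g)\<^sup>T * B * snd N g)"
      using g B car by (simp add: form_row_kronecker)
    moreover have "snd (Unit (Rep G)) g * form_row B = form_row B"
      using g left_mult_one_mat[OF form_row_carrier[OF B]] by simp
    moreover have "(snd M g)\<^sup>T * B * snd N g \<in> carrier_mat (fst M) (fst N)"
      using car B by (auto intro!: carrier_matI)
    ultimately show ?thesis using form_row_inj[OF _ B] by auto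
  qed
  then show ?thesis
    using form_row_carrier[OF B] by (auto simp: intertwiners_iff)
qed

text \<open>All associativity and unit constraints are identity matrices, and coevaluation is
  \<open>form_col\<close> of the identity, so what remains is a zigzag composite. Non-singularity
  thus means invertibility of the Gram matrix.\<close>

lemma adjoint_map_form_row:
  assumes M: "M \<in> representations G" and B: "B \<in> carrier_mat (fst M) (fst M)"
  shows "adjoint_map (Rep G) M (form_row B) = B\<^sup>T"
proof -
  let ?n = "fst M" and ?D = "Dual (Rep G) M"
  have D: "?D \<in> representations G" using M by simp
  have a: "inv_arrow (Rep G) ((M \<boxtimes>\<^bsub>Rep G\<^esub> M) \<boxtimes>\<^bsub>Rep G\<^esub> ?D) (M \<boxtimes>\<^bsub>Rep G\<^esub> (M \<boxtimes>\<^bsub>Rep G\<^esub> ?D))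
      (1\<^sub>m (?n * ?n * ?n)) = 1\<^sub>m (?n * ?n * ?n)"
    using M D by (simp add: TObj_assoc mult.assoc)
  have u: "inv_arrow (Rep G) (M \<boxtimes>\<^bsub>Rep G\<^esub> Unit (Rep G)) M (1\<^sub>m ?n) = 1\<^sub>m ?n"
    using M by (simp add: TObj_Unit)
  let ?b = "kronecker (form_row B) (1\<^sub>m ?n)" and ?c = "kronecker (1\<^sub>m ?n) (form_col (1\<^sub>m ?n))"
  have car: "?b \<in> carrier_mat ?n (?n * ?n * ?n)" "?c \<in> carrier_mat (?n * ?n * ?n) ?n"
    using B by (auto intro!: carrier_matI)
  have "adjoint_map (Rep G) M (form_row B) = 1\<^sub>m ?n * (?b * (1\<^sub>m (?n * ?n * ?n) * (?c * 1\<^sub>m ?n)))"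
    unfolding adjoint_map_def by (simp add: a u coev_mat_form_col)
  also have "\<dots> = ?b * ?c"
    using car by simp
  also have "\<dots> = (B * 1\<^sub>m ?n)\<^sup>T"
    by (rule form_zigzag[OF B]) simp
  finally show ?thesis using B by simp
qed

lemma quadratic_objects_Rep:
  "quadratic_objects (Rep G) = {(M, form_row B) | M B. orthogonal_form M B}"
proof (intro equalityI subsetI)
  fix x assume "x \<in> quadratic_objects (Rep G)"
  then obtain M b where x: "x = (M, b)" and M: "M \<in> representations G"
    and b: "b \<in> intertwiners G (M \<boxtimes>\<^bsub>Rep G\<^esub> M) (Unit (Rep G))" "b * flip_mat (fst M) (fst M) = b"
      "iso_arrow (Rep G) M (Dual (Rep G) M) (adjoint_map (Rep G) M b)"
    by (auto simp: quadratic_objects_def)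
  have "b \<in> carrier_mat 1 (fst M * fst M)" using intertwiners_carrier[OF b(1)] by simp
  then obtain B where B: "B \<in> carrier_mat (fst M) (fst M)" "b = form_row B"
    by (rule form_row_surj)
  have "form_row (B\<^sup>T) = form_row B"
    using b(2) B by (simp add: form_row_flip_mat)
  from form_row_inj[OF _ B(1) this] have sym: "B\<^sup>T = B"
    using B(1) by simp
  have "\<exists>S\<in>carrier_mat (fst M) (fst M). S * B = 1\<^sub>m (fst M) \<and> B * S = 1\<^sub>m (fst M)"
    using b(3) iso_arrow_iff[OF M Dual_rep[OF M]] adjoint_map_form_row[OF M B(1)] sym B(2) by auto
  then have "orthogonal_form M B"
    using M B b(1) sym form_row_intertwiner_iff[OF M M B(1)] by (auto simp: orthogonal_form_def)
  then show "x \<in> {(M, form_row B) | M B. orthogonal_form M B}"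
    unfolding x B(2) by blast
next
  fix x assume "x \<in> {(M, form_row B) | M B. orthogonal_form M B}"
  then obtain M B where x: "x = (M, form_row B)" and o: "orthogonal_form M B" by blast
  from o obtain Bi where M: "M \<in> representations G" and B: "B \<in> carrier_mat (fst M) (fst M)"
    and sym: "B\<^sup>T = B" and Bi: "Bi \<in> carrier_mat (fst M) (fst M)"
      "B * Bi = 1\<^sub>m (fst M)" "Bi * B = 1\<^sub>m (fst M)"
    and inv: "\<And>g. g \<in> carrier G \<Longrightarrow> (snd M g)\<^sup>T * B * snd M g = B"
    by (auto simp: orthogonal_form_def)
  have "B \<in> intertwiners G M (Dual (Rep G) M)"
    unfolding intertwiners_iff
  proof (intro conjI ballI)
    show "B \<in> carrier_mat (fst (Dual (Rep G) M)) (fst M)" using B by simp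
    fix g assume g: "g \<in> carrier G"
    note car = rep_carrier[OF M g] rep_carrier[OF M inv_closed[OF g]]
    \<comment> \<open>Invariance is inserted for \<open>B\<close>; the action of \<open>g\<close> on
      the left then cancels against the dual action.\<close>
    have "snd (Dual (Rep G) M) g * B = (snd M (inv g))\<^sup>T * ((snd M g)\<^sup>T * B * snd M g)"
      using g by (simp add: inv)
    also have "\<dots> = ((snd M (inv g))\<^sup>T * (snd M g)\<^sup>T) * (B * snd M g)"
      using car B by (simp add: mat_mult_assoc carrier_matD)
    also have "(snd M (inv g))\<^sup>T * (snd M g)\<^sup>T = 1\<^sub>m (fst M)"
      using transpose_mult[OF car] rep_inv[OF M g] by simp
    also have "1\<^sub>m (fst M) * (B * snd M g) = B * snd M g"
      by (rule left_mult_one_mat[OF mult_carrier_mat[OF B car(1)]])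
    finally show "B * snd M g = snd (Dual (Rep G) M) g * B" by simp
  qed
  then have "iso_arrow (Rep G) M (Dual (Rep G) M) (adjoint_map (Rep G) M (form_row B))"
    unfolding adjoint_map_form_row[OF M B] sym iso_arrow_iff[OF M Dual_rep[OF M]]
    using Bi by auto
  moreover have "form_row B \<in> intertwiners G (M \<boxtimes>\<^bsub>Rep G\<^esub> M) (Unit (Rep G))"
    unfolding form_row_intertwiner_iff[OF M M B] using inv by blast
  moreover have "form_row B * flip_mat (fst M) (fst M) = form_row B"
    by (simp add: form_row_flip_mat[OF B] sym)
  ultimately show "x \<in> quadratic_objects (Rep G)"
    unfolding x quadratic_objects_def mem_Collect_eq using M
    by (intro exI[of _ M] exI[of _ "form_row B"]) simp
qed

text \<open>
  By \<open>symmetric_forms_congruent\<close> a nondegenerate symmetric form on a representation is unique up to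
  isometry.
\<close>

lemma isometry_rel_Rep:
  "isometry_rel (Rep G) = {(x, y). x \<in> quadratic_objects (Rep G) \<and> y \<in> quadratic_objects (Rep G) \<and>
     rep_iso (fst x) (fst y)}"
proof (intro equalityI subsetI)
  fix z assume "z \<in> isometry_rel (Rep G)"
  then obtain M b M' b' f where z: "z = ((M, b), (M', b'))" and
    q: "(M, b) \<in> quadratic_objects (Rep G)" "(M', b') \<in> quadratic_objects (Rep G)" and
    f: "iso_arrow (Rep G) M M' f"
    by (auto simp: isometry_rel_def)
  have "M \<in> representations G" "M' \<in> representations G"
    using q by (auto simp: quadratic_objects_def)
  then have "rep_iso M M'" using f by (auto simp: rep_iso_def)
  then show "z \<in> {(x, y). x \<in> quadratic_objects (Rep G) \<and> y \<in> quadratic_objects (Rep G) \<and>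
     rep_iso (fst x) (fst y)}" using q by (simp add: z)
next
  fix z assume "z \<in> {(x, y). x \<in> quadratic_objects (Rep G) \<and> y \<in> quadratic_objects (Rep G) \<and>
     rep_iso (fst x) (fst y)}"
  then obtain M b M' b' where z: "z = ((M, b), (M', b'))" and
    q: "(M, b) \<in> quadratic_objects (Rep G)" "(M', b') \<in> quadratic_objects (Rep G)" and
    iso: "rep_iso M M'"
    by auto
  from q obtain B B' where b: "b = form_row B" "b' = form_row B'"
    and o: "orthogonal_form M B" "orthogonal_form M' B'"
    unfolding quadratic_objects_Rep by blast
  from o(1) obtain Bi where M: "M \<in> representations G" and B: "B \<in> carrier_mat (fst M) (fst M)"
    "Bi \<in> carrier_mat (fst M) (fst M)" "B\<^sup>T = B" "B * Bi = 1\<^sub>m (fst M)"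
    and inv: "\<forall>g\<in>carrier G. (snd M g)\<^sup>T * B * snd M g = B" and Bi: "Bi * B = 1\<^sub>m (fst M)"
    by (rule orthogonal_formE)
  have M': "M' \<in> representations G" and B': "B' \<in> carrier_mat (fst M') (fst M')"
    using o(2) by (simp_all add: orthogonal_form_def)
  from iso obtain T R where T: "T \<in> intertwiners G M M'" "R \<in> intertwiners G M' M"
    "R * T = 1\<^sub>m (fst M)" "T * R = 1\<^sub>m (fst M')"
    by (elim rep_isoE)
  note Tc = intertwiners_carrier[OF T(1)] intertwiners_carrier[OF T(2)]
  \<comment> \<open>The second form is pulled back along the isomorphism \<open>T\<close>, so that
    both forms live on \<open>M\<close>.\<close>
  let ?C = "T\<^sup>T * B' * T"
  from orthogonal_form_pullback[OF o(2) M T] obtain Ci where C: "?C \<in> carrier_mat (fst M) (fst M)"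
    "Ci \<in> carrier_mat (fst M) (fst M)" "?C\<^sup>T = ?C" "?C * Ci = 1\<^sub>m (fst M)"
    and invC: "\<forall>g\<in>carrier G. (snd M g)\<^sup>T * ?C * snd M g = ?C" and Ci: "Ci * ?C = 1\<^sub>m (fst M)"
    by (rule orthogonal_formE)
  from symmetric_forms_congruent[OF B(1) C(1) B(2) C(2) B(3) C(3) B(4) Bi C(4) Ci]
  obtain S Si where S: "S \<in> carrier_mat (fst M) (fst M)" "Si \<in> carrier_mat (fst M) (fst M)"
      "S * Si = 1\<^sub>m (fst M)" "Si * S = 1\<^sub>m (fst M)" "S\<^sup>T * ?C * S = B"
    and comm: "\<And>Q. Q \<in> carrier_mat (fst M) (fst M) \<Longrightarrow> Q\<^sup>T * B * Q = B \<Longrightarrow>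
      Q\<^sup>T * ?C * Q = ?C \<Longrightarrow> Q * S = S * Q"
    by metis
  note d = carrier_matD[OF Tc(1)] carrier_matD[OF Tc(2)] carrier_matD[OF B']
    carrier_matD[OF S(1)] carrier_matD[OF S(2)]
  \<comment> \<open>Each group element preserves both forms and therefore commutes with the root
    \<open>S\<close>; this is what makes the isometry equivariant.\<close>
  have SM: "S \<in> intertwiners G M M"
    unfolding intertwiners_iff using S(1) comm[OF rep_carrier[OF M] bspec[OF inv] bspec[OF invC]] by simp
  have TS: "T * S \<in> intertwiners G M M'" by (rule intertwiner_comp[OF T(1) SM M M M'])
  have "(Si * R) * (T * S) = Si * ((R * T) * S)" by (simp add: mat_mult_assoc d)
  then have 1: "(Si * R) * (T * S) = 1\<^sub>m (fst M)" unfolding T(3) using S by simp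
  have "(T * S) * (Si * R) = T * ((S * Si) * R)" by (simp add: mat_mult_assoc d)
  then have 2: "(T * S) * (Si * R) = 1\<^sub>m (fst M')" unfolding S(3) using Tc T(4) by simp
  have "iso_arrow (Rep G) M M' (T * S)"
    unfolding iso_arrow_iff[OF M M']
    by (intro conjI TS bexI[of _ "Si * R"] 1 2) (use d in \<open>auto intro!: carrier_matI\<close>)
  moreover have "b' * kronecker (T * S) (T * S) = b"
  proof -
    have "b' * kronecker (T * S) (T * S) = form_row ((T * S)\<^sup>T * B' * (T * S))"
      unfolding b by (rule form_row_kronecker) (simp_all add: d)
    also have "(T * S)\<^sup>T * B' * (T * S) = S\<^sup>T * ?C * S"
      unfolding transpose_mult[OF Tc(1) S(1)] by (simp add: mat_mult_assoc d)
    finally show ?thesis unfolding S(5) b .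
  qed
  ultimately show "z \<in> isometry_rel (Rep G)"
    using q unfolding z isometry_rel_def mem_Collect_eq
    by (intro exI[of _ M] exI[of _ b] exI[of _ M'] exI[of _ b']) auto
qed

lemma equiv_isometry_rel: "equiv (quadratic_objects (Rep G)) (isometry_rel (Rep G))"
proof (rule equivI)
  show "refl_on (quadratic_objects (Rep G)) (isometry_rel (Rep G))"
    by (auto simp: refl_on_def isometry_rel_Rep quadratic_objects_def intro: rep_iso_refl)
  show "sym (isometry_rel (Rep G))"
    by (auto simp: sym_def isometry_rel_Rep intro: rep_iso_sym)
  show "trans (isometry_rel (Rep G))"
    by (auto simp: trans_def isometry_rel_Rep intro: rep_iso_trans)
qed (auto simp: isometry_rel_Rep)

section \<open>Representations carrying a non-singular symmetric form\<close>

definition orthogonal where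
  "orthogonal M \<longleftrightarrow> (\<exists>b. (M, b) \<in> quadratic_objects (Rep G))"

text \<open>An isometry class indexed by the underlying object alone, which is possible because the
  form is unique up to isometry. It is empty if \<open>M\<close> carries no form.\<close>

definition quadratic_class where
  "quadratic_class M = {y \<in> quadratic_objects (Rep G). rep_iso M (fst y)}"

lemma orthogonal_rep: "orthogonal M \<Longrightarrow> M \<in> representations G"
  by (auto simp: orthogonal_def quadratic_objects_def)

lemma isometry_class:
  "x \<in> quadratic_objects (Rep G) \<Longrightarrow> isometry_rel (Rep G) `` {x} = quadratic_class (fst x)"
  by (auto simp: isometry_rel_Rep quadratic_class_def)

lemma quadratic_class_eqI: "rep_iso M N \<Longrightarrow> quadratic_class M = quadratic_class N"
  by (auto simp: quadratic_class_def intro: rep_iso_trans rep_iso_sym)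

lemma quadratic_class_eq_iff:
  assumes "orthogonal M" "orthogonal N"
  shows "quadratic_class M = quadratic_class N \<longleftrightarrow> rep_iso M N"
proof
  assume eq: "quadratic_class M = quadratic_class N"
  from assms(2) obtain c where "(N, c) \<in> quadratic_objects (Rep G)" by (auto simp: orthogonal_def)
  then have "(N, c) \<in> quadratic_class N"
    using rep_iso_refl[OF orthogonal_rep[OF assms(2)]] by (simp add: quadratic_class_def)
  then show "rep_iso M N" unfolding eq[symmetric] by (simp add: quadratic_class_def)
qed (rule quadratic_class_eqI)

lemma orthogonal_iff: "orthogonal M \<longleftrightarrow> (\<exists>B. orthogonal_form M B)"
  unfolding orthogonal_def quadratic_objects_Rep by blast

lemma orthogonal_iso:
  assumes "orthogonal M" "rep_iso M N"
  shows "orthogonal N"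
proof -
  from assms(1) obtain B where B: "orthogonal_form M B"
    unfolding orthogonal_iff by blast
  from assms(2) obtain T R where N: "N \<in> representations G" and T: "T \<in> intertwiners G M N" "R \<in> intertwiners G N M"
    "R * T = 1\<^sub>m (fst M)" "T * R = 1\<^sub>m (fst N)"
    by (elim rep_isoE)
  show ?thesis
    unfolding orthogonal_iff using orthogonal_form_pullback[OF B N T(2,1,4,3)] by blast
qed

lemma quadratic_objectsI: "orthogonal_form M B \<Longrightarrow> (M, form_row B) \<in> quadratic_objects (Rep G)"
  unfolding quadratic_objects_Rep by blast

lemma orthogonal_form_tensor:
  assumes "orthogonal_form M B" "orthogonal_form N C"
  shows "orthogonal_form (M \<boxtimes>\<^bsub>Rep G\<^esub> N) (kronecker B C)"
proof -
  from assms(1) obtain Bi where B: "M \<in> representations G" "B \<in> carrier_mat (fst M) (fst M)" "Bi \<in> carrier_mat (fst M) (fst M)"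
    "B\<^sup>T = B" "B * Bi = 1\<^sub>m (fst M)"
    "\<forall>g\<in>carrier G. (snd M g)\<^sup>T * B * snd M g = B" "Bi * B = 1\<^sub>m (fst M)"
    by (rule orthogonal_formE)
  from assms(2) obtain Ci where C: "N \<in> representations G" "C \<in> carrier_mat (fst N) (fst N)" "Ci \<in> carrier_mat (fst N) (fst N)"
    "C\<^sup>T = C" "C * Ci = 1\<^sub>m (fst N)"
    "\<forall>g\<in>carrier G. (snd N g)\<^sup>T * C * snd N g = C" "Ci * C = 1\<^sub>m (fst N)"
    by (rule orthogonal_formE)
  show ?thesis
  proof (rule orthogonal_formI)
    show "kronecker B C * kronecker Bi Ci = 1\<^sub>m (fst (M \<boxtimes>\<^bsub>Rep G\<^esub> N))"
      using B C by (simp add: kronecker_mult kronecker_one)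
    fix g assume g: "g \<in> carrier G"
    have "(kronecker (snd M g) (snd N g))\<^sup>T * kronecker B C * kronecker (snd M g) (snd N g) =
        kronecker ((snd M g)\<^sup>T * B * snd M g) ((snd N g)\<^sup>T * C * snd N g)"
      using B(1,2) C(1,2) g by (simp add: kronecker_transpose kronecker_mult rep_dim)
    then show "(snd (M \<boxtimes>\<^bsub>Rep G\<^esub> N) g)\<^sup>T * kronecker B C * snd (M \<boxtimes>\<^bsub>Rep G\<^esub> N) g = kronecker B C"
      using g B(6) C(6) by simp
  qed (use B(1-4) C(1-4) in \<open>auto simp: kronecker_transpose intro!: carrier_matI\<close>)
qed

lemma middle_swap_Rep:
  assumes M: "M \<in> representations G" and N: "N \<in> representations G"
  shows "middle_swap (Rep G) M N =
    kronecker (1\<^sub>m (fst M)) (kronecker (flip_mat (fst N) (fst M)) (1\<^sub>m (fst N)))"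
proof -
  let ?n = "fst M" and ?m = "fst N"
  have MN: "M \<boxtimes>\<^bsub>Rep G\<^esub> N \<in> representations G" "N \<boxtimes>\<^bsub>Rep G\<^esub> N \<in> representations G" using M N by simp_all
  have a: "inv_arrow (Rep G) ((M \<boxtimes>\<^bsub>Rep G\<^esub> M) \<boxtimes>\<^bsub>Rep G\<^esub> (N \<boxtimes>\<^bsub>Rep G\<^esub> N))
      (M \<boxtimes>\<^bsub>Rep G\<^esub> (M \<boxtimes>\<^bsub>Rep G\<^esub> (N \<boxtimes>\<^bsub>Rep G\<^esub> N))) (1\<^sub>m (?n * ?n * (?m * ?m))) = 1\<^sub>m (?n * ?n * (?m * ?m))"
    unfolding TObj_assoc[OF M M MN(2)] using M N by (intro inv_arrow_one) (simp_all add: ac_simps)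
  have b: "inv_arrow (Rep G) ((N \<boxtimes>\<^bsub>Rep G\<^esub> M) \<boxtimes>\<^bsub>Rep G\<^esub> N)
      (N \<boxtimes>\<^bsub>Rep G\<^esub> (M \<boxtimes>\<^bsub>Rep G\<^esub> N)) (1\<^sub>m (?m * ?n * ?m)) = 1\<^sub>m (?m * ?n * ?m)"
    unfolding TObj_assoc[OF N M N] using M N by (intro inv_arrow_one) (simp_all add: ac_simps)
  let ?F = "kronecker (flip_mat ?m ?n) (1\<^sub>m ?m)"
  have F: "?F \<in> carrier_mat (?n * ?m * ?m) (?m * ?n * ?m)" by (auto intro!: carrier_matI)
  have K: "kronecker (1\<^sub>m ?n) ?F \<in> carrier_mat (?n * ?n * (?m * ?m)) (?n * ?m * (?n * ?m))"
    by (auto intro!: carrier_matI simp: ac_simps)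
  have "middle_swap (Rep G) M N = 1\<^sub>m (?n * ?n * (?m * ?m)) *
      (kronecker (1\<^sub>m ?n) (1\<^sub>m (?n * ?m * ?m) * (?F * 1\<^sub>m (?m * ?n * ?m))) * 1\<^sub>m (?n * ?m * (?n * ?m)))"
    unfolding middle_swap_def by (simp add: a b)
  also have "\<dots> = kronecker (1\<^sub>m ?n) ?F"
    using F K by simp
  finally show ?thesis .
qed

lemma tensor_quad_Rep:
  assumes "orthogonal_form M B" "orthogonal_form N C"
  shows "tensor_quad (Rep G) (M, form_row B) (N, form_row C) = (M \<boxtimes>\<^bsub>Rep G\<^esub> N, form_row (kronecker B C))"
proof -
  have M: "M \<in> representations G" "B \<in> carrier_mat (fst M) (fst M)"
    and N: "N \<in> representations G" "C \<in> carrier_mat (fst N) (fst N)"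
    using assms by (auto simp: orthogonal_form_def)
  have "kronecker (form_row B) (form_row C) * middle_swap (Rep G) M N = form_row (kronecker B C)"
    unfolding middle_swap_Rep[OF M(1) N(1)] by (rule kronecker_form_row_middle_flip[OF M(2) N(2)])
  moreover have "1\<^sub>m 1 * form_row (kronecker B C) = form_row (kronecker B C)"
    by (rule left_mult_one_mat[OF form_row_carrier[OF kronecker_carrier[OF M(2) N(2)]]])
  ultimately show ?thesis by (simp add: tensor_quad_def)
qed

text \<open>The form on the sum is pulled back along the two projections. Its inverse has the same
  shape with \<open>Bi\<close> and \<open>Ci\<close>, since \<open>P\<close> and \<open>Q\<close>
  satisfy the biproduct equations with their transposes.\<close>

lemma orthogonal_form_sum:
  assumes "orthogonal_form M B" "orthogonal_form N C"
  defines "P \<equiv> pr1_mat (fst M) (fst N)" and "Q \<equiv> pr2_mat (fst M) (fst N)"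
  shows "orthogonal_form (M \<uplus>\<^bsub>Rep G\<^esub> N) (P\<^sup>T * B * P + Q\<^sup>T * C * Q)"
proof -
  from assms(1) obtain Bi where B: "M \<in> representations G" "B \<in> carrier_mat (fst M) (fst M)" "Bi \<in> carrier_mat (fst M) (fst M)"
    "B\<^sup>T = B" "B * Bi = 1\<^sub>m (fst M)"
    "\<forall>g\<in>carrier G. (snd M g)\<^sup>T * B * snd M g = B" "Bi * B = 1\<^sub>m (fst M)"
    by (rule orthogonal_formE)
  from assms(2) obtain Ci where C: "N \<in> representations G" "C \<in> carrier_mat (fst N) (fst N)" "Ci \<in> carrier_mat (fst N) (fst N)"
    "C\<^sup>T = C" "C * Ci = 1\<^sub>m (fst N)"
    "\<forall>g\<in>carrier G. (snd N g)\<^sup>T * C * snd N g = C" "Ci * C = 1\<^sub>m (fst N)"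
    by (rule orthogonal_formE)
  let ?n = "fst M" and ?m = "fst N"
  let ?k = "?n + ?m"
  let ?D = "P\<^sup>T * B * P" and ?E = "Q\<^sup>T * C * Q"
  let ?Di = "P\<^sup>T * Bi * P" and ?Ei = "Q\<^sup>T * Ci * Q"
  have PQ: "P \<in> carrier_mat ?n ?k" "Q \<in> carrier_mat ?m ?k"
    by (simp_all add: P_def Q_def pr_mat_carrier)
  note d = carrier_matD[OF PQ(1)] carrier_matD[OF PQ(2)] carrier_matD[OF B(2)] carrier_matD[OF B(3)]
    carrier_matD[OF C(2)] carrier_matD[OF C(3)]
  have car: "?D \<in> carrier_mat ?k ?k" "?E \<in> carrier_mat ?k ?k" "?Di \<in> carrier_mat ?k ?k" "?Ei \<in> carrier_mat ?k ?k"
    using d by (auto intro!: carrier_matI)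
  note pr = pr_mat_transpose[of ?n ?m, folded P_def Q_def]
  have prod: "?D * ?Di = P\<^sup>T * (B * ((P * P\<^sup>T) * (Bi * P)))"
    "?E * ?Ei = Q\<^sup>T * (C * ((Q * Q\<^sup>T) * (Ci * Q)))"
    "?D * ?Ei = P\<^sup>T * (B * ((P * Q\<^sup>T) * (Ci * Q)))"
    "?E * ?Di = Q\<^sup>T * (C * ((Q * P\<^sup>T) * (Bi * P)))"
    by (simp_all add: mat_mult_assoc d)
  have zero: "?D * ?Ei = 0\<^sub>m ?k ?k" "?E * ?Di = 0\<^sub>m ?k ?k"
  proof -
    have "0\<^sub>m ?n ?m * (Ci * Q) = 0\<^sub>m ?n ?k" "0\<^sub>m ?m ?n * (Bi * P) = 0\<^sub>m ?m ?k"
      by (rule left_mult_zero_mat, use d in \<open>auto intro!: carrier_matI\<close>)+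
    then show "?D * ?Ei = 0\<^sub>m ?k ?k" "?E * ?Di = 0\<^sub>m ?k ?k"
      unfolding prod pr using B C PQ by simp_all
  qed
  have one: "?D * ?Di = P\<^sup>T * P" "?E * ?Ei = Q\<^sup>T * Q"
  proof -
    have "1\<^sub>m ?n * (Bi * P) = Bi * P" "1\<^sub>m ?m * (Ci * Q) = Ci * Q"
      by (rule left_mult_one_mat, use d in \<open>auto intro!: carrier_matI\<close>)+
    moreover have "B * (Bi * P) = (B * Bi) * P" "C * (Ci * Q) = (C * Ci) * Q"
      by (simp_all add: mat_mult_assoc d)
    ultimately show "?D * ?Di = P\<^sup>T * P" "?E * ?Ei = Q\<^sup>T * Q"
      unfolding prod pr using B(5) C(5) PQ by simp_all
  qed
  have inv: "(?D + ?E) * (?Di + ?Ei) = 1\<^sub>m ?k"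
  proof -
    have "(?D + ?E) * (?Di + ?Ei) = ?D * (?Di + ?Ei) + ?E * (?Di + ?Ei)"
      by (rule add_mult_distrib_mat[OF car(1,2), of _ ?k]) (use car in auto)
    also have "?D * (?Di + ?Ei) = ?D * ?Di + ?D * ?Ei"
      by (rule mult_add_distrib_mat[OF car(1,3,4)])
    also have "?E * (?Di + ?Ei) = ?E * ?Di + ?E * ?Ei"
      by (rule mult_add_distrib_mat[OF car(2,3,4)])
    finally have "(?D + ?E) * (?Di + ?Ei) = (P\<^sup>T * P + 0\<^sub>m ?k ?k) + (0\<^sub>m ?k ?k + Q\<^sup>T * Q)"
      unfolding zero one .
    also have "\<dots> = P\<^sup>T * P + Q\<^sup>T * Q"
    proof -
      have "P\<^sup>T * P \<in> carrier_mat ?k ?k" "Q\<^sup>T * Q \<in> carrier_mat ?k ?k"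
        using d by (auto intro!: carrier_matI)
      then show ?thesis by simp
    qed
    finally show ?thesis using pr_mat_decomposition[of ?n ?m] by (simp add: P_def Q_def)
  qed
  show ?thesis
  proof (rule orthogonal_formI)
    show "(?D + ?E) * (?Di + ?Ei) = 1\<^sub>m (fst (M \<uplus>\<^bsub>Rep G\<^esub> N))" using inv by simp
    show "(?D + ?E)\<^sup>T = ?D + ?E"
      using congruence_transpose[OF B(2) PQ(1)] congruence_transpose[OF C(2) PQ(2)]
      by (simp add: transpose_add[OF car(1,2)] B(4) C(4))
    fix g assume g: "g \<in> carrier G"
    let ?X = "snd (M \<uplus>\<^bsub>Rep G\<^esub> N) g"
    note r = rep_carrier[OF B(1) g] rep_carrier[OF C(1) g]
    have X: "?X \<in> carrier_mat ?k ?k" "?X\<^sup>T \<in> carrier_mat ?k ?k" using r g by auto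
    have PX: "P * ?X = snd M g * P" "Q * ?X = snd N g * Q"
      using pr_mat_four_block[OF r] g by (simp_all add: P_def Q_def)
    note dX = carrier_matD[OF X(1)] carrier_matD[OF r(1)] carrier_matD[OF r(2)]
    \<comment> \<open>Applied to both projections: if \<open>Z\<close> is equivariant, the pullback
      along \<open>Z\<close> of an invariant form is invariant.\<close>
    have inv1: "?X\<^sup>T * (Z\<^sup>T * A * Z) * ?X = Z\<^sup>T * A * Z"
      if Z: "Z \<in> carrier_mat l ?k" "Z * ?X = R * Z" and R: "R \<in> carrier_mat l l" "A \<in> carrier_mat l l"
        "R\<^sup>T * A * R = A" for Z A R l
    proof -
      note dZ = carrier_matD[OF Z(1)] carrier_matD[OF R(1)] carrier_matD[OF R(2)]
      have "?X\<^sup>T * (Z\<^sup>T * A * Z) * ?X = (?X\<^sup>T * Z\<^sup>T) * A * (Z * ?X)"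
        by (simp add: mat_mult_assoc dX dZ)
      also have "?X\<^sup>T * Z\<^sup>T = (R * Z)\<^sup>T"
        unfolding Z(2)[symmetric] by (rule transpose_mult[OF Z(1) X(1), symmetric])
      also have "\<dots> = Z\<^sup>T * R\<^sup>T"
        by (rule transpose_mult[OF R(1) Z(1)])
      also have "(Z\<^sup>T * R\<^sup>T) * A * (Z * ?X) = Z\<^sup>T * (R\<^sup>T * A * R) * Z"
        unfolding Z(2) by (simp add: mat_mult_assoc dX dZ)
      finally show ?thesis unfolding R(3) .
    qed
    have "?X\<^sup>T * (?D + ?E) * ?X = (?X\<^sup>T * ?D + ?X\<^sup>T * ?E) * ?X"
      by (simp only: mult_add_distrib_mat[OF X(2) car(1,2)])
    also have "\<dots> = ?X\<^sup>T * ?D * ?X + ?X\<^sup>T * ?E * ?X"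
      by (rule add_mult_distrib_mat[of _ ?k ?k]) (use X car in \<open>auto intro!: carrier_matI\<close>)
    also have "\<dots> = ?D + ?E"
      using inv1[OF PQ(1) PX(1) r(1) B(2) bspec[OF B(6) g]] inv1[OF PQ(2) PX(2) r(2) C(2) bspec[OF C(6) g]] by simp
    finally show "?X\<^sup>T * (?D + ?E) * ?X = ?D + ?E" .
  qed (use B(1) C(1) car in auto)
qed

lemma orth_sum_Rep:
  assumes "orthogonal_form M B" "orthogonal_form N C"
  defines "P \<equiv> pr1_mat (fst M) (fst N)" and "Q \<equiv> pr2_mat (fst M) (fst N)"
  shows "orth_sum (Rep G) (M, form_row B) (N, form_row C) =
    (M \<uplus>\<^bsub>Rep G\<^esub> N, form_row (P\<^sup>T * B * P + Q\<^sup>T * C * Q))"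
proof -
  have B: "B \<in> carrier_mat (fst M) (fst M)" and C: "C \<in> carrier_mat (fst N) (fst N)"
    using assms by (auto simp: orthogonal_form_def)
  have "form_row B * kronecker P P = form_row (P\<^sup>T * B * P)"
    "form_row C * kronecker Q Q = form_row (Q\<^sup>T * C * Q)"
    using B C by (auto simp: P_def Q_def intro!: form_row_kronecker)
  then show ?thesis
    using B C by (simp add: orth_sum_def P_def Q_def form_row_add)
qed

text \<open>Evaluation has the identity as Gram matrix, also after the flip. The hyperbolic form is
  therefore the antidiagonal block matrix with identity blocks, which is symmetric and its own
  inverse; it is invariant because the dual acts by the inverse transpose.\<close>

lemma hyperbolic_Rep:
  assumes M: "M \<in> representations G"
  shows "hyperbolic (Rep G) M \<in> quadratic_objects (Rep G)"
    "fst (hyperbolic (Rep G) M) = M \<uplus>\<^bsub>Rep G\<^esub> Dual (Rep G) M"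
proof -
  let ?n = "fst M" and ?D = "Dual (Rep G) M"
  let ?P = "pr1_mat ?n ?n" and ?Q = "pr2_mat ?n ?n" and ?k = "fst M + fst M"
  let ?A = "?Q\<^sup>T * ?P" and ?B = "?P\<^sup>T * ?Q"
  have D: "?D \<in> representations G" using M by simp
  have r1: "form_row (1\<^sub>m ?n) * kronecker ?Q ?P = form_row ?A"
    "form_row (1\<^sub>m ?n) * kronecker ?P ?Q = form_row ?B"
    by (auto simp: form_row_kronecker right_mult_one_mat[of _ ?k])
  have "form_row (1\<^sub>m ?n) * flip_mat ?n ?n = form_row (1\<^sub>m ?n)"
    using form_row_flip_mat[of "1\<^sub>m ?n" ?n ?n] by simp
  then have h: "hyperbolic (Rep G) M = (M \<uplus>\<^bsub>Rep G\<^esub> ?D, form_row (?A + ?B))"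
    by (simp add: hyperbolic_def ev_mat_form_row r1 form_row_add)
  then show "fst (hyperbolic (Rep G) M) = M \<uplus>\<^bsub>Rep G\<^esub> ?D" by simp
  have car: "?A \<in> carrier_mat ?k ?k" "?B \<in> carrier_mat ?k ?k" by (auto intro!: carrier_matI)
  have At: "?A\<^sup>T = ?B" "?B\<^sup>T = ?A"
    using transpose_mult[OF transpose_carrier_mat[THEN iffD2, OF pr_mat_carrier(2)] pr_mat_carrier(1)]
      transpose_mult[OF transpose_carrier_mat[THEN iffD2, OF pr_mat_carrier(1)] pr_mat_carrier(2)] by simp_all
  have "?A * ?A = ?Q\<^sup>T * ((?P * ?Q\<^sup>T) * ?P)"
    "?A * ?B = ?Q\<^sup>T * ((?P * ?P\<^sup>T) * ?Q)"
    "?B * ?A = ?P\<^sup>T * ((?Q * ?Q\<^sup>T) * ?P)"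
    "?B * ?B = ?P\<^sup>T * ((?Q * ?P\<^sup>T) * ?Q)"
    by (simp_all add: mat_mult_assoc)
  then have mult: "?A * ?A = 0\<^sub>m ?k ?k" "?A * ?B = ?Q\<^sup>T * ?Q" "?B * ?A = ?P\<^sup>T * ?P" "?B * ?B = 0\<^sub>m ?k ?k"
    by (simp_all add: pr_mat_transpose pr_mat_carrier left_mult_one_mat[OF pr_mat_carrier(1)] left_mult_one_mat[OF pr_mat_carrier(2)])
  have inv: "(?A + ?B) * (?A + ?B) = 1\<^sub>m ?k"
  proof -
    have "(?A + ?B) * (?A + ?B) = ?A * (?A + ?B) + ?B * (?A + ?B)"
      by (rule add_mult_distrib_mat[OF car]) (use car in auto)
    also have "\<dots> = (?A * ?A + ?A * ?B) + (?B * ?A + ?B * ?B)"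
      by (simp only: mult_add_distrib_mat[OF car(1) car] mult_add_distrib_mat[OF car(2) car])
    also have "\<dots> = ?P\<^sup>T * ?P + ?Q\<^sup>T * ?Q"
    proof -
      have c: "?P\<^sup>T * ?P \<in> carrier_mat ?k ?k" "?Q\<^sup>T * ?Q \<in> carrier_mat ?k ?k"
        by (auto intro!: carrier_matI)
      then show ?thesis unfolding mult using comm_add_mat[OF c] by simp
    qed
    finally show ?thesis by (simp add: pr_mat_decomposition)
  qed
  have "orthogonal_form (M \<uplus>\<^bsub>Rep G\<^esub> ?D) (?A + ?B)"
  proof (rule orthogonal_formI)
    show "(?A + ?B)\<^sup>T = ?A + ?B"
      unfolding transpose_add[OF car] At by (rule comm_add_mat[OF car(2,1)])
    fix g assume g: "g \<in> carrier G"
    let ?X = "snd (M \<uplus>\<^bsub>Rep G\<^esub> ?D) g"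
    note r = rep_carrier[OF M g] rep_carrier[OF D g] rep_carrier[OF M inv_closed[OF g]]
    have X: "?X \<in> carrier_mat ?k ?k" "?X\<^sup>T \<in> carrier_mat ?k ?k" using r g by auto
    have PX: "?P * ?X = snd M g * ?P" "?Q * ?X = snd ?D g * ?Q"
      using pr_mat_four_block[of "snd M g" ?n "snd ?D g" ?n] r g by simp_all
    have XP: "?X\<^sup>T * ?P\<^sup>T = ?P\<^sup>T * (snd M g)\<^sup>T"
      "?X\<^sup>T * ?Q\<^sup>T = ?Q\<^sup>T * (snd ?D g)\<^sup>T"
      using arg_cong[OF PX(1), of transpose_mat] arg_cong[OF PX(2), of transpose_mat] r
      by (simp_all only: transpose_mult[OF pr_mat_carrier(1) X(1)] transpose_mult[OF pr_mat_carrier(2) X(1)]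
          transpose_mult[OF r(1) pr_mat_carrier(1)] transpose_mult[OF r(2)[unfolded fst_Rep_obj] pr_mat_carrier(2)])
    have one: "(snd ?D g)\<^sup>T * snd M g = 1\<^sub>m ?n" "(snd M g)\<^sup>T * snd ?D g = 1\<^sub>m ?n"
      using g rep_inv[OF M g] transpose_mult[OF r(3) r(1)] by simp_all
    note dX = carrier_matD[OF X(1)] carrier_matD[OF r(1)] carrier_matD[OF r(2)[unfolded fst_Rep_obj]]
    have "?X\<^sup>T * ?A * ?X = (?X\<^sup>T * ?Q\<^sup>T) * (?P * ?X)"
      "?X\<^sup>T * ?B * ?X = (?X\<^sup>T * ?P\<^sup>T) * (?Q * ?X)"
      by (simp_all add: mat_mult_assoc dX)
    then have "?X\<^sup>T * ?A * ?X = ?Q\<^sup>T * (((snd ?D g)\<^sup>T * snd M g) * ?P)"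
      "?X\<^sup>T * ?B * ?X = ?P\<^sup>T * (((snd M g)\<^sup>T * snd ?D g) * ?Q)"
      unfolding PX XP by (simp_all add: mat_mult_assoc dX)
    then have AB: "?X\<^sup>T * ?A * ?X = ?A" "?X\<^sup>T * ?B * ?X = ?B"
      unfolding one by (simp_all add: left_mult_one_mat[OF pr_mat_carrier(1)] left_mult_one_mat[OF pr_mat_carrier(2)])
    have "?X\<^sup>T * (?A + ?B) * ?X = (?X\<^sup>T * ?A + ?X\<^sup>T * ?B) * ?X"
      by (simp only: mult_add_distrib_mat[OF X(2) car(1,2)])
    also have "\<dots> = ?X\<^sup>T * ?A * ?X + ?X\<^sup>T * ?B * ?X"
      by (rule add_mult_distrib_mat[of _ ?k ?k]) (use X car in \<open>auto intro!: carrier_matI\<close>)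
    finally show "?X\<^sup>T * (?A + ?B) * ?X = ?A + ?B" unfolding AB .
  qed (use M car inv in auto)
  then show "hyperbolic (Rep G) M \<in> quadratic_objects (Rep G)"
    unfolding h by (rule quadratic_objectsI)
qed

lemma orthogonal_hyperbolic: "M \<in> representations G \<Longrightarrow> orthogonal (M \<uplus>\<^bsub>Rep G\<^esub> Dual (Rep G) M)"
  using hyperbolic_Rep[of M] unfolding orthogonal_def by (metis prod.collapse)

lemma orthogonal_TObj: "orthogonal M \<Longrightarrow> orthogonal N \<Longrightarrow> orthogonal (M \<boxtimes>\<^bsub>Rep G\<^esub> N)"
  using orthogonal_form_tensor unfolding orthogonal_iff by blast

lemma orthogonal_DSum: "orthogonal M \<Longrightarrow> orthogonal N \<Longrightarrow> orthogonal (M \<uplus>\<^bsub>Rep G\<^esub> N)"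
  using orthogonal_form_sum unfolding orthogonal_iff by blast

lemma orthogonal_form_Unit: "orthogonal_form (Unit (Rep G)) (1\<^sub>m 1)"
  by (rule orthogonal_formI[where Bi = "1\<^sub>m 1"]) auto

lemma orthogonal_form_ZeroObj: "orthogonal_form (ZeroObj (Rep G)) (0\<^sub>m 0 0)"
  by (rule orthogonal_formI[where Bi = "0\<^sub>m 0 0"]) (auto intro!: eq_matI)

lemma orthogonal_self_dual:
  assumes "orthogonal M"
  shows "rep_iso M (Dual (Rep G) M)"
proof -
  from assms obtain b where "(M, b) \<in> quadratic_objects (Rep G)" by (auto simp: orthogonal_def)
  then have "M \<in> representations G" "iso_arrow (Rep G) M (Dual (Rep G) M) (adjoint_map (Rep G) M b)"
    by (auto simp: quadratic_objects_def)
  then show ?thesis unfolding rep_iso_def by auto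
qed

end

text \<open>Brings the subgroup in the definition of the Witt ring into the form
  \<open>diff_ideal\<close>, for which the ideal property and transport along isomorphisms are
  available.\<close>

lemma (in comm_semiring_struct) K0_map_image:
  assumes closed: "\<And>a b. a \<in> carrier W \<Longrightarrow> b \<in> carrier W \<Longrightarrow> a \<otimes>\<^bsub>W\<^esub> b \<in> carrier W"
    and f: "\<And>a. a \<in> carrier W \<Longrightarrow> f a \<in> carrier R"
    and hom: "\<And>a b. a \<in> carrier W \<Longrightarrow> b \<in> carrier W \<Longrightarrow> f (a \<otimes>\<^bsub>W\<^esub> b) = f a \<oplus> f b"
  shows "K0_map (add_monoid R) f ` carrier (K0 W) = diff_ideal (f ` carrier W)"
proof -
  have carW: "carrier (K0 W) = {K0_rel W `` {(a, b)} | a b. a \<in> carrier W \<and> b \<in> carrier W}"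
    by (auto simp: K0_def quotient_def)
  have map: "K0_map (add_monoid R) f (K0_rel W `` {(a, b)}) = diff_class R (f a) (f b)"
    if ab: "a \<in> carrier W" "b \<in> carrier W" for a b
  proof -
    have "diff_class R (f c) (f d) = diff_class R (f a) (f b)" if "(c, d) \<in> K0_rel W `` {(a, b)}" for c d
    proof -
      from that obtain k where cd: "c \<in> carrier W" "d \<in> carrier W" "k \<in> carrier W"
        "(a \<otimes>\<^bsub>W\<^esub> d) \<otimes>\<^bsub>W\<^esub> k = (c \<otimes>\<^bsub>W\<^esub> b) \<otimes>\<^bsub>W\<^esub> k"
        by (auto simp: K0_rel_def)
      have "f ((a \<otimes>\<^bsub>W\<^esub> d) \<otimes>\<^bsub>W\<^esub> k) = f ((c \<otimes>\<^bsub>W\<^esub> b) \<otimes>\<^bsub>W\<^esub> k)" by (simp only: cd(4))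
      then have "(f a \<oplus> f d) \<oplus> f k = (f c \<oplus> f b) \<oplus> f k"
        using ab cd(1-3) by (simp add: hom closed)
      then have "diff_class R (f a) (f b) = diff_class R (f c) (f d)"
        unfolding diff_class_eq_iff[OF f[OF ab(1)] f[OF ab(2)] f[OF cd(1)] f[OF cd(2)]]
        using f[OF cd(3)] by blast
      then show ?thesis by (rule sym)
    qed
    moreover have "(a, b) \<in> K0_rel W `` {(a, b)}"
      using ab by (auto simp: K0_rel_def)
    ultimately have "(\<Union>(c, d)\<in>K0_rel W `` {(a, b)}. diff_class R (f c) (f d)) = diff_class R (f a) (f b)"
      by blast
    then show ?thesis
      unfolding K0_map_def diff_class_def diff_rel_def .
  qed
  show ?thesis
  proof (intro equalityI subsetI)
    fix x assume "x \<in> K0_map (add_monoid R) f ` carrier (K0 W)"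
    then obtain a b where "a \<in> carrier W" "b \<in> carrier W" "x = K0_map (add_monoid R) f (K0_rel W `` {(a, b)})"
      unfolding carW by blast
    then show "x \<in> diff_ideal (f ` carrier W)"
      unfolding diff_ideal_def using map by blast
  next
    fix x assume "x \<in> diff_ideal (f ` carrier W)"
    then obtain a b where ab: "a \<in> carrier W" "b \<in> carrier W" "x = diff_class R (f a) (f b)"
      unfolding diff_ideal_def by blast
    then have "x = K0_map (add_monoid R) f (K0_rel W `` {(a, b)})" by (simp only: map)
    then show "x \<in> K0_map (add_monoid R) f ` carrier (K0 W)"
      unfolding carW using ab by blast
  qed
qed

context group_reps
begin

section \<open>The Witt ring of the category of representations\<close>

lemma quadratic_objectE:
  assumes "x \<in> quadratic_objects (Rep G)"
  obtains M B where "x = (M, form_row B)" "orthogonal_form M B"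
  using assms unfolding quadratic_objects_Rep by blast

lemma orth_sum_quadratic:
  assumes "x \<in> quadratic_objects (Rep G)" "y \<in> quadratic_objects (Rep G)"
  shows "orth_sum (Rep G) x y \<in> quadratic_objects (Rep G)"
    "fst (orth_sum (Rep G) x y) = fst x \<uplus>\<^bsub>Rep G\<^esub> fst y"
proof -
  from assms(1) obtain M B where x: "x = (M, form_row B)" "orthogonal_form M B" by (rule quadratic_objectE)
  from assms(2) obtain N C where y: "y = (N, form_row C)" "orthogonal_form N C" by (rule quadratic_objectE)
  show "orth_sum (Rep G) x y \<in> quadratic_objects (Rep G)"
    unfolding x(1) y(1) orth_sum_Rep[OF x(2) y(2)]
    by (rule quadratic_objectsI, rule orthogonal_form_sum[OF x(2) y(2)])
  show "fst (orth_sum (Rep G) x y) = fst x \<uplus>\<^bsub>Rep G\<^esub> fst y"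
    unfolding x(1) y(1) orth_sum_Rep[OF x(2) y(2)] by simp
qed

lemma tensor_quad_quadratic:
  assumes "x \<in> quadratic_objects (Rep G)" "y \<in> quadratic_objects (Rep G)"
  shows "tensor_quad (Rep G) x y \<in> quadratic_objects (Rep G)"
    "fst (tensor_quad (Rep G) x y) = fst x \<boxtimes>\<^bsub>Rep G\<^esub> fst y"
proof -
  from assms(1) obtain M B where x: "x = (M, form_row B)" "orthogonal_form M B" by (rule quadratic_objectE)
  from assms(2) obtain N C where y: "y = (N, form_row C)" "orthogonal_form N C" by (rule quadratic_objectE)
  show "tensor_quad (Rep G) x y \<in> quadratic_objects (Rep G)"
    unfolding x(1) y(1) tensor_quad_Rep[OF x(2) y(2)]
    by (rule quadratic_objectsI, rule orthogonal_form_tensor[OF x(2) y(2)])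
  show "fst (tensor_quad (Rep G) x y) = fst x \<boxtimes>\<^bsub>Rep G\<^esub> fst y"
    unfolding x(1) y(1) tensor_quad_Rep[OF x(2) y(2)] by simp
qed

lemma carrier_quadratic_semiring:
  "carrier (quadratic_semiring (Rep G)) = {quadratic_class M | M. orthogonal M}"
proof -
  have "carrier (quadratic_semiring (Rep G)) = {isometry_rel (Rep G) `` {x} | x. x \<in> quadratic_objects (Rep G)}"
    by (auto simp: quadratic_semiring_def quotient_def)
  also have "\<dots> = {quadratic_class M | M. orthogonal M}"
  proof (intro equalityI subsetI)
    fix X assume "X \<in> {isometry_rel (Rep G) `` {x} | x. x \<in> quadratic_objects (Rep G)}"
    then obtain x where "X = quadratic_class (fst x)" "x \<in> quadratic_objects (Rep G)"
      using isometry_class by blast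
    moreover from this have "orthogonal (fst x)" by (cases x) (auto simp: orthogonal_def)
    ultimately show "X \<in> {quadratic_class M | M. orthogonal M}" by blast
  next
    fix X assume "X \<in> {quadratic_class M | M. orthogonal M}"
    then obtain M b where "X = quadratic_class M" "(M, b) \<in> quadratic_objects (Rep G)"
      by (auto simp: orthogonal_def)
    then have "X = isometry_rel (Rep G) `` {(M, b)}" "(M, b) \<in> quadratic_objects (Rep G)"
      using isometry_class[of "(M, b)"] by auto
    then show "X \<in> {isometry_rel (Rep G) `` {x} | x. x \<in> quadratic_objects (Rep G)}" by blast
  qed
  finally show ?thesis .
qed

lemma quadratic_class_closed [simp]:
  "orthogonal M \<Longrightarrow> quadratic_class M \<in> carrier (quadratic_semiring (Rep G))"
  unfolding carrier_quadratic_semiring by blast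

text \<open>Isometry of quadratic objects is isomorphism of the underlying objects, so an operation
  is well defined on classes as soon as its effect \<open>t\<close> on objects respects
  isomorphism.\<close>

lemma class_op_quadratic_class:
  assumes M: "orthogonal M" and N: "orthogonal N"
    and q: "\<And>x y. x \<in> quadratic_objects (Rep G) \<Longrightarrow> y \<in> quadratic_objects (Rep G) \<Longrightarrow>
      f x y \<in> quadratic_objects (Rep G) \<and> fst (f x y) = t (fst x) (fst y)"
    and t: "\<And>M M' N N'. rep_iso M M' \<Longrightarrow> rep_iso N N' \<Longrightarrow> rep_iso (t M N) (t M' N')"
  shows "class_op (isometry_rel (Rep G)) f (quadratic_class M) (quadratic_class N) = quadratic_class (t M N)"
proof -
  from M N obtain b c where x: "(M, b) \<in> quadratic_objects (Rep G)" "(N, c) \<in> quadratic_objects (Rep G)"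
    by (auto simp: orthogonal_def)
  have "class_op (isometry_rel (Rep G)) f (isometry_rel (Rep G) `` {(M, b)}) (isometry_rel (Rep G) `` {(N, c)}) =
      isometry_rel (Rep G) `` {f (M, b) (N, c)}"
    by (rule class_op_class[OF equiv_isometry_rel x]) (use q t in \<open>auto simp: isometry_rel_Rep\<close>)
  then show ?thesis
    using q[OF x] by (simp add: isometry_class x)
qed

lemma quadratic_class_add:
  "orthogonal M \<Longrightarrow> orthogonal N \<Longrightarrow>
    quadratic_class M \<oplus>\<^bsub>quadratic_semiring (Rep G)\<^esub> quadratic_class N = quadratic_class (M \<uplus>\<^bsub>Rep G\<^esub> N)"
  using class_op_quadratic_class[of M N "orth_sum (Rep G)" "\<lambda>M N. M \<uplus>\<^bsub>Rep G\<^esub> N"]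
  by (simp add: quadratic_semiring_def orth_sum_quadratic rep_iso_DSum)

lemma quadratic_class_mult:
  "orthogonal M \<Longrightarrow> orthogonal N \<Longrightarrow>
    quadratic_class M \<otimes>\<^bsub>quadratic_semiring (Rep G)\<^esub> quadratic_class N = quadratic_class (M \<boxtimes>\<^bsub>Rep G\<^esub> N)"
  using class_op_quadratic_class[of M N "tensor_quad (Rep G)" "\<lambda>M N. M \<boxtimes>\<^bsub>Rep G\<^esub> N"]
  by (simp add: quadratic_semiring_def tensor_quad_quadratic rep_iso_TObj)

lemma orthogonal_Unit: "orthogonal (Unit (Rep G))"
  and quadratic_semiring_one: "\<one>\<^bsub>quadratic_semiring (Rep G)\<^esub> = quadratic_class (Unit (Rep G))"
proof -
  have "form_row (1\<^sub>m 1) = 1\<^sub>m 1" by (rule eq_matI) (auto simp: form_row_def)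
  then have q: "(Unit (Rep G), 1\<^sub>m 1) \<in> quadratic_objects (Rep G)"
    using quadratic_objectsI[OF orthogonal_form_Unit] by simp
  then show "orthogonal (Unit (Rep G))" unfolding orthogonal_def by blast
  show "\<one>\<^bsub>quadratic_semiring (Rep G)\<^esub> = quadratic_class (Unit (Rep G))"
    using isometry_class[OF q] by (simp add: quadratic_semiring_def)
qed

lemma orthogonal_ZeroObj: "orthogonal (ZeroObj (Rep G))"
  and quadratic_semiring_zero: "\<zero>\<^bsub>quadratic_semiring (Rep G)\<^esub> = quadratic_class (ZeroObj (Rep G))"
proof -
  have "form_row (0\<^sub>m 0 0) = 0\<^sub>m 1 0" by (rule eq_matI) (auto simp: form_row_def)
  then have q: "(ZeroObj (Rep G), 0\<^sub>m 1 0) \<in> quadratic_objects (Rep G)"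
    using quadratic_objectsI[OF orthogonal_form_ZeroObj] by simp
  then show "orthogonal (ZeroObj (Rep G))" unfolding orthogonal_def by blast
  show "\<zero>\<^bsub>quadratic_semiring (Rep G)\<^esub> = quadratic_class (ZeroObj (Rep G))"
    using isometry_class[OF q] by (simp add: quadratic_semiring_def)
qed

text \<open>Associativity, units, annihilation and left distributivity are strict already for
  objects. Only the two commutative laws use an isomorphism; right distributivity then follows from
  commutativity.\<close>

lemma comm_semiring_quadratic: "comm_semiring_struct (quadratic_semiring (Rep G))"
proof -
  let ?S = "quadratic_semiring (Rep G)"
  note S = quadratic_class_add quadratic_class_mult quadratic_semiring_one quadratic_semiring_zero
    orthogonal_Unit orthogonal_ZeroObj orthogonal_DSum orthogonal_TObj
  have elem: "\<exists>M. orthogonal M \<and> x = quadratic_class M" if "x \<in> carrier ?S" for x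
    using that unfolding carrier_quadratic_semiring by blast
  have add_comm: "x \<oplus>\<^bsub>?S\<^esub> y = y \<oplus>\<^bsub>?S\<^esub> x" if xy: "x \<in> carrier ?S" "y \<in> carrier ?S" for x y
  proof -
    from elem[OF xy(1)] obtain M where M: "orthogonal M" "x = quadratic_class M" by blast
    from elem[OF xy(2)] obtain N where N: "orthogonal N" "y = quadratic_class N" by blast
    have "rep_iso (M \<uplus>\<^bsub>Rep G\<^esub> N) (N \<uplus>\<^bsub>Rep G\<^esub> M)"
      by (rule rep_iso_DSum_comm[OF orthogonal_rep[OF N(1)] orthogonal_rep[OF M(1)]])
    then show ?thesis using M N by (simp add: S quadratic_class_eqI)
  qed
  have mult_comm: "x \<otimes>\<^bsub>?S\<^esub> y = y \<otimes>\<^bsub>?S\<^esub> x" if xy: "x \<in> carrier ?S" "y \<in> carrier ?S" for x y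
  proof -
    from elem[OF xy(1)] obtain M where M: "orthogonal M" "x = quadratic_class M" by blast
    from elem[OF xy(2)] obtain N where N: "orthogonal N" "y = quadratic_class N" by blast
    have "rep_iso (M \<boxtimes>\<^bsub>Rep G\<^esub> N) (N \<boxtimes>\<^bsub>Rep G\<^esub> M)"
      by (rule rep_iso_TObj_comm[OF orthogonal_rep[OF M(1)] orthogonal_rep[OF N(1)]])
    then show ?thesis using M N by (simp add: S quadratic_class_eqI)
  qed
  have add_closed: "x \<oplus>\<^bsub>?S\<^esub> y \<in> carrier ?S" and mult_closed: "x \<otimes>\<^bsub>?S\<^esub> y \<in> carrier ?S"
    if xy: "x \<in> carrier ?S" "y \<in> carrier ?S" for x y
    using elem[OF xy(1)] elem[OF xy(2)] by (auto simp: S)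
  have add_assoc: "x \<oplus>\<^bsub>?S\<^esub> y \<oplus>\<^bsub>?S\<^esub> z = x \<oplus>\<^bsub>?S\<^esub> (y \<oplus>\<^bsub>?S\<^esub> z)"
    and mult_assoc: "x \<otimes>\<^bsub>?S\<^esub> y \<otimes>\<^bsub>?S\<^esub> z = x \<otimes>\<^bsub>?S\<^esub> (y \<otimes>\<^bsub>?S\<^esub> z)"
    and distr: "(x \<oplus>\<^bsub>?S\<^esub> y) \<otimes>\<^bsub>?S\<^esub> z = x \<otimes>\<^bsub>?S\<^esub> z \<oplus>\<^bsub>?S\<^esub> y \<otimes>\<^bsub>?S\<^esub> z"
    if xyz: "x \<in> carrier ?S" "y \<in> carrier ?S" "z \<in> carrier ?S" for x y z
    using elem[OF xyz(1)] elem[OF xyz(2)] elem[OF xyz(3)]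
    by (auto simp: S DSum_assoc TObj_assoc TObj_DSum orthogonal_rep)
  have unit: "\<one>\<^bsub>?S\<^esub> \<otimes>\<^bsub>?S\<^esub> x = x" "\<zero>\<^bsub>?S\<^esub> \<oplus>\<^bsub>?S\<^esub> x = x" "\<zero>\<^bsub>?S\<^esub> \<otimes>\<^bsub>?S\<^esub> x = \<zero>\<^bsub>?S\<^esub>"
    if x: "x \<in> carrier ?S" for x
    using elem[OF x] by (auto simp: S TObj_Unit DSum_ZeroObj TObj_ZeroObj orthogonal_rep)
  have one: "\<one>\<^bsub>?S\<^esub> \<in> carrier ?S" "\<zero>\<^bsub>?S\<^esub> \<in> carrier ?S"
    by (simp_all add: S)
  have mon: "comm_monoid ?S"
    by (rule comm_monoidI) (use mult_closed one mult_assoc unit mult_comm in auto)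
  interpret comm_monoid ?S by (rule mon)
  have "abelian_monoid ?S"
    by (rule abelian_monoidI) (use add_closed one add_assoc unit add_comm in auto)
  then interpret abelian_monoid ?S .
  show ?thesis
    by unfold_locales
      (use distr mult_comm add_closed mult_closed unit one in \<open>simp_all\<close>)
qed

text \<open>The flip is an involution, so hyperbolic objects are formed from all
  representations.\<close>

lemma weakly_symmetric_objects_Rep: "weakly_symmetric_objects (Rep G) = representations G"
proof -
  have "ev_mat n * (flip_mat n n * flip_mat n n) = ev_mat n" for n
    unfolding flip_mat_flip_mat by (rule right_mult_one_mat[of _ 1]) (simp add: ev_mat_def)
  then show ?thesis by (auto simp: weakly_symmetric_objects_def)
qed

lemma isomorphism_rel_Rep: "isomorphism_rel (Rep G) = {(M, N). rep_iso M N}"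
  unfolding isomorphism_rel_def weakly_symmetric_objects_Rep rep_iso_def by blast

lemma equiv_isomorphism_rel: "equiv (representations G) (isomorphism_rel (Rep G))"
proof (rule equivI)
  show "isomorphism_rel (Rep G) \<subseteq> representations G \<times> representations G"
    unfolding isomorphism_rel_Rep using rep_iso_reps by blast
  show "refl_on (representations G) (isomorphism_rel (Rep G))"
    unfolding isomorphism_rel_Rep refl_on_def using rep_iso_refl by blast
  show "sym (isomorphism_rel (Rep G))"
    unfolding isomorphism_rel_Rep sym_def using rep_iso_sym by blast
  show "trans (isomorphism_rel (Rep G))"
    unfolding isomorphism_rel_Rep trans_def using rep_iso_trans by blast
qed

lemma carrier_weakly_symmetric_monoid:
  "carrier (weakly_symmetric_monoid (Rep G)) = {isomorphism_rel (Rep G) `` {M} | M. M \<in> representations G}"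
  by (auto simp: weakly_symmetric_monoid_def weakly_symmetric_objects_Rep quotient_def)

lemma weakly_symmetric_monoid_mult:
  "M \<in> representations G \<Longrightarrow> N \<in> representations G \<Longrightarrow>
    isomorphism_rel (Rep G) `` {M} \<otimes>\<^bsub>weakly_symmetric_monoid (Rep G)\<^esub> isomorphism_rel (Rep G) `` {N} =
    isomorphism_rel (Rep G) `` {M \<uplus>\<^bsub>Rep G\<^esub> N}"
  unfolding weakly_symmetric_monoid_def
  by (simp, rule class_op_class[OF equiv_isomorphism_rel]) (auto simp: isomorphism_rel_Rep rep_iso_DSum)

definition hyperbolic_sum where
  "hyperbolic_sum M = M \<uplus>\<^bsub>Rep G\<^esub> Dual (Rep G) M"

lemma hyperbolic_sum_iso: "rep_iso M N \<Longrightarrow> rep_iso (hyperbolic_sum M) (hyperbolic_sum N)"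
  unfolding hyperbolic_sum_def by (intro rep_iso_DSum rep_iso_Dual)

lemma orthogonal_hyperbolic_sum: "M \<in> representations G \<Longrightarrow> orthogonal (hyperbolic_sum M)"
  unfolding hyperbolic_sum_def by (rule orthogonal_hyperbolic)

lemma hyperbolic_class_Rep:
  assumes M: "M \<in> representations G"
  shows "hyperbolic_class (Rep G) (isomorphism_rel (Rep G) `` {M}) = quadratic_class (hyperbolic_sum M)"
proof -
  have "isometry_rel (Rep G) `` {hyperbolic (Rep G) N} = quadratic_class (hyperbolic_sum M)"
    if "rep_iso M N" for N
  proof -
    have "isometry_rel (Rep G) `` {hyperbolic (Rep G) N} = quadratic_class (hyperbolic_sum N)"
      using hyperbolic_Rep[OF rep_iso_reps(2)[OF that]] isometry_class by (simp add: hyperbolic_sum_def)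
    then show ?thesis using quadratic_class_eqI[OF hyperbolic_sum_iso[OF that]] by simp
  qed
  moreover have "rep_iso M M" using M by (rule rep_iso_refl)
  ultimately show ?thesis
    unfolding hyperbolic_class_def isomorphism_rel_Rep by blast
qed

lemma rep_iso_hyperbolic_sum_DSum:
  assumes M: "M \<in> representations G" and N: "N \<in> representations G"
  shows "rep_iso (hyperbolic_sum (M \<uplus>\<^bsub>Rep G\<^esub> N)) (hyperbolic_sum M \<uplus>\<^bsub>Rep G\<^esub> hyperbolic_sum N)"
proof -
  let ?M = "Dual (Rep G) M" and ?N = "Dual (Rep G) N"
  have D: "?M \<in> representations G" "?N \<in> representations G" using M N by simp_all
  have swap: "rep_iso (N \<uplus>\<^bsub>Rep G\<^esub> ?M) (?M \<uplus>\<^bsub>Rep G\<^esub> N)" by (rule rep_iso_DSum_comm[OF D(1) N])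
  have "hyperbolic_sum (M \<uplus>\<^bsub>Rep G\<^esub> N) = M \<uplus>\<^bsub>Rep G\<^esub> ((N \<uplus>\<^bsub>Rep G\<^esub> ?M) \<uplus>\<^bsub>Rep G\<^esub> ?N)"
    using M N D by (simp add: hyperbolic_sum_def Dual_DSum DSum_assoc)
  moreover have "hyperbolic_sum M \<uplus>\<^bsub>Rep G\<^esub> hyperbolic_sum N = M \<uplus>\<^bsub>Rep G\<^esub> ((?M \<uplus>\<^bsub>Rep G\<^esub> N) \<uplus>\<^bsub>Rep G\<^esub> ?N)"
    using M N D by (simp add: hyperbolic_sum_def DSum_assoc)
  ultimately show ?thesis
    using M D swap by (simp add: rep_iso_DSum rep_iso_refl)
qed

text \<open>After distributing, the second summands differ only by \<open>N\<close> against its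
  dual, and \<open>N\<close> is self-dual because it carries a form. This makes the hyperbolic
  classes closed under multiplication by the semiring.\<close>

lemma rep_iso_hyperbolic_sum_TObj:
  assumes M: "M \<in> representations G" and N: "orthogonal N"
  shows "rep_iso (hyperbolic_sum M \<boxtimes>\<^bsub>Rep G\<^esub> N) (hyperbolic_sum (M \<boxtimes>\<^bsub>Rep G\<^esub> N))"
proof -
  have N': "N \<in> representations G" by (rule orthogonal_rep[OF N])
  have D: "Dual (Rep G) M \<in> representations G" "Dual (Rep G) N \<in> representations G" using M N' by simp_all
  have "hyperbolic_sum M \<boxtimes>\<^bsub>Rep G\<^esub> N = (M \<boxtimes>\<^bsub>Rep G\<^esub> N) \<uplus>\<^bsub>Rep G\<^esub> (Dual (Rep G) M \<boxtimes>\<^bsub>Rep G\<^esub> N)"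
    unfolding hyperbolic_sum_def by (rule TObj_DSum[OF M D(1) N'])
  moreover have "hyperbolic_sum (M \<boxtimes>\<^bsub>Rep G\<^esub> N) =
      (M \<boxtimes>\<^bsub>Rep G\<^esub> N) \<uplus>\<^bsub>Rep G\<^esub> (Dual (Rep G) M \<boxtimes>\<^bsub>Rep G\<^esub> Dual (Rep G) N)"
    unfolding hyperbolic_sum_def Dual_TObj[OF M N'] ..
  ultimately show ?thesis
    using M N' D orthogonal_self_dual[OF N] by (simp add: rep_iso_DSum rep_iso_TObj rep_iso_refl)
qed

definition hyperbolic_classes where
  "hyperbolic_classes = {quadratic_class (hyperbolic_sum M) | M. M \<in> representations G}"

text \<open>The hyperbolic map is additive on isomorphism classes, so its image on Grothendieck
  groups consists of the differences of hyperbolic classes.\<close>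

lemma Witt_ring_Rep:
  "Witt_ring (Rep G) = K0_ring (quadratic_semiring (Rep G)) Quot
     comm_semiring_struct.diff_ideal (quadratic_semiring (Rep G)) hyperbolic_classes"
proof -
  let ?S = "quadratic_semiring (Rep G)" and ?W = "weakly_symmetric_monoid (Rep G)"
  interpret S: comm_semiring_struct ?S by (rule comm_semiring_quadratic)
  have image: "hyperbolic_class (Rep G) ` carrier ?W = hyperbolic_classes"
  proof (intro equalityI subsetI)
    fix X assume "X \<in> hyperbolic_class (Rep G) ` carrier ?W"
    then obtain M where "M \<in> representations G" "X = hyperbolic_class (Rep G) (isomorphism_rel (Rep G) `` {M})"
      unfolding carrier_weakly_symmetric_monoid by blast
    then show "X \<in> hyperbolic_classes"
      unfolding hyperbolic_classes_def using hyperbolic_class_Rep by blast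
  next
    fix X assume "X \<in> hyperbolic_classes"
    then obtain M where "M \<in> representations G" "X = hyperbolic_class (Rep G) (isomorphism_rel (Rep G) `` {M})"
      unfolding hyperbolic_classes_def using hyperbolic_class_Rep by blast
    then show "X \<in> hyperbolic_class (Rep G) ` carrier ?W"
      unfolding carrier_weakly_symmetric_monoid by blast
  qed
  have "K0_map (add_monoid ?S) (hyperbolic_class (Rep G)) ` carrier (K0 ?W) = S.diff_ideal hyperbolic_classes"
    unfolding image[symmetric]
  proof (rule S.K0_map_image)
    fix a assume "a \<in> carrier ?W"
    then obtain M where M: "M \<in> representations G" "a = isomorphism_rel (Rep G) `` {M}"
      unfolding carrier_weakly_symmetric_monoid by blast
    show "hyperbolic_class (Rep G) a \<in> carrier ?S"
      unfolding M(2) hyperbolic_class_Rep[OF M(1)] using orthogonal_hyperbolic_sum[OF M(1)] by simp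
    fix b assume "b \<in> carrier ?W"
    then obtain N where N: "N \<in> representations G" "b = isomorphism_rel (Rep G) `` {N}"
      unfolding carrier_weakly_symmetric_monoid by blast
    have MN: "M \<uplus>\<^bsub>Rep G\<^esub> N \<in> representations G" using M N by simp
    show "a \<otimes>\<^bsub>?W\<^esub> b \<in> carrier ?W"
      unfolding M(2) N(2) weakly_symmetric_monoid_mult[OF M(1) N(1)]
      unfolding carrier_weakly_symmetric_monoid using MN by blast
    show "hyperbolic_class (Rep G) (a \<otimes>\<^bsub>?W\<^esub> b) = hyperbolic_class (Rep G) a \<oplus>\<^bsub>?S\<^esub> hyperbolic_class (Rep G) b"
      unfolding M(2) N(2) weakly_symmetric_monoid_mult[OF M(1) N(1)] hyperbolic_class_Rep[OF M(1)]
        hyperbolic_class_Rep[OF N(1)] hyperbolic_class_Rep[OF MN]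
        quadratic_class_add[OF orthogonal_hyperbolic_sum[OF M(1)] orthogonal_hyperbolic_sum[OF N(1)]]
      by (rule quadratic_class_eqI[OF rep_iso_hyperbolic_sum_DSum[OF M(1) N(1)]])
  qed
  then show ?thesis by (simp add: Witt_ring_def)
qed

lemma ideal_hyperbolic_classes:
  "ideal (comm_semiring_struct.diff_ideal (quadratic_semiring (Rep G)) hyperbolic_classes)
     (K0_ring (quadratic_semiring (Rep G)))"
proof -
  let ?S = "quadratic_semiring (Rep G)"
  interpret S: comm_semiring_struct ?S by (rule comm_semiring_quadratic)
  show ?thesis
  proof (rule S.ideal_diff_ideal)
    show "hyperbolic_classes \<subseteq> carrier ?S"
      unfolding hyperbolic_classes_def using orthogonal_hyperbolic_sum quadratic_class_closed by blast
    have "hyperbolic_sum (ZeroObj (Rep G)) = ZeroObj (Rep G)"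
    proof -
      have "Dual (Rep G) (ZeroObj (Rep G)) = ZeroObj (Rep G)" by (rule rep_eqI) simp_all
      then show ?thesis by (simp add: hyperbolic_sum_def DSum_ZeroObj)
    qed
    then show "\<zero>\<^bsub>?S\<^esub> \<in> hyperbolic_classes"
      unfolding quadratic_semiring_zero hyperbolic_classes_def using ZeroObj_rep by (metis (mono_tags, lifting) mem_Collect_eq)
    fix a assume "a \<in> hyperbolic_classes"
    then obtain M where M: "M \<in> representations G" "a = quadratic_class (hyperbolic_sum M)"
      unfolding hyperbolic_classes_def by blast
    note oM = orthogonal_hyperbolic_sum[OF M(1)]
    {
      fix b assume "b \<in> hyperbolic_classes"
      then obtain N where N: "N \<in> representations G" "b = quadratic_class (hyperbolic_sum N)"
        unfolding hyperbolic_classes_def by blast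
      have "a \<oplus>\<^bsub>?S\<^esub> b = quadratic_class (hyperbolic_sum (M \<uplus>\<^bsub>Rep G\<^esub> N))"
        unfolding M(2) N(2) quadratic_class_add[OF oM orthogonal_hyperbolic_sum[OF N(1)]]
        by (rule quadratic_class_eqI[OF rep_iso_sym[OF rep_iso_hyperbolic_sum_DSum[OF M(1) N(1)]]])
      moreover have "M \<uplus>\<^bsub>Rep G\<^esub> N \<in> representations G" using M N by simp
      ultimately show "a \<oplus>\<^bsub>?S\<^esub> b \<in> hyperbolic_classes"
        unfolding hyperbolic_classes_def by blast
    next
      fix c assume "c \<in> carrier ?S"
      then obtain N where N: "orthogonal N" "c = quadratic_class N"
        unfolding carrier_quadratic_semiring by blast
      have "a \<otimes>\<^bsub>?S\<^esub> c = quadratic_class (hyperbolic_sum (M \<boxtimes>\<^bsub>Rep G\<^esub> N))"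
        unfolding M(2) N(2) quadratic_class_mult[OF oM N(1)]
        by (rule quadratic_class_eqI[OF rep_iso_hyperbolic_sum_TObj[OF M(1) N(1)]])
      moreover have "M \<boxtimes>\<^bsub>Rep G\<^esub> N \<in> representations G" using M orthogonal_rep[OF N(1)] by simp
      ultimately show "a \<otimes>\<^bsub>?S\<^esub> c \<in> hyperbolic_classes"
        unfolding hyperbolic_classes_def by blast
    }
  qed
qed

lemma cring_Witt_ring: "cring (Witt_ring (Rep G))"
  unfolding Witt_ring_Rep
  by (rule ideal.quotient_is_cring[OF ideal_hyperbolic_classes
        comm_semiring_struct.cring_K0_ring[OF comm_semiring_quadratic]])

end

text \<open>Reduces the claim to isomorphism classes of objects: \<Phi> is only a map on objects,
  and no action on arrows or compatibility with chosen forms enters.\<close>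

lemma Witt_ring_iso:
  fixes G :: "('a, 'y) monoid_scheme" and H :: "('b, 'z) monoid_scheme" and \<Phi> :: "'a rep \<Rightarrow> 'b rep"
  assumes "group G" "group H"
    and rep: "\<And>M. M \<in> representations G \<Longrightarrow> \<Phi> M \<in> representations H"
    and iso: "\<And>M N. M \<in> representations G \<Longrightarrow> N \<in> representations G \<Longrightarrow>
      group_reps.rep_iso H (\<Phi> M) (\<Phi> N) \<longleftrightarrow> group_reps.rep_iso G M N"
    and surj: "\<And>N. N \<in> representations H \<Longrightarrow> \<exists>M\<in>representations G. group_reps.rep_iso H (\<Phi> M) N"
    and orth: "\<And>M. M \<in> representations G \<Longrightarrow> group_reps.orthogonal H (\<Phi> M) \<longleftrightarrow> group_reps.orthogonal G M"
    and sum: "\<And>M N. M \<in> representations G \<Longrightarrow> N \<in> representations G \<Longrightarrow>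
      group_reps.rep_iso H (\<Phi> (M \<uplus>\<^bsub>Rep G\<^esub> N)) (\<Phi> M \<uplus>\<^bsub>Rep H\<^esub> \<Phi> N)"
    and tensor: "\<And>M N. M \<in> representations G \<Longrightarrow> N \<in> representations G \<Longrightarrow>
      group_reps.rep_iso H (\<Phi> (M \<boxtimes>\<^bsub>Rep G\<^esub> N)) (\<Phi> M \<boxtimes>\<^bsub>Rep H\<^esub> \<Phi> N)"
    and unit: "group_reps.rep_iso H (\<Phi> (Unit (Rep G))) (Unit (Rep H))"
    and dual: "\<And>M. M \<in> representations G \<Longrightarrow>
      group_reps.rep_iso H (\<Phi> (Dual (Rep G) M)) (Dual (Rep H) (\<Phi> M))"
  shows "Witt_ring (Rep G) \<simeq> Witt_ring (Rep H)"
proof -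
  interpret G: group_reps G by (rule group_reps.intro) fact
  interpret H: group_reps H by (rule group_reps.intro) fact
  let ?S = "quadratic_semiring (Rep G)" and ?T = "quadratic_semiring (Rep H)"
  interpret S: comm_semiring_struct ?S by (rule G.comm_semiring_quadratic)
  interpret T: comm_semiring_struct ?T by (rule H.comm_semiring_quadratic)
  define \<theta> where "\<theta> X = (\<Union>x\<in>X. H.quadratic_class (\<Phi> (fst x)))" for X :: "('a rep \<times> complex mat) set"
  have \<theta>: "\<theta> (G.quadratic_class M) = H.quadratic_class (\<Phi> M)" if M: "G.orthogonal M" for M
  proof -
    have "H.quadratic_class (\<Phi> (fst x)) = H.quadratic_class (\<Phi> M)" if "x \<in> G.quadratic_class M" for x
    proof -
      have "G.rep_iso M (fst x)" using that by (simp add: G.quadratic_class_def)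
      then have "H.rep_iso (\<Phi> M) (\<Phi> (fst x))"
        using iso G.rep_iso_reps by blast
      then show ?thesis using H.quadratic_class_eqI by metis
    qed
    moreover obtain b where "(M, b) \<in> G.quadratic_class M"
      using M G.rep_iso_refl[OF G.orthogonal_rep[OF M]] by (auto simp: G.orthogonal_def G.quadratic_class_def)
    ultimately show ?thesis unfolding \<theta>_def by blast
  qed
  have elem: "\<exists>M. G.orthogonal M \<and> x = G.quadratic_class M" if "x \<in> carrier ?S" for x
    using that unfolding G.carrier_quadratic_semiring by blast
  have orthH: "H.orthogonal (\<Phi> M)" if "G.orthogonal M" for M
    using orth[OF G.orthogonal_rep[OF that]] that by simp
  have \<theta>iso: "\<theta> \<in> ring_iso ?S ?T"
  proof (rule ring_iso_memI)
    show "\<theta> \<one>\<^bsub>?S\<^esub> = \<one>\<^bsub>?T\<^esub>"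
      unfolding G.quadratic_semiring_one H.quadratic_semiring_one \<theta>[OF G.orthogonal_Unit]
      by (rule H.quadratic_class_eqI[OF unit])
    fix x y assume xy: "x \<in> carrier ?S" "y \<in> carrier ?S"
    from elem[OF xy(1)] obtain M where M: "G.orthogonal M" "x = G.quadratic_class M" by blast
    from elem[OF xy(2)] obtain N where N: "G.orthogonal N" "y = G.quadratic_class N" by blast
    show "\<theta> x \<in> carrier ?T"
      unfolding M(2) \<theta>[OF M(1)] by (rule H.quadratic_class_closed[OF orthH[OF M(1)]])
    show "\<theta> (x \<oplus>\<^bsub>?S\<^esub> y) = \<theta> x \<oplus>\<^bsub>?T\<^esub> \<theta> y"
      unfolding M(2) N(2) G.quadratic_class_add[OF M(1) N(1)] \<theta>[OF M(1)] \<theta>[OF N(1)]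
        \<theta>[OF G.orthogonal_DSum[OF M(1) N(1)]] H.quadratic_class_add[OF orthH[OF M(1)] orthH[OF N(1)]]
      by (rule H.quadratic_class_eqI[OF sum[OF G.orthogonal_rep[OF M(1)] G.orthogonal_rep[OF N(1)]]])
    show "\<theta> (x \<otimes>\<^bsub>?S\<^esub> y) = \<theta> x \<otimes>\<^bsub>?T\<^esub> \<theta> y"
      unfolding M(2) N(2) G.quadratic_class_mult[OF M(1) N(1)] \<theta>[OF M(1)] \<theta>[OF N(1)]
        \<theta>[OF G.orthogonal_TObj[OF M(1) N(1)]] H.quadratic_class_mult[OF orthH[OF M(1)] orthH[OF N(1)]]
      by (rule H.quadratic_class_eqI[OF tensor[OF G.orthogonal_rep[OF M(1)] G.orthogonal_rep[OF N(1)]]])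
  next
    show "bij_betw \<theta> (carrier ?S) (carrier ?T)"
      unfolding bij_betw_def
    proof
      show "inj_on \<theta> (carrier ?S)"
      proof (rule inj_onI)
        fix x y assume xy: "x \<in> carrier ?S" "y \<in> carrier ?S" and eq: "\<theta> x = \<theta> y"
        from elem[OF xy(1)] obtain M where M: "G.orthogonal M" "x = G.quadratic_class M" by blast
        from elem[OF xy(2)] obtain N where N: "G.orthogonal N" "y = G.quadratic_class N" by blast
        have "H.rep_iso (\<Phi> M) (\<Phi> N)"
          using eq H.quadratic_class_eq_iff[OF orthH[OF M(1)] orthH[OF N(1)]]
          unfolding M(2) N(2) \<theta>[OF M(1)] \<theta>[OF N(1)] by blast
        then have "G.rep_iso M N"
          using iso[OF G.orthogonal_rep[OF M(1)] G.orthogonal_rep[OF N(1)]] by blast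
        then show "x = y" unfolding M(2) N(2) by (rule G.quadratic_class_eqI)
      qed
      show "\<theta> ` carrier ?S = carrier ?T"
      proof (intro equalityI subsetI)
        fix z assume "z \<in> \<theta> ` carrier ?S"
        then obtain M where "G.orthogonal M" "z = \<theta> (G.quadratic_class M)" using elem by blast
        then show "z \<in> carrier ?T" using \<theta> orthH H.quadratic_class_closed by metis
      next
        fix z assume "z \<in> carrier ?T"
        then obtain N where N: "H.orthogonal N" "z = H.quadratic_class N"
          unfolding H.carrier_quadratic_semiring by blast
        from surj[OF H.orthogonal_rep[OF N(1)]] obtain M where M: "M \<in> representations G" "H.rep_iso (\<Phi> M) N"
          by blast
        \<comment> \<open>A form on \<open>N\<close> moves along the isomorphism to \<Phi> M, and
          \<open>orth\<close> reflects it to \<open>M\<close>, so the preimage lies in the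
          semiring.\<close>
        have "H.orthogonal (\<Phi> M)" by (rule H.orthogonal_iso[OF N(1) H.rep_iso_sym[OF M(2)]])
        then have oM: "G.orthogonal M" using orth[OF M(1)] by blast
        have "z = \<theta> (G.quadratic_class M)"
          unfolding N(2) \<theta>[OF oM] by (rule H.quadratic_class_eqI[OF H.rep_iso_sym[OF M(2)]])
        then show "z \<in> \<theta> ` carrier ?S" using G.quadratic_class_closed[OF oM] by blast
      qed
    qed
  qed
  have hyp: "\<theta> (G.quadratic_class (G.hyperbolic_sum M)) = H.quadratic_class (H.hyperbolic_sum (\<Phi> M))"
    if M: "M \<in> representations G" for M
  proof -
    have "H.rep_iso (\<Phi> (M \<uplus>\<^bsub>Rep G\<^esub> Dual (Rep G) M)) (\<Phi> M \<uplus>\<^bsub>Rep H\<^esub> \<Phi> (Dual (Rep G) M))"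
      using M by (intro sum) simp_all
    moreover have "H.rep_iso (\<Phi> M \<uplus>\<^bsub>Rep H\<^esub> \<Phi> (Dual (Rep G) M)) (\<Phi> M \<uplus>\<^bsub>Rep H\<^esub> Dual (Rep H) (\<Phi> M))"
      by (intro H.rep_iso_DSum H.rep_iso_refl rep dual M)
    ultimately have "H.rep_iso (\<Phi> (G.hyperbolic_sum M)) (H.hyperbolic_sum (\<Phi> M))"
      unfolding G.hyperbolic_sum_def H.hyperbolic_sum_def by (rule H.rep_iso_trans)
    then show ?thesis
      unfolding \<theta>[OF G.orthogonal_hyperbolic_sum[OF M]] by (rule H.quadratic_class_eqI)
  qed
  have classes: "\<theta> ` G.hyperbolic_classes = H.hyperbolic_classes"
  proof (intro equalityI subsetI)
    fix z assume "z \<in> \<theta> ` G.hyperbolic_classes"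
    then show "z \<in> H.hyperbolic_classes"
      unfolding G.hyperbolic_classes_def H.hyperbolic_classes_def using hyp rep by blast
  next
    fix z assume "z \<in> H.hyperbolic_classes"
    then obtain N where N: "N \<in> representations H" "z = H.quadratic_class (H.hyperbolic_sum N)"
      unfolding H.hyperbolic_classes_def by blast
    from surj[OF N(1)] obtain M where M: "M \<in> representations G" "H.rep_iso (\<Phi> M) N" by blast
    have "z = \<theta> (G.quadratic_class (G.hyperbolic_sum M))"
      unfolding hyp[OF M(1)] N(2)
      by (rule H.quadratic_class_eqI[OF H.hyperbolic_sum_iso[OF H.rep_iso_sym[OF M(2)]]])
    then show "z \<in> \<theta> ` G.hyperbolic_classes"
      unfolding G.hyperbolic_classes_def using M(1) by blast
  qed
  have sub: "G.hyperbolic_classes \<subseteq> carrier ?S"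
    unfolding G.hyperbolic_classes_def using G.orthogonal_hyperbolic_sum G.quadratic_class_closed by blast
  obtain \<Theta> where \<Theta>: "\<Theta> \<in> ring_iso (K0_ring ?S) (K0_ring ?T)"
    "\<Theta> ` S.diff_ideal G.hyperbolic_classes = T.diff_ideal (\<theta> ` G.hyperbolic_classes)"
    using ring_iso_K0_ring[OF G.comm_semiring_quadratic H.comm_semiring_quadratic \<theta>iso sub] .
  show ?thesis
    unfolding G.Witt_ring_Rep H.Witt_ring_Rep
  proof (rule FactRing_ring_iso[OF _ _ \<Theta>(1) H.ideal_hyperbolic_classes])
    show "ring (K0_ring ?S)" "ring (K0_ring ?T)"
      using S.cring_K0_ring T.cring_K0_ring by (simp_all add: cring.axioms(1))
    show "S.diff_ideal G.hyperbolic_classes \<subseteq> carrier (K0_ring ?S)"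
      using ideal.axioms(1)[OF G.ideal_hyperbolic_classes] by (rule additive_subgroup.a_subset)
    show "\<Theta> ` S.diff_ideal G.hyperbolic_classes = T.diff_ideal H.hyperbolic_classes"
      unfolding \<Theta>(2) classes ..
  qed
qed

section \<open>Symmetry of forms via traces\<close>

context group_reps
begin

text \<open>For an arbitrary matrix \<open>X\<close> the sum of its conjugates under the group is an
  endomorphism of \<open>N\<close>. Since \<beta> commutes with the action, the trace of \<beta>
  times this sum is the group order times the trace of \<open>\<beta> * X\<close>. The order is a
  nonzero scalar, so the hypothesis extends from endomorphisms to all matrices.\<close>

lemma trace_form_nondegenerate:
  assumes fin: "finite (carrier G)" and N: "N \<in> representations G"
    and \<beta>: "\<beta> \<in> intertwiners G N N"
    and tr: "\<And>f. f \<in> intertwiners G N N \<Longrightarrow> mat_trace (\<beta> * f) = 0"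
  shows "\<beta> = 0\<^sub>m (fst N) (fst N)"
proof -
  let ?n = "fst N" and ?\<rho> = "snd N"
  have \<beta>c: "\<beta> \<in> carrier_mat ?n ?n" by (rule intertwiners_carrier[OF \<beta>])
  have zero: "mat_trace (\<beta> * X) = 0" if X: "X \<in> carrier_mat ?n ?n" for X
  proof -
    define K where "K h = ?\<rho> h * X * ?\<rho> (inv h)" for h
    define f where "f = mat ?n ?n (\<lambda>(i, j). \<Sum>h\<in>carrier G. K h $$ (i, j))"
    have K: "K h \<in> carrier_mat ?n ?n" if "h \<in> carrier G" for h
      using rep_dim[OF N] that X by (auto simp: K_def intro!: carrier_matI)
    have fc: "f \<in> carrier_mat ?n ?n" by (simp add: f_def)
    have sum_left: "(A * f) $$ (i, j) = (\<Sum>h\<in>carrier G. (A * K h) $$ (i, j))"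
      if A: "A \<in> carrier_mat ?n ?n" and ij: "i < ?n" "j < ?n" for A i j
    proof -
      have "(A * f) $$ (i, j) = (\<Sum>k = 0..<?n. A $$ (i, k) * f $$ (k, j))"
        using A fc ij by (subst index_mult_mat_sum) auto
      also have "\<dots> = (\<Sum>k = 0..<?n. \<Sum>h\<in>carrier G. A $$ (i, k) * K h $$ (k, j))"
        using ij by (intro sum.cong) (auto simp: f_def sum_distrib_left)
      also have "\<dots> = (\<Sum>h\<in>carrier G. \<Sum>k = 0..<?n. A $$ (i, k) * K h $$ (k, j))"
        by (rule sum.swap)
      also have "\<dots> = (\<Sum>h\<in>carrier G. (A * K h) $$ (i, j))"
      proof (rule sum.cong[OF refl])
        fix h assume "h \<in> carrier G"
        then show "(\<Sum>k = 0..<?n. A $$ (i, k) * K h $$ (k, j)) = (A * K h) $$ (i, j)"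
          using A K[of h] ij by (subst index_mult_mat_sum) auto
      qed
      finally show ?thesis .
    qed
    have sum_right: "(f * A) $$ (i, j) = (\<Sum>h\<in>carrier G. (K h * A) $$ (i, j))"
      if A: "A \<in> carrier_mat ?n ?n" and ij: "i < ?n" "j < ?n" for A i j
    proof -
      have "(f * A) $$ (i, j) = (\<Sum>k = 0..<?n. f $$ (i, k) * A $$ (k, j))"
        using A fc ij by (subst index_mult_mat_sum) auto
      also have "\<dots> = (\<Sum>k = 0..<?n. \<Sum>h\<in>carrier G. K h $$ (i, k) * A $$ (k, j))"
        using ij by (intro sum.cong) (auto simp: f_def sum_distrib_right)
      also have "\<dots> = (\<Sum>h\<in>carrier G. \<Sum>k = 0..<?n. K h $$ (i, k) * A $$ (k, j))"
        by (rule sum.swap)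
      also have "\<dots> = (\<Sum>h\<in>carrier G. (K h * A) $$ (i, j))"
      proof (rule sum.cong[OF refl])
        fix h assume "h \<in> carrier G"
        then show "(\<Sum>k = 0..<?n. K h $$ (i, k) * A $$ (k, j)) = (K h * A) $$ (i, j)"
          using A K[of h] ij by (subst index_mult_mat_sum) auto
      qed
      finally show ?thesis .
    qed
    have "f \<in> intertwiners G N N"
      unfolding intertwiners_iff
    proof (intro conjI ballI fc)
      fix g assume g: "g \<in> carrier G"
      note r = rep_carrier[OF N g]
      \<comment> \<open>Moving \<open>g\<close> past a summand translates its index by
        \<open>g\<close>; the sum over the whole group is unchanged.\<close>
      have shift: "?\<rho> g * K h = K (g \<otimes> h) * ?\<rho> g" if h: "h \<in> carrier G" for h
      proof -
        have d: "dim_row (?\<rho> k) = ?n" "dim_col (?\<rho> k) = ?n" if "k \<in> carrier G" for k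
          using rep_dim[OF N that] .
        have "K (g \<otimes> h) * ?\<rho> g = ?\<rho> g * (?\<rho> h * (X * (?\<rho> (inv h) * (?\<rho> (inv g) * ?\<rho> g))))"
          unfolding K_def using g h X
          by (simp add: rep_mult[OF N] inv_mult_group mat_mult_assoc d)
        also have "\<dots> = ?\<rho> g * (?\<rho> h * (X * ?\<rho> (inv h)))"
          using rep_inv(1)[OF N g] rep_carrier[OF N inv_closed[OF h]] by simp
        also have "\<dots> = ?\<rho> g * K h"
          unfolding K_def using g h X by (simp add: mat_mult_assoc d)
        finally show ?thesis by simp
      qed
      show "f * ?\<rho> g = ?\<rho> g * f"
      proof (rule eq_matI)
        fix i j assume "i < dim_row (?\<rho> g * f)" "j < dim_col (?\<rho> g * f)"
        then have ij: "i < ?n" "j < ?n" using r fc by auto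
        have "(?\<rho> g * f) $$ (i, j) = (\<Sum>h\<in>carrier G. (K (g \<otimes> h) * ?\<rho> g) $$ (i, j))"
          unfolding sum_left[OF r ij] by (rule sum.cong) (simp_all add: shift)
        also have "\<dots> = (\<Sum>h\<in>carrier G. (K h * ?\<rho> g) $$ (i, j))"
          by (rule sum.reindex_bij_betw[where g = "\<lambda>h. (K h * ?\<rho> g) $$ (i, j)"])
            (simp add: bij_betw_def inj_on_cmult[OF g] surj_const_mult[OF g])
        finally show "(f * ?\<rho> g) $$ (i, j) = (?\<rho> g * f) $$ (i, j)"
          unfolding sum_right[OF r ij] by simp
      qed (use r fc in auto)
    qed
    then have "0 = mat_trace (\<beta> * f)" using tr by simp
    also have "\<dots> = (\<Sum>i = 0..<?n. \<Sum>h\<in>carrier G. (\<beta> * K h) $$ (i, i))"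
      unfolding mat_trace_def using \<beta>c by (intro sum.cong) (auto simp: sum_left[OF \<beta>c] simp del: index_mult_mat(1))
    also have "\<dots> = (\<Sum>h\<in>carrier G. mat_trace (\<beta> * K h))"
      unfolding mat_trace_def using \<beta>c by (subst sum.swap) simp
    also have "\<dots> = (\<Sum>h\<in>carrier G. mat_trace (\<beta> * X))"
    proof (rule sum.cong[OF refl])
      fix h assume h: "h \<in> carrier G"
      note d = rep_dim[OF N h] rep_dim[OF N inv_closed[OF h]] carrier_matD[OF \<beta>c] carrier_matD[OF X]
      have "mat_trace (\<beta> * K h) = mat_trace ((\<beta> * ?\<rho> h * X) * ?\<rho> (inv h))"
        unfolding K_def by (simp add: mat_mult_assoc d)
      also have "\<dots> = mat_trace (?\<rho> (inv h) * (\<beta> * ?\<rho> h * X))"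
        by (rule mat_trace_mult_comm[of _ ?n ?n]) (use d in \<open>auto intro!: carrier_matI\<close>)
      also have "\<beta> * ?\<rho> h = ?\<rho> h * \<beta>"
        using \<beta> h by (simp add: intertwiners_iff)
      also have "?\<rho> (inv h) * (?\<rho> h * \<beta> * X) = (?\<rho> (inv h) * ?\<rho> h) * (\<beta> * X)"
        by (simp add: mat_mult_assoc d)
      also have "\<dots> = \<beta> * X"
        unfolding rep_inv(1)[OF N h] by (rule left_mult_one_mat[OF mult_carrier_mat[OF \<beta>c X]])
      finally show "mat_trace (\<beta> * K h) = mat_trace (\<beta> * X)" .
    qed
    also have "\<dots> = of_nat (card (carrier G)) * mat_trace (\<beta> * X)" by simp
    finally show ?thesis
      using fin one_closed by (auto simp: card_eq_0_iff)
  qed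
  show ?thesis
  proof (rule eq_matI)
    fix a b assume "a < dim_row (0\<^sub>m ?n ?n :: complex mat)" "b < dim_col (0\<^sub>m ?n ?n :: complex mat)"
    then have ab: "a < ?n" "b < ?n" by auto
    \<comment> \<open>The elementary matrix at position \<open>(b, a)\<close> extracts the entry of
      \<beta> at \<open>(a, b)\<close>.\<close>
    let ?X = "mat ?n ?n (\<lambda>(r, c). if r = b \<and> c = a then 1 else 0) :: complex mat"
    have "mat_trace (\<beta> * ?X) = (\<Sum>i = 0..<?n. \<Sum>k = 0..<?n. if k = b then (if i = a then \<beta> $$ (i, k) else 0) else 0)"
      unfolding mat_trace_def using \<beta>c
      by (intro sum.cong) (auto simp: index_mult_mat_sum mult_delta simp del: index_mult_mat(1))
    also have "\<dots> = \<beta> $$ (a, b)" using ab by simp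
    finally show "\<beta> $$ (a, b) = 0\<^sub>m ?n ?n $$ (a, b)"
      using zero[of ?X] ab by simp
  qed (use \<beta>c in auto)
qed

text \<open>
  Let \<open>\<alpha> = B\<^sup>-\<^sup>1 B\<^sup>T\<close> be the asymmetry of \<open>B\<close>. The first condition on traces says
  \<open>tr (\<alpha> f) = tr (\<alpha>\<^sup>-\<^sup>1 f)\<close> for all endomorphisms \<open>f\<close>, hence \<open>\<alpha>\<^sup>2 = 1\<close>. The projection \<open>f\<close> onto the
  \<open>-1\<close>-eigenspace then satisfies \<open>tr (\<alpha> f) = - tr f\<close>, and vanishes by the second condition.
\<close>

lemma form_symmetric_if_traces:
  assumes fin: "finite (carrier G)" and N: "N \<in> representations G"
    and B: "B \<in> carrier_mat (fst N) (fst N)" and C: "C \<in> carrier_mat (fst N) (fst N)"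
    and BC: "B * C = 1\<^sub>m (fst N)"
    and inv: "\<And>g. g \<in> carrier G \<Longrightarrow> (snd N g)\<^sup>T * B * snd N g = B"
    and tr: "\<And>f. f \<in> intertwiners G N N \<Longrightarrow>
      mat_trace (f\<^sup>T * B * C\<^sup>T) = mat_trace (B * f * C\<^sup>T)"
    and pos: "\<And>f. f \<in> intertwiners G N N \<Longrightarrow> f * f = f \<Longrightarrow>
      \<exists>k::nat. mat_trace (f\<^sup>T * B * C\<^sup>T) = of_nat k"
  shows "B\<^sup>T = B"
proof -
  let ?n = "fst N"
  have CB: "C * B = 1\<^sub>m ?n" by (rule mat_mult_left_right_inverse[OF B C BC])
  define \<alpha> \<alpha>' where "\<alpha> = C * B\<^sup>T" and "\<alpha>' = C\<^sup>T * B"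
  have \<alpha>c: "\<alpha> \<in> carrier_mat ?n ?n" "\<alpha>' \<in> carrier_mat ?n ?n"
    using B C by (auto simp: \<alpha>_def \<alpha>'_def intro!: carrier_matI)
  note d = carrier_matD[OF B] carrier_matD[OF C]
  have BtCt: "B\<^sup>T * C\<^sup>T = 1\<^sub>m ?n"
    using transpose_mult[OF C B] CB by simp
  have \<alpha>\<alpha>': "\<alpha> * \<alpha>' = 1\<^sub>m ?n"
  proof -
    have "\<alpha> * \<alpha>' = C * ((B\<^sup>T * C\<^sup>T) * B)"
      unfolding \<alpha>_def \<alpha>'_def by (simp add: mat_mult_assoc d)
    then show ?thesis unfolding BtCt using B CB by simp
  qed
  have tr1: "mat_trace (f\<^sup>T * B * C\<^sup>T) = mat_trace (\<alpha> * f)"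
    if f: "f \<in> carrier_mat ?n ?n" for f
  proof -
    note df = carrier_matD[OF f]
    have "(\<alpha> * f)\<^sup>T = f\<^sup>T * \<alpha>\<^sup>T"
      by (rule transpose_mult[OF \<alpha>c(1) f])
    also have "\<alpha>\<^sup>T = B * C\<^sup>T"
      unfolding \<alpha>_def using transpose_mult[OF C, of "B\<^sup>T" ?n] B by simp
    finally have "(\<alpha> * f)\<^sup>T = f\<^sup>T * B * C\<^sup>T"
      by (simp add: mat_mult_assoc d df)
    then show ?thesis
      using mat_trace_transpose[OF mult_carrier_mat[OF \<alpha>c(1) f]] by simp
  qed
  have tr2: "mat_trace (B * f * C\<^sup>T) = mat_trace (\<alpha>' * f)" if f: "f \<in> carrier_mat ?n ?n" for f
  proof -
    note df = carrier_matD[OF f]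
    have "mat_trace (B * f * C\<^sup>T) = mat_trace (C\<^sup>T * (B * f))"
      by (rule mat_trace_mult_comm[of _ ?n ?n]) (use d df in \<open>auto intro!: carrier_matI\<close>)
    then show ?thesis unfolding \<alpha>'_def by (simp add: mat_mult_assoc d df)
  qed
  have \<alpha>: "\<alpha> \<in> intertwiners G N N"
    unfolding intertwiners_iff
  proof (intro conjI ballI \<alpha>c(1))
    fix g assume g: "g \<in> carrier G"
    note r = rep_carrier[OF N g]
    note dg = carrier_matD[OF r]
    \<comment> \<open>The transpose of an invariant form is invariant, and so is \<open>C\<close> as
      a copairing; composing the two makes \<alpha> equivariant.\<close>
    have Bt: "(snd N g)\<^sup>T * B\<^sup>T * snd N g = B\<^sup>T"
      using congruence_transpose[OF B r] inv[OF g] by simp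
    have "snd N g * \<alpha> = snd N g * C * ((snd N g)\<^sup>T * B\<^sup>T * snd N g)"
      unfolding Bt \<alpha>_def by (simp add: mat_mult_assoc d dg)
    also have "\<dots> = (snd N g * C * (snd N g)\<^sup>T) * (B\<^sup>T * snd N g)"
      by (simp add: mat_mult_assoc d dg)
    also have "\<dots> = \<alpha> * snd N g"
      unfolding invariant_form_inverse[OF B C r BC inv[OF g] CB] \<alpha>_def by (simp add: mat_mult_assoc d dg)
    finally show "\<alpha> * snd N g = snd N g * \<alpha>" by simp
  qed
  have \<alpha>': "\<alpha>' \<in> intertwiners G N N"
  proof -
    have "iso_arrow (Rep G) N N \<alpha>"
      unfolding iso_arrow_iff[OF N N]
      using \<alpha> \<alpha>c \<alpha>\<alpha>' mat_mult_left_right_inverse[OF \<alpha>c \<alpha>\<alpha>'] by blast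
    then obtain S where S: "S \<in> intertwiners G N N" "S * \<alpha> = 1\<^sub>m ?n"
      by (auto simp: iso_arrow_def inverse_arrows_def)
    have "S = S * (\<alpha> * \<alpha>')"
      unfolding \<alpha>\<alpha>' using intertwiners_carrier[OF S(1)] by simp
    also have "\<dots> = (S * \<alpha>) * \<alpha>'"
      using intertwiners_carrier[OF S(1)] \<alpha>c by (intro mat_mult_assoc[symmetric]) auto
    also have "\<dots> = \<alpha>'" unfolding S(2) using \<alpha>c by simp
    finally show ?thesis using S by simp
  qed
  have sub: "A + (- 1) \<cdot>\<^sub>m A' \<in> intertwiners G N N"
    if "A \<in> intertwiners G N N" "A' \<in> intertwiners G N N" for A A'
    using that N by (intro intertwiner_add intertwiner_smult)
  have "\<alpha> + (- 1) \<cdot>\<^sub>m \<alpha>' = 0\<^sub>m ?n ?n"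
  proof (rule trace_form_nondegenerate[OF fin N sub[OF \<alpha> \<alpha>']])
    fix f assume f: "f \<in> intertwiners G N N"
    note fc = intertwiners_carrier[OF f]
    have "(\<alpha> + (- 1) \<cdot>\<^sub>m \<alpha>') * f = \<alpha> * f + ((- 1) \<cdot>\<^sub>m \<alpha>') * f"
      by (rule add_mult_distrib_mat[OF \<alpha>c(1) _ fc]) (use \<alpha>c in simp)
    also have "((- 1) \<cdot>\<^sub>m \<alpha>') * f = (- 1) \<cdot>\<^sub>m (\<alpha>' * f)"
      by (rule mult_smult_assoc_mat[OF \<alpha>c(2) fc])
    also have "mat_trace (\<alpha> * f + (- 1) \<cdot>\<^sub>m (\<alpha>' * f)) = mat_trace (\<alpha> * f) + mat_trace ((- 1) \<cdot>\<^sub>m (\<alpha>' * f))"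
      by (rule mat_trace_add[of _ ?n]) (use \<alpha>c fc in \<open>auto intro!: carrier_matI\<close>)
    also have "mat_trace ((- 1) \<cdot>\<^sub>m (\<alpha>' * f)) = - 1 * mat_trace (\<alpha>' * f)"
      by (rule mat_trace_smult[OF mult_carrier_mat[OF \<alpha>c(2) fc]])
    finally show "mat_trace ((\<alpha> + (- 1) \<cdot>\<^sub>m \<alpha>') * f) = 0"
      using tr[OF f] tr1[OF fc] tr2[OF fc] by simp
  qed
  then have eq: "\<alpha> = \<alpha>'"
  proof -
    assume z: "\<alpha> + (- 1) \<cdot>\<^sub>m \<alpha>' = 0\<^sub>m ?n ?n"
    show ?thesis
    proof (rule eq_matI)
      fix i j assume ij: "i < dim_row \<alpha>'" "j < dim_col \<alpha>'"
      have "(\<alpha> + (- 1) \<cdot>\<^sub>m \<alpha>') $$ (i, j) = 0" unfolding z using ij \<alpha>c by auto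
      then show "\<alpha> $$ (i, j) = \<alpha>' $$ (i, j)" using ij \<alpha>c by auto
    qed (use \<alpha>c in auto)
  qed
  define f where "f = (1 / 2) \<cdot>\<^sub>m (1\<^sub>m ?n + (- 1) \<cdot>\<^sub>m \<alpha>)"
  have f: "f \<in> intertwiners G N N"
    unfolding f_def using N by (intro intertwiner_smult sub intertwiner_id \<alpha>)
  have fc: "f \<in> carrier_mat ?n ?n" by (rule intertwiners_carrier[OF f])
  have \<alpha>2: "\<alpha> * \<alpha> = 1\<^sub>m ?n" using \<alpha>\<alpha>' eq by simp
  have \<alpha>f: "\<alpha> * f = - f"
  proof -
    have "\<alpha> * f = (1 / 2) \<cdot>\<^sub>m (\<alpha> * (1\<^sub>m ?n + (- 1) \<cdot>\<^sub>m \<alpha>))"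
      unfolding f_def by (rule mult_smult_distrib[OF \<alpha>c(1)]) (use \<alpha>c in auto)
    also have "\<alpha> * (1\<^sub>m ?n + (- 1) \<cdot>\<^sub>m \<alpha>) = \<alpha> * 1\<^sub>m ?n + \<alpha> * ((- 1) \<cdot>\<^sub>m \<alpha>)"
      by (rule mult_add_distrib_mat[OF \<alpha>c(1)]) (use \<alpha>c in auto)
    also have "\<alpha> * ((- 1) \<cdot>\<^sub>m \<alpha>) = (- 1) \<cdot>\<^sub>m 1\<^sub>m ?n"
      using mult_smult_distrib[OF \<alpha>c(1) \<alpha>c(1), of "- 1"] \<alpha>2 by simp
    also have "(1 / 2) \<cdot>\<^sub>m (\<alpha> * 1\<^sub>m ?n + (- 1) \<cdot>\<^sub>m 1\<^sub>m ?n) = - f"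
      using \<alpha>c unfolding f_def by (intro eq_matI) (auto simp: field_simps)
    finally show ?thesis .
  qed
  have ff: "f * f = f"
  proof -
    have "f * f = (1 / 2) \<cdot>\<^sub>m ((1\<^sub>m ?n + (- 1) \<cdot>\<^sub>m \<alpha>) * f)"
      by (subst (1) f_def, rule mult_smult_assoc_mat[OF _ fc]) (use \<alpha>c in auto)
    also have "(1\<^sub>m ?n + (- 1) \<cdot>\<^sub>m \<alpha>) * f = 1\<^sub>m ?n * f + ((- 1) \<cdot>\<^sub>m \<alpha>) * f"
      by (rule add_mult_distrib_mat[OF _ _ fc]) (use \<alpha>c in auto)
    also have "((- 1) \<cdot>\<^sub>m \<alpha>) * f = (- 1) \<cdot>\<^sub>m (- f)"
      unfolding mult_smult_assoc_mat[OF \<alpha>c(1) fc] \<alpha>f ..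
    also have "(1 / 2) \<cdot>\<^sub>m (1\<^sub>m ?n * f + (- 1) \<cdot>\<^sub>m (- f)) = f"
      using fc left_mult_one_mat[OF fc] by (intro eq_matI) auto
    finally show ?thesis .
  qed
  obtain k :: nat where k: "mat_trace f = of_nat k" "k = 0 \<longrightarrow> f = 0\<^sub>m ?n ?n"
    using idempotent_trace[OF fc ff] by metis
  obtain l :: nat where l: "mat_trace (\<alpha> * f) = of_nat l"
    using pos[OF f ff] tr1[OF fc] by auto
  have "- of_nat k = (of_nat l :: complex)"
    using l mat_trace_uminus[OF fc] unfolding \<alpha>f k(1) by simp
  then have "of_nat (k + l) = (0 :: complex)" by (simp add: neg_eq_iff_add_eq_0)
  then have "k = 0" by (simp only: of_nat_eq_0_iff)
  then have f0: "f = 0\<^sub>m ?n ?n" using k(2) by blast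
  have \<alpha>1: "\<alpha> = 1\<^sub>m ?n"
  proof (rule eq_matI)
    fix i j assume ij: "i < dim_row (1\<^sub>m ?n)" "j < dim_col (1\<^sub>m ?n)"
    then have "f $$ (i, j) = 0" unfolding f0 by simp
    then show "\<alpha> $$ (i, j) = 1\<^sub>m ?n $$ (i, j)"
      using ij \<alpha>c unfolding f_def by (auto split: if_splits)
  qed (use \<alpha>c in auto)
  have "B\<^sup>T = (B * C) * B\<^sup>T" unfolding BC using B by simp
  also have "\<dots> = B * \<alpha>" unfolding \<alpha>_def by (simp add: mat_mult_assoc d)
  also have "\<dots> = B" unfolding \<alpha>1 using B by simp
  finally show ?thesis .
qed

text \<open>A perfect invariant pairing identifies one factor with the dual of the other. This is
  uniqueness of duals, and it recognises the image of a dual under the equivalence.\<close>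

lemma pairing_dual_iso:
  assumes A: "A \<in> representations G" and A': "A' \<in> representations G"
    and P: "P \<in> carrier_mat (fst A') (fst A)" and Q: "Q \<in> carrier_mat (fst A) (fst A')"
    and PQ: "P * Q = 1\<^sub>m (fst A')" "Q * P = 1\<^sub>m (fst A)"
    and p: "form_row P \<in> intertwiners G (A' \<boxtimes>\<^bsub>Rep G\<^esub> A) (Unit (Rep G))"
  shows "rep_iso A' (Dual (Rep G) A)"
proof (rule rep_isoI[OF A' Dual_rep[OF A]])
  show "P\<^sup>T \<in> intertwiners G A' (Dual (Rep G) A)"
    unfolding intertwiners_iff
  proof (intro conjI ballI)
    show "P\<^sup>T \<in> carrier_mat (fst (Dual (Rep G) A)) (fst A')" using P by simp
    fix g assume g: "g \<in> carrier G"
    note r = rep_carrier[OF A' g] rep_carrier[OF A g] rep_carrier[OF A inv_closed[OF g]]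
    note d = carrier_matD[OF P] carrier_matD[OF r(1)] carrier_matD[OF r(2)] carrier_matD[OF r(3)]
    have "(snd A' g)\<^sup>T * P * snd A g = P"
      using p g form_row_intertwiner_iff[OF A' A P] by blast
    then have "P\<^sup>T = ((snd A' g)\<^sup>T * P * snd A g)\<^sup>T" by simp
    also have "\<dots> = (snd A g)\<^sup>T * ((snd A' g)\<^sup>T * P)\<^sup>T"
      by (rule transpose_mult[OF _ r(2)]) (use d in \<open>auto intro!: carrier_matI\<close>)
    also have "((snd A' g)\<^sup>T * P)\<^sup>T = P\<^sup>T * snd A' g"
      using transpose_mult[of "(snd A' g)\<^sup>T" "fst A'" "fst A'" P "fst A"] P r by simp
    finally have inv: "(snd A g)\<^sup>T * (P\<^sup>T * snd A' g) = P\<^sup>T" by simp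
    have "P\<^sup>T * snd A' g = ((snd A (inv g))\<^sup>T * (snd A g)\<^sup>T) * (P\<^sup>T * snd A' g)"
    proof -
      have "(snd A (inv g))\<^sup>T * (snd A g)\<^sup>T = 1\<^sub>m (fst A)"
        using transpose_mult[OF r(2,3)] rep_inv[OF A g] by simp
      moreover have "P\<^sup>T * snd A' g \<in> carrier_mat (fst A) (fst A')"
        using d by (auto intro!: carrier_matI)
      ultimately show ?thesis by (simp only: left_mult_one_mat)
    qed
    also have "\<dots> = (snd A (inv g))\<^sup>T * ((snd A g)\<^sup>T * (P\<^sup>T * snd A' g))"
      by (simp add: mat_mult_assoc d)
    finally show "P\<^sup>T * snd A' g = snd (Dual (Rep G) A) g * P\<^sup>T"
      unfolding inv using g by simp
  qed
  show "Q\<^sup>T * P\<^sup>T = 1\<^sub>m (fst A')"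
    using transpose_mult[OF P Q] PQ by simp
  show "P\<^sup>T * Q\<^sup>T = 1\<^sub>m (fst (Dual (Rep G) A))"
    using transpose_mult[OF Q P] PQ by simp
qed (use Q in simp)

lemma form_col_intertwiner:
  assumes M: "M \<in> representations G" and N: "N \<in> representations G" and C: "C \<in> carrier_mat (fst M) (fst N)"
    and inv: "\<And>g. g \<in> carrier G \<Longrightarrow> snd M g * C * (snd N g)\<^sup>T = C"
  shows "form_col C \<in> intertwiners G (Unit (Rep G)) (M \<boxtimes>\<^bsub>Rep G\<^esub> N)"
  unfolding intertwiners_iff
proof (intro conjI ballI)
  show "form_col C \<in> carrier_mat (fst (M \<boxtimes>\<^bsub>Rep G\<^esub> N)) (fst (Unit (Rep G)))"
    using form_col_carrier[OF C] by simp
  fix g assume g: "g \<in> carrier G"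
  have "kronecker (snd M g) (snd N g) * form_col C = form_col C"
    using C rep_dim[OF M g] rep_dim[OF N g] inv[OF g] by (simp add: kronecker_form_col)
  then show "form_col C * snd (Unit (Rep G)) g = snd (M \<boxtimes>\<^bsub>Rep G\<^esub> N) g * form_col C"
    using g right_mult_one_mat[OF form_col_carrier[OF C]] by simp
qed

end

text \<open>The other zigzag composite. Transposition turns it into the first one with pairing and
  copairing exchanged.\<close>

lemma form_zigzag':
  assumes P: "P \<in> carrier_mat a b" and Q: "Q \<in> carrier_mat b a"
  shows "kronecker (1\<^sub>m b) (form_row P) * kronecker (form_col Q) (1\<^sub>m b) = Q * P"
proof -
  have t: "(form_row A)\<^sup>T = form_col A" "(form_col A)\<^sup>T = form_row A" for A
    by (rule eq_matI; auto simp: form_row_def form_col_def)+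
  have "(kronecker (1\<^sub>m b) (form_row P) * kronecker (form_col Q) (1\<^sub>m b))\<^sup>T =
      (kronecker (form_col Q) (1\<^sub>m b))\<^sup>T * (kronecker (1\<^sub>m b) (form_row P))\<^sup>T"
    by (rule transpose_mult[of _ b "b * (a * b)" _ b]) (use P Q in \<open>auto intro!: carrier_matI\<close>)
  also have "\<dots> = kronecker (form_row Q) (1\<^sub>m b) * kronecker (1\<^sub>m b) (form_col P)"
    by (simp add: kronecker_transpose t)
  also have "\<dots> = (Q * P)\<^sup>T" by (rule form_zigzag[OF Q P])
  finally show ?thesis by (metis transpose_transpose)
qed

section \<open>Transport along a monoidal equivalence\<close>

text \<open>Naturality writes \<open>f * \<eta> A\<close> in terms of the image of \<open>f\<close>,
  and \<eta> A can be cancelled. The lemma serves both functors of the equivalence, by exchanging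
  \<open>F\<close> and \<open>K\<close>.\<close>

lemma (in group_reps) nat_iso_id_faithful:
  assumes nat: "naturally_isomorphic (Rep G) (Rep G) (comp_functor K F) id_functor"
    and AB: "A \<in> representations G" "B \<in> representations G"
    and f: "f \<in> intertwiners G A B" and g: "g \<in> intertwiners G A B"
    and eq: "FArr F A B f = FArr F A B g"
  shows "f = g"
proof -
  from nat obtain \<eta> where \<eta>: "\<forall>A\<in>representations G. iso_arrow (Rep G) (FObj K (FObj F A)) A (\<eta> A)"
    and nat\<eta>: "\<forall>A\<in>representations G. \<forall>B\<in>representations G. \<forall>f\<in>intertwiners G A B.
      \<eta> B * FArr K (FObj F A) (FObj F B) (FArr F A B f) = f * \<eta> A"
    unfolding naturally_isomorphic_def comp_functor_def id_functor_def by auto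
  have natural: "\<eta> B * FArr K (FObj F A) (FObj F B) (FArr F A B f) = f * \<eta> A"
    if "f \<in> intertwiners G A B" for f
    using nat\<eta> AB that by blast
  from \<eta> AB(1) have "iso_arrow (Rep G) (FObj K (FObj F A)) A (\<eta> A)" by blast
  then obtain \<epsilon> where \<epsilon>: "\<eta> A \<in> carrier_mat (fst A) (fst (FObj K (FObj F A)))"
    "\<epsilon> \<in> carrier_mat (fst (FObj K (FObj F A))) (fst A)" "\<eta> A * \<epsilon> = 1\<^sub>m (fst A)"
    unfolding iso_arrow_def inverse_arrows_def by (auto dest: intertwiners_carrier)
  have "h = (h * \<eta> A) * \<epsilon>" if h: "h \<in> intertwiners G A B" for h
  proof -
    have "(h * \<eta> A) * \<epsilon> = h * (\<eta> A * \<epsilon>)"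
      using \<epsilon>(1,2) dim_intertwiner[OF h] by (intro mat_mult_assoc) auto
    then show ?thesis unfolding \<epsilon>(3) using intertwiners_carrier[OF h] by simp
  qed
  moreover have "f * \<eta> A = g * \<eta> A"
    unfolding natural[OF f, symmetric] natural[OF g, symmetric] eq ..
  ultimately show ?thesis using f g by metis
qed

locale rep_equivalence = G: group_reps G + H: group_reps H
  for G :: "('a, 'y) monoid_scheme" and H :: "('b, 'z) monoid_scheme" +
  fixes F :: "('a rep, complex mat, 'b rep, complex mat) functor_data"
    and J :: "'a rep \<Rightarrow> 'a rep \<Rightarrow> complex mat" and u :: "complex mat"
  assumes linear: "is_linear_functor (Rep G) (Rep H) F"
    and equivalence: "is_equivalence (Rep G) (Rep H) F"
    and monoidal: "is_monoidal_structure (Rep G) (Rep H) F J u"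
begin

abbreviation "\<Phi> \<equiv> FObj F"
abbreviation "\<phi> \<equiv> FArr F"
abbreviation "unitG \<equiv> Unit (Rep G)"
abbreviation "unitH \<equiv> Unit (Rep H)"
abbreviation tensorG (infixr \<open>\<otimes>\<^sub>G\<close> 80) where "M \<otimes>\<^sub>G N \<equiv> M \<boxtimes>\<^bsub>Rep G\<^esub> N"
abbreviation tensorH (infixr \<open>\<otimes>\<^sub>H\<close> 80) where "M \<otimes>\<^sub>H N \<equiv> M \<boxtimes>\<^bsub>Rep H\<^esub> N"

lemma functor_axioms: "is_functor (Rep G) (Rep H) F"
  using linear by (simp add: is_linear_functor_def)

lemma obj [simp]: "M \<in> representations G \<Longrightarrow> \<Phi> M \<in> representations H"
  using functor_axioms by (simp add: is_functor_def)

lemma arr: "M \<in> representations G \<Longrightarrow> N \<in> representations G \<Longrightarrow> f \<in> intertwiners G M N \<Longrightarrow>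
    \<phi> M N f \<in> intertwiners H (\<Phi> M) (\<Phi> N)"
  using functor_axioms by (simp add: is_functor_def)

lemma arr_id: "M \<in> representations G \<Longrightarrow> \<phi> M M (1\<^sub>m (fst M)) = 1\<^sub>m (fst (\<Phi> M))"
  using functor_axioms by (simp add: is_functor_def)

lemma arr_comp:
  "M \<in> representations G \<Longrightarrow> N \<in> representations G \<Longrightarrow> L \<in> representations G \<Longrightarrow>
    f \<in> intertwiners G M N \<Longrightarrow> g \<in> intertwiners G N L \<Longrightarrow> \<phi> M L (g * f) = \<phi> N L g * \<phi> M N f"
  using functor_axioms by (simp add: is_functor_def)

lemma arr_add:
  "M \<in> representations G \<Longrightarrow> N \<in> representations G \<Longrightarrow> f \<in> intertwiners G M N \<Longrightarrow> g \<in> intertwiners G M N \<Longrightarrow>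
    \<phi> M N (f + g) = \<phi> M N f + \<phi> M N g"
  using linear by (simp add: is_linear_functor_def)

lemma arr_smult:
  "M \<in> representations G \<Longrightarrow> N \<in> representations G \<Longrightarrow> f \<in> intertwiners G M N \<Longrightarrow>
    \<phi> M N (c \<cdot>\<^sub>m f) = c \<cdot>\<^sub>m \<phi> M N f"
  using linear by (simp add: is_linear_functor_def)

text \<open>Linearity speaks only of sums and scalar multiples, so zero is treated as 0 times
  itself.\<close>

lemma arr_zero:
  assumes "M \<in> representations G" "N \<in> representations G"
  shows "\<phi> M N (0\<^sub>m (fst N) (fst M)) = 0\<^sub>m (fst (\<Phi> N)) (fst (\<Phi> M))"
proof -
  have z: "0\<^sub>m (fst N) (fst M) \<in> intertwiners G M N"
    by (auto simp: intertwiners_iff left_mult_zero_mat[OF G.rep_carrier[OF assms(1)]]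
        right_mult_zero_mat[OF G.rep_carrier[OF assms(2)]])
  have "0 \<cdot>\<^sub>m 0\<^sub>m (fst N) (fst M) = (0\<^sub>m (fst N) (fst M) :: complex mat)" by (rule eq_matI) auto
  then have "\<phi> M N (0\<^sub>m (fst N) (fst M)) = 0 \<cdot>\<^sub>m \<phi> M N (0\<^sub>m (fst N) (fst M))"
    using arr_smult[OF assms z, of 0] by simp
  also have "\<dots> = 0\<^sub>m (fst (\<Phi> N)) (fst (\<Phi> M))"
    using intertwiners_carrier[OF arr[OF assms z]] by (simp add: smult_mat_zero)
  finally show ?thesis .
qed

text \<open>Fullness lifts an arrow through the quasi-inverse \<open>K\<close>; faithfulness of
  \<open>K\<close> then shows that the lift has the right image.\<close>

lemma fully_faithful:
  assumes MN: "M \<in> representations G" "N \<in> representations G"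
  shows "inj_on (\<phi> M N) (intertwiners G M N)"
    "\<phi> M N ` intertwiners G M N = intertwiners H (\<Phi> M) (\<Phi> N)"
proof -
  from equivalence obtain K where K: "is_functor (Rep H) (Rep G) K"
    and n1: "naturally_isomorphic (Rep G) (Rep G) (comp_functor K F) id_functor"
    and n2: "naturally_isomorphic (Rep H) (Rep H) (comp_functor F K) id_functor"
    by (auto simp: is_equivalence_def)
  show "inj_on (\<phi> M N) (intertwiners G M N)"
    using G.nat_iso_id_faithful[OF n1 MN] by (auto intro: inj_onI)
  from n1 obtain \<eta> where \<eta>: "\<forall>A\<in>representations G. iso_arrow (Rep G) (FObj K (\<Phi> A)) A (\<eta> A)"
    and nat\<eta>: "\<forall>A\<in>representations G. \<forall>B\<in>representations G. \<forall>f\<in>intertwiners G A B.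
      \<eta> B * FArr K (\<Phi> A) (\<Phi> B) (\<phi> A B f) = f * \<eta> A"
    unfolding naturally_isomorphic_def comp_functor_def id_functor_def by auto
  have natural: "\<eta> N * FArr K (\<Phi> M) (\<Phi> N) (\<phi> M N f) = f * \<eta> M" if "f \<in> intertwiners G M N" for f
    using nat\<eta> MN that by blast
  have Kobj: "FObj K A \<in> representations G" if "A \<in> representations H" for A
    using K that by (simp add: is_functor_def)
  let ?M = "FObj K (\<Phi> M)" and ?N = "FObj K (\<Phi> N)"
  have KM: "?M \<in> representations G" "?N \<in> representations G" using MN Kobj by simp_all
  show "\<phi> M N ` intertwiners G M N = intertwiners H (\<Phi> M) (\<Phi> N)"
  proof (intro equalityI subsetI)
    fix h assume h: "h \<in> intertwiners H (\<Phi> M) (\<Phi> N)"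
    have Kh: "FArr K (\<Phi> M) (\<Phi> N) h \<in> intertwiners G ?M ?N"
      using K h MN by (simp add: is_functor_def)
    from bspec[OF \<eta> MN(1)] obtain \<epsilon> where \<epsilon>: "\<eta> M \<in> intertwiners G ?M M" "\<epsilon> \<in> intertwiners G M ?M"
      "\<epsilon> * \<eta> M = 1\<^sub>m (fst ?M)"
      by (auto simp: iso_arrow_def inverse_arrows_def)
    from bspec[OF \<eta> MN(2)] obtain \<zeta> where \<zeta>: "\<eta> N \<in> intertwiners G ?N N" "\<zeta> \<in> intertwiners G N ?N"
      "\<zeta> * \<eta> N = 1\<^sub>m (fst ?N)"
      by (auto simp: iso_arrow_def inverse_arrows_def)
    \<comment> \<open>The candidate preimage is the image of \<open>h\<close> under
      \<open>K\<close>, conjugated by the natural isomorphism \<eta>.\<close>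
    define f where "f = \<eta> N * FArr K (\<Phi> M) (\<Phi> N) h * \<epsilon>"
    have f: "f \<in> intertwiners G M N"
      unfolding f_def
      by (rule G.intertwiner_comp[OF G.intertwiner_comp[OF \<zeta>(1) Kh KM MN(2)] \<epsilon>(2) MN(1) KM(1) MN(2)])
    let ?k = "FArr K (\<Phi> M) (\<Phi> N) h" and ?l = "FArr K (\<Phi> M) (\<Phi> N) (\<phi> M N f)"
    have Kf: "?l \<in> intertwiners G ?M ?N"
      using K arr[OF MN f] MN by (simp add: is_functor_def)
    note d = dim_intertwiner[OF Kh] dim_intertwiner[OF Kf] dim_intertwiner[OF \<epsilon>(1)] dim_intertwiner[OF \<epsilon>(2)]
      dim_intertwiner[OF \<zeta>(1)] dim_intertwiner[OF \<zeta>(2)]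
    have "\<eta> N * ?l = \<eta> N * ?k * (\<epsilon> * \<eta> M)"
      unfolding natural[OF f] unfolding f_def by (simp add: mat_mult_assoc d)
    also have "\<dots> = \<eta> N * ?k"
      unfolding \<epsilon>(3) using d by (intro right_mult_one_mat) (auto intro: carrier_matI)
    finally have e: "\<eta> N * ?l = \<eta> N * ?k" .
    have cancel: "X = \<zeta> * (\<eta> N * X)" if X: "X \<in> intertwiners G ?M ?N" for X
    proof -
      have "\<zeta> * (\<eta> N * X) = (\<zeta> * \<eta> N) * X"
        using d dim_intertwiner[OF X] by (intro mat_mult_assoc[symmetric]) auto
      then show ?thesis unfolding \<zeta>(3) using intertwiners_carrier[OF X] by simp
    qed
    have "?l = ?k" using cancel[OF Kf] cancel[OF Kh] e by metis
    \<comment> \<open>Both arrows have the same image under \<open>K\<close>, and \<open>K\<close>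
      is faithful by the second natural isomorphism.\<close>
    then have "\<phi> M N f = h"
      using H.nat_iso_id_faithful[OF n2 obj[OF MN(1)] obj[OF MN(2)] arr[OF MN f] h] by simp
    then show "h \<in> \<phi> M N ` intertwiners G M N" using f by blast
  qed (use arr[OF MN] in auto)
qed

lemma faithful:
  "M \<in> representations G \<Longrightarrow> N \<in> representations G \<Longrightarrow> f \<in> intertwiners G M N \<Longrightarrow> g \<in> intertwiners G M N \<Longrightarrow>
    \<phi> M N f = \<phi> M N g \<Longrightarrow> f = g"
  using fully_faithful(1)[of M N] by (auto dest: inj_onD)

lemma full:
  assumes "M \<in> representations G" "N \<in> representations G" "h \<in> intertwiners H (\<Phi> M) (\<Phi> N)"
  obtains f where "f \<in> intertwiners G M N" "\<phi> M N f = h"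
proof -
  have "h \<in> \<phi> M N ` intertwiners G M N"
    unfolding fully_faithful(2)[OF assms(1,2)] by (rule assms(3))
  then obtain f where "h = \<phi> M N f" "f \<in> intertwiners G M N" by (rule imageE)
  then show thesis by (intro that[of f]) simp_all
qed

lemma essentially_surjective:
  assumes N: "N \<in> representations H"
  shows "\<exists>M\<in>representations G. H.rep_iso (\<Phi> M) N"
proof -
  from equivalence obtain K where K: "is_functor (Rep H) (Rep G) K"
    and n2: "naturally_isomorphic (Rep H) (Rep H) (comp_functor F K) id_functor"
    by (auto simp: is_equivalence_def)
  have "FObj K N \<in> representations G" using K N by (simp add: is_functor_def)
  moreover from n2 N obtain \<epsilon> where "iso_arrow (Rep H) (\<Phi> (FObj K N)) N \<epsilon>"
    unfolding naturally_isomorphic_def comp_functor_def id_functor_def by auto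
  ultimately have "H.rep_iso (\<Phi> (FObj K N)) N" using N by (auto simp: H.rep_iso_def)
  with \<open>FObj K N \<in> representations G\<close> show ?thesis by blast
qed

text \<open>For reflection, both mutually inverse arrows are lifted by fullness, and the two inverse
  laws are checked by faithfulness.\<close>

lemma rep_iso_iff:
  assumes MN: "M \<in> representations G" "N \<in> representations G"
  shows "H.rep_iso (\<Phi> M) (\<Phi> N) \<longleftrightarrow> G.rep_iso M N"
proof
  assume "G.rep_iso M N"
  then obtain T S where TS: "T \<in> intertwiners G M N" "S \<in> intertwiners G N M"
    "S * T = 1\<^sub>m (fst M)" "T * S = 1\<^sub>m (fst N)"
    by (elim G.rep_isoE)
  have "\<phi> N M S * \<phi> M N T = 1\<^sub>m (fst (\<Phi> M))"
    using arr_comp[OF MN MN(1) TS(1,2)] arr_id[OF MN(1)] unfolding TS(3) by simp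
  moreover have "\<phi> M N T * \<phi> N M S = 1\<^sub>m (fst (\<Phi> N))"
    using arr_comp[OF MN(2,1,2) TS(2,1)] arr_id[OF MN(2)] unfolding TS(4) by simp
  ultimately show "H.rep_iso (\<Phi> M) (\<Phi> N)"
    by (rule H.rep_isoI[OF obj[OF MN(1)] obj[OF MN(2)] arr[OF MN TS(1)]
          intertwiners_carrier[OF arr[OF MN(2,1) TS(2)]]])
next
  assume "H.rep_iso (\<Phi> M) (\<Phi> N)"
  then obtain T S where TS: "T \<in> intertwiners H (\<Phi> M) (\<Phi> N)" "S \<in> intertwiners H (\<Phi> N) (\<Phi> M)"
    "S * T = 1\<^sub>m (fst (\<Phi> M))" "T * S = 1\<^sub>m (fst (\<Phi> N))"
    by (elim H.rep_isoE)
  obtain t where t: "t \<in> intertwiners G M N" "\<phi> M N t = T" by (rule full[OF MN TS(1)])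
  obtain s where s: "s \<in> intertwiners G N M" "\<phi> N M s = S" by (rule full[OF MN(2,1) TS(2)])
  have "s * t = 1\<^sub>m (fst M)"
    by (rule faithful[OF MN(1,1) G.intertwiner_comp[OF s(1) t(1) MN MN(1)] G.intertwiner_id[OF MN(1)]])
      (simp add: arr_comp[OF MN MN(1) t(1) s(1)] arr_id MN t s TS)
  moreover have "t * s = 1\<^sub>m (fst N)"
    by (rule faithful[OF MN(2,2) G.intertwiner_comp[OF t(1) s(1) MN(2,1,2)] G.intertwiner_id[OF MN(2)]])
      (simp add: arr_comp[OF MN(2,1,2) s(1) t(1)] arr_id MN t s TS)
  ultimately show "G.rep_iso M N"
    by (rule G.rep_isoI[OF MN t(1) intertwiners_carrier[OF s(1)]])
qed

lemma rep_iso_sum: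
  assumes M: "M \<in> representations G" and N: "N \<in> representations G"
  shows "H.rep_iso (\<Phi> (M \<uplus>\<^bsub>Rep G\<^esub> N)) (\<Phi> M \<uplus>\<^bsub>Rep H\<^esub> \<Phi> N)"
proof -
  let ?X = "M \<uplus>\<^bsub>Rep G\<^esub> N" and ?p = "pr1_mat (fst M) (fst N)" and ?q = "pr2_mat (fst M) (fst N)"
  let ?i = "?p\<^sup>T" and ?j = "?q\<^sup>T"
  have X: "?X \<in> representations G" using M N by simp
  note pr = G.intertwiner_pr[OF M N]
  note rel = pr_mat_transpose[of "fst M" "fst N"]
  show ?thesis
  proof (rule H.biproduct_rep_iso[OF obj[OF X] obj[OF M] obj[OF N] arr[OF X M pr(1)] arr[OF X N pr(2)]
        arr[OF M X pr(3)] arr[OF N X pr(4)]])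
    show "\<phi> ?X M ?p * \<phi> M ?X ?i = 1\<^sub>m (fst (\<Phi> M))"
      using arr_comp[OF M X M pr(3,1)] arr_id[OF M] by (simp add: rel)
    show "\<phi> ?X N ?q * \<phi> N ?X ?j = 1\<^sub>m (fst (\<Phi> N))"
      using arr_comp[OF N X N pr(4,2)] arr_id[OF N] by (simp add: rel)
    show "\<phi> ?X M ?p * \<phi> N ?X ?j = 0\<^sub>m (fst (\<Phi> M)) (fst (\<Phi> N))"
      using arr_comp[OF N X M pr(4,1)] arr_zero[OF N M] by (simp add: rel)
    show "\<phi> ?X N ?q * \<phi> M ?X ?i = 0\<^sub>m (fst (\<Phi> N)) (fst (\<Phi> M))"
      using arr_comp[OF M X N pr(3,2)] arr_zero[OF M N] by (simp add: rel)
    have "\<phi> M ?X ?i * \<phi> ?X M ?p + \<phi> N ?X ?j * \<phi> ?X N ?q = \<phi> ?X ?X (?i * ?p + ?j * ?q)"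
      using arr_comp[OF X M X pr(1,3)] arr_comp[OF X N X pr(2,4)]
        arr_add[OF X X G.intertwiner_comp[OF pr(3,1) X M X] G.intertwiner_comp[OF pr(4,2) X N X]] by simp
    then show "\<phi> M ?X ?i * \<phi> ?X M ?p + \<phi> N ?X ?j * \<phi> ?X N ?q = 1\<^sub>m (fst (\<Phi> ?X))"
      using arr_id[OF X] by (simp add: pr_mat_decomposition)
  qed
qed

section \<open>Coherence of the monoidal structure and transport of pairings\<close>

lemma J_iso:
  "M \<in> representations G \<Longrightarrow> N \<in> representations G \<Longrightarrow>
    iso_arrow (Rep H) (\<Phi> M \<otimes>\<^sub>H \<Phi> N) (\<Phi> (M \<otimes>\<^sub>G N)) (J M N)"
  and u_iso: "iso_arrow (Rep H) unitH (\<Phi> unitG) u"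
  using monoidal by (simp_all add: is_monoidal_structure_def)

lemma J_natural:
  "A \<in> representations G \<Longrightarrow> A' \<in> representations G \<Longrightarrow> B \<in> representations G \<Longrightarrow> B' \<in> representations G \<Longrightarrow>
    f \<in> intertwiners G A A' \<Longrightarrow> g \<in> intertwiners G B B' \<Longrightarrow>
    J A' B' * kronecker (\<phi> A A' f) (\<phi> B B' g) = \<phi> (A \<otimes>\<^sub>G B) (A' \<otimes>\<^sub>G B') (kronecker f g) * J A B"
  using monoidal by (simp add: is_monoidal_structure_def)

lemma J_intertwiner:
  "M \<in> representations G \<Longrightarrow> N \<in> representations G \<Longrightarrow> J M N \<in> intertwiners H (\<Phi> M \<otimes>\<^sub>H \<Phi> N) (\<Phi> (M \<otimes>\<^sub>G N))"
  and u_intertwiner: "u \<in> intertwiners H unitH (\<Phi> unitG)"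
  using J_iso[of M N] u_iso by (auto simp: iso_arrow_def inverse_arrows_def)

text \<open>The functor takes source and target as arguments, so the identity matrix of the
  associator is sent to an identity only because the two bracketings are the same object.
  Associativity of \<open>J\<close> survives as an equation without constraints.\<close>

lemma J_assoc:
  assumes A: "A \<in> representations G" and B: "B \<in> representations G" and E: "E \<in> representations G"
  shows "J (A \<otimes>\<^sub>G B) E * kronecker (J A B) (1\<^sub>m (fst (\<Phi> E))) =
    J A (B \<otimes>\<^sub>G E) * kronecker (1\<^sub>m (fst (\<Phi> A))) (J B E)"
proof -
  let ?X = "(A \<otimes>\<^sub>G B) \<otimes>\<^sub>G E"
  have X: "?X \<in> representations G" using A B E by simp
  have eq: "A \<otimes>\<^sub>G (B \<otimes>\<^sub>G E) = ?X" by (rule G.TObj_assoc[OF A B E, symmetric])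
  have "\<phi> ?X ?X (1\<^sub>m (fst A * fst B * fst E)) * (J (A \<otimes>\<^sub>G B) E * kronecker (J A B) (1\<^sub>m (fst (\<Phi> E)))) =
      J A (B \<otimes>\<^sub>G E) * (kronecker (1\<^sub>m (fst (\<Phi> A))) (J B E) * 1\<^sub>m (fst (\<Phi> A) * fst (\<Phi> B) * fst (\<Phi> E)))"
    using monoidal A B E unfolding eq[symmetric] by (simp add: is_monoidal_structure_def G.TObj_assoc)
  moreover have "\<phi> ?X ?X (1\<^sub>m (fst A * fst B * fst E)) = 1\<^sub>m (fst (\<Phi> ?X))"
    using arr_id[OF X] by simp
  moreover have "1\<^sub>m (fst (\<Phi> ?X)) * (J (A \<otimes>\<^sub>G B) E * kronecker (J A B) (1\<^sub>m (fst (\<Phi> E)))) =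
      J (A \<otimes>\<^sub>G B) E * kronecker (J A B) (1\<^sub>m (fst (\<Phi> E)))"
    using dim_intertwiner[OF J_intertwiner[of "A \<otimes>\<^sub>G B" E]] A B E
    by (intro left_mult_one_mat[of _ _ "dim_col (kronecker (J A B) (1\<^sub>m (fst (\<Phi> E))))"]) (auto intro!: carrier_matI)
  moreover have "kronecker (1\<^sub>m (fst (\<Phi> A))) (J B E) * 1\<^sub>m (fst (\<Phi> A) * fst (\<Phi> B) * fst (\<Phi> E)) =
      kronecker (1\<^sub>m (fst (\<Phi> A))) (J B E)"
    using dim_intertwiner[OF J_intertwiner[OF B E]]
    by (intro right_mult_one_mat[of _ "dim_row (kronecker (1\<^sub>m (fst (\<Phi> A))) (J B E))"]) (auto intro!: carrier_matI simp: mult.assoc)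
  ultimately show ?thesis by simp
qed

lemma J_unit:
  assumes A: "A \<in> representations G"
  shows "J unitG A * kronecker u (1\<^sub>m (fst (\<Phi> A))) = 1\<^sub>m (fst (\<Phi> A))"
    "J A unitG * kronecker (1\<^sub>m (fst (\<Phi> A))) u = 1\<^sub>m (fst (\<Phi> A))"
proof -
  note t = G.TObj_Unit[OF A]
  have "\<phi> (unitG \<otimes>\<^sub>G A) A (1\<^sub>m (fst A)) * (J unitG A * kronecker u (1\<^sub>m (fst (\<Phi> A)))) = 1\<^sub>m (fst (\<Phi> A))"
    "\<phi> (A \<otimes>\<^sub>G unitG) A (1\<^sub>m (fst A)) * (J A unitG * kronecker (1\<^sub>m (fst (\<Phi> A))) u) = 1\<^sub>m (fst (\<Phi> A))"
    using monoidal A by (simp_all add: is_monoidal_structure_def)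
  moreover have "1\<^sub>m (fst (\<Phi> A)) * (J unitG A * kronecker u (1\<^sub>m (fst (\<Phi> A)))) = J unitG A * kronecker u (1\<^sub>m (fst (\<Phi> A)))"
    using dim_intertwiner[OF J_intertwiner[OF G.Unit_rep A]] unfolding t
    by (intro left_mult_one_mat[of _ _ "dim_col (kronecker u (1\<^sub>m (fst (\<Phi> A))))"]) (auto intro!: carrier_matI)
  moreover have "1\<^sub>m (fst (\<Phi> A)) * (J A unitG * kronecker (1\<^sub>m (fst (\<Phi> A))) u) = J A unitG * kronecker (1\<^sub>m (fst (\<Phi> A))) u"
    using dim_intertwiner[OF J_intertwiner[OF A G.Unit_rep]] unfolding t
    by (intro left_mult_one_mat[of _ _ "dim_col (kronecker (1\<^sub>m (fst (\<Phi> A))) u)"]) (auto intro!: carrier_matI)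
  ultimately show "J unitG A * kronecker u (1\<^sub>m (fst (\<Phi> A))) = 1\<^sub>m (fst (\<Phi> A))"
    "J A unitG * kronecker (1\<^sub>m (fst (\<Phi> A))) u = 1\<^sub>m (fst (\<Phi> A))"
    unfolding t arr_id[OF A] by simp_all
qed

lemma rep_iso_tensor:
  assumes "M \<in> representations G" "N \<in> representations G"
  shows "H.rep_iso (\<Phi> (M \<otimes>\<^sub>G N)) (\<Phi> M \<otimes>\<^sub>H \<Phi> N)"
proof (rule H.rep_iso_sym)
  show "H.rep_iso (\<Phi> M \<otimes>\<^sub>H \<Phi> N) (\<Phi> (M \<otimes>\<^sub>G N))"
    unfolding H.rep_iso_def using J_iso[OF assms] assms by auto
qed

lemma rep_iso_unit: "H.rep_iso (\<Phi> unitG) unitH"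
proof (rule H.rep_iso_sym)
  show "H.rep_iso unitH (\<Phi> unitG)"
    unfolding H.rep_iso_def using u_iso by auto
qed

text \<open>
  \<open>transported_pairing A B p p'\<close> and \<open>transported_copairing A B q q'\<close> say that \<open>p'\<close> and \<open>q'\<close> are the images of
  \<open>p : A \<otimes> B \<rightarrow> I\<close> and \<open>q : I \<rightarrow> A \<otimes> B\<close> under the monoidal functor.
\<close>

definition transported_pairing where
  "transported_pairing A B p p' \<longleftrightarrow>
     p \<in> intertwiners G (A \<otimes>\<^sub>G B) unitG \<and> p' \<in> intertwiners H (\<Phi> A \<otimes>\<^sub>H \<Phi> B) unitH \<and>
     u * p' = \<phi> (A \<otimes>\<^sub>G B) unitG p * J A B"

definition transported_copairing where
  "transported_copairing A B q q' \<longleftrightarrow>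
     q \<in> intertwiners G unitG (A \<otimes>\<^sub>G B) \<and> q' \<in> intertwiners H unitH (\<Phi> A \<otimes>\<^sub>H \<Phi> B) \<and>
     J A B * q' = \<phi> unitG (A \<otimes>\<^sub>G B) q * u"

lemma u_inverse:
  obtains v where "v \<in> intertwiners H (\<Phi> unitG) unitH" "v * u = 1\<^sub>m 1" "u * v = 1\<^sub>m (fst (\<Phi> unitG))"
  using u_iso by (auto simp: iso_arrow_def inverse_arrows_def)

lemma J_inverse:
  assumes "A \<in> representations G" "B \<in> representations G"
  obtains K where "K \<in> intertwiners H (\<Phi> (A \<otimes>\<^sub>G B)) (\<Phi> A \<otimes>\<^sub>H \<Phi> B)"
    "K * J A B = 1\<^sub>m (fst (\<Phi> A) * fst (\<Phi> B))" "J A B * K = 1\<^sub>m (fst (\<Phi> (A \<otimes>\<^sub>G B)))"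
  using J_iso[OF assms] by (auto simp: iso_arrow_def inverse_arrows_def)

context
  fixes A B assumes A: "A \<in> representations G" and B: "B \<in> representations G"
begin

lemma TObj_reps: "A \<otimes>\<^sub>G B \<in> representations G" "\<Phi> A \<otimes>\<^sub>H \<Phi> B \<in> representations H"
  using A B by simp_all

lemma transported_pairing_ex:
  assumes p: "p \<in> intertwiners G (A \<otimes>\<^sub>G B) unitG"
  obtains p' where "transported_pairing A B p p'"
proof -
  obtain v where v: "v \<in> intertwiners H (\<Phi> unitG) unitH" "u * v = 1\<^sub>m (fst (\<Phi> unitG))" by (rule u_inverse)
  let ?q = "\<phi> (A \<otimes>\<^sub>G B) unitG p * J A B"
  have q: "?q \<in> intertwiners H (\<Phi> A \<otimes>\<^sub>H \<Phi> B) (\<Phi> unitG)"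
    by (rule H.intertwiner_comp[OF arr[OF TObj_reps(1) G.Unit_rep p] J_intertwiner[OF A B] TObj_reps(2) obj[OF TObj_reps(1)] obj[OF G.Unit_rep]])
  have "u * (v * ?q) = (u * v) * ?q"
    using dim_intertwiner[OF q] dim_intertwiner[OF v(1)] dim_intertwiner[OF u_intertwiner]
    by (intro mat_mult_assoc[symmetric]) auto
  then have "u * (v * ?q) = ?q" unfolding v(2) using intertwiners_carrier[OF q] by (simp only: left_mult_one_mat)
  moreover have "v * ?q \<in> intertwiners H (\<Phi> A \<otimes>\<^sub>H \<Phi> B) unitH"
    by (rule H.intertwiner_comp[OF v(1) q TObj_reps(2) obj[OF G.Unit_rep] H.Unit_rep])
  ultimately show thesis using that p by (auto simp: transported_pairing_def)
qed

lemma transported_copairing_ex: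
  assumes q: "q \<in> intertwiners G unitG (A \<otimes>\<^sub>G B)"
  obtains q' where "transported_copairing A B q q'"
proof -
  obtain K where K: "K \<in> intertwiners H (\<Phi> (A \<otimes>\<^sub>G B)) (\<Phi> A \<otimes>\<^sub>H \<Phi> B)" "J A B * K = 1\<^sub>m (fst (\<Phi> (A \<otimes>\<^sub>G B)))"
    by (rule J_inverse[OF A B])
  let ?r = "\<phi> unitG (A \<otimes>\<^sub>G B) q * u"
  have r: "?r \<in> intertwiners H unitH (\<Phi> (A \<otimes>\<^sub>G B))"
    by (rule H.intertwiner_comp[OF arr[OF G.Unit_rep TObj_reps(1) q] u_intertwiner H.Unit_rep obj[OF G.Unit_rep] obj[OF TObj_reps(1)]])
  have "J A B * (K * ?r) = (J A B * K) * ?r"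
    using dim_intertwiner[OF r] dim_intertwiner[OF K(1)] dim_intertwiner[OF J_intertwiner[OF A B]]
    by (intro mat_mult_assoc[symmetric]) auto
  then have "J A B * (K * ?r) = ?r" unfolding K(2) using intertwiners_carrier[OF r] by (simp only: left_mult_one_mat)
  moreover have "K * ?r \<in> intertwiners H unitH (\<Phi> A \<otimes>\<^sub>H \<Phi> B)"
    by (rule H.intertwiner_comp[OF K(1) r H.Unit_rep obj[OF TObj_reps(1)] TObj_reps(2)])
  ultimately show thesis using that q by (auto simp: transported_copairing_def)
qed

text \<open>Pulls a pairing back from \<open>H\<close> by fullness; needed to reflect, and not only
  preserve, the existence of symmetric forms.\<close>

lemma transported_pairing_ex_inv:
  assumes p': "p' \<in> intertwiners H (\<Phi> A \<otimes>\<^sub>H \<Phi> B) unitH"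
  obtains p where "transported_pairing A B p p'"
proof -
  obtain K where K: "K \<in> intertwiners H (\<Phi> (A \<otimes>\<^sub>G B)) (\<Phi> A \<otimes>\<^sub>H \<Phi> B)" "K * J A B = 1\<^sub>m (fst (\<Phi> A) * fst (\<Phi> B))"
    by (rule J_inverse[OF A B])
  have up: "u * p' \<in> intertwiners H (\<Phi> A \<otimes>\<^sub>H \<Phi> B) (\<Phi> unitG)"
    by (rule H.intertwiner_comp[OF u_intertwiner p' TObj_reps(2) H.Unit_rep obj[OF G.Unit_rep]])
  have r: "(u * p') * K \<in> intertwiners H (\<Phi> (A \<otimes>\<^sub>G B)) (\<Phi> unitG)"
    by (rule H.intertwiner_comp[OF up K(1) obj[OF TObj_reps(1)] TObj_reps(2) obj[OF G.Unit_rep]])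
  obtain p where p: "p \<in> intertwiners G (A \<otimes>\<^sub>G B) unitG" "\<phi> (A \<otimes>\<^sub>G B) unitG p = (u * p') * K"
    by (rule full[OF TObj_reps(1) G.Unit_rep r])
  have "(u * p') * K * J A B = (u * p') * (K * J A B)"
    using dim_intertwiner[OF up] dim_intertwiner[OF K(1)] dim_intertwiner[OF J_intertwiner[OF A B]]
    by (intro mat_mult_assoc) auto
  also have "\<dots> = u * p'"
    unfolding K(2) using intertwiners_carrier[OF up] by (simp only: fst_Rep_obj right_mult_one_mat)
  finally have "transported_pairing A B p p'"
    unfolding transported_pairing_def p(2) using p(1) p' by simp
  then show thesis by (rule that)
qed

lemma transported_copairing_ex_inv:
  assumes q': "q' \<in> intertwiners H unitH (\<Phi> A \<otimes>\<^sub>H \<Phi> B)"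
  obtains q where "transported_copairing A B q q'"
proof -
  obtain v where v: "v \<in> intertwiners H (\<Phi> unitG) unitH" "v * u = 1\<^sub>m 1" by (rule u_inverse)
  have Jq: "J A B * q' \<in> intertwiners H unitH (\<Phi> (A \<otimes>\<^sub>G B))"
    by (rule H.intertwiner_comp[OF J_intertwiner[OF A B] q' H.Unit_rep TObj_reps(2) obj[OF TObj_reps(1)]])
  have r: "(J A B * q') * v \<in> intertwiners H (\<Phi> unitG) (\<Phi> (A \<otimes>\<^sub>G B))"
    by (rule H.intertwiner_comp[OF Jq v(1) obj[OF G.Unit_rep] H.Unit_rep obj[OF TObj_reps(1)]])
  obtain q where q: "q \<in> intertwiners G unitG (A \<otimes>\<^sub>G B)" "\<phi> unitG (A \<otimes>\<^sub>G B) q = (J A B * q') * v"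
    by (rule full[OF G.Unit_rep TObj_reps(1) r])
  have "(J A B * q') * v * u = (J A B * q') * (v * u)"
    using dim_intertwiner[OF Jq] dim_intertwiner[OF v(1)] dim_intertwiner[OF u_intertwiner]
    by (intro mat_mult_assoc) auto
  also have "\<dots> = J A B * q'"
    unfolding v(2) using intertwiners_carrier[OF Jq] by (simp only: fst_Rep_obj right_mult_one_mat)
  finally have "transported_copairing A B q q'"
    unfolding transported_copairing_def q(2) using q(1) q' by simp
  then show thesis by (rule that)
qed

end

end

text \<open>The matrix computation behind functoriality of a zigzag composite. The letters
  \<open>j1\<close> to \<open>j6\<close> stand for components of \<open>J\<close>, \<open>fp\<close>
  and \<open>fq\<close> for the images of the pairing and the copairing, \<open>Fp\<close> and
  \<open>Fq\<close> for the images of their tensor products with an identity. An identity built from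
  \<open>j1\<close> and \<open>u\<close> is inserted, naturality extracts \<open>Fp\<close>,
  associativity of \<open>J\<close> passes the middle, and naturality on the other side extracts
  \<open>Fq\<close>.\<close>

lemma zigzag_chain:
  fixes u p q :: "complex mat"
  assumes car: "u \<in> carrier_mat i 1" "p \<in> carrier_mat 1 (a * b)" "q \<in> carrier_mat (b * a) 1"
    "j1 \<in> carrier_mat a (i * a)" "fp \<in> carrier_mat i x" "j2 \<in> carrier_mat x (a * b)"
    "Fp \<in> carrier_mat a y" "j3 \<in> carrier_mat y (x * a)" "j4 \<in> carrier_mat w (b * a)"
    "j5 \<in> carrier_mat y (a * w)" "fq \<in> carrier_mat w i" "Fq \<in> carrier_mat y a" "j6 \<in> carrier_mat a (a * i)"
    and eq: "j1 * kronecker u (1\<^sub>m a) = 1\<^sub>m a" "u * p = fp * j2"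
    "j1 * kronecker fp (1\<^sub>m a) = Fp * j3"
    "j3 * kronecker j2 (1\<^sub>m a) = j5 * kronecker (1\<^sub>m a) j4" "j4 * q = fq * u"
    "j5 * kronecker (1\<^sub>m a) fq = Fq * j6" "j6 * kronecker (1\<^sub>m a) u = 1\<^sub>m a"
  shows "kronecker p (1\<^sub>m a) * kronecker (1\<^sub>m a) q = Fp * Fq"
proof -
  note d = car[THEN carrier_matD(1)] car[THEN carrier_matD(2)]
  let ?Z = "kronecker p (1\<^sub>m a) * kronecker (1\<^sub>m a) q"
  have k1: "kronecker u (1\<^sub>m a) * kronecker p (1\<^sub>m a) = kronecker fp (1\<^sub>m a) * kronecker j2 (1\<^sub>m a)"
    by (simp add: kronecker_mult d eq(2))
  have k2: "kronecker (1\<^sub>m a) j4 * kronecker (1\<^sub>m a) q = kronecker (1\<^sub>m a) fq * kronecker (1\<^sub>m a) u"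
    by (simp add: kronecker_mult d eq(5))
  have "?Z = (j1 * kronecker u (1\<^sub>m a)) * ?Z"
    unfolding eq(1) by (rule left_mult_one_mat[of _ a a, symmetric]) (use d in \<open>auto intro!: carrier_matI\<close>)
  also have "\<dots> = j1 * ((kronecker u (1\<^sub>m a) * kronecker p (1\<^sub>m a)) * kronecker (1\<^sub>m a) q)"
    by (simp add: mat_mult_assoc d ac_simps)
  also have "\<dots> = (j1 * kronecker fp (1\<^sub>m a)) * (kronecker j2 (1\<^sub>m a) * kronecker (1\<^sub>m a) q)"
    unfolding k1 by (simp add: mat_mult_assoc d ac_simps)
  also have "\<dots> = Fp * ((j3 * kronecker j2 (1\<^sub>m a)) * kronecker (1\<^sub>m a) q)"
    unfolding eq(3) by (simp add: mat_mult_assoc d ac_simps)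
  also have "\<dots> = Fp * (j5 * (kronecker (1\<^sub>m a) j4 * kronecker (1\<^sub>m a) q))"
    unfolding eq(4) by (simp add: mat_mult_assoc d ac_simps)
  also have "\<dots> = Fp * ((j5 * kronecker (1\<^sub>m a) fq) * kronecker (1\<^sub>m a) u)"
    unfolding k2 by (simp add: mat_mult_assoc d ac_simps)
  also have "\<dots> = Fp * (Fq * (j6 * kronecker (1\<^sub>m a) u))"
    unfolding eq(6) by (simp add: mat_mult_assoc d ac_simps)
  also have "\<dots> = Fp * Fq"
    unfolding eq(7) right_mult_one_mat[OF car(12)] ..
  finally show ?thesis .
qed

text \<open>The mirror image of \<open>zigzag_chain\<close>, with the identity on the other side of
  each tensor product.\<close>

lemma zigzag_chain':
  fixes u p q :: "complex mat"
  assumes car: "u \<in> carrier_mat i 1" "p \<in> carrier_mat 1 (a * b)" "q \<in> carrier_mat (b * a) 1"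
    "j1 \<in> carrier_mat b (b * i)" "fp \<in> carrier_mat i x" "j2 \<in> carrier_mat x (a * b)"
    "Fp \<in> carrier_mat b y" "j3 \<in> carrier_mat y (b * x)" "j4 \<in> carrier_mat w (b * a)"
    "j5 \<in> carrier_mat y (w * b)" "fq \<in> carrier_mat w i" "Fq \<in> carrier_mat y b" "j6 \<in> carrier_mat b (i * b)"
    and eq: "j1 * kronecker (1\<^sub>m b) u = 1\<^sub>m b" "u * p = fp * j2"
    "j1 * kronecker (1\<^sub>m b) fp = Fp * j3"
    "j3 * kronecker (1\<^sub>m b) j2 = j5 * kronecker j4 (1\<^sub>m b)" "j4 * q = fq * u"
    "j5 * kronecker fq (1\<^sub>m b) = Fq * j6" "j6 * kronecker u (1\<^sub>m b) = 1\<^sub>m b"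
  shows "kronecker (1\<^sub>m b) p * kronecker q (1\<^sub>m b) = Fp * Fq"
proof -
  note d = car[THEN carrier_matD(1)] car[THEN carrier_matD(2)]
  let ?Z = "kronecker (1\<^sub>m b) p * kronecker q (1\<^sub>m b)"
  have k1: "kronecker (1\<^sub>m b) u * kronecker (1\<^sub>m b) p = kronecker (1\<^sub>m b) fp * kronecker (1\<^sub>m b) j2"
    by (simp add: kronecker_mult d eq(2))
  have k2: "kronecker j4 (1\<^sub>m b) * kronecker q (1\<^sub>m b) = kronecker fq (1\<^sub>m b) * kronecker u (1\<^sub>m b)"
    by (simp add: kronecker_mult d eq(5))
  have "?Z = (j1 * kronecker (1\<^sub>m b) u) * ?Z"
    unfolding eq(1) by (rule left_mult_one_mat[of _ b b, symmetric]) (use d in \<open>auto intro!: carrier_matI\<close>)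
  also have "\<dots> = j1 * ((kronecker (1\<^sub>m b) u * kronecker (1\<^sub>m b) p) * kronecker q (1\<^sub>m b))"
    by (simp add: mat_mult_assoc d ac_simps)
  also have "\<dots> = (j1 * kronecker (1\<^sub>m b) fp) * (kronecker (1\<^sub>m b) j2 * kronecker q (1\<^sub>m b))"
    unfolding k1 by (simp add: mat_mult_assoc d ac_simps)
  also have "\<dots> = Fp * ((j3 * kronecker (1\<^sub>m b) j2) * kronecker q (1\<^sub>m b))"
    unfolding eq(3) by (simp add: mat_mult_assoc d ac_simps)
  also have "\<dots> = Fp * (j5 * (kronecker j4 (1\<^sub>m b) * kronecker q (1\<^sub>m b)))"
    unfolding eq(4) by (simp add: mat_mult_assoc d ac_simps)
  also have "\<dots> = Fp * ((j5 * kronecker fq (1\<^sub>m b)) * kronecker u (1\<^sub>m b))"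
    unfolding k2 by (simp add: mat_mult_assoc d ac_simps)
  also have "\<dots> = Fp * (Fq * (j6 * kronecker u (1\<^sub>m b)))"
    unfolding eq(6) by (simp add: mat_mult_assoc d ac_simps)
  also have "\<dots> = Fp * Fq"
    unfolding eq(7) right_mult_one_mat[OF car(12)] ..
  finally show ?thesis .
qed

text \<open>For symmetric \<open>B\<close> the transpose of \<open>C\<close> is again a two-sided
  inverse of \<open>B\<close>, so the asymmetry is trivial and both expressions collapse to the
  trace of \<open>g\<close>.\<close>

lemma symmetric_form_traces:
  fixes B C g :: "complex mat"
  assumes B: "B \<in> carrier_mat n n" and C: "C \<in> carrier_mat n n" and g: "g \<in> carrier_mat n n"
    and BC: "B * C = 1\<^sub>m n" and sym: "B\<^sup>T = B"
  shows "mat_trace (g\<^sup>T * B * C\<^sup>T) = mat_trace g"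
    "mat_trace (B * g * C\<^sup>T) = mat_trace g"
proof -
  note d = carrier_matD[OF B] carrier_matD[OF C] carrier_matD[OF g]
  have CtB: "C\<^sup>T * B = 1\<^sub>m n" using transpose_mult[OF B C] BC sym by simp
  have BCt: "B * C\<^sup>T = 1\<^sub>m n"
    by (rule mat_mult_left_right_inverse[OF _ B CtB]) (use C in simp)
  have "g\<^sup>T * B * C\<^sup>T = g\<^sup>T * (B * C\<^sup>T)"
    by (simp add: mat_mult_assoc d)
  then have "g\<^sup>T * B * C\<^sup>T = g\<^sup>T"
    unfolding BCt using g by simp
  then show "mat_trace (g\<^sup>T * B * C\<^sup>T) = mat_trace g"
    using mat_trace_transpose[OF g] by simp
  have "mat_trace (B * g * C\<^sup>T) = mat_trace (C\<^sup>T * (B * g))"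
    by (rule mat_trace_mult_comm[of _ n n]) (use d in \<open>auto intro!: carrier_matI\<close>)
  also have "C\<^sup>T * (B * g) = (C\<^sup>T * B) * g"
    by (simp add: mat_mult_assoc d)
  finally show "mat_trace (B * g * C\<^sup>T) = mat_trace g"
    unfolding CtB using g by simp
qed

context rep_equivalence
begin

text \<open>Zigzag composites involve only tensor products and composition, so they pass through the
  functor although it ignores the flip. In particular mutually inverse pairings and copairings stay
  mutually inverse.\<close>

lemma transported_zigzag:
  assumes A: "A \<in> representations G" and B: "B \<in> representations G"
    and P: "transported_pairing A B p p'" and Q: "transported_copairing B A q q'"
  defines "a \<equiv> fst (\<Phi> A)" and "b \<equiv> fst (\<Phi> B)"
  shows "kronecker p (1\<^sub>m (fst A)) * kronecker (1\<^sub>m (fst A)) q \<in> intertwiners G A A"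
    "kronecker p' (1\<^sub>m a) * kronecker (1\<^sub>m a) q' =
      \<phi> A A (kronecker p (1\<^sub>m (fst A)) * kronecker (1\<^sub>m (fst A)) q)"
    "kronecker (1\<^sub>m b) p' * kronecker q' (1\<^sub>m b) =
      \<phi> B B (kronecker (1\<^sub>m (fst B)) p * kronecker q (1\<^sub>m (fst B)))"
proof -
  note I = G.Unit_rep
  have AB: "A \<otimes>\<^sub>G B \<in> representations G" and BA: "B \<otimes>\<^sub>G A \<in> representations G" using A B by simp_all
  from P have p: "p \<in> intertwiners G (A \<otimes>\<^sub>G B) unitG" "p' \<in> intertwiners H (\<Phi> A \<otimes>\<^sub>H \<Phi> B) unitH"
    "u * p' = \<phi> (A \<otimes>\<^sub>G B) unitG p * J A B"
    by (auto simp: transported_pairing_def)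
  from Q have q: "q \<in> intertwiners G unitG (B \<otimes>\<^sub>G A)" "q' \<in> intertwiners H unitH (\<Phi> B \<otimes>\<^sub>H \<Phi> A)"
    "J B A * q' = \<phi> unitG (B \<otimes>\<^sub>G A) q * u"
    by (auto simp: transported_copairing_def)
  note uA = G.TObj_Unit[OF A] and uB = G.TObj_Unit[OF B]
  note assoc = G.TObj_assoc[OF A B A] and assoc' = G.TObj_assoc[OF B A B]
  let ?X = "(A \<otimes>\<^sub>G B) \<otimes>\<^sub>G A" and ?Y = "B \<otimes>\<^sub>G (A \<otimes>\<^sub>G B)"
  have X: "?X \<in> representations G" and Y: "?Y \<in> representations G" using A B by simp_all
  have p1: "kronecker p (1\<^sub>m (fst A)) \<in> intertwiners G ?X A"
    using G.intertwiner_kronecker[OF p(1) G.intertwiner_id[OF A] AB I A A] unfolding uA .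
  have q1: "kronecker (1\<^sub>m (fst A)) q \<in> intertwiners G A ?X"
    using G.intertwiner_kronecker[OF G.intertwiner_id[OF A] q(1) A A I BA] unfolding uA assoc .
  have p2: "kronecker (1\<^sub>m (fst B)) p \<in> intertwiners G ?Y B"
    using G.intertwiner_kronecker[OF G.intertwiner_id[OF B] p(1) B B AB I] unfolding uB .
  have q2: "kronecker q (1\<^sub>m (fst B)) \<in> intertwiners G B ?Y"
    using G.intertwiner_kronecker[OF q(1) G.intertwiner_id[OF B] I BA B B] unfolding uB assoc' .
  show "kronecker p (1\<^sub>m (fst A)) * kronecker (1\<^sub>m (fst A)) q \<in> intertwiners G A A"
    by (rule G.intertwiner_comp[OF p1 q1 A X A])
  note c = intertwiners_carrier
  note fp = arr[OF AB I p(1)] and fq = arr[OF I BA q(1)]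
  have JI: "J unitG A \<in> carrier_mat a (fst (\<Phi> unitG) * a)" "J A unitG \<in> carrier_mat a (a * fst (\<Phi> unitG))"
      "J unitG B \<in> carrier_mat b (fst (\<Phi> unitG) * b)" "J B unitG \<in> carrier_mat b (b * fst (\<Phi> unitG))"
    using c[OF J_intertwiner[OF I A]] c[OF J_intertwiner[OF A I]] c[OF J_intertwiner[OF I B]] c[OF J_intertwiner[OF B I]]
    unfolding uA uB a_def b_def by simp_all
  have n1: "J unitG A * kronecker (\<phi> (A \<otimes>\<^sub>G B) unitG p) (1\<^sub>m a) =
      \<phi> ?X A (kronecker p (1\<^sub>m (fst A))) * J (A \<otimes>\<^sub>G B) A"
    using J_natural[OF AB I A A p(1) G.intertwiner_id[OF A]] unfolding arr_id[OF A] uA a_def .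
  have n2: "J A (B \<otimes>\<^sub>G A) * kronecker (1\<^sub>m a) (\<phi> unitG (B \<otimes>\<^sub>G A) q) =
      \<phi> A ?X (kronecker (1\<^sub>m (fst A)) q) * J A unitG"
    using J_natural[OF A A I BA G.intertwiner_id[OF A] q(1)] unfolding arr_id[OF A] uA assoc a_def .
  have n3: "J B unitG * kronecker (1\<^sub>m b) (\<phi> (A \<otimes>\<^sub>G B) unitG p) =
      \<phi> ?Y B (kronecker (1\<^sub>m (fst B)) p) * J B (A \<otimes>\<^sub>G B)"
    using J_natural[OF B B AB I G.intertwiner_id[OF B] p(1)] unfolding arr_id[OF B] uB b_def .
  have n4: "J (B \<otimes>\<^sub>G A) B * kronecker (\<phi> unitG (B \<otimes>\<^sub>G A) q) (1\<^sub>m b) =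
      \<phi> B ?Y (kronecker q (1\<^sub>m (fst B))) * J unitG B"
    using J_natural[OF I BA B B q(1) G.intertwiner_id[OF B]] unfolding arr_id[OF B] uB assoc' b_def .
  have "kronecker p' (1\<^sub>m a) * kronecker (1\<^sub>m a) q' =
      \<phi> ?X A (kronecker p (1\<^sub>m (fst A))) * \<phi> A ?X (kronecker (1\<^sub>m (fst A)) q)"
  proof (rule zigzag_chain[OF _ _ _ JI(1) _ _ _ _ _ _ _ _ JI(2)])
    show "u \<in> carrier_mat (fst (\<Phi> unitG)) 1" using c[OF u_intertwiner] by simp
    show "p' \<in> carrier_mat 1 (a * b)" "q' \<in> carrier_mat (b * a) 1"
      using c[OF p(2)] c[OF q(2)] by (simp_all add: a_def b_def)
    show "\<phi> (A \<otimes>\<^sub>G B) unitG p \<in> carrier_mat (fst (\<Phi> unitG)) (fst (\<Phi> (A \<otimes>\<^sub>G B)))" by (rule c[OF fp])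
    show "\<phi> unitG (B \<otimes>\<^sub>G A) q \<in> carrier_mat (fst (\<Phi> (B \<otimes>\<^sub>G A))) (fst (\<Phi> unitG))" by (rule c[OF fq])
    show "J A B \<in> carrier_mat (fst (\<Phi> (A \<otimes>\<^sub>G B))) (a * b)" "J B A \<in> carrier_mat (fst (\<Phi> (B \<otimes>\<^sub>G A))) (b * a)"
      using c[OF J_intertwiner[OF A B]] c[OF J_intertwiner[OF B A]] by (simp_all add: a_def b_def)
    show "\<phi> ?X A (kronecker p (1\<^sub>m (fst A))) \<in> carrier_mat a (fst (\<Phi> ?X))"
      "\<phi> A ?X (kronecker (1\<^sub>m (fst A)) q) \<in> carrier_mat (fst (\<Phi> ?X)) a"
      using c[OF arr[OF X A p1]] c[OF arr[OF A X q1]] by (simp_all add: a_def)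
    show "J (A \<otimes>\<^sub>G B) A \<in> carrier_mat (fst (\<Phi> ?X)) (fst (\<Phi> (A \<otimes>\<^sub>G B)) * a)"
      using c[OF J_intertwiner[OF AB A]] by (simp add: a_def)
    show "J A (B \<otimes>\<^sub>G A) \<in> carrier_mat (fst (\<Phi> ?X)) (a * fst (\<Phi> (B \<otimes>\<^sub>G A)))"
      using c[OF J_intertwiner[OF A BA]] unfolding assoc by (simp add: a_def)
    show "J unitG A * kronecker u (1\<^sub>m a) = 1\<^sub>m a" "J A unitG * kronecker (1\<^sub>m a) u = 1\<^sub>m a"
      using J_unit[OF A] unfolding a_def by simp_all
    show "J (A \<otimes>\<^sub>G B) A * kronecker (J A B) (1\<^sub>m a) = J A (B \<otimes>\<^sub>G A) * kronecker (1\<^sub>m a) (J B A)"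
      unfolding a_def by (rule J_assoc[OF A B A])
  qed (rule p(3) q(3) n1 n2)+
  then show "kronecker p' (1\<^sub>m a) * kronecker (1\<^sub>m a) q' =
      \<phi> A A (kronecker p (1\<^sub>m (fst A)) * kronecker (1\<^sub>m (fst A)) q)"
    unfolding arr_comp[OF A X A q1 p1] .
  have "kronecker (1\<^sub>m b) p' * kronecker q' (1\<^sub>m b) =
      \<phi> ?Y B (kronecker (1\<^sub>m (fst B)) p) * \<phi> B ?Y (kronecker q (1\<^sub>m (fst B)))"
  proof (rule zigzag_chain'[OF _ _ _ JI(4) _ _ _ _ _ _ _ _ JI(3)])
    show "u \<in> carrier_mat (fst (\<Phi> unitG)) 1" using c[OF u_intertwiner] by simp
    show "p' \<in> carrier_mat 1 (a * b)" "q' \<in> carrier_mat (b * a) 1"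
      using c[OF p(2)] c[OF q(2)] by (simp_all add: a_def b_def)
    show "\<phi> (A \<otimes>\<^sub>G B) unitG p \<in> carrier_mat (fst (\<Phi> unitG)) (fst (\<Phi> (A \<otimes>\<^sub>G B)))" by (rule c[OF fp])
    show "\<phi> unitG (B \<otimes>\<^sub>G A) q \<in> carrier_mat (fst (\<Phi> (B \<otimes>\<^sub>G A))) (fst (\<Phi> unitG))" by (rule c[OF fq])
    show "J A B \<in> carrier_mat (fst (\<Phi> (A \<otimes>\<^sub>G B))) (a * b)" "J B A \<in> carrier_mat (fst (\<Phi> (B \<otimes>\<^sub>G A))) (b * a)"
      using c[OF J_intertwiner[OF A B]] c[OF J_intertwiner[OF B A]] by (simp_all add: a_def b_def)
    show "\<phi> ?Y B (kronecker (1\<^sub>m (fst B)) p) \<in> carrier_mat b (fst (\<Phi> ?Y))"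
      "\<phi> B ?Y (kronecker q (1\<^sub>m (fst B))) \<in> carrier_mat (fst (\<Phi> ?Y)) b"
      using c[OF arr[OF Y B p2]] c[OF arr[OF B Y q2]] by (simp_all add: b_def)
    show "J B (A \<otimes>\<^sub>G B) \<in> carrier_mat (fst (\<Phi> ?Y)) (b * fst (\<Phi> (A \<otimes>\<^sub>G B)))"
      using c[OF J_intertwiner[OF B AB]] by (simp add: b_def)
    show "J (B \<otimes>\<^sub>G A) B \<in> carrier_mat (fst (\<Phi> ?Y)) (fst (\<Phi> (B \<otimes>\<^sub>G A)) * b)"
      using c[OF J_intertwiner[OF BA B]] unfolding assoc' by (simp add: b_def)
    show "J B unitG * kronecker (1\<^sub>m b) u = 1\<^sub>m b" "J unitG B * kronecker u (1\<^sub>m b) = 1\<^sub>m b"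
      using J_unit[OF B] unfolding b_def by simp_all
    show "J B (A \<otimes>\<^sub>G B) * kronecker (1\<^sub>m b) (J A B) = J (B \<otimes>\<^sub>G A) B * kronecker (J B A) (1\<^sub>m b)"
      unfolding b_def by (rule J_assoc[OF B A B, symmetric])
  qed (rule p(3) q(3) n3 n4)+
  then show "kronecker (1\<^sub>m b) p' * kronecker q' (1\<^sub>m b) =
      \<phi> B B (kronecker (1\<^sub>m (fst B)) p * kronecker q (1\<^sub>m (fst B)))"
    unfolding arr_comp[OF B Y B q2 p2] .
qed

lemma transported_pairing_form:
  assumes "transported_pairing A B p p'"
  obtains P where "P \<in> carrier_mat (fst (\<Phi> A)) (fst (\<Phi> B))" "p' = form_row P"
proof -
  have "p' \<in> carrier_mat 1 (fst (\<Phi> A) * fst (\<Phi> B))"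
  proof -
    have "p' \<in> intertwiners H (\<Phi> A \<otimes>\<^sub>H \<Phi> B) unitH"
      using assms by (simp add: transported_pairing_def)
    from intertwiners_carrier[OF this] show ?thesis by simp
  qed
  then show thesis by (rule form_row_surj) (rule that)
qed

lemma transported_copairing_form:
  assumes "transported_copairing A B q q'"
  obtains Q where "Q \<in> carrier_mat (fst (\<Phi> A)) (fst (\<Phi> B))" "q' = form_col Q"
proof -
  have "q' \<in> carrier_mat (fst (\<Phi> A) * fst (\<Phi> B)) 1"
  proof -
    have "q' \<in> intertwiners H unitH (\<Phi> A \<otimes>\<^sub>H \<Phi> B)"
      using assms by (simp add: transported_copairing_def)
    from intertwiners_carrier[OF this] show ?thesis by simp
  qed
  then show thesis by (rule form_col_surj) (rule that)
qed

text \<open>Evaluation and coevaluation are transported with their triangle identities, which gives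
  a perfect pairing between the image of the dual and the image of the object.\<close>

lemma rep_iso_dual:
  assumes A: "A \<in> representations G"
  shows "H.rep_iso (\<Phi> (Dual (Rep G) A)) (Dual (Rep H) (\<Phi> A))"
proof -
  let ?D = "Dual (Rep G) A" and ?n = "fst A"
  have D: "?D \<in> representations G" using A by simp
  have p: "form_row (1\<^sub>m ?n) \<in> intertwiners G (?D \<otimes>\<^sub>G A) unitG"
  proof (subst G.form_row_intertwiner_iff[OF D A])
    show "1\<^sub>m ?n \<in> carrier_mat (fst ?D) ?n" by simp
    show "\<forall>g\<in>carrier G. (snd ?D g)\<^sup>T * 1\<^sub>m ?n * snd A g = 1\<^sub>m ?n"
      using A by (auto simp: G.rep_inv right_mult_one_mat[OF G.rep_carrier[OF A G.inv_closed]])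
  qed
  have q: "form_col (1\<^sub>m ?n) \<in> intertwiners G unitG (A \<otimes>\<^sub>G ?D)"
    by (rule G.form_col_intertwiner[OF A D])
      (use A in \<open>auto simp: G.rep_inv right_mult_one_mat[OF G.rep_carrier[OF A]]\<close>)
  obtain p' where p': "transported_pairing ?D A (form_row (1\<^sub>m ?n)) p'"
    by (rule transported_pairing_ex[OF D A p])
  obtain q' where q': "transported_copairing A ?D (form_col (1\<^sub>m ?n)) q'"
    by (rule transported_copairing_ex[OF A D q])
  obtain P where P: "P \<in> carrier_mat (fst (\<Phi> ?D)) (fst (\<Phi> A))" "p' = form_row P"
    by (rule transported_pairing_form[OF p'])
  obtain Q where Q: "Q \<in> carrier_mat (fst (\<Phi> A)) (fst (\<Phi> ?D))" "q' = form_col Q"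
    by (rule transported_copairing_form[OF q'])
  have z: "kronecker (form_row (1\<^sub>m ?n)) (1\<^sub>m ?n) * kronecker (1\<^sub>m ?n) (form_col (1\<^sub>m ?n)) = 1\<^sub>m ?n"
    "kronecker (1\<^sub>m ?n) (form_row (1\<^sub>m ?n)) * kronecker (form_col (1\<^sub>m ?n)) (1\<^sub>m ?n) = 1\<^sub>m ?n"
    using form_zigzag[of "1\<^sub>m ?n" ?n ?n "1\<^sub>m ?n" ?n] form_zigzag'[of "1\<^sub>m ?n" ?n ?n "1\<^sub>m ?n"] by simp_all
  note zz = transported_zigzag[OF D A p' q']
  have "(P * Q)\<^sup>T = 1\<^sub>m (fst (\<Phi> ?D))"
    using zz(2) arr_id[OF D] form_zigzag[OF P(1) Q(1)] unfolding P(2) Q(2) by (simp add: z)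
  then have PQ: "P * Q = 1\<^sub>m (fst (\<Phi> ?D))"
    by (metis transpose_transpose transpose_one)
  have QP: "Q * P = 1\<^sub>m (fst (\<Phi> A))"
    using zz(3) arr_id[OF A] form_zigzag'[OF P(1) Q(1)] unfolding P(2) Q(2) by (simp add: z)
  have "form_row P \<in> intertwiners H (\<Phi> ?D \<otimes>\<^sub>H \<Phi> A) unitH"
    using p' unfolding transported_pairing_def P(2) by blast
  then show ?thesis
    by (rule H.pairing_dual_iso[OF obj[OF A] obj[OF D] P(1) Q(1) PQ QP])
qed

text \<open>The composite \<open>p * (k * q)\<close> is an endomorphism of the unit, hence a scalar.
  A linear functor keeps the scalar, and conjugation by \<open>u\<close> does not change it. The
  matrix \<open>K\<close> corresponds to \<open>k\<close> under \<open>J\<close>.\<close>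

lemma transported_scalar:
  assumes M: "M \<in> representations G" and P: "transported_pairing M M p p'" and Q: "transported_copairing M M q q'"
    and k: "k \<in> intertwiners G (M \<otimes>\<^sub>G M) (M \<otimes>\<^sub>G M)"
    and K: "K \<in> carrier_mat (fst (\<Phi> M) * fst (\<Phi> M)) (fst (\<Phi> M) * fst (\<Phi> M))"
    and JK: "J M M * K = \<phi> (M \<otimes>\<^sub>G M) (M \<otimes>\<^sub>G M) k * J M M"
    and s: "p * (k * q) = s \<cdot>\<^sub>m 1\<^sub>m 1"
  shows "p' * (K * q') = s \<cdot>\<^sub>m 1\<^sub>m 1"
proof -
  note I = G.Unit_rep
  have MM: "M \<otimes>\<^sub>G M \<in> representations G" using M by simp
  from P have p: "p \<in> intertwiners G (M \<otimes>\<^sub>G M) unitG" "p' \<in> intertwiners H (\<Phi> M \<otimes>\<^sub>H \<Phi> M) unitH"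
    "u * p' = \<phi> (M \<otimes>\<^sub>G M) unitG p * J M M"
    by (auto simp: transported_pairing_def)
  from Q have q: "q \<in> intertwiners G unitG (M \<otimes>\<^sub>G M)" "q' \<in> intertwiners H unitH (\<Phi> M \<otimes>\<^sub>H \<Phi> M)"
    "J M M * q' = \<phi> unitG (M \<otimes>\<^sub>G M) q * u"
    by (auto simp: transported_copairing_def)
  let ?p = "\<phi> (M \<otimes>\<^sub>G M) unitG p" and ?k = "\<phi> (M \<otimes>\<^sub>G M) (M \<otimes>\<^sub>G M) k" and ?q = "\<phi> unitG (M \<otimes>\<^sub>G M) q"
  note d = dim_intertwiner[OF arr[OF MM I p(1)]] dim_intertwiner[OF arr[OF MM MM k]] dim_intertwiner[OF arr[OF I MM q(1)]]
    dim_intertwiner[OF p(2)] dim_intertwiner[OF q(2)] dim_intertwiner[OF u_intertwiner]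
    dim_intertwiner[OF J_intertwiner[OF M M]] carrier_matD[OF K]
  let ?Y = "p' * (K * q')"
  have Y: "?Y \<in> carrier_mat 1 1" using d by (auto intro!: carrier_matI)
  have "u * ?Y = (u * p') * (K * q')" by (simp add: mat_mult_assoc d)
  also have "\<dots> = ?p * ((J M M * K) * q')" unfolding p(3) by (simp add: mat_mult_assoc d)
  also have "\<dots> = ?p * (?k * (J M M * q'))" unfolding JK by (simp add: mat_mult_assoc d)
  also have "\<dots> = (?p * (?k * ?q)) * u" unfolding q(3) by (simp add: mat_mult_assoc d)
  also have "?p * (?k * ?q) = \<phi> unitG unitG (p * (k * q))"
    using arr_comp[OF I MM MM q(1) k] arr_comp[OF I MM I G.intertwiner_comp[OF k q(1) I MM MM] p(1)] by simp
  also have "\<dots> = s \<cdot>\<^sub>m 1\<^sub>m (fst (\<Phi> unitG))"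
    unfolding s using arr_smult[OF I I G.intertwiner_id[OF I], of s] arr_id[OF I] by simp
  also have "(s \<cdot>\<^sub>m 1\<^sub>m (fst (\<Phi> unitG))) * u = s \<cdot>\<^sub>m u"
    using mult_smult_assoc_mat[of "1\<^sub>m (fst (\<Phi> unitG))" "fst (\<Phi> unitG)" "fst (\<Phi> unitG)" u 1 s]
      intertwiners_carrier[OF u_intertwiner] by simp
  \<comment> \<open>Cancelling \<open>u\<close> on the left by its inverse \<open>v\<close> leaves
    the claim.\<close>
  finally have uY: "u * ?Y = s \<cdot>\<^sub>m u" .
  obtain v where v: "v \<in> intertwiners H (\<Phi> unitG) unitH" "v * u = 1\<^sub>m 1" by (rule u_inverse)
  note vc = intertwiners_carrier[OF v(1)] intertwiners_carrier[OF u_intertwiner]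
  have "?Y = (v * u) * ?Y" unfolding v(2) using Y by (simp only: left_mult_one_mat)
  also have "\<dots> = v * (u * ?Y)" using vc Y by (intro mat_mult_assoc) auto
  also have "\<dots> = s \<cdot>\<^sub>m (v * u)" unfolding uY by (rule mult_smult_distrib[OF vc])
  finally show ?thesis unfolding v(2) .
qed

context
  fixes M B C B' C'
  assumes M: "M \<in> representations G"
    and B: "B \<in> carrier_mat (fst M) (fst M)" and C: "C \<in> carrier_mat (fst M) (fst M)"
    and B': "B' \<in> carrier_mat (fst (\<Phi> M)) (fst (\<Phi> M))" and C': "C' \<in> carrier_mat (fst (\<Phi> M)) (fst (\<Phi> M))"
    and P: "transported_pairing M M (form_row B) (form_row B')"
    and Q: "transported_copairing M M (form_col C) (form_col C')"
begin

text \<open>The zigzag of the transported data is the image of the original zigzag, and faithfulness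
  makes the correspondence an equivalence, so it serves transport in both directions.\<close>

lemma transported_inverse: "B' * C' = 1\<^sub>m (fst (\<Phi> M)) \<longleftrightarrow> B * C = 1\<^sub>m (fst M)"
proof -
  note zz = transported_zigzag[OF M M P Q]
  have z: "(B' * C')\<^sup>T = \<phi> M M ((B * C)\<^sup>T)" "(B * C)\<^sup>T \<in> intertwiners G M M"
    using zz(1,2) unfolding form_zigzag[OF B C] form_zigzag[OF B' C'] by simp_all
  have "B' * C' = 1\<^sub>m (fst (\<Phi> M)) \<longleftrightarrow> (B' * C')\<^sup>T = 1\<^sub>m (fst (\<Phi> M))"
    by (metis transpose_one transpose_transpose)
  also have "\<dots> \<longleftrightarrow> (B * C)\<^sup>T = 1\<^sub>m (fst M)"
    unfolding z(1) using faithful[OF M M z(2) G.intertwiner_id[OF M]] arr_id[OF M] by metis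
  also have "\<dots> \<longleftrightarrow> B * C = 1\<^sub>m (fst M)"
    by (metis transpose_one transpose_transpose)
  finally show ?thesis .
qed

text \<open>The endomorphism is inserted on the first or on the second tensor factor between
  copairing and pairing; naturality of \<open>J\<close> with an identity in the other factor makes
  both scalars transportable.\<close>

lemma transported_traces:
  assumes g: "g \<in> intertwiners G M M"
  shows "mat_trace ((\<phi> M M g)\<^sup>T * B' * C'\<^sup>T) = mat_trace (g\<^sup>T * B * C\<^sup>T)"
    "mat_trace (B' * \<phi> M M g * C'\<^sup>T) = mat_trace (B * g * C\<^sup>T)"
proof -
  let ?n = "fst M" and ?m = "fst (\<Phi> M)" and ?f = "\<phi> M M g"
  note f = arr[OF M M g]
  note gc = intertwiners_carrier[OF g] and fc = intertwiners_carrier[OF f]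
  have scalar_eq: "s = t" if "s \<cdot>\<^sub>m 1\<^sub>m 1 = t \<cdot>\<^sub>m (1\<^sub>m 1 :: complex mat)" for s t
  proof -
    have "(s \<cdot>\<^sub>m 1\<^sub>m 1) $$ (0, 0) = (t \<cdot>\<^sub>m (1\<^sub>m 1 :: complex mat)) $$ (0, 0)" using that by simp
    then show ?thesis by simp
  qed
  \<comment> \<open>Evaluates the two scalars on either side of the equivalence: the endomorphism is
    absorbed into the Gram matrix, and contraction with the copairing is a trace.\<close>
  have val: "form_row X * (kronecker h (1\<^sub>m n) * form_col Y) = mat_trace (h\<^sup>T * X * Y\<^sup>T) \<cdot>\<^sub>m 1\<^sub>m 1"
    "form_row X * (kronecker (1\<^sub>m n) h * form_col Y) = mat_trace (X * h * Y\<^sup>T) \<cdot>\<^sub>m 1\<^sub>m 1"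
    if c: "X \<in> carrier_mat n n" "Y \<in> carrier_mat n n" "h \<in> carrier_mat n n" for X Y h n
  proof -
    note d = carrier_matD[OF c(1)] carrier_matD[OF c(2)] carrier_matD[OF c(3)]
    have m: "h\<^sup>T * X \<in> carrier_mat n n" "X * h \<in> carrier_mat n n"
      using d by (auto intro!: carrier_matI)
    have "form_row X * (kronecker h (1\<^sub>m n) * form_col Y) = (form_row X * kronecker h (1\<^sub>m n)) * form_col Y"
      "form_row X * (kronecker (1\<^sub>m n) h * form_col Y) = (form_row X * kronecker (1\<^sub>m n) h) * form_col Y"
      by (simp_all add: mat_mult_assoc d)
    moreover have "form_row X * kronecker h (1\<^sub>m n) = form_row (h\<^sup>T * X)"
      using form_row_kronecker[of h X "1\<^sub>m n"] d right_mult_one_mat[OF m(1)] by simp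
    moreover have "form_row X * kronecker (1\<^sub>m n) h = form_row (X * h)"
      using form_row_kronecker[of "1\<^sub>m n" X h] d left_mult_one_mat[OF c(1)] by simp
    ultimately show
      "form_row X * (kronecker h (1\<^sub>m n) * form_col Y) = mat_trace (h\<^sup>T * X * Y\<^sup>T) \<cdot>\<^sub>m 1\<^sub>m 1"
      "form_row X * (kronecker (1\<^sub>m n) h * form_col Y) = mat_trace (X * h * Y\<^sup>T) \<cdot>\<^sub>m 1\<^sub>m 1"
      using form_row_mult_form_col_trace[OF m(1) c(2)] form_row_mult_form_col_trace[OF m(2) c(2)] by simp_all
  qed
  note id = G.intertwiner_id[OF M]
  have n: "J M M * kronecker ?f (1\<^sub>m ?m) = \<phi> (M \<otimes>\<^sub>G M) (M \<otimes>\<^sub>G M) (kronecker g (1\<^sub>m ?n)) * J M M"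
    "J M M * kronecker (1\<^sub>m ?m) ?f = \<phi> (M \<otimes>\<^sub>G M) (M \<otimes>\<^sub>G M) (kronecker (1\<^sub>m ?n) g) * J M M"
    using J_natural[OF M M M M g id] J_natural[OF M M M M id g] unfolding arr_id[OF M] .
  have "form_row B' * (kronecker ?f (1\<^sub>m ?m) * form_col C') = mat_trace (g\<^sup>T * B * C\<^sup>T) \<cdot>\<^sub>m 1\<^sub>m 1"
    by (rule transported_scalar[OF M P Q G.intertwiner_kronecker[OF g id M M M M] _ n(1) val(1)[OF B C gc]])
      (use fc in \<open>auto intro!: carrier_matI\<close>)
  then show "mat_trace (?f\<^sup>T * B' * C'\<^sup>T) = mat_trace (g\<^sup>T * B * C\<^sup>T)"
    unfolding val(1)[OF B' C' fc] by (rule scalar_eq)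
  have "form_row B' * (kronecker (1\<^sub>m ?m) ?f * form_col C') = mat_trace (B * g * C\<^sup>T) \<cdot>\<^sub>m 1\<^sub>m 1"
    by (rule transported_scalar[OF M P Q G.intertwiner_kronecker[OF id g M M M M] _ n(2) val(2)[OF B C gc]])
      (use fc in \<open>auto intro!: carrier_matI\<close>)
  then show "mat_trace (B' * ?f * C'\<^sup>T) = mat_trace (B * g * C\<^sup>T)"
    unfolding val(2)[OF B' C' fc] by (rule scalar_eq)
qed

end

text \<open>The traces of the transported form equal those of the given symmetric form, which are
  plain traces of endomorphisms; this supplies both conditions of
  \<open>form_symmetric_if_traces\<close>. Each direction tests symmetry on the receiving side and
  uses the finiteness of that group.\<close>

lemma orthogonal_transport:
  assumes fin: "finite (carrier G)" "finite (carrier H)" and M: "M \<in> representations G"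
  shows "H.orthogonal (\<Phi> M) \<longleftrightarrow> G.orthogonal M"
proof
  let ?n = "fst M" and ?m = "fst (\<Phi> M)"
  note N = obj[OF M]
  assume "G.orthogonal M"
  then obtain B where "G.orthogonal_form M B" unfolding G.orthogonal_iff by blast
  then obtain C where B: "B \<in> carrier_mat ?n ?n" and C: "C \<in> carrier_mat ?n ?n"
    and sym: "B\<^sup>T = B" and BC: "B * C = 1\<^sub>m ?n" "C * B = 1\<^sub>m ?n"
    and inv: "\<forall>g\<in>carrier G. (snd M g)\<^sup>T * B * snd M g = B"
    by (auto simp: G.orthogonal_form_def)
  have p: "form_row B \<in> intertwiners G (M \<otimes>\<^sub>G M) unitG"
    unfolding G.form_row_intertwiner_iff[OF M M B] by (rule inv)
  have q: "form_col C \<in> intertwiners G unitG (M \<otimes>\<^sub>G M)"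
    by (rule G.form_col_intertwiner[OF M M C])
      (rule invariant_form_inverse[OF B C G.rep_carrier[OF M] BC(1) bspec[OF inv] BC(2)])
  obtain p' where p': "transported_pairing M M (form_row B) p'" by (rule transported_pairing_ex[OF M M p])
  obtain q' where q': "transported_copairing M M (form_col C) q'" by (rule transported_copairing_ex[OF M M q])
  obtain B' where B': "B' \<in> carrier_mat ?m ?m" "p' = form_row B'" by (rule transported_pairing_form[OF p'])
  obtain C' where C': "C' \<in> carrier_mat ?m ?m" "q' = form_col C'" by (rule transported_copairing_form[OF q'])
  note P = p'[unfolded B'(2)] and Q = q'[unfolded C'(2)]
  have BC': "B' * C' = 1\<^sub>m ?m" using transported_inverse[OF M B C B'(1) C'(1) P Q] BC by blast
  have "form_row B' \<in> intertwiners H (\<Phi> M \<otimes>\<^sub>H \<Phi> M) unitH" using P by (auto simp: transported_pairing_def)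
  then have inv': "(snd (\<Phi> M) h)\<^sup>T * B' * snd (\<Phi> M) h = B'" if "h \<in> carrier H" for h
    using that H.form_row_intertwiner_iff[OF N N B'(1)] by blast
  note tr = transported_traces[OF M B C B'(1) C'(1) P Q]
  have "B'\<^sup>T = B'"
  proof (rule H.form_symmetric_if_traces[OF fin(2) N B'(1) C'(1) BC' inv'])
    fix f assume f: "f \<in> intertwiners H (\<Phi> M) (\<Phi> M)"
    obtain g where g: "g \<in> intertwiners G M M" "\<phi> M M g = f" by (rule full[OF M M f])
    note s = symmetric_form_traces[OF B C intertwiners_carrier[OF g(1)] BC(1) sym]
    show "mat_trace (f\<^sup>T * B' * C'\<^sup>T) = mat_trace (B' * f * C'\<^sup>T)"
      using tr[OF g(1)] unfolding g(2) s by simp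
    assume ff: "f * f = f"
    \<comment> \<open>Faithfulness reflects idempotency, so the trace on the symmetric side is a
      natural number.\<close>
    have "g * g = g"
      by (rule faithful[OF M M G.intertwiner_comp[OF g(1,1) M M M] g(1)])
        (simp add: arr_comp[OF M M M g(1,1)] g(2) ff)
    then obtain k :: nat where "mat_trace g = of_nat k"
      using idempotent_trace[OF intertwiners_carrier[OF g(1)]] by metis
    then show "\<exists>k::nat. mat_trace (f\<^sup>T * B' * C'\<^sup>T) = of_nat k"
      using tr(1)[OF g(1)] unfolding g(2) s by simp
  qed
  then have "H.orthogonal_form (\<Phi> M) B'"
    by (rule H.orthogonal_formI[OF N B'(1) C'(1) _ BC' inv'])
  then show "H.orthogonal (\<Phi> M)" unfolding H.orthogonal_iff by blast
next
  let ?n = "fst M" and ?m = "fst (\<Phi> M)"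
  note N = obj[OF M]
  assume "H.orthogonal (\<Phi> M)"
  then obtain B' where "H.orthogonal_form (\<Phi> M) B'" unfolding H.orthogonal_iff by blast
  then obtain C' where B': "B' \<in> carrier_mat ?m ?m" and C': "C' \<in> carrier_mat ?m ?m"
    and sym: "B'\<^sup>T = B'" and BC': "B' * C' = 1\<^sub>m ?m" "C' * B' = 1\<^sub>m ?m"
    and inv': "\<forall>g\<in>carrier H. (snd (\<Phi> M) g)\<^sup>T * B' * snd (\<Phi> M) g = B'"
    by (auto simp: H.orthogonal_form_def)
  have p': "form_row B' \<in> intertwiners H (\<Phi> M \<otimes>\<^sub>H \<Phi> M) unitH"
    unfolding H.form_row_intertwiner_iff[OF N N B'] by (rule inv')
  have q': "form_col C' \<in> intertwiners H unitH (\<Phi> M \<otimes>\<^sub>H \<Phi> M)"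
    by (rule H.form_col_intertwiner[OF N N C'])
      (rule invariant_form_inverse[OF B' C' H.rep_carrier[OF N] BC'(1) bspec[OF inv'] BC'(2)])
  obtain p where p: "transported_pairing M M p (form_row B')" by (rule transported_pairing_ex_inv[OF M M p'])
  obtain q where q: "transported_copairing M M q (form_col C')" by (rule transported_copairing_ex_inv[OF M M q'])
  have pi: "p \<in> intertwiners G (M \<otimes>\<^sub>G M) unitG" and qi: "q \<in> intertwiners G unitG (M \<otimes>\<^sub>G M)"
    using p q by (auto simp: transported_pairing_def transported_copairing_def)
  have "p \<in> carrier_mat 1 (?n * ?n)" using intertwiners_carrier[OF pi] by simp
  then obtain B where B: "B \<in> carrier_mat ?n ?n" "p = form_row B" by (rule form_row_surj)
  have "q \<in> carrier_mat (?n * ?n) 1" using intertwiners_carrier[OF qi] by simp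
  then obtain C where C: "C \<in> carrier_mat ?n ?n" "q = form_col C" by (rule form_col_surj)
  note P = p[unfolded B(2)] and Q = q[unfolded C(2)]
  have BC: "B * C = 1\<^sub>m ?n" using transported_inverse[OF M B(1) C(1) B' C' P Q] BC' by blast
  have inv: "(snd M g)\<^sup>T * B * snd M g = B" if "g \<in> carrier G" for g
    using that pi G.form_row_intertwiner_iff[OF M M B(1)] unfolding B(2) by blast
  note tr = transported_traces[OF M B(1) C(1) B' C' P Q]
  have "B\<^sup>T = B"
  proof (rule G.form_symmetric_if_traces[OF fin(1) M B(1) C(1) BC inv])
    fix g assume g: "g \<in> intertwiners G M M"
    note f = arr[OF M M g]
    note s = symmetric_form_traces[OF B' C' intertwiners_carrier[OF f] BC'(1) sym]
    show "mat_trace (g\<^sup>T * B * C\<^sup>T) = mat_trace (B * g * C\<^sup>T)"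
      using tr[OF g] unfolding s by simp
    assume gg: "g * g = g"
    \<comment> \<open>In this direction the symmetric side is \<open>H\<close>, and functoriality
      alone carries the idempotent there.\<close>
    have "\<phi> M M g * \<phi> M M g = \<phi> M M g"
      using arr_comp[OF M M M g g] unfolding gg by simp
    then obtain k :: nat where "mat_trace (\<phi> M M g) = of_nat k"
      using idempotent_trace[OF intertwiners_carrier[OF f]] by metis
    then show "\<exists>k::nat. mat_trace (g\<^sup>T * B * C\<^sup>T) = of_nat k"
      using tr(1)[OF g] unfolding s by metis
  qed
  then have "G.orthogonal_form M B"
    by (rule G.orthogonal_formI[OF M B(1) C(1) _ BC inv])
  then show "G.orthogonal M" unfolding G.orthogonal_iff by blast
qed

end

theorem theorem5p2:
  fixes G :: "('a, 'y) monoid_scheme" and H :: "('b, 'z) monoid_scheme"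
  assumes "group G" and "finite (carrier G)"
    and "group H" and "finite (carrier H)"
    and "isocategorical G H"
  shows "cring (Witt_ring (Rep G)) \<and> cring (Witt_ring (Rep H)) \<and>
    Witt_ring (Rep G) \<simeq> Witt_ring (Rep H)"
proof -
  from assms(5) obtain F J u where "is_linear_functor (Rep G) (Rep H) F"
    "is_equivalence (Rep G) (Rep H) F" "is_monoidal_structure (Rep G) (Rep H) F J u"
    unfolding isocategorical_def linear_monoidal_equivalent_def by blast
  then interpret rep_equivalence G H F J u
    by (intro rep_equivalence.intro group_reps.intro rep_equivalence_axioms.intro assms(1,3))
  have "Witt_ring (Rep G) \<simeq> Witt_ring (Rep H)"
    by (rule Witt_ring_iso[OF assms(1,3) obj rep_iso_iff essentially_surjective
          orthogonal_transport[OF assms(2,4)] rep_iso_sum rep_iso_tensor rep_iso_unit rep_iso_dual])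
  then show ?thesis
    using G.cring_Witt_ring H.cring_Witt_ring by blast
qed

end
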